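(* Let $L$ be a non-archimedean local field of characteristic $p$ and $G=\mathrm{GL}_2(L)$. Let $\pi_1$ be a supersingular representation of $G$ over $\overline{\mathbb F}_p$, and $\pi_2$ a principal series or a special series of $G$. Then $\mathrm{Ext}^1_G(\pi_2,\pi_1)=0$.
   Context: $P$ is the upper triangular Borel, $T$ the diagonal torus of $G$. A principal series is $\mathrm{Ind}_P^G\chi$ (smooth induction) with $\chi$ a smooth character of $T$, $\chi\neq\chi^s$, where $\chi^s(\mathrm{diag}(a,d))=\chi(\mathrm{diag}(d,a))$. A special series is a twist $\mathrm{Sp}\otimes(\eta\circ\det)$ of the Steinberg representation $\mathrm{Sp}=\mathrm{Ind}_P^G1/1$ by a smooth character $\eta$ of $L^\times$. A supersingular representation is a smooth irreducible representation of $G$ over $\overline{\mathbb F}_p$ (with central character) which is not a subquotient of any $\mathrm{Ind}_P^G\chi$. $\mathrm{Ext}^1_G$ is taken in smooth representations of $G$ over $\overline{\mathbb F}_p$. *)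

theory Defs
  imports
    "HOL-Analysis.Analysis"
    "HOL-Algebra.Algebraic_Closure"
    "HOL-Algebra.Multiplicative_Group"
begin

section \<open>The local field and the coefficient field\<close>

text \<open>A field complete with respect to a nontrivial discrete non-archimedean absolute value with
  finite residue field.  The topology is the metric one; positive definiteness of \<open>absval\<close> follows
  from that of \<open>dist\<close>.  It is a parameter of its own since \<open>norm\<close> is reserved for
  real normed vector spaces.\<close>

class nonarch_local_field = field + complete_space +
  fixes absval :: "'a \<Rightarrow> real"
  assumes dist_absval: "dist x y = absval (x - y)"
    and absval_mult: "absval (x * y) = absval x * absval y"
    and absval_ultrametric: "absval (x + y) \<le> max (absval x) (absval y)"
    and absval_nontrivial: "\<exists>x. x \<noteq> 0 \<and> absval x \<noteq> 1"
    and absval_discrete: "\<exists>c<1. \<forall>x. absval x < 1 \<longrightarrow> absval x \<le> c"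
    and finite_residue_field:
      "finite ({x. absval x \<le> 1} //
         {(x, y). absval x \<le> 1 \<and> absval y \<le> 1 \<and> absval (x - y) < 1})"

text \<open>A subfield with \<open>p\<close> elements is necessarily the prime field.\<close>

definition is_Fp_bar :: "nat \<Rightarrow> ('k, 'm) ring_scheme \<Rightarrow> bool"
  where "is_Fp_bar p k \<longleftrightarrow> (\<exists>F. card F = p \<and> algebraic_closure k F)"

section \<open>Smooth representations\<close>

text \<open>Groups carry the subspace topology induced on the carrier by the topology of the ambient type.
  A representation is a vector space together with an action of the group; the ring multiplication
  and unit of the underlying module record play no role.\<close>

record ('k, 'v, 'g) rep = "('k, 'v) module" +
  act :: "'g \<Rightarrow> 'v \<Rightarrow> 'v"

locale representation = group G + field k + Module.module k V
  for G :: "'g monoid" and k :: "'k ring" and V :: "('k, 'v, 'g) rep" +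
  assumes act_closed:
      "\<lbrakk>g \<in> carrier G; v \<in> carrier V\<rbrakk> \<Longrightarrow> act V g v \<in> carrier V"
    and act_add:
      "\<lbrakk>g \<in> carrier G; v \<in> carrier V; w \<in> carrier V\<rbrakk>
        \<Longrightarrow> act V g (v \<oplus>\<^bsub>V\<^esub> w) = act V g v \<oplus>\<^bsub>V\<^esub> act V g w"
    and act_smult:
      "\<lbrakk>g \<in> carrier G; a \<in> carrier k; v \<in> carrier V\<rbrakk>
        \<Longrightarrow> act V g (a \<odot>\<^bsub>V\<^esub> v) = a \<odot>\<^bsub>V\<^esub> act V g v"
    and act_one:
      "v \<in> carrier V \<Longrightarrow> act V \<one>\<^bsub>G\<^esub> v = v"
    and act_mult:
      "\<lbrakk>g \<in> carrier G; h \<in> carrier G; v \<in> carrier V\<rbrakk>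
        \<Longrightarrow> act V (g \<otimes>\<^bsub>G\<^esub> h) v = act V g (act V h v)"

locale smooth_representation = representation G k V
  for G :: "'g::topological_space monoid" and k :: "'k ring" and V :: "('k, 'v, 'g) rep" +
  assumes open_stabilizer:
      "v \<in> carrier V \<Longrightarrow>
        openin (top_of_set (carrier G)) {g \<in> carrier G. act V g v = v}"

definition rep_hom ::
  "'g monoid \<Rightarrow> 'k ring \<Rightarrow> ('k, 'v, 'g) rep \<Rightarrow> ('k, 'w, 'g) rep \<Rightarrow> ('v \<Rightarrow> 'w) set"
  where "rep_hom G k V W =
    {f \<in> hom (add_monoid V) (add_monoid W).
       (\<forall>a\<in>carrier k. \<forall>v\<in>carrier V. f (a \<odot>\<^bsub>V\<^esub> v) = a \<odot>\<^bsub>W\<^esub> f v) \<and>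
       (\<forall>g\<in>carrier G. \<forall>v\<in>carrier V. f (act V g v) = act W g (f v))}"

definition rep_iso ::
  "'g monoid \<Rightarrow> 'k ring \<Rightarrow> ('k, 'v, 'g) rep \<Rightarrow> ('k, 'w, 'g) rep \<Rightarrow> ('v \<Rightarrow> 'w) set"
  where "rep_iso G k V W = {f \<in> rep_hom G k V W. bij_betw f (carrier V) (carrier W)}"

definition rep_isomorphic ::
  "'g monoid \<Rightarrow> 'k ring \<Rightarrow> ('k, 'v, 'g) rep \<Rightarrow> ('k, 'w, 'g) rep \<Rightarrow> bool"
  where "rep_isomorphic G k V W \<longleftrightarrow> rep_iso G k V W \<noteq> {}"

definition subrep :: "'g monoid \<Rightarrow> 'k ring \<Rightarrow> ('k, 'v, 'g) rep \<Rightarrow> 'v set \<Rightarrow> bool"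
  where "subrep G k V W \<longleftrightarrow>
    submodule W k V \<and> (\<forall>g\<in>carrier G. \<forall>w\<in>W. act V g w \<in> W)"

text \<open>The scalar multiple of the coset \<open>W + x\<close> by \<open>a\<close> is \<open>W + a x\<close>; adding \<open>W\<close> to the image
  \<open>a (W + x)\<close> is needed for \<open>a = 0\<close> only.\<close>

definition quot_rep :: "('k, 'v, 'g) rep \<Rightarrow> 'v set \<Rightarrow> ('k, 'v set, 'g) rep"
  where "quot_rep V W =
    \<lparr>carrier = a_rcosets\<^bsub>V\<^esub> W, mult = undefined, one = undefined,
     zero = W, add = set_add V,
     smult = (\<lambda>a C. set_add V W ((\<lambda>x. a \<odot>\<^bsub>V\<^esub> x) ` C)),
     act = (\<lambda>g C. act V g ` C)\<rparr>"

definition is_subquotient ::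
  "'g monoid \<Rightarrow> 'k ring \<Rightarrow> ('k, 'v, 'g) rep \<Rightarrow> ('k, 'w, 'g) rep \<Rightarrow> bool"
  where "is_subquotient G k U V \<longleftrightarrow>
    (\<exists>W1 W2. subrep G k V W1 \<and> subrep G k V W2 \<and> W1 \<subseteq> W2 \<and>
       rep_isomorphic G k U (quot_rep (V\<lparr>carrier := W2\<rparr>) W1))"

definition irreducible_rep :: "'g monoid \<Rightarrow> 'k ring \<Rightarrow> ('k, 'v, 'g) rep \<Rightarrow> bool"
  where "irreducible_rep G k V \<longleftrightarrow>
    representation G k V \<and> carrier V \<noteq> {\<zero>\<^bsub>V\<^esub>} \<and>
    (\<forall>W. subrep G k V W \<longrightarrow> W = {\<zero>\<^bsub>V\<^esub>} \<or> W = carrier V)"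

definition smooth_characters :: "'g::topological_space monoid \<Rightarrow> 'k ring \<Rightarrow> ('g \<Rightarrow> 'k) set"
  where "smooth_characters G k =
    {\<theta> \<in> hom G (mult_of k). openin (top_of_set (carrier G)) (kernel G (mult_of k) \<theta>)}"

definition twist :: "('k, 'v, 'g) rep \<Rightarrow> ('g \<Rightarrow> 'k) \<Rightarrow> ('k, 'v, 'g) rep"
  where "twist V \<theta> = V\<lparr>act := (\<lambda>g v. \<theta> g \<odot>\<^bsub>V\<^esub> act V g v)\<rparr>"

text \<open>Smooth induction of a character \<open>\<theta>\<close> of a subgroup \<open>H\<close> (not normalised): functions with
  \<open>f (h g) = \<theta> h * f g\<close> that are right invariant under some open subgroup, with \<open>G\<close> acting by
  right translation.\<close>

definition smooth_ind ::
  "'g::topological_space monoid \<Rightarrow> 'k ring \<Rightarrow> 'g set \<Rightarrow> ('g \<Rightarrow> 'k) \<Rightarrow> ('k, 'g \<Rightarrow> 'k, 'g) rep"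
  where "smooth_ind G k H \<theta> =
    \<lparr>carrier = {f \<in> carrier G \<rightarrow>\<^sub>E carrier k.
        (\<forall>h\<in>H. \<forall>g\<in>carrier G. f (h \<otimes>\<^bsub>G\<^esub> g) = \<theta> h \<otimes>\<^bsub>k\<^esub> f g) \<and>
        (\<exists>K. subgroup K G \<and> openin (top_of_set (carrier G)) K \<and>
           (\<forall>g\<in>carrier G. \<forall>u\<in>K. f (g \<otimes>\<^bsub>G\<^esub> u) = f g))},
     mult = undefined, one = undefined,
     zero = (\<lambda>g\<in>carrier G. \<zero>\<^bsub>k\<^esub>),
     add = (\<lambda>f f'. \<lambda>g\<in>carrier G. f g \<oplus>\<^bsub>k\<^esub> f' g),
     smult = (\<lambda>a f. \<lambda>g\<in>carrier G. a \<otimes>\<^bsub>k\<^esub> f g),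
     act = (\<lambda>x f. \<lambda>g\<in>carrier G. f (g \<otimes>\<^bsub>G\<^esub> x))\<rparr>"

section \<open>\<open>Ext\<^sup>1\<close> in the category of smooth representations\<close>

definition direct_sum_rep ::
  "('k, 'v, 'g) rep \<Rightarrow> ('k, 'w, 'g) rep \<Rightarrow> ('k, 'v \<times> 'w, 'g) rep"
  where "direct_sum_rep V W =
    \<lparr>carrier = carrier V \<times> carrier W, mult = undefined, one = undefined,
     zero = (\<zero>\<^bsub>V\<^esub>, \<zero>\<^bsub>W\<^esub>),
     add = (\<lambda>(v, w) (v', w'). (v \<oplus>\<^bsub>V\<^esub> v', w \<oplus>\<^bsub>W\<^esub> w')),
     smult = (\<lambda>a (v, w). (a \<odot>\<^bsub>V\<^esub> v, a \<odot>\<^bsub>W\<^esub> w)),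
     act = (\<lambda>g (v, w). (act V g v, act W g w))\<rparr>"

text \<open>Yoneda extensions \<open>0 \<rightarrow> V \<rightarrow> E \<rightarrow> W \<rightarrow> 0\<close> by smooth representations.  The carrier of the middle
  term is taken in the type \<open>'v \<times> 'w\<close>.  This loses nothing: a linear section of \<open>E \<rightarrow> W\<close> identifies
  the vector space \<open>E\<close> with the product of \<open>V\<close> and \<open>W\<close>, so every extension, with \<open>E\<close> in any type,
  is equivalent to one of these.\<close>

definition smooth_extensions ::
  "'g::topological_space monoid \<Rightarrow> 'k ring \<Rightarrow> ('k, 'w, 'g) rep \<Rightarrow> ('k, 'v, 'g) rep
    \<Rightarrow> (('k, 'v \<times> 'w, 'g) rep \<times> ('v \<Rightarrow> 'v \<times> 'w) \<times> ('v \<times> 'w \<Rightarrow> 'w)) set"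
  where "smooth_extensions G k W V =
    {(E, i, q). smooth_representation G k E \<and>
       i \<in> rep_hom G k V E \<and> inj_on i (carrier V) \<and>
       q \<in> rep_hom G k E W \<and> q ` carrier E = carrier W \<and>
       i ` carrier V = {e \<in> carrier E. q e = \<zero>\<^bsub>W\<^esub>}}"

definition extension_equiv ::
  "'g::topological_space monoid \<Rightarrow> 'k ring \<Rightarrow> ('k, 'w, 'g) rep \<Rightarrow> ('k, 'v, 'g) rep
    \<Rightarrow> (('k, 'v \<times> 'w, 'g) rep \<times> ('v \<Rightarrow> 'v \<times> 'w) \<times> ('v \<times> 'w \<Rightarrow> 'w)) rel"
  where "extension_equiv G k W V =
    {((E, i, q), (E', i', q')).
       (E, i, q) \<in> smooth_extensions G k W V \<and> (E', i', q') \<in> smooth_extensions G k W V \<and>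
       (\<exists>f\<in>rep_iso G k E E'.
          (\<forall>v\<in>carrier V. f (i v) = i' v) \<and> (\<forall>e\<in>carrier E. q' (f e) = q e))}"

definition Ext1 ::
  "'g::topological_space monoid \<Rightarrow> 'k ring \<Rightarrow> ('k, 'w, 'g) rep \<Rightarrow> ('k, 'v, 'g) rep
    \<Rightarrow> (('k, 'v \<times> 'w, 'g) rep \<times> ('v \<Rightarrow> 'v \<times> 'w) \<times> ('v \<times> 'w \<Rightarrow> 'w)) set set"
  where "Ext1 G k W V = smooth_extensions G k W V // extension_equiv G k W V"

text \<open>The class of the split extension is the neutral element for the Baer sum.\<close>

definition Ext1_zero ::
  "'g::topological_space monoid \<Rightarrow> 'k ring \<Rightarrow> ('k, 'w, 'g) rep \<Rightarrow> ('k, 'v, 'g) rep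
    \<Rightarrow> (('k, 'v \<times> 'w, 'g) rep \<times> ('v \<Rightarrow> 'v \<times> 'w) \<times> ('v \<times> 'w \<Rightarrow> 'w)) set"
  where "Ext1_zero G k W V =
    extension_equiv G k W V `` {(direct_sum_rep V W, \<lambda>v. (v, \<zero>\<^bsub>W\<^esub>), snd)}"

section \<open>Representations of \<open>GL\<^sub>2(L)\<close>\<close>

definition mult_group :: "'l::field monoid"
  where "mult_group = \<lparr>carrier = - {0}, mult = (*), one = 1\<rparr>"

definition GL2 :: "('l::field ^ 2 ^ 2) monoid"
  where "GL2 = \<lparr>carrier = {A. invertible A}, mult = (**), one = mat 1\<rparr>"

definition diag2 :: "'l::field \<Rightarrow> 'l \<Rightarrow> 'l ^ 2 ^ 2"
  where "diag2 a d = vector [vector [a, 0], vector [0, d]]"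

definition torus :: "('l::field ^ 2 ^ 2) monoid"
  where "torus = GL2\<lparr>carrier := {diag2 a d | a d. a \<noteq> 0 \<and> d \<noteq> 0}\<rparr>"

definition borel_subgroup :: "('l::field ^ 2 ^ 2) set"
  where "borel_subgroup = {A. invertible A \<and> A $ 2 $ 1 = 0}"

definition swap_char :: "('l::field ^ 2 ^ 2 \<Rightarrow> 'k) \<Rightarrow> 'l ^ 2 ^ 2 \<Rightarrow> 'k"
  where "swap_char \<theta> A = \<theta> (diag2 (A $ 2 $ 2) (A $ 1 $ 1))"

text \<open>A character of the torus is inflated to the Borel subgroup.\<close>

definition Ind_borel ::
  "'k ring \<Rightarrow> ('l::nonarch_local_field ^ 2 ^ 2 \<Rightarrow> 'k) \<Rightarrow> ('k, 'l ^ 2 ^ 2 \<Rightarrow> 'k, 'l ^ 2 ^ 2) rep"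
  where "Ind_borel k \<theta> =
    smooth_ind GL2 k borel_subgroup (\<lambda>A. \<theta> (diag2 (A $ 1 $ 1) (A $ 2 $ 2)))"

definition Steinberg ::
  "'k ring \<Rightarrow> ('k, ('l::nonarch_local_field ^ 2 ^ 2 \<Rightarrow> 'k) set, 'l ^ 2 ^ 2) rep"
  where "Steinberg k =
    quot_rep (Ind_borel k (\<lambda>_. \<one>\<^bsub>k\<^esub>)) {\<lambda>g\<in>carrier GL2. c | c. c \<in> carrier k}"

definition is_principal_series ::
  "'k ring \<Rightarrow> ('k, 'v, 'l::nonarch_local_field ^ 2 ^ 2) rep \<Rightarrow> bool"
  where "is_principal_series k V \<longleftrightarrow>
    smooth_representation GL2 k V \<and>
    (\<exists>\<theta>\<in>smooth_characters torus k.
       (\<exists>t\<in>carrier torus. \<theta> t \<noteq> swap_char \<theta> t) \<and>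
       rep_isomorphic GL2 k V (Ind_borel k \<theta>))"

definition is_special_series ::
  "'k ring \<Rightarrow> ('k, 'v, 'l::nonarch_local_field ^ 2 ^ 2) rep \<Rightarrow> bool"
  where "is_special_series k V \<longleftrightarrow>
    smooth_representation GL2 k V \<and>
    (\<exists>\<eta>\<in>smooth_characters mult_group k.
       rep_isomorphic GL2 k V (twist (Steinberg k) (\<eta> \<circ> det)))"

definition has_central_character ::
  "'k ring \<Rightarrow> ('k, 'v, 'l::nonarch_local_field ^ 2 ^ 2) rep \<Rightarrow> bool"
  where "has_central_character k V \<longleftrightarrow>
    (\<exists>\<omega>\<in>smooth_characters mult_group k.
       \<forall>z. z \<noteq> 0 \<longrightarrow> (\<forall>v\<in>carrier V. act V (mat z) v = \<omega> z \<odot>\<^bsub>V\<^esub> v))"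

definition is_supersingular ::
  "'k ring \<Rightarrow> ('k, 'v, 'l::nonarch_local_field ^ 2 ^ 2) rep \<Rightarrow> bool"
  where "is_supersingular k V \<longleftrightarrow>
    smooth_representation GL2 k V \<and> irreducible_rep GL2 k V \<and> has_central_character k V \<and>
    (\<forall>\<theta>\<in>smooth_characters torus k. \<not> is_subquotient GL2 k V (Ind_borel k \<theta>))"

end

theory Submission
  imports Defs "HOL-Library.Function_Algebras" "HOL-Number_Theory.Cong"
begin

text \<open>Write \<open>u(a)\<close> for the upper unipotents, \<open>t = diag(\<pi>, 1)\<close>, \<open>O\<close> for the integers of \<open>L\<close>, and \<open>h = \<Sum>u(a) t\<close>, with
  \<open>a\<close> in \<open>O/\<pi>O\<close>, for the Hecke operator on \<open>u(O)\<close>-invariants.  A \<open>u(O)\<close>-invariant eigenvector \<open>e\<close> of \<open>h\<close> (with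
  nonzero eigenvalue) and of the integral torus is the image of a generator of some induced representation
  \<open>Ind \<theta>\<close> under an equivariant map.  A supersingular \<open>V\<close> contains no such \<open>e\<close>, hence \<open>h\<close> is locally nilpotent on its
  \<open>u(O)\<close>-invariants: a vector with independent iterates would generate a reducible representation.  Let \<open>E\<close> be an extension by \<open>V\<close> of a quotient of \<open>Ind \<theta>\<close>, and lift the image of the generator to
  \<open>e0\<close> in \<open>E\<close>.  Since \<open>L\<close> has characteristic \<open>p\<close>, \<open>O\<close> has an additive complement \<open>A\<close> in \<open>L\<close>, and by nilpotency the
  norm over a large part \<open>A(j)\<close> of \<open>A\<close> kills any given vector of \<open>V\<close>; therefore the norm of \<open>e0\<close> over \<open>A(j)\<close>, rescaled
  by \<open>t\<^sup>j\<close>, is \<open>u(O)\<close>-invariant, and a power of \<open>h\<close> makes it an eigenvector.  The resulting map \<open>Ind \<theta> \<rightarrow> E\<close>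
  vanishes on the kernel of \<open>Ind \<theta> \<rightarrow> E/V\<close>, as \<open>V\<close> is no subquotient of \<open>Ind \<theta>\<close>, and so splits the extension.\<close>

text \<open>No admissibility of \<open>V\<close> is at hand, so its \<open>u(O)\<close>-invariants
  may be infinite-dimensional and \<open>h\<close> is studied one vector at a time: if the iterates
  of a vector satisfy a linear relation, a root of the corresponding polynomial gives an
  eigenvector, otherwise they are independent. Reducibility in the independent case is seen on
  \<open>x = h v - \<omega> v\<close>, with \<open>v = h y\<close> and \<open>\<omega>\<close> the
  central character at the uniformizer: \<open>x\<close> and \<open>w x\<close> are combinations of
  Borel translates of \<open>v\<close> and \<open>w v\<close> in which the coefficients at
  \<open>w v\<close> add up to zero, this property passes to all \<open>G\<close>-translates of
  \<open>x\<close>, and \<open>w v\<close> itself does not have it. The recurring device is that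
  commuting operators of order \<open>p\<close> have common fixed vectors modulo a stable subset. It
  is applied to vectors, to functions on the residue field and to formal combinations alike, so the
  ambient type of vectors is merely a commutative ring of characteristic \<open>p\<close>. The
  eigenvalue of \<open>h\<close> has to be nonzero twice: it becomes a value of
  \<open>\<theta>\<close>, and it is inverted when approximate eigenvectors are corrected.\<close>

section \<open>Unipotent operators in characteristic \<open>p\<close>\<close>

lemma additive_of_nat_mult:
  fixes f :: "'x::comm_ring_1 \<Rightarrow> 'x"
  assumes "Modules.additive f"
  shows "f (of_nat n * x) = of_nat n * f x"
proof -
  interpret Modules.additive f by fact
  show ?thesis by (induction n) (simp_all add: zero add algebra_simps)
qed

lemma additive_minus_one_power_mult:
  fixes f :: "'x::comm_ring_1 \<Rightarrow> 'x"
  assumes "Modules.additive f"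
  shows "f ((-1) ^ n * x) = (-1) ^ n * f x"
proof -
  interpret Modules.additive f by fact
  show ?thesis by (induction n arbitrary: x) (simp_all add: minus)
qed

lemma additive_minus_id: "Modules.additive f \<Longrightarrow> Modules.additive (\<lambda>x. f x - (x::'x::ab_group_add))"
  by (simp add: Modules.additive_def)

lemma additive_funpow: "Modules.additive (f :: 'x::ab_group_add \<Rightarrow> 'x) \<Longrightarrow> Modules.additive (f ^^ n)"
  by (induction n) (simp_all add: Modules.additive_def)

text \<open>The binomial theorem for the commuting operators \<open>f\<close> and \<open>-1\<close>,
  evaluated at \<open>x\<close>. Additivity of \<open>f\<close> is what lets the integer
  coefficients and the signs pass through it.\<close>

lemma funpow_minus_id:
  fixes f :: "'x::comm_ring_1 \<Rightarrow> 'x"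
  assumes f: "Modules.additive f"
  shows "((\<lambda>x. f x - x) ^^ n) x = (\<Sum>i\<le>n. of_nat (n choose i) * ((-1) ^ (n - i) * (f ^^ i) x))"
proof (induction n)
  case (Suc n)
  interpret Modules.additive f by fact
  let ?g = "\<lambda>n i. of_nat (n choose i) * ((-1) ^ (n - i) * (f ^^ i) x)"
  let ?h = "\<lambda>i. of_nat (n choose i) * ((-1) ^ (n - i) * (f ^^ Suc i) x)"
  have "((\<lambda>x. f x - x) ^^ Suc n) x = (\<Sum>i\<le>n. ?h i) - (\<Sum>i\<le>n. ?g n i)"
    by (simp add: Suc sum additive_of_nat_mult[OF f] additive_minus_one_power_mult[OF f])
  also have "(\<Sum>i\<le>n. ?h i) = (\<Sum>i\<le>Suc n. if i = 0 then 0 else ?h (i - 1))"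
    by (subst sum.atMost_Suc_shift) simp
  also have "(\<Sum>i\<le>n. ?g n i) = (\<Sum>i\<le>Suc n. ?g n i)"
    by (simp add: binomial_eq_0)
  also have "(\<Sum>i\<le>Suc n. if i = 0 then 0 else ?h (i - 1)) - (\<Sum>i\<le>Suc n. ?g n i)
      = (\<Sum>i\<le>Suc n. (if i = 0 then 0 else ?h (i - 1)) - ?g n i)"
    by (rule sum_subtractf[symmetric])
  also have "\<dots> = (\<Sum>i\<le>Suc n. ?g (Suc n) i)"
  proof (rule sum.cong)
    fix i assume i: "i \<in> {..Suc n}"
    show "(if i = 0 then 0 else ?h (i - 1)) - ?g n i = ?g (Suc n) i"
    proof (cases i)
      case (Suc j)
      show ?thesis
      proof (cases "j = n")
        case False
        then have "n - j = Suc (n - Suc j)" using i Suc by auto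
        then show ?thesis using Suc by (simp add: algebra_simps)
      qed (use Suc in \<open>simp add: binomial_eq_0\<close>)
    qed simp
  qed simp
  finally show ?case .
qed simp

text \<open>The inner binomial coefficients are divisible by \<open>p\<close>. The sign of the
  constant term is \<open>-1\<close> for odd \<open>p\<close>, and for \<open>p = 2\<close> it does
  not matter since \<open>x = - x\<close>.\<close>

lemma funpow_prime_minus_id:
  fixes f :: "'x::comm_ring_1 \<Rightarrow> 'x"
  assumes f: "Modules.additive f" and p: "Factorial_Ring.prime (p::nat)" "of_nat p = (0::'x)"
  shows "((\<lambda>x. f x - x) ^^ p) x = (f ^^ p) x - x"
proof -
  let ?g = "\<lambda>i. of_nat (p choose i) * ((-1) ^ (p - i) * (f ^^ i) x)"
  have p0: "p \<noteq> 0" using p by auto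
  have z: "of_nat (p choose i) = (0::'x)" if "i \<noteq> 0" "i < p" for i
  proof -
    have "p dvd (p choose i)"
      using that p(1) by (intro dvd_choose_prime) auto
    then obtain c where "p choose i = p * c" by (elim dvdE)
    then show ?thesis by (simp add: p)
  qed
  have "(\<Sum>i\<le>p. ?g i) = (\<Sum>i\<in>{0, p}. ?g i)"
    by (rule sum.mono_neutral_right) (auto simp: z)
  also have "\<dots> = (f ^^ p) x + (-1) ^ p * x"
    using p0 by simp
  also have "(-1) ^ p * x = - x"
  proof (cases "p = 2")
    case True
    then have "x + x = 0"
      using p(2) by (metis mult_2 mult_zero_left of_nat_numeral)
    then show ?thesis using True by (simp add: eq_neg_iff_add_eq_0)
  next
    case False
    then have "odd p" using p(1) by (metis prime_nat_iff dvd_refl primes_dvd_imp_eq two_is_prime_nat)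
    then show ?thesis by simp
  qed
  finally show ?thesis by (simp add: funpow_minus_id[OF f])
qed

text \<open>Commuting operators of order \<open>p\<close> are unipotent in characteristic \<open>p\<close>, since
  \<open>(f - 1)\<^sup>p = f\<^sup>p - 1\<close>.\<close>

lemma unipotent_fixed_vector:
  fixes F :: "('x::comm_ring_1 \<Rightarrow> 'x) set"
  assumes p: "Factorial_Ring.prime (p::nat)" "of_nat p = (0::'x)" and fin: "finite F"
    and additive: "\<And>f. f \<in> F \<Longrightarrow> Modules.additive f"
    and commute: "\<And>f g x. f \<in> F \<Longrightarrow> g \<in> F \<Longrightarrow> f (g x) = g (f x)"
    and order: "\<And>f x. f \<in> F \<Longrightarrow> x \<in> M \<Longrightarrow> (f ^^ p) x = x"
    and M: "\<And>f x. f \<in> F \<Longrightarrow> x \<in> M \<Longrightarrow> f x - x \<in> M"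
    and N: "\<And>f x. f \<in> F \<Longrightarrow> x \<in> N \<Longrightarrow> f x - x \<in> N" "0 \<in> N"
    and x: "x \<in> M" "x \<notin> N"
  shows "\<exists>y\<in>M. y \<notin> N \<and> (\<forall>f\<in>F. f y - y \<in> N)"
  using fin additive commute order M N(1)
proof (induction F rule: finite_induct)
  case empty
  show ?case using x by blast
next
  case (insert f F)
  then obtain y where y: "y \<in> M" "y \<notin> N" "\<And>g. g \<in> F \<Longrightarrow> g y - y \<in> N" by auto
  \<comment> \<open>The induction hypothesis supplies a \<open>y\<close> fixed modulo
    \<open>N\<close> by the operators in \<open>F\<close>. Among the iterates of \<open>D\<close> on
    \<open>y\<close>, the last one outside \<open>N\<close> before the first one inside is fixed
    modulo \<open>N\<close> by \<open>f\<close> as well.\<close>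
  define D where "D = (\<lambda>x. f x - x)"
  have f: "Modules.additive f" using insert.prems(1) by simp
  have D: "Modules.additive D" unfolding D_def by (rule additive_minus_id[OF f])
  have DM: "(D ^^ j) y \<in> M" for j
    by (induction j) (use y(1) insert.prems(4) in \<open>auto simp: D_def\<close>)
  have DN: "(D ^^ j) z \<in> N" if "z \<in> N" for j z
    by (induction j) (use that insert.prems(5) in \<open>auto simp: D_def\<close>)
  have "(D ^^ p) y = 0"
    using funpow_prime_minus_id[OF f p, of y] insert.prems(3)[OF _ y(1), of f] by (simp add: D_def)
  then have ex: "(D ^^ p) y \<in> N" using N(2) by simp
  define j where "j = (LEAST j. (D ^^ j) y \<in> N)"
  have jN: "(D ^^ j) y \<in> N" unfolding j_def using ex by (rule LeastI)
  then have "j \<noteq> 0" using y(2) by (metis funpow_0)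
  then obtain i where i: "j = Suc i" using not0_implies_Suc by blast
  have iN: "(D ^^ i) y \<notin> N" using not_less_Least[of i "\<lambda>j. (D ^^ j) y \<in> N"] i j_def by simp
  \<comment> \<open>\<open>D\<close> commutes with each \<open>g\<close> in \<open>F\<close>, so
    passing from \<open>y\<close> to an iterate of \<open>D\<close> does not destroy what is known
    for \<open>F\<close>.\<close>
  have comm: "(D ^^ i) (g z) = g ((D ^^ i) z)" if "g \<in> F" for g z
  proof (induction i)
    case (Suc i)
    interpret g: Modules.additive g using insert.prems(1) that by simp
    have "D (g u) = g (D u)" for u
      using insert.prems(2)[of f g u] that by (simp add: D_def g.diff)
    then show ?case using Suc by simp
  qed simp
  have "\<forall>g\<in>insert f F. g ((D ^^ i) y) - (D ^^ i) y \<in> N"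
  proof safe
    show "f ((D ^^ i) y) - (D ^^ i) y \<in> N" using jN i by (simp add: D_def)
  next
    fix g assume g: "g \<in> F"
    interpret Di: Modules.additive "D ^^ i" by (rule additive_funpow[OF D])
    show "g ((D ^^ i) y) - (D ^^ i) y \<in> N"
      using DN[OF y(3)[OF g], of i] comm[OF g, of y] by (simp add: Di.diff)
  qed
  then show ?case using DM iN by blast
qed

section \<open>Eigenvectors over an algebraically closed field\<close>

text \<open>The unit law is absent on purpose: in the application the scalars annihilate a
  complement of the representation inside the ambient type, so \<open>sc \<one> x = x\<close> can
  only be asked for on a submodule. Additivity is demanded for every \<open>a\<close>, also outside
  \<open>carrier k\<close>, which saves side conditions.\<close>

locale scalar_action = algebraically_closed k for k :: "'k ring" (structure) +
  fixes sc :: "'k \<Rightarrow> 'x::comm_ring_1 \<Rightarrow> 'x"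
  assumes sc_additive: "Modules.additive (sc a)"
    and sc_mult: "\<lbrakk>a \<in> carrier k; b \<in> carrier k\<rbrakk> \<Longrightarrow> sc (a \<otimes> b) x = sc a (sc b x)"
    and sc_add: "\<lbrakk>a \<in> carrier k; b \<in> carrier k\<rbrakk> \<Longrightarrow> sc (a \<oplus> b) x = sc a x + sc b x"
begin

lemma sc_plus: "sc a (x + y) = sc a x + sc a y"
  using sc_additive by (rule Modules.additive.add)

lemma sc_sum: "sc a (\<Sum>i\<in>I. f i) = (\<Sum>i\<in>I. sc a (f i))"
  using sc_additive by (rule Modules.additive.sum)

lemma sc_zero_right [simp]: "sc a 0 = 0"
  using sc_additive by (rule Modules.additive.zero)

lemma sc_diff: "sc a (x - y) = sc a x - sc a y"
  using sc_additive by (rule Modules.additive.diff)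

lemma sc_zero_left [simp]: "sc \<zero> x = 0"
  using sc_add[of \<zero> \<zero> x] by simp

lemma sc_a_inv: "a \<in> carrier k \<Longrightarrow> sc (\<ominus> a) x = - sc a x"
  using sc_add[of a "\<ominus> a" x] by (simp add: r_neg eq_neg_iff_add_eq_0 add.commute)

lemma sc_commute: "\<lbrakk>a \<in> carrier k; b \<in> carrier k\<rbrakk> \<Longrightarrow> sc a (sc b x) = sc b (sc a x)"
  by (metis m_comm sc_mult)

text \<open>Polynomials are coefficient lists with the leading coefficient first, hence the reversed
  index \<open>n - i\<close>.\<close>

lemma polynomial_root:
  assumes a: "\<And>i. a i \<in> carrier k" "a n \<noteq> \<zero>" and n: "n \<noteq> 0"
  shows "\<exists>l\<in>carrier k. eval (map (\<lambda>i. a (n - i)) [0..<Suc n]) l = \<zero>"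
proof -
  define P where "P = map (\<lambda>i. a (n - i)) [0..<Suc n]"
  have P: "P \<in> carrier (poly_ring k)"
    using a unfolding univ_poly_carrier[symmetric] polynomial_def P_def
    by (auto simp: upt_conv_Cons simp del: upt_Suc)
  have "splitted P" using roots_over_carrier[OF P] .
  moreover have "degree P = n" by (simp add: P_def)
  ultimately have "roots P \<noteq> {#}" using n by (auto simp: splitted_def)
  then obtain l where "l \<in># roots P" by blast
  then show ?thesis using roots_mem_iff_is_root[OF P] unfolding is_root_def P_def by auto
qed

lemma eval_snoc:
  assumes "set xs \<subseteq> carrier k" "b \<in> carrier k" "l \<in> carrier k"
  shows "eval (xs @ [b]) l = eval xs l \<otimes> l \<oplus> b"
  using assms eval_append[of xs "[b]" l] by simp

text \<open>Divide a relation of minimal length between consecutive iterates of \<open>v\<close>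
  modulo \<open>N\<close> by \<open>X - l\<close> for a root \<open>l\<close>: the quotient
  polynomial, applied to the iterates, is the eigenvector. Minimality keeps it outside
  \<open>N\<close>, and makes the constant coefficient, hence \<open>l\<close>, nonzero.\<close>

lemma exists_eigenvector_mod:
  assumes T: "Modules.additive T" and comm: "\<And>a x. a \<in> carrier k \<Longrightarrow> T (sc a x) = sc a (T x)"
    and N0: "\<And>x y. x \<in> N \<Longrightarrow> y \<in> N \<Longrightarrow> x + y \<in> N" "0 \<in> N"
    and Nsc: "\<And>a x. a \<in> carrier k \<Longrightarrow> x \<in> N \<Longrightarrow> sc a x \<in> N"
    and one: "\<And>i. sc \<one> ((T ^^ i) v) = (T ^^ i) v"
    and nonnil: "\<And>i. (T ^^ i) v \<notin> N"
    and rel: "\<And>i. a i \<in> carrier k" "a n \<noteq> \<zero>" "(\<Sum>i\<le>n. sc (a i) ((T ^^ i) v)) \<in> N"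
    and M: "\<And>x y. x \<in> M \<Longrightarrow> y \<in> M \<Longrightarrow> x + y \<in> M" "0 \<in> M"
      "\<And>a x. a \<in> carrier k \<Longrightarrow> x \<in> M \<Longrightarrow> sc a x \<in> M" "\<And>i. (T ^^ i) v \<in> M"
  shows "\<exists>l w. l \<in> carrier k \<and> l \<noteq> \<zero> \<and> w \<in> M \<and> w \<notin> N \<and> T w - sc l w \<in> N"
proof -
  \<comment> \<open>The shift \<open>m\<close> makes it possible to get rid of a vanishing constant
    coefficient: the relation then starts one iterate later and is shorter by one.\<close>
  define P where "P = (\<lambda>n. \<exists>m a. (\<forall>i. a i \<in> carrier k) \<and> a n \<noteq> \<zero> \<and>
    (\<Sum>i\<le>n. sc (a i) ((T ^^ (m + i)) v)) \<in> N)"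
  have "P n" unfolding P_def using rel by (intro exI[of _ 0] exI[of _ a]) auto
  define d where "d = (LEAST n. P n)"
  have "P d" unfolding d_def using \<open>P n\<close> by (rule LeastI)
  then obtain m a where a: "\<And>i. a i \<in> carrier k" "a d \<noteq> \<zero>"
    and s: "(\<Sum>i\<le>d. sc (a i) ((T ^^ (m + i)) v)) \<in> N"
    unfolding P_def by blast
  have notP: "\<not> P n" if "n < d" for n
    using that not_less_Least[of n P] unfolding d_def by simp
  have inv_N: "x \<in> N" if "c \<in> carrier k" "c \<noteq> \<zero>" "sc c x \<in> N" "sc \<one> x = x" for c x
  proof -
    have U: "c \<in> Units k" using that(1,2) field_Units by blast
    have ic: "inv c \<in> carrier k" using U by (rule Units_inv_closed)
    have "sc (inv c) (sc c x) \<in> N" using ic that(3) by (rule Nsc)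
    moreover have "sc (inv c) (sc c x) = sc (inv c \<otimes> c) x"
      using ic that(1) by (simp only: sc_mult)
    ultimately show ?thesis using that(4) Units_l_inv[OF U] by simp
  qed
  have d0: "d \<noteq> 0"
  proof
    assume "d = 0"
    then have "sc (a 0) ((T ^^ m) v) \<in> N" using s by simp
    then show False using inv_N[OF _ _ _ one] a \<open>d = 0\<close> nonnil by blast
  qed
  have a0: "a 0 \<noteq> \<zero>"
  proof
    assume "a 0 = \<zero>"
    have "(\<Sum>i\<le>d. sc (a i) ((T ^^ (m + i)) v)) = (\<Sum>i\<le>d - 1. sc (a (Suc i)) ((T ^^ (Suc m + i)) v))"
      using d0 \<open>a 0 = \<zero>\<close> sum.atMost_Suc_shift[of "\<lambda>i. sc (a i) ((T ^^ (m + i)) v)" "d - 1"] by simp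
    then have "P (d - 1)"
      unfolding P_def using s a d0 by (intro exI[of _ "Suc m"] exI[of _ "\<lambda>i. a (Suc i)"]) auto
    then show False using notP d0 by simp
  qed
  obtain l where l: "l \<in> carrier k" "eval (map (\<lambda>i. a (d - i)) [0..<Suc d]) l = \<zero>"
    using polynomial_root[of a d] a d0 by blast
  \<comment> \<open>Horner's scheme: the \<open>c r\<close> with \<open>r < d\<close> are the
    coefficients of the quotient by \<open>X - l\<close>, and \<open>c d\<close> is the remainder,
    that is, the value at \<open>l\<close>.\<close>
  define c where "c = (\<lambda>r. eval (map (\<lambda>i. a (d - i)) [0..<Suc r]) l)"
  have c_closed: "c r \<in> carrier k" for r
    unfolding c_def using a l by (intro eval_in_carrier) auto
  have c0: "c 0 = a d" using a l by (simp add: c_def)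
  have cS: "c (Suc r) = a (d - Suc r) \<oplus> l \<otimes> c r" for r
  proof -
    have "c (Suc r) = c r \<otimes> l \<oplus> a (d - Suc r)"
      using a l eval_snoc[of "map (\<lambda>i. a (d - i)) [0..<Suc r]" "a (d - Suc r)" l]
      unfolding c_def by auto
    then show ?thesis using a l c_closed by (simp add: a_comm m_comm)
  qed
  have cd: "c d = \<zero>" using l by (simp add: c_def)
  define Z where "Z = (\<lambda>i. (T ^^ (m + i)) v)"
  have TZ: "T (Z i) = Z (Suc i)" for i by (simp add: Z_def)
  \<comment> \<open>Partial sums of the quotient polynomial in \<open>T\<close>. Applying
    \<open>T - l\<close> telescopes and leaves the leading terms of the relation together with one
    correction term.\<close>
  define W where "W = (\<lambda>r. \<Sum>s\<le>r. sc (c s) (Z (d - 1 - s)))"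
  have T_add: "T (x + y) = T x + T y" for x y using T by (rule Modules.additive.add)
  have W: "T (W r) - sc l (W r) = (\<Sum>s\<le>r. sc (a (d - s)) (Z (d - s))) - sc (l \<otimes> c r) (Z (d - 1 - r))"
    if "r < d" for r
    using that
  proof (induction r)
    case 0
    have "T (W 0) = sc (a d) (Z d)" using d0 by (simp add: W_def comm c_closed c0 TZ a)
    moreover have "sc l (W 0) = sc (l \<otimes> c 0) (Z (d - 1))"
      using l c_closed by (simp add: W_def sc_mult)
    ultimately show ?case by simp
  next
    case (Suc r)
    have e: "d - 1 - r = d - Suc r" "Suc (d - 1 - Suc r) = d - Suc r" using Suc.prems by auto
    have WS: "W (Suc r) = W r + sc (c (Suc r)) (Z (d - 1 - Suc r))" by (simp add: W_def)
    have x1: "T (W (Suc r)) = T (W r) + sc (c (Suc r)) (Z (d - Suc r))"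
      by (simp only: WS T_add comm[OF c_closed] TZ e)
    have x2: "sc l (W (Suc r)) = sc l (W r) + sc (l \<otimes> c (Suc r)) (Z (d - 1 - Suc r))"
      using l c_closed by (simp only: WS sc_plus sc_mult)
    have x3: "sc (c (Suc r)) (Z (d - Suc r)) = sc (a (d - Suc r)) (Z (d - Suc r)) + sc (l \<otimes> c r) (Z (d - Suc r))"
      unfolding cS using a l c_closed by (simp add: sc_add)
    have x4: "T (W r) = sc l (W r) + (\<Sum>s\<le>r. sc (a (d - s)) (Z (d - s))) - sc (l \<otimes> c r) (Z (d - Suc r))"
      using Suc unfolding e by (simp add: algebra_simps)
    show ?case unfolding x1 x2 x3 x4 by simp
  qed
  define w where "w = W (d - 1)"
  have "T w - sc l w = (\<Sum>s\<le>d - 1. sc (a (d - s)) (Z (d - s))) - sc (l \<otimes> c (d - 1)) (Z 0)"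
    using W[of "d - 1"] d0 by (simp add: w_def)
  also have "sc (l \<otimes> c (d - 1)) (Z 0) = - sc (a 0) (Z 0)"
  proof -
    have "a 0 \<oplus> l \<otimes> c (d - 1) = \<zero>" using cS[of "d - 1"] cd d0 by simp
    then have "sc (a 0) (Z 0) + sc (l \<otimes> c (d - 1)) (Z 0) = 0"
      using a l c_closed by (simp flip: sc_add)
    then show ?thesis by (simp add: eq_neg_iff_add_eq_0 add.commute)
  qed
  also have "(\<Sum>s\<le>d - 1. sc (a (d - s)) (Z (d - s))) - - sc (a 0) (Z 0)
      = (\<Sum>s\<le>d. sc (a (d - s)) (Z (d - s)))"
    using d0 sum.atMost_Suc[of "\<lambda>s. sc (a (d - s)) (Z (d - s))" "d - 1"] by simp
  also have "\<dots> = (\<Sum>i\<le>d. sc (a i) (Z i))"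
    by (rule sum.reindex_bij_witness[of _ "\<lambda>i. d - i" "\<lambda>i. d - i"]) auto
  finally have wN: "T w - sc l w \<in> N" using s by (simp add: Z_def)
  have "w \<notin> N"
  proof
    assume "w \<in> N"
    moreover have "w = (\<Sum>i\<le>d - 1. sc (c (d - 1 - i)) (Z i))"
      unfolding w_def W_def
      by (rule sum.reindex_bij_witness[of _ "\<lambda>i. d - 1 - i" "\<lambda>i. d - 1 - i"])
        (simp_all del: One_nat_def diff_diff_left)
    ultimately have "P (d - 1)"
      unfolding P_def using c_closed c0 a
      by (intro exI[of _ m] exI[of _ "\<lambda>i. c (d - 1 - i)"]) (auto simp: Z_def)
    then show False using notP d0 by simp
  qed
  moreover have "w \<in> M"
  proof -
    have "(\<Sum>s\<in>S. sc (c s) (Z (d - 1 - s))) \<in> M" if "finite S" for S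
      using that by (induction S rule: finite_induct) (auto simp: M Z_def c_closed)
    then show ?thesis by (simp add: w_def W_def)
  qed
  moreover have "l \<noteq> \<zero>"
  proof
    assume "l = \<zero>"
    then have "c d = a 0" using cS[of "d - 1"] d0 a c_closed by simp
    then show False using cd a0 by simp
  qed
  ultimately show ?thesis using l wN by blast
qed

end

section \<open>Abelian groups of exponent \<open>p\<close>\<close>

lemma (in group) prime_exponent_root:
  assumes p: "Factorial_Ring.prime (p::nat)" and x: "x \<in> carrier G" "x [^] p = \<one>" and i: "\<not> p dvd i"
  shows "\<exists>j::nat. (x [^] i) [^] j = x"
proof -
  have "coprime i p" using p i by (metis coprime_commute prime_imp_coprime_nat)
  then obtain j where "[i * j = Suc 0] (mod p)" using cong_solve_coprime_nat by blast
  then have "i * j mod p = 1" using p prime_gt_1_nat by (auto simp: cong_def)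
  then have "i * j = p * (i * j div p) + 1" by (metis mult_div_mod_eq)
  then have "x [^] (i * j) = x [^] (p * (i * j div p)) \<otimes> x"
    using x(1) nat_pow_mult[of x "p * (i * j div p)" 1] by simp
  also have "x [^] (p * (i * j div p)) = (x [^] p) [^] (i * j div p)"
    using x(1) by (simp add: nat_pow_pow)
  finally show ?thesis using x by (auto simp: nat_pow_pow)
qed

text \<open>An abelian group of exponent \<open>p\<close> is a vector space over the prime field.
  The complement is a maximal subgroup meeting \<open>H\<close> trivially, from Zorn's
  lemma.\<close>

lemma (in comm_group) exists_complement:
  assumes p: "Factorial_Ring.prime (p::nat)" and exp: "\<And>x. x \<in> carrier G \<Longrightarrow> x [^] p = \<one>"
    and H: "subgroup H G"
  shows "\<exists>C. subgroup C G \<and> H \<inter> C = {\<one>} \<and> (\<forall>x\<in>carrier G. \<exists>h\<in>H. \<exists>c\<in>C. x = h \<otimes> c)"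
proof -
  interpret H: subgroup H G by fact
  define A where "A = {C. subgroup C G \<and> H \<inter> C = {\<one>}}"
  have "{\<one>} \<in> A" by (auto simp: A_def triv_subgroup)
  then have "A \<noteq> {}" by blast
  moreover have "\<Union>\<C> \<in> A" if ne: "\<C> \<noteq> {}" and ch: "subset.chain A \<C>" for \<C>
  proof -
    have CA: "\<C> \<subseteq> A" and lin: "\<And>D E. D \<in> \<C> \<Longrightarrow> E \<in> \<C> \<Longrightarrow> D \<subseteq> E \<or> E \<subseteq> D"
      using ch by (auto simp: subset_chain_def)
    have sub: "subgroup D G" if "D \<in> \<C>" for D using CA that by (auto simp: A_def)
    have "subgroup (\<Union>\<C>) G"
    proof (rule subgroupI)
      show "\<Union>\<C> \<subseteq> carrier G" using sub subgroup.subset by blast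
      show "\<Union>\<C> \<noteq> {}" using ne sub subgroup.one_closed by blast
      show "inv a \<in> \<Union>\<C>" if "a \<in> \<Union>\<C>" for a
      proof -
        obtain D where "D \<in> \<C>" "a \<in> D" using \<open>a \<in> \<Union>\<C>\<close> by blast
        then show ?thesis using subgroup.m_inv_closed[OF sub] by blast
      qed
      show "a \<otimes> b \<in> \<Union>\<C>" if ab: "a \<in> \<Union>\<C>" "b \<in> \<Union>\<C>" for a b
      proof -
        obtain D E where DE: "D \<in> \<C>" "a \<in> D" "E \<in> \<C>" "b \<in> E" using ab by blast
        have "D \<subseteq> E \<or> E \<subseteq> D" using lin DE by blast
        then show ?thesis
          using subgroup.m_closed[OF sub[OF DE(1)]] subgroup.m_closed[OF sub[OF DE(3)]] DE by blast
      qed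
    qed
    moreover have "H \<inter> \<Union>\<C> = {\<one>}" using CA ne by (auto simp: A_def)
    ultimately show ?thesis by (simp add: A_def)
  qed
  ultimately obtain C where C: "C \<in> A" and max: "\<And>D. D \<in> A \<Longrightarrow> C \<subseteq> D \<Longrightarrow> D = C"
    using subset_Zorn_nonempty[of A] by blast
  interpret C: subgroup C G using C by (simp add: A_def)
  have HC: "H \<inter> C = {\<one>}" using C by (simp add: A_def)
  have pow_H: "h [^] (n::nat) \<in> H" if "h \<in> H" for h n
    by (induction n) (use that H.m_closed in auto)
  have pow_C: "h [^] (n::nat) \<in> C" if "h \<in> C" for h n
    by (induction n) (use that C.m_closed in auto)
  have "\<exists>h\<in>H. \<exists>c\<in>C. x = h \<otimes> c" if x: "x \<in> carrier G" for x
  proof (rule ccontr)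
    assume no: "\<not> ?thesis"
    \<comment> \<open>If \<open>x\<close> is outside the product of \<open>H\<close> and
      \<open>C\<close>, the subgroup generated by \<open>C\<close> and \<open>x\<close> still meets
      \<open>H\<close> trivially: from \<open>h = c x^i\<close> with \<open>i\<close> prime to
      \<open>p\<close>, a power of both sides would exhibit \<open>x\<close> in that
      product.\<close>
    define D where "D = {c \<otimes> x [^] (i::nat) | c i. c \<in> C}"
    have "subgroup D G"
    proof (rule subgroupI)
      show "D \<subseteq> carrier G" using x by (auto simp: D_def)
      have "\<one> \<otimes> x [^] (0::nat) \<in> D"
        unfolding D_def using C.one_closed by (metis (mono_tags, lifting) mem_Collect_eq)
      then show "D \<noteq> {}" by blast
    next
      fix a assume "a \<in> D"
      then obtain c i where a: "a = c \<otimes> x [^] (i::nat)" "c \<in> C" by (auto simp: D_def)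
      have "x [^] i \<otimes> x [^] ((p - 1) * i) = x [^] (p * i)"
        using x p prime_gt_0_nat[OF p] by (simp add: nat_pow_mult add.commute mult_eq_if)
      also have "\<dots> = \<one>" using x exp by (simp flip: nat_pow_pow)
      finally have e: "inv (x [^] i) = x [^] ((p - 1) * i)"
        using x by (metis inv_equality nat_pow_closed m_comm)
      have "inv a = inv c \<otimes> x [^] ((p - 1) * i)"
        using a x by (simp add: inv_mult e)
      then show "inv a \<in> D" using a by (auto simp: D_def)
    next
      fix a b assume "a \<in> D" "b \<in> D"
      then obtain c i d j where ab: "a = c \<otimes> x [^] (i::nat)" "c \<in> C" "b = d \<otimes> x [^] (j::nat)" "d \<in> C"
        by (auto simp: D_def)
      have "a \<otimes> b = (c \<otimes> d) \<otimes> x [^] (i + j)"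
        using ab x by (simp add: nat_pow_mult[symmetric] m_ac)
      then show "a \<otimes> b \<in> D" using ab by (auto simp: D_def)
    qed
    moreover have "H \<inter> D \<subseteq> {\<one>}"
    proof
      fix h assume "h \<in> H \<inter> D"
      then obtain c i where h: "h \<in> H" "h = c \<otimes> x [^] (i::nat)" "c \<in> C" by (auto simp: D_def)
      show "h \<in> {\<one>}"
      proof (cases "p dvd i")
        case True
        then have "x [^] i = \<one>" using x exp by (auto simp: dvd_def simp flip: nat_pow_pow)
        then show ?thesis using h HC by auto
      next
        case False
        then obtain j :: nat where j: "(x [^] i) [^] j = x"
          using prime_exponent_root[OF p x exp[OF x]] by blast
        have "h [^] j = c [^] j \<otimes> x"
          using h x j by (simp add: pow_mult_distrib m_comm)
        then have "x = h [^] j \<otimes> inv (c [^] j)"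
          using h x by (metis C.mem_carrier inv_solve_right m_comm nat_pow_closed H.mem_carrier)
        then show ?thesis using no pow_H[OF h(1)] pow_C[OF h(3)] C.m_inv_closed by blast
      qed
    qed
    ultimately have "D \<in> A" using subgroup.one_closed by (fastforce simp: A_def)
    moreover have "C \<subseteq> D"
    proof
      fix c assume "c \<in> C"
      then have "c = c \<otimes> x [^] (0::nat)" by simp
      then show "c \<in> D" using \<open>c \<in> C\<close> unfolding D_def by blast
    qed
    ultimately have "D = C" using max by blast
    moreover have "\<one> \<otimes> x [^] (1::nat) \<in> D"
      unfolding D_def using C.one_closed by (metis (mono_tags, lifting) mem_Collect_eq)
    ultimately have "x \<in> C" using x by simp
    then have "x = \<one> \<otimes> x" using x by simp
    then show False using no \<open>x \<in> C\<close> H.one_closed by blast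
  qed
  then show ?thesis using HC C.subgroup_axioms by blast
qed

text \<open>On the product of the cyclic group of \<open>x\<close> and a complement
  \<open>C\<close>, read off the exponent of \<open>x\<close> as an element of \<open>'l\<close>;
  this is well defined because \<open>'l\<close> has characteristic \<open>p\<close>.\<close>

lemma (in comm_group) exists_separating_functional:
  assumes p: "Factorial_Ring.prime (p::nat)" "CHAR('l::field) = p"
    and exp: "\<And>x. x \<in> carrier G \<Longrightarrow> x [^] p = \<one>"
    and x: "x \<in> carrier G" "x \<noteq> \<one>"
  shows "\<exists>f::'a \<Rightarrow> 'l. (\<forall>a\<in>carrier G. \<forall>b\<in>carrier G. f (a \<otimes> b) = f a + f b) \<and> f x \<noteq> 0"
proof -
  define H where "H = range (\<lambda>i::nat. x [^] i)"
  have pow_p: "x [^] (p * i) = \<one>" for i using x exp by (simp flip: nat_pow_pow)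
  have "subgroup H G"
  proof (rule subgroupI)
    show "H \<subseteq> carrier G" using x by (auto simp: H_def)
    show "H \<noteq> {}" by (auto simp: H_def)
    show "a \<otimes> b \<in> H" if "a \<in> H" "b \<in> H" for a b
      using that x by (auto simp: H_def nat_pow_mult)
    show "inv a \<in> H" if "a \<in> H" for a
    proof -
      obtain i where i: "a = x [^] (i::nat)" using \<open>a \<in> H\<close> by (auto simp: H_def)
      have "x [^] ((p - 1) * i) \<otimes> x [^] i = x [^] (p * i)"
        using x p prime_gt_0_nat[OF p(1)] by (simp add: nat_pow_mult add.commute mult_eq_if)
      then have "inv a = x [^] ((p - 1) * i)" using x i pow_p by (simp add: inv_equality)
      then show ?thesis by (auto simp: H_def)
    qed
  qed
  from exists_complement[OF p(1) exp this] obtain C where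
    C: "subgroup C G" "H \<inter> C = {\<one>}" and dec: "\<And>a. a \<in> carrier G \<Longrightarrow> \<exists>h\<in>H. \<exists>c\<in>C. a = h \<otimes> c"
    by blast
  interpret C: subgroup C G by fact
  have uniq: "of_nat i = (of_nat j :: 'l)" if "x [^] i \<otimes> c = x [^] j \<otimes> d" "c \<in> C" "d \<in> C" for i j c d
  proof -
    have *: "of_nat i = (of_nat j :: 'l)"
      if e: "x [^] i \<otimes> c = x [^] j \<otimes> d" "c \<in> C" "d \<in> C" and "i \<le> j" for i j c d
    proof -
      have "x [^] j = x [^] i \<otimes> x [^] (j - i)" using x \<open>i \<le> j\<close> by (simp add: nat_pow_mult)
      then have "x [^] i \<otimes> c = x [^] i \<otimes> (x [^] (j - i) \<otimes> d)" using e x by (simp add: m_assoc)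
      then have "c = x [^] (j - i) \<otimes> d" using e x by simp
      then have "x [^] (j - i) = c \<otimes> inv d" using e x by (simp add: inv_solve_right)
      moreover have "c \<otimes> inv d \<in> C" using e by blast
      moreover have "x [^] (j - i) \<in> H" by (simp add: H_def)
      ultimately have "x [^] (j - i) \<in> H \<inter> C" by simp
      then have one: "x [^] (j - i) = \<one>" using C by auto
      have "p dvd j - i"
      proof (rule ccontr)
        assume "\<not> p dvd j - i"
        then obtain m :: nat where "(x [^] (j - i)) [^] m = x"
          using prime_exponent_root[OF p(1) x(1) exp[OF x(1)]] by blast
        then show False using one x by simp
      qed
      then have "of_nat (j - i) = (0::'l)" using p(2) of_nat_eq_0_iff_char_dvd by blast
      then show ?thesis using \<open>i \<le> j\<close> by (simp add: of_nat_diff)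
    qed
    show ?thesis
    proof (cases "i \<le> j")
      case True then show ?thesis by (rule *[OF that])
    next
      case False
      then have "j \<le> i" by simp
      then show ?thesis using *[OF that(1)[symmetric] that(3,2)] by simp
    qed
  qed
  define f where "f = (\<lambda>a. of_nat (SOME i. \<exists>c\<in>C. a = x [^] (i::nat) \<otimes> c) :: 'l)"
  have f: "f (x [^] i \<otimes> c) = of_nat i" if "c \<in> C" for i c
  proof -
    define j where "j = (SOME j. \<exists>d\<in>C. x [^] i \<otimes> c = x [^] (j::nat) \<otimes> d)"
    have "\<exists>d\<in>C. x [^] i \<otimes> c = x [^] i \<otimes> d" using that by (intro bexI[of _ c]) auto
    then have "\<exists>d\<in>C. x [^] i \<otimes> c = x [^] j \<otimes> d" unfolding j_def by (rule someI)
    then obtain d where "d \<in> C" "x [^] i \<otimes> c = x [^] j \<otimes> d" by (elim bexE)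
    then have "of_nat i = (of_nat j :: 'l)" using uniq[OF _ that] by simp
    then show ?thesis by (simp add: f_def j_def)
  qed
  have "f (a \<otimes> b) = f a + f b" if ab: "a \<in> carrier G" "b \<in> carrier G" for a b
  proof -
    obtain i c where a: "a = x [^] (i::nat) \<otimes> c" "c \<in> C" using dec[OF ab(1)] by (auto simp: H_def)
    obtain j d where b: "b = x [^] (j::nat) \<otimes> d" "d \<in> C" using dec[OF ab(2)] by (auto simp: H_def)
    have "a \<otimes> b = x [^] (i + j) \<otimes> (c \<otimes> d)"
      using a b x by (simp add: nat_pow_mult[symmetric] m_ac)
    then show ?thesis using a b f[of "c \<otimes> d" "i + j"] f by simp
  qed
  moreover have "f x \<noteq> 0" using f[of \<one> 1] x by simp
  ultimately show ?thesis by blast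
qed

text \<open>One functional for each nontrivial element separates the points. This turns the additive
  group of a representation, given as a record, into a subset of a ring type of characteristic
  \<open>p\<close>.\<close>

lemma (in comm_group) exists_injective_hom_fun:
  assumes p: "Factorial_Ring.prime (p::nat)" "CHAR('l::field) = p"
    and exp: "\<And>x. x \<in> carrier G \<Longrightarrow> x [^] p = \<one>"
  shows "\<exists>e::'a \<Rightarrow> 'a \<Rightarrow> 'l. inj_on e (carrier G) \<and>
    (\<forall>a\<in>carrier G. \<forall>b\<in>carrier G. e (a \<otimes> b) = e a + e b)"
proof -
  obtain F :: "'a \<Rightarrow> 'a \<Rightarrow> 'l" where
    F: "\<And>x a b. \<lbrakk>x \<in> carrier G; x \<noteq> \<one>; a \<in> carrier G; b \<in> carrier G\<rbrakk> \<Longrightarrow> F x (a \<otimes> b) = F x a + F x b"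
      "\<And>x. \<lbrakk>x \<in> carrier G; x \<noteq> \<one>\<rbrakk> \<Longrightarrow> F x x \<noteq> 0"
    using exists_separating_functional[OF p exp] by metis
  define e where "e = (\<lambda>a x. if x \<in> carrier G \<and> x \<noteq> \<one> then F x a else 0)"
  have add: "e (a \<otimes> b) = e a + e b" if "a \<in> carrier G" "b \<in> carrier G" for a b
    using that F by (auto simp: e_def fun_eq_iff)
  have "a = b" if ab: "a \<in> carrier G" "b \<in> carrier G" "e a = e b" for a b
  proof (rule ccontr)
    assume "a \<noteq> b"
    define x where "x = a \<otimes> inv b"
    have x: "x \<in> carrier G" "x \<noteq> \<one>" "a = x \<otimes> b"
      using ab \<open>a \<noteq> b\<close> by (auto simp: x_def m_assoc inv_solve_right')
    then have "e x = 0" using add[of x b] ab by simp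
    then have "e x x = 0" by simp
    then have "F x x = 0" using x by (simp add: e_def)
    then show False using F(2) x by blast
  qed
  then have "inj_on e (carrier G)" by (rule inj_onI)
  then show ?thesis using add by blast
qed

definition additive_subgroup_set :: "'a::ab_group_add set \<Rightarrow> bool"
  where "additive_subgroup_set H \<longleftrightarrow> 0 \<in> H \<and> (\<forall>x\<in>H. \<forall>y\<in>H. x - y \<in> H)"

lemma additive_subgroup_set_add: "\<lbrakk>additive_subgroup_set H; x \<in> H; y \<in> H\<rbrakk> \<Longrightarrow> x + y \<in> H"
  by (metis additive_subgroup_set_def diff_0 diff_minus_eq_add)

text \<open>Needed for the integers inside the field, for a submodule \<open>V\<close> (to compute
  modulo \<open>V\<close>), and for the image of an embedded representation.\<close>

lemma exists_additive_complement:
  fixes H :: "'x::comm_ring_1 set"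
  assumes p: "Factorial_Ring.prime (p::nat)" "of_nat p = (0::'x)" and H: "additive_subgroup_set H"
  shows "\<exists>C. additive_subgroup_set C \<and> H \<inter> C = {0} \<and> (\<forall>x. \<exists>h\<in>H. \<exists>c\<in>C. x = h + c)"
proof -
  define G where "G = \<lparr>carrier = UNIV :: 'x set, monoid.mult = (+), one = (0::'x)\<rparr>"
  interpret G: comm_group G
    by (rule comm_groupI) (auto simp: G_def algebra_simps intro: exI[of _ "- _"])
  have G_simps: "carrier G = UNIV" "\<And>x y. x \<otimes>\<^bsub>G\<^esub> y = x + y" "\<one>\<^bsub>G\<^esub> = 0"
    by (auto simp: G_def)
  have inv: "inv\<^bsub>G\<^esub> x = - x" for x by (rule G.inv_equality) (auto simp: G_simps)
  have pow: "x [^]\<^bsub>G\<^esub> (n::nat) = of_nat n * x" for x n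
    by (induction n) (auto simp: G_simps algebra_simps)
  have sub: "subgroup S G \<longleftrightarrow> additive_subgroup_set S" for S
  proof
    assume "subgroup S G"
    then interpret S: subgroup S G .
    have "x - y \<in> S" if "x \<in> S" "y \<in> S" for x y
      using S.m_closed[OF that(1) S.m_inv_closed[OF that(2)]] by (simp add: G_simps inv)
    then show "additive_subgroup_set S"
      using S.one_closed by (simp add: additive_subgroup_set_def G_simps)
  next
    assume S: "additive_subgroup_set S"
    then have 0: "0 \<in> S" and d: "\<And>x y. x \<in> S \<Longrightarrow> y \<in> S \<Longrightarrow> x - y \<in> S"
      by (auto simp: additive_subgroup_set_def)
    show "subgroup S G"
    proof (rule G.subgroupI)
      show "inv\<^bsub>G\<^esub> a \<in> S" if "a \<in> S" for a using d[OF 0 that] by (simp add: inv)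
      show "a \<otimes>\<^bsub>G\<^esub> b \<in> S" if "a \<in> S" "b \<in> S" for a b
        using additive_subgroup_set_add[OF S that] by (simp add: G_simps)
    qed (use 0 in \<open>auto simp: G_simps\<close>)
  qed
  have "\<exists>C. subgroup C G \<and> H \<inter> C = {\<one>\<^bsub>G\<^esub>} \<and> (\<forall>x\<in>carrier G. \<exists>h\<in>H. \<exists>c\<in>C. x = h \<otimes>\<^bsub>G\<^esub> c)"
    by (rule G.exists_complement[OF p(1)]) (use H in \<open>auto simp: sub pow p(2) G_simps\<close>)
  then show ?thesis unfolding sub by (simp add: G_simps)
qed

section \<open>Finite transversals and the local field\<close>

text \<open>\<open>C\<close> is thought of as a union of cosets of \<open>H\<close> rather than as a
  group, since besides the ideals also the units and the annuli occur.\<close>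

definition transversal :: "'a::ab_group_add set \<Rightarrow> 'a set \<Rightarrow> 'a set \<Rightarrow> bool"
  where "transversal R H C \<longleftrightarrow> finite R \<and> R \<subseteq> C \<and> (\<forall>x\<in>C. \<exists>!r. r \<in> R \<and> x - r \<in> H)"

lemma transversalD:
  assumes "transversal R H C"
  shows "finite R" "R \<subseteq> C" "\<And>x. x \<in> C \<Longrightarrow> \<exists>r\<in>R. x - r \<in> H"
    "\<And>x r s. \<lbrakk>x \<in> C; r \<in> R; s \<in> R; x - r \<in> H; x - s \<in> H\<rbrakk> \<Longrightarrow> r = s"
  using assms unfolding transversal_def by auto

lemma additive_subgroup_setD:
  assumes "additive_subgroup_set H"
  shows "0 \<in> H" "\<And>x y. x \<in> H \<Longrightarrow> y \<in> H \<Longrightarrow> x - y \<in> H" "\<And>x. x \<in> H \<Longrightarrow> - x \<in> H"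
    "\<And>x y. x \<in> H \<Longrightarrow> y \<in> H \<Longrightarrow> x + y \<in> H"
  using assms additive_subgroup_set_add[OF assms] unfolding additive_subgroup_set_def
  by (simp_all, metis diff_0)

lemma transversal_image:
  assumes R: "transversal R H C" and bij: "bij_betw g C D"
    and equiv: "\<And>x y. \<lbrakk>x \<in> C; y \<in> C\<rbrakk> \<Longrightarrow> g x - g y \<in> H' \<longleftrightarrow> x - y \<in> H"
  shows "transversal (g ` R) H' D"
  unfolding transversal_def
proof safe
  note tr = transversalD[OF R]
  show "finite (g ` R)" using tr(1) by simp
  show "g r \<in> D" if "r \<in> R" for r using that tr(2) bij by (auto simp: bij_betw_def)
  fix y assume "y \<in> D"
  then obtain x where x: "x \<in> C" "y = g x" using bij by (auto simp: bij_betw_def)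
  then obtain r where r: "r \<in> R" "x - r \<in> H" using tr(3) by blast
  show "\<exists>r. r \<in> g ` R \<and> y - r \<in> H'"
    using r x equiv tr(2) by (intro exI[of _ "g r"]) auto
  fix a b assume "a \<in> R" "b \<in> R" "y - g a \<in> H'" "y - g b \<in> H'"
  then show "g a = g b" using x equiv tr(2,4) by (metis subsetD)
qed

lemma transversal_sum_eq:
  fixes f :: "'a::ab_group_add \<Rightarrow> 'b::comm_monoid_add"
  assumes R: "transversal R H C" and S: "transversal S H C" and H: "additive_subgroup_set H"
    and f: "\<And>x y. \<lbrakk>x \<in> C; y \<in> C; x - y \<in> H\<rbrakk> \<Longrightarrow> f x = f y"
  shows "sum f R = sum f S"
proof -
  note r = transversalD[OF R] and s = transversalD[OF S] and h = additive_subgroup_setD[OF H]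
  define i where "i = (\<lambda>x. SOME y. y \<in> S \<and> x - y \<in> H)"
  define j where "j = (\<lambda>x. SOME y. y \<in> R \<and> x - y \<in> H)"
  have i: "i x \<in> S" "x - i x \<in> H" if "x \<in> C" for x
    using someI_ex[of "\<lambda>y. y \<in> S \<and> x - y \<in> H"] s(3)[OF that] by (auto simp: i_def)
  have j: "j x \<in> R" "x - j x \<in> H" if "x \<in> C" for x
    using someI_ex[of "\<lambda>y. y \<in> R \<and> x - y \<in> H"] r(3)[OF that] by (auto simp: j_def)
  have sym: "y - x \<in> H" if "x - y \<in> H" for x y using h(3)[OF that] by simp
  show ?thesis
  proof (rule sum.reindex_bij_witness[of _ j i])
    fix a assume a: "a \<in> R"
    then have aC: "a \<in> C" using r(2) by blast
    show "i a \<in> S" using i aC by blast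
    have "i a \<in> C" using i aC s(2) by blast
    then show "j (i a) = a" using r(4)[of "i a" "j (i a)" a] j[of "i a"] a sym[OF i(2)[OF aC]] by blast
    show "f (i a) = f a" using f[OF _ _ i(2)[OF aC]] aC \<open>i a \<in> C\<close> by simp
  next
    fix b assume b: "b \<in> S"
    then have bC: "b \<in> C" using s(2) by blast
    show "j b \<in> R" using j bC by blast
    have "j b \<in> C" using j bC r(2) by blast
    then show "i (j b) = b" using s(4)[of "j b" "i (j b)" b] i[of "j b"] b sym[OF j(2)[OF bC]] by blast
  qed
qed

lemma transversal_plus:
  assumes R: "transversal R H C" and S: "transversal S K H"
    and H: "additive_subgroup_set H" and K: "additive_subgroup_set K" "K \<subseteq> H"
    and CH: "\<And>c h. c \<in> C \<Longrightarrow> h \<in> H \<Longrightarrow> c + h \<in> C"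
  shows "transversal ((\<lambda>(r, s). r + s) ` (R \<times> S)) K C" "inj_on (\<lambda>(r, s). r + s) (R \<times> S)"
proof -
  note r = transversalD[OF R] and s = transversalD[OF S] and h = additive_subgroup_setD[OF H]
    and k = additive_subgroup_setD[OF K(1)]
  have uniq: "x = x' \<and> y = y'"
    if xy: "x \<in> R" "x' \<in> R" "y \<in> S" "y' \<in> S" "c - (x + y) \<in> K" "c - (x' + y') \<in> K" "c \<in> C" for x x' y y' c
  proof -
    have "c - (x + y) + y \<in> H" "c - (x' + y') + y' \<in> H" using xy s(2) K(2) h(4) by blast+
    then have "c - x \<in> H" "c - x' \<in> H" by (simp_all add: algebra_simps)
    then have "x = x'" using r(4) xy by blast
    moreover have "y = y'"
      using s(4)[of "c - x" y y'] xy \<open>x = x'\<close> \<open>c - x \<in> H\<close> by (simp add: diff_diff_eq)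
    ultimately show ?thesis by blast
  qed
  show "inj_on (\<lambda>(r, s). r + s) (R \<times> S)"
  proof (rule inj_onI, clarify)
    fix x y x' y' assume a: "x \<in> R" "y \<in> S" "x' \<in> R" "y' \<in> S" "x + y = x' + y'"
    have "x + y \<in> C" using a r(2) s(2) CH by blast
    then show "x = x' \<and> y = y'" using uniq[of x x' y y' "x + y"] a k(1) by simp
  qed
  show "transversal ((\<lambda>(r, s). r + s) ` (R \<times> S)) K C"
    unfolding transversal_def
  proof (intro conjI ballI)
    show "finite ((\<lambda>(r, s). r + s) ` (R \<times> S))" using r(1) s(1) by simp
    show "(\<lambda>(r, s). r + s) ` (R \<times> S) \<subseteq> C" using r(2) s(2) CH by auto
    fix c assume c: "c \<in> C"
    obtain x where x: "x \<in> R" "c - x \<in> H" using r(3) c by blast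
    obtain y where y: "y \<in> S" "c - x - y \<in> K" using s(3) x by blast
    show "\<exists>!z. z \<in> (\<lambda>(r, s). r + s) ` (R \<times> S) \<and> c - z \<in> K"
    proof (rule ex1I[of _ "x + y"])
      show "x + y \<in> (\<lambda>(r, s). r + s) ` (R \<times> S) \<and> c - (x + y) \<in> K"
        using x y by (auto simp: diff_diff_eq)
    next
      fix z assume "z \<in> (\<lambda>(r, s). r + s) ` (R \<times> S) \<and> c - z \<in> K"
      then obtain x' y' where "x' \<in> R" "y' \<in> S" "z = x' + y'" "c - (x' + y') \<in> K" by auto
      then show "z = x + y" using uniq[of x x' y y' c] x y c by (simp add: diff_diff_eq)
    qed
  qed
qed

lemma transversal_sum_plus:
  fixes f :: "'a::ab_group_add \<Rightarrow> 'b::comm_monoid_add"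
  assumes "transversal R H C" "transversal S K H" "additive_subgroup_set H"
    "additive_subgroup_set K" "K \<subseteq> H" "\<And>c h. c \<in> C \<Longrightarrow> h \<in> H \<Longrightarrow> c + h \<in> C"
    and T: "transversal T K C" and f: "\<And>x y. \<lbrakk>x \<in> C; y \<in> C; x - y \<in> K\<rbrakk> \<Longrightarrow> f x = f y"
  shows "sum f T = (\<Sum>r\<in>R. \<Sum>s\<in>S. f (r + s))"
proof -
  note pl = transversal_plus[OF assms(1-6)]
  have "sum f T = sum f ((\<lambda>(r, s). r + s) ` (R \<times> S))"
    by (rule transversal_sum_eq[OF T pl(1) assms(4) f])
  also have "\<dots> = (\<Sum>(r, s)\<in>R \<times> S. f (r + s))"
    by (subst sum.reindex[OF pl(2)]) (auto intro!: sum.cong)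
  finally show ?thesis by (simp add: sum.cartesian_product)
qed

lemma transversal_union:
  assumes R: "transversal R H C" and S: "transversal S H D" and "C \<inter> D = {}"
    and H: "additive_subgroup_set H"
    and "\<And>c h. c \<in> C \<Longrightarrow> h \<in> H \<Longrightarrow> c + h \<in> C" "\<And>c h. c \<in> D \<Longrightarrow> h \<in> H \<Longrightarrow> c + h \<in> D"
  shows "transversal (R \<union> S) H (C \<union> D)"
proof -
  note r = transversalD[OF R] and s = transversalD[OF S] and h = additive_subgroup_setD[OF H]
  have cd: False if "c \<in> C" "d \<in> D" "c - d \<in> H" for c d
    using assms(3) assms(6)[OF that(2,3)] that by auto
  have dc: False if "c \<in> C" "d \<in> D" "d - c \<in> H" for c d
    using cd[OF that(1,2)] h(3)[OF that(3)] by simp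
  show ?thesis
    unfolding transversal_def
  proof (intro conjI ballI)
    show "finite (R \<union> S)" "R \<union> S \<subseteq> C \<union> D" using r s by auto
    fix x assume "x \<in> C \<union> D"
    then show "\<exists>!y. y \<in> R \<union> S \<and> x - y \<in> H"
    proof
      assume x: "x \<in> C"
      then obtain y where "y \<in> R" "x - y \<in> H" using r(3) by blast
      then show ?thesis using x r(2,4) s(2) cd by (intro ex1I[of _ y]) (blast, blast)
    next
      assume x: "x \<in> D"
      then obtain y where "y \<in> S" "x - y \<in> H" using s(3) by blast
      then show ?thesis using x s(2,4) r(2) dc by (intro ex1I[of _ y]) (blast, blast)
    qed
  qed
qed

section \<open>Valuation and fractional ideals\<close>

lemma absval_nonneg [simp]: "absval x \<ge> 0"
  using dist_absval[of x 0] by (metis zero_le_dist diff_zero)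

lemma absval_eq_0_iff [simp]: "absval x = 0 \<longleftrightarrow> x = 0"
  using dist_absval[of x 0] by (metis dist_eq_0_iff diff_zero)

lemma absval_zero [simp]: "absval 0 = 0" by simp

lemma absval_pos_iff [simp]: "0 < absval x \<longleftrightarrow> x \<noteq> 0"
  using absval_nonneg[of x] absval_eq_0_iff[of x] by linarith

lemma absval_one [simp]: "absval 1 = 1"
  using absval_mult[of 1 1] absval_eq_0_iff[of 1] by simp

lemma absval_minus [simp]: "absval (- x) = absval x"
  using dist_absval[of 0 x] dist_absval[of x 0] by (simp add: dist_commute)

lemma absval_diff_le: "absval (x - y) \<le> max (absval x) (absval y)"
  using absval_ultrametric[of x "- y"] by simp

lemma absval_inverse [simp]: "absval (inverse x) = inverse (absval x)"
proof (cases "x = 0")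
  case False
  then have "absval x * absval (inverse x) = 1" using absval_mult[of x "inverse x"] by simp
  then show ?thesis by (metis inverse_unique)
qed simp

lemma absval_divide: "absval (x / y) = absval x / absval y"
  by (simp add: divide_inverse absval_mult)

lemma absval_power: "absval (x ^ n) = absval x ^ n"
  by (induction n) (simp_all add: absval_mult)

lemma absval_power_int: "absval (x powi n) = absval x powi n"
  by (simp add: power_int_def absval_power)

lemma absval_add_eq: "absval y < absval x \<Longrightarrow> absval (x + y) = absval x"
  using absval_ultrametric[of x y] absval_diff_le[of "x + y" y] by auto

text \<open>The supremum \<open>s\<close> of the absolute values below \<open>1\<close> is itself
  below \<open>1\<close> by discreteness. A value above \<open>s^2\<close> is already the largest
  one: its quotient by a larger value below \<open>1\<close> would lie strictly between
  \<open>s\<close> and \<open>1\<close>.\<close>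

lemma exists_uniformizer: "\<exists>x::'a::nonarch_local_field. 0 < absval x \<and> absval x < 1 \<and> (\<forall>y::'a. absval y < 1 \<longrightarrow> absval y \<le> absval x)"
proof -
  obtain c where c: "c < 1" "\<And>x::'a. absval x < 1 \<Longrightarrow> absval x \<le> c" using absval_discrete by blast
  obtain x0 :: 'a where x0: "x0 \<noteq> 0" "absval x0 \<noteq> 1" using absval_nontrivial by blast
  define S where "S = {absval x | x::'a. absval x < 1}"
  have bdd: "bdd_above S" using c by (auto simp: S_def bdd_above_def)
  define s where "s = Sup S"
  have ub: "absval x \<le> s" if "absval x < 1" for x :: 'a
    unfolding s_def by (rule cSup_upper[OF _ bdd]) (use that in \<open>auto simp: S_def\<close>)
  have "\<exists>x1::'a. 0 < absval x1 \<and> absval x1 < 1"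
  proof (cases "absval x0 < 1")
    case True then show ?thesis using x0 by (intro exI[of _ x0]) simp
  next
    case False
    then have "absval (inverse x0) < 1" using x0 by (simp add: inverse_less_1_iff)
    then show ?thesis using x0 by (intro exI[of _ "inverse x0"]) simp
  qed
  then obtain x1 :: 'a where x1: "0 < absval x1" "absval x1 < 1" by blast
  then have s0: "0 < s" using ub[of x1] by linarith
  have "s \<le> c" unfolding s_def
    by (rule cSup_least) (use x1 c in \<open>auto simp: S_def\<close>)
  then have s1: "s < 1" using c by simp
  have "s * s < s" using s0 s1 by simp
  then obtain r where "r \<in> S" "s * s < r"
    using less_cSup_iff[of S "s * s"] bdd x1 unfolding s_def by (auto simp: S_def)
  then obtain x :: 'a where x: "absval x < 1" "s * s < absval x" by (auto simp: S_def)
  have xp: "0 < absval x" using x s0 by (smt (verit) mult_nonneg_nonneg)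
  have "absval y \<le> absval x" if y: "absval y < 1" for y :: 'a
  proof (rule ccontr)
    assume "\<not> ?thesis"
    then have l: "absval x < absval y" by simp
    then have "absval (x / y) < 1" using xp absval_pos_iff[of y] by (simp add: absval_divide del: absval_pos_iff)
    then have "absval x / absval y \<le> s" using ub by (metis absval_divide)
    then have "absval x \<le> s * absval y" using l by (simp add: pos_divide_le_eq[OF order_le_less_trans[OF absval_nonneg l]])
    also have "\<dots> \<le> s * s" using ub[OF y] s0 by simp
    finally show False using x by simp
  qed
  then show ?thesis using x xp by blast
qed

definition unif :: "'a::nonarch_local_field"
  where "unif = (SOME x. 0 < absval x \<and> absval x < 1 \<and> (\<forall>y::'a. absval y < 1 \<longrightarrow> absval y \<le> absval x))"

lemma unif: "0 < absval (unif::'a::nonarch_local_field)" "absval (unif::'a) < 1"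
  "absval (y::'a) < 1 \<Longrightarrow> absval y \<le> absval (unif::'a)"
  using someI_ex[OF exists_uniformizer] unfolding unif_def by auto

lemma unif_nz [simp]: "(unif::'a::nonarch_local_field) \<noteq> 0" using unif(1) by simp

lemma exists_valuation:
  assumes "x \<noteq> (0::'a::nonarch_local_field)" shows "\<exists>n::int. absval x = absval (unif::'a) powi n"
proof -
  let ?q = "absval (unif::'a)"
  define n where "n = \<lfloor>log ?q (absval x)\<rfloor>"
  have x: "absval x > 0" using assms by simp
  have e: "?q powr log ?q (absval x) = absval x" using unif(1,2)[where ?'a = 'a] x by (intro powr_log_cancel) auto
  have le: "absval x \<le> ?q powi n"
  proof -
    have "?q powr log ?q (absval x) \<le> ?q powr real_of_int n"
      using unif(1,2)[where ?'a = 'a] by (intro powr_mono') (auto simp: n_def)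
    then show ?thesis using e unif(1)[where ?'a = 'a] by (simp add: powr_real_of_int' del: of_int_add)
  qed
  have lt: "?q powi (n + 1) < absval x"
  proof -
    have "?q powr real_of_int (n + 1) < ?q powr log ?q (absval x)"
      using unif(1,2)[where ?'a = 'a] by (intro powr_less_mono') (auto simp: n_def)
    then show ?thesis using e unif(1)[where ?'a = 'a] by (simp add: powr_real_of_int' del: of_int_add)
  qed
  \<comment> \<open>After division by the power of the uniformizer the value exceeds
    \<open>absval unif\<close> and is at most \<open>1\<close>, and \<open>1\<close> is the only
    such value.\<close>
  define y where "y = x / unif powi n"
  have y: "absval y = absval x / ?q powi n" by (simp add: y_def absval_divide absval_power_int)
  have qp: "0 < ?q powi n" by simp
  have "absval y \<le> 1" using le qp by (simp add: y)
  moreover have "\<not> absval y < 1"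
  proof
    assume "absval y < 1"
    then have "absval x / ?q powi n \<le> ?q" using unif(3) y by metis
    then have "absval x \<le> ?q powi n * ?q" using qp by (simp add: field_simps)
    then show False using lt by (simp add: power_int_add)
  qed
  ultimately have "absval y = 1" by simp
  then have "absval x = ?q powi n" using y qp by (simp add: field_simps)
  then show ?thesis by blast
qed

text \<open>\<open>val 0\<close> is an unspecified integer, which is why \<open>0\<close> is treated
  separately in \<open>pideal_iff\<close> and excluded from \<open>ounits\<close> and
  \<open>annulus\<close>.\<close>

definition val :: "'a::nonarch_local_field \<Rightarrow> int"
  where "val x = (SOME n. absval x = absval (unif::'a) powi n)"

lemma absval_val: "x \<noteq> (0::'a::nonarch_local_field) \<Longrightarrow> absval x = absval (unif::'a) powi (val x)"
  unfolding val_def by (drule exists_valuation) (rule someI_ex)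

lemma unif_powi_le_iff: "absval (unif::'a::nonarch_local_field) powi m \<le> absval (unif::'a) powi n \<longleftrightarrow> n \<le> m"
proof -
  have mono: "absval (unif::'a) powi a < absval (unif::'a) powi b" if "b < a" for a b
    using unif(1,2)[where ?'a = 'a] that by (intro power_int_strict_decreasing) auto
  show ?thesis using mono[of m n] mono[of n m] by (cases m n rule: linorder_cases) auto
qed

lemma unif_powi_eq_iff: "absval (unif::'a::nonarch_local_field) powi m = absval (unif::'a) powi n \<longleftrightarrow> m = n"
proof
  assume e: "absval (unif::'a) powi m = absval (unif::'a) powi n"
  have "absval (unif::'a) powi m \<le> absval (unif::'a) powi n" "absval (unif::'a) powi n \<le> absval (unif::'a) powi m"
    by (simp_all only: e order_refl)
  then show "m = n" unfolding unif_powi_le_iff by simp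
qed simp

lemma val_eqI: "absval (x::'a::nonarch_local_field) = absval (unif::'a) powi n \<Longrightarrow> val x = n"
proof -
  assume e: "absval x = absval (unif::'a) powi n"
  have "0 < absval (unif::'a) powi n" by simp
  then have "x \<noteq> 0" using e by auto
  from absval_val[OF this] have "absval (unif::'a) powi (val x) = absval (unif::'a) powi n" using e by (simp only:)
  then show ?thesis by (simp only: unif_powi_eq_iff)
qed

lemma val_mult: "\<lbrakk>x \<noteq> 0; y \<noteq> 0\<rbrakk> \<Longrightarrow> val (x * y) = val x + val y"
  by (intro val_eqI) (simp add: absval_mult absval_val[of x] absval_val[of y] power_int_add)

lemma val_one [simp]: "val (1::'a::nonarch_local_field) = 0" by (rule val_eqI) simp

lemma val_unif [simp]: "val (unif::'a::nonarch_local_field) = 1" by (rule val_eqI) simp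

lemma val_minus [simp]: "val (- x) = val x" by (simp add: val_def)

lemma val_inverse: "x \<noteq> 0 \<Longrightarrow> val (inverse x) = - val x"
  using val_mult[of x "inverse x"] by simp

lemma val_divide: "\<lbrakk>x \<noteq> 0; y \<noteq> 0\<rbrakk> \<Longrightarrow> val (x / y) = val x - val y"
  by (simp add: divide_inverse val_mult val_inverse)

lemma val_unif_powi [simp]: "val (unif powi n :: 'a::nonarch_local_field) = n"
  by (rule val_eqI) (simp add: absval_power_int)

definition pideal :: "int \<Rightarrow> 'a::nonarch_local_field set"
  where "pideal n = {x. absval x \<le> absval (unif::'a) powi n}"

lemma pideal_iff: "x \<in> pideal n \<longleftrightarrow> x = 0 \<or> n \<le> val x"
  by (cases "x = 0") (simp_all add: pideal_def absval_val[of x] unif_powi_le_iff)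

lemma zero_in_pideal [simp]: "(0::'a::nonarch_local_field) \<in> pideal n" by (simp add: pideal_iff)

lemma one_in_pideal [simp]: "(1::'a::nonarch_local_field) \<in> pideal n \<longleftrightarrow> n \<le> 0" by (simp add: pideal_iff)

lemma pideal_add: "\<lbrakk>x \<in> pideal n; y \<in> pideal n\<rbrakk> \<Longrightarrow> x + y \<in> pideal n"
  using absval_ultrametric[of x y] by (auto simp: pideal_def)

lemma pideal_minus [simp]: "- x \<in> pideal n \<longleftrightarrow> x \<in> pideal n"
  by (simp add: pideal_def)

lemma pideal_diff: "\<lbrakk>x \<in> pideal n; y \<in> pideal n\<rbrakk> \<Longrightarrow> x - y \<in> pideal n"
  using pideal_add[of x n "- y"] by simp

lemma pideal_mult: "\<lbrakk>x \<in> pideal m; y \<in> pideal n\<rbrakk> \<Longrightarrow> x * y \<in> pideal (m + n)"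
  by (cases "x = 0"; cases "y = 0") (simp_all add: pideal_iff val_mult)

lemma pideal_mono: "m \<le> n \<Longrightarrow> (pideal n :: 'a::nonarch_local_field set) \<subseteq> pideal m"
  by (auto simp: pideal_iff)

lemma pideal_monoD: "\<lbrakk>x \<in> pideal n; m \<le> n\<rbrakk> \<Longrightarrow> x \<in> pideal m"
  using pideal_mono by blast

lemma subgroup_pideal: "additive_subgroup_set (pideal n :: 'a::nonarch_local_field set)"
  by (simp add: additive_subgroup_set_def pideal_diff)

lemma pideal_scale: "c \<noteq> 0 \<Longrightarrow> c * x \<in> pideal (val c + n) \<longleftrightarrow> x \<in> pideal n"
  by (cases "x = 0") (simp_all add: pideal_iff val_mult)

lemma exists_pideal: "\<exists>n. (x::'a::nonarch_local_field) \<in> pideal n"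
  by (auto simp: pideal_iff)

lemma exists_pideal_finite: "finite (S :: 'a::nonarch_local_field set) \<Longrightarrow> \<exists>n. S \<subseteq> pideal n"
proof (induction S rule: finite_induct)
  case (insert x S)
  then obtain m n where "S \<subseteq> pideal m" "x \<in> pideal n" using exists_pideal by blast
  then have "insert x S \<subseteq> pideal (min m n)"
    using pideal_mono[of "min m n" m, where ?'a = 'a] pideal_mono[of "min m n" n, where ?'a = 'a] by auto
  then show ?case by blast
qed simp

lemma val_add_eq: "\<lbrakk>x \<noteq> (0::'a::nonarch_local_field); y \<in> pideal n; val x < n\<rbrakk> \<Longrightarrow> x + y \<noteq> 0 \<and> val (x + y) = val x"
proof -
  assume a: "x \<noteq> 0" "y \<in> pideal n" "val x < n"
  have "absval y < absval x"
  proof -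
    have "absval y \<le> absval (unif::'a) powi n" using a by (simp add: pideal_def)
    also have "\<dots> < absval x" using a unif_powi_le_iff[of "val x" n] by (simp add: absval_val[of x] not_le[symmetric])
    finally show ?thesis .
  qed
  then have "absval (x + y) = absval x" by (rule absval_add_eq)
  then show ?thesis using a absval_eq_0_iff[of x] absval_eq_0_iff[of "x + y"]
    val_eqI[of "x + y" "val x"] absval_val[of x] by auto
qed

lemma finite_transversal_residue: "\<exists>R. transversal R (pideal 1) (pideal 0 :: 'a::nonarch_local_field set)"
proof -
  have p0: "x \<in> pideal 0 \<longleftrightarrow> absval x \<le> 1" for x :: 'a by (simp add: pideal_def)
  have p1: "x \<in> pideal 1 \<longleftrightarrow> absval x < 1" for x :: 'a
    using unif(2)[where ?'a = 'a] unif(3)[of x] by (auto simp: pideal_def)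
  define r where "r = {(x::'a, y). absval x \<le> 1 \<and> absval y \<le> 1 \<and> absval (x - y) < 1}"
  have r: "(x, y) \<in> r \<longleftrightarrow> x \<in> pideal 0 \<and> y \<in> pideal 0 \<and> x - y \<in> pideal 1" for x y
    by (simp add: r_def p0 p1)
  have sym: "y - x \<in> pideal n" if "x - y \<in> pideal n" for x y :: 'a and n
    using that pideal_minus[of "x - y"] by simp
  have tri: "x - z \<in> pideal n" if "x - y \<in> pideal n" "y - z \<in> pideal n" for x y z :: 'a and n
    using pideal_add[OF that] by simp
  have fin: "finite (pideal 0 // r)"
  proof -
    have "pideal 0 = {x::'a. absval x \<le> 1}" using p0 by blast
    then show ?thesis using finite_residue_field[where ?'a = 'a] by (simp add: r_def)
  qed
  define g where "g = (\<lambda>Q. SOME x. x \<in> (Q :: 'a set))"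
  have gQ: "g Q \<in> Q" if "Q \<in> pideal 0 // r" for Q
  proof -
    obtain x where "x \<in> pideal 0" "Q = r `` {x}" using \<open>Q \<in> _\<close> by (auto simp: quotient_def)
    then have "x \<in> Q" by (simp add: r)
    then show ?thesis unfolding g_def by (rule someI)
  qed
  have "transversal (g ` (pideal 0 // r)) (pideal 1) (pideal 0)"
    unfolding transversal_def
  proof (intro conjI ballI)
    show "finite (g ` (pideal 0 // r))" using fin by simp
    show "g ` (pideal 0 // r) \<subseteq> pideal 0" 
    proof clarify
      fix Q assume Q: "Q \<in> pideal 0 // r"
      then obtain x where "Q = r `` {x}" by (auto simp: quotient_def)
      then show "g Q \<in> pideal 0" using gQ[OF Q] by (simp add: r)
    qed
    fix x :: 'a assume x: "x \<in> pideal 0"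
    have Q: "r `` {x} \<in> pideal 0 // r" using x by (simp add: quotientI)
    show "\<exists>!y. y \<in> g ` (pideal 0 // r) \<and> x - y \<in> pideal 1"
    proof (rule ex1I[of _ "g (r `` {x})"])
      show "g (r `` {x}) \<in> g ` (pideal 0 // r) \<and> x - g (r `` {x}) \<in> pideal 1"
        using gQ[OF Q] Q by (auto simp: r)
    next
      fix y assume y: "y \<in> g ` (pideal 0 // r) \<and> x - y \<in> pideal 1"
      then obtain Q' where Q': "Q' \<in> pideal 0 // r" "y = g Q'" by blast
      then obtain z where z: "z \<in> pideal 0" "Q' = r `` {z}" by (auto simp: quotient_def)
      have "z - y \<in> pideal 1" using gQ[OF Q'(1)] Q' z by (simp add: r)
      then have xz: "x - z \<in> pideal 1" using y sym tri by blast
      have "r `` {x} = r `` {z}"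
      proof (rule Set.set_eqI)
        fix y
        have "x - y \<in> pideal 1 \<longleftrightarrow> z - y \<in> pideal 1"
          using tri[OF xz, of y] tri[OF sym[OF xz], of y] by blast
        then show "y \<in> r `` {x} \<longleftrightarrow> y \<in> r `` {z}" using x z by (simp add: r)
      qed
      then show "y = g (r `` {x})" using Q' z by simp
    qed
  qed
  then show ?thesis by blast
qed

lemma transversal_scale:
  assumes c: "c \<noteq> (0::'a::nonarch_local_field)" and R: "transversal R (pideal j) (pideal i)"
  shows "transversal ((*) c ` R) (pideal (val c + j)) (pideal (val c + i))"
proof (rule transversal_image[OF R])
  show "bij_betw ((*) c) (pideal i) (pideal (val c + i))"
  proof (rule bij_betw_byWitness[of _ "\<lambda>x. x / c"])
    show "(*) c ` pideal i \<subseteq> pideal (val c + i)" using c by (auto simp: pideal_scale)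
    show "(\<lambda>x. x / c) ` pideal (val c + i) \<subseteq> pideal i"
    proof clarify
      fix x :: 'a assume "x \<in> pideal (val c + i)"
      then have "c * (x / c) \<in> pideal (val c + i)" using c by simp
      then show "x / c \<in> pideal i" using c pideal_scale by blast
    qed
  qed (use c in auto)
  show "c * x - c * y \<in> pideal (val c + j) \<longleftrightarrow> x - y \<in> pideal j" for x y :: 'a
    using pideal_scale[OF c, of "x - y"] by (simp add: right_diff_distrib)
qed

lemma finite_transversal_pideal: "i \<le> j \<Longrightarrow> \<exists>R. transversal R (pideal j) (pideal i :: 'a::nonarch_local_field set)"
proof (induction j rule: int_ge_induct)
  case base
  have "transversal {0} (pideal i) (pideal i :: 'a set)" by (auto simp: transversal_def)
  then show ?case by blast
next
  case (step j)
  then obtain R :: "'a set" where R: "transversal R (pideal j) (pideal i)" by blast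
  obtain S :: "'a set" where S: "transversal S (pideal 1) (pideal 0)" using finite_transversal_residue by blast
  have "transversal ((*) (unif powi j) ` S) (pideal (j + 1)) (pideal j)"
    using transversal_scale[OF _ S, of "unif powi j"] by simp
  then have S': "transversal ((*) (unif powi j) ` S) (pideal (j + 1)) (pideal j)" .
  have "pideal (j + 1) \<subseteq> (pideal j :: 'a set)" by (rule pideal_mono) simp
  moreover have "c + h \<in> pideal i" if "c \<in> pideal i" "h \<in> pideal j" for c h :: 'a
    using that pideal_add pideal_monoD[OF that(2) step.hyps] by blast
  ultimately show ?case
    using transversal_plus(1)[OF R S' subgroup_pideal subgroup_pideal] by blast
qed

definition reps :: "int \<Rightarrow> int \<Rightarrow> 'a::nonarch_local_field set"
  where "reps i j = (SOME R. transversal R (pideal j) (pideal i))"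

lemma reps: "i \<le> j \<Longrightarrow> transversal (reps i j :: 'a::nonarch_local_field set) (pideal j) (pideal i)"
  unfolding reps_def by (rule someI_ex[OF finite_transversal_pideal])

lemma finite_reps: "i \<le> j \<Longrightarrow> finite (reps i j :: 'a::nonarch_local_field set)"
  and reps_subset: "i \<le> j \<Longrightarrow> (reps i j :: 'a::nonarch_local_field set) \<subseteq> pideal i"
  using transversalD[OF reps] by blast+

section \<open>Smooth modules\<close>

definition mk2 :: "'l::field \<Rightarrow> 'l \<Rightarrow> 'l \<Rightarrow> 'l \<Rightarrow> 'l ^ 2 ^ 2"
  where "mk2 a b c d = vector [vector [a, b], vector [c, d]]"

lemma mk2_nth [simp]:
  "mk2 a b c d $ 1 $ 1 = a" "mk2 a b c d $ 1 $ 2 = b" "mk2 a b c d $ 2 $ 1 = c" "mk2 a b c d $ 2 $ 2 = d"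
  by (simp_all add: mk2_def)

lemma mk2_eta: "mk2 (g $ 1 $ 1) (g $ 1 $ 2) (g $ 2 $ 1) (g $ 2 $ 2) = g"
  by (simp add: vec_eq_iff forall_2)

lemma mk2_eq_iff: "mk2 a b c d = mk2 a' b' c' d' \<longleftrightarrow> a = a' \<and> b = b' \<and> c = c' \<and> d = d'"
  by (auto simp: vec_eq_iff forall_2)

lemma mk2_mult: "mk2 a b c d ** mk2 a' b' c' d'
    = mk2 (a * a' + b * c') (a * b' + b * d') (c * a' + d * c') (c * b' + d * d')"
  by (simp add: vec_eq_iff forall_2 matrix_matrix_mult_def sum_2)

lemma det_mk2 [simp]: "det (mk2 a b c d) = a * d - b * c"
  by (simp add: det_2)

lemma invertible_mk2 [simp]: "invertible (mk2 a b c d) \<longleftrightarrow> a * d - b * c \<noteq> 0"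
  by (simp add: invertible_det_nz)

lemma mat_eq_mk2: "mat z = mk2 z 0 0 z"
  by (simp add: vec_eq_iff forall_2 mat_def)

lemma diag2_eq_mk2: "diag2 a d = mk2 a 0 0 d"
  by (simp add: diag2_def mk2_def)

lemma val_unif_power [simp]: "val (unif ^ n :: 'a::nonarch_local_field) = int n"
  using val_unif_powi[of "int n", where ?'a = 'a] by simp

text \<open>The ring type \<open>'x\<close> is a container: \<open>M\<close> is the representation
  proper, and the group acts on all of \<open>'x\<close>, so that sums and additive maps need no
  carrier conditions. Smoothness is expressed by congruence neighbourhoods of the identity, and
  \<open>char_x\<close> records that the vectors are killed by \<open>p\<close>.\<close>

locale smooth_module = scalar_action k sc
  for k :: "'k ring" (structure) and sc :: "'k \<Rightarrow> 'x::comm_ring_1 \<Rightarrow> 'x" +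
  fixes p :: nat and act :: "'l::nonarch_local_field ^ 2 ^ 2 \<Rightarrow> 'x \<Rightarrow> 'x" and M :: "'x set"
  assumes prime_p: "Factorial_Ring.prime p" and char_x: "of_nat p = (0::'x)" and char_l: "CHAR('l) = p"
    and act_additive: "Modules.additive (act g)"
    and act_mult: "\<lbrakk>invertible g; invertible h\<rbrakk> \<Longrightarrow> act (g ** h) x = act g (act h x)"
    and act_one: "act (mat 1) x = x"
    and act_sc: "\<lbrakk>invertible g; a \<in> carrier k\<rbrakk> \<Longrightarrow> act g (sc a x) = sc a (act g x)"
    and M_subgroup: "additive_subgroup_set M"
    and M_act: "\<lbrakk>invertible g; x \<in> M\<rbrakk> \<Longrightarrow> act g x \<in> M"
    and M_sc: "\<lbrakk>a \<in> carrier k; x \<in> M\<rbrakk> \<Longrightarrow> sc a x \<in> M"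
    and sc_one: "x \<in> M \<Longrightarrow> sc \<one> x = x"
    and smooth: "\<exists>n. \<forall>a b c d. a - 1 \<in> pideal n \<longrightarrow> b \<in> pideal n \<longrightarrow> c \<in> pideal n \<longrightarrow> d - 1 \<in> pideal n
      \<longrightarrow> a * d - b * c \<noteq> 0 \<longrightarrow> act (mk2 a b c d) x = x"
begin

definition u :: "'l \<Rightarrow> 'x \<Rightarrow> 'x" where "u a = act (mk2 1 a 0 1)"
definition l :: "'l \<Rightarrow> 'x \<Rightarrow> 'x" where "l a = act (mk2 1 0 a 1)"
definition D :: "'l \<Rightarrow> 'l \<Rightarrow> 'x \<Rightarrow> 'x" where "D a d = act (mk2 a 0 0 d)"
definition w :: "'x \<Rightarrow> 'x" where "w = act (mk2 0 1 1 0)"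

lemmas gens_def = u_def l_def D_def w_def

lemma act_mk2: "\<lbrakk>a * d - b * c \<noteq> 0; a' * d' - b' * c' \<noteq> 0\<rbrakk> \<Longrightarrow> act (mk2 a b c d) (act (mk2 a' b' c' d') x)
    = act (mk2 (a * a' + b * c') (a * b' + b * d') (c * a' + d * c') (c * b' + d * d')) x"
  by (simp flip: act_mult mk2_mult)

lemma u_u: "u a (u b x) = u (a + b) x" by (simp add: gens_def act_mk2 add.commute)
lemma u_0 [simp]: "u 0 x = x" using act_one[of x] by (simp add: u_def mat_eq_mk2)
lemma l_0 [simp]: "l 0 x = x" using act_one[of x] by (simp add: l_def mat_eq_mk2)
lemma D_1 [simp]: "D 1 1 x = x" using act_one[of x] by (simp add: D_def mat_eq_mk2)
lemma w_w [simp]: "w (w x) = x" using act_one[of x] by (simp add: w_def act_mk2 mat_eq_mk2)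
lemma D_D: "\<lbrakk>a \<noteq> 0; b \<noteq> 0; c \<noteq> 0; d \<noteq> 0\<rbrakk> \<Longrightarrow> D a b (D c d x) = D (a * c) (b * d) x"
  by (simp add: gens_def act_mk2)
lemma D_u: "\<lbrakk>a \<noteq> 0; d \<noteq> 0\<rbrakk> \<Longrightarrow> D a d (u b x) = u (a * b / d) (D a d x)"
  by (simp add: gens_def act_mk2)
lemma D_l: "\<lbrakk>a \<noteq> 0; d \<noteq> 0\<rbrakk> \<Longrightarrow> D a d (l b x) = l (d * b / a) (D a d x)"
  by (simp add: gens_def act_mk2)
lemma w_l: "w (l b x) = u b (w x)" by (simp add: gens_def act_mk2)
lemma w_D: "\<lbrakk>a \<noteq> 0; d \<noteq> 0\<rbrakk> \<Longrightarrow> w (D a d x) = D d a (w x)" by (simp add: gens_def act_mk2)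
text \<open>Bruhat decomposition in rank one. On a vector fixed by \<open>l (1 / c)\<close> it
  replaces \<open>w\<close> by an element of the Borel subgroup.\<close>

lemma w_u_bruhat: "c \<noteq> 0 \<Longrightarrow> w (u c x) = u (1 / c) (D (- 1 / c) c (l (1 / c) x))"
  by (simp add: gens_def act_mk2)
text \<open>The triangular factorisation of a matrix with lower right entry \<open>1 + c a\<close>.
  In \<open>l_hn\<close> it shows how lower unipotents permute the summands of a power of
  \<open>h\<close>.\<close>

lemma l_u: "1 + c * a \<noteq> 0 \<Longrightarrow>
    l c (u a x) = u (a / (1 + c * a)) (D (1 / (1 + c * a)) (1 + c * a) (l (c / (1 + c * a)) x))"
proof -
  assume nz: "1 + c * a \<noteq> 0"
  define s where "s = 1 + c * a"
  have s: "s \<noteq> 0" "1 / s + a / s * c = 1" "a / s * s = a" "s * (c / s) = c" "s = c * a + 1"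
    using nz by (simp_all add: s_def add_divide_distrib[symmetric] mult.commute add.commute)
  have "l c (u a x) = act (mk2 1 a c s) x" using s by (simp add: gens_def act_mk2)
  moreover have "D (1 / s) s (l (c / s) x) = act (mk2 (1 / s) 0 c s) x"
    using s(1,4) by (simp add: gens_def act_mk2)
  moreover have "u (a / s) (act (mk2 (1 / s) 0 c s) x) = act (mk2 1 a c s) x"
    using s(1,2,3) by (simp add: gens_def act_mk2)
  ultimately show ?thesis by (simp add: s_def)
qed

lemma act_plus: "act g (x + y) = act g x + act g y" using act_additive by (rule Modules.additive.add)
lemma act_diff: "act g (x - y) = act g x - act g y" using act_additive by (rule Modules.additive.diff)
lemma act_zero [simp]: "act g 0 = 0" using act_additive by (rule Modules.additive.zero)
lemma act_sum: "act g (\<Sum>i\<in>I. f i) = (\<Sum>i\<in>I. act g (f i))" using act_additive by (rule Modules.additive.sum)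

lemma u_sum: "u a (\<Sum>i\<in>I. f i) = (\<Sum>i\<in>I. u a (f i))" by (simp add: u_def act_sum)
lemma l_sum: "l a (\<Sum>i\<in>I. f i) = (\<Sum>i\<in>I. l a (f i))" by (simp add: l_def act_sum)
lemma D_sum: "D a d (\<Sum>i\<in>I. f i) = (\<Sum>i\<in>I. D a d (f i))" by (simp add: D_def act_sum)
lemma w_sum: "w (\<Sum>i\<in>I. f i) = (\<Sum>i\<in>I. w (f i))" by (simp add: w_def act_sum)
lemma u_plus: "u a (x + y) = u a x + u a y" by (simp add: u_def act_plus)
lemma u_diff: "u a (x - y) = u a x - u a y" by (simp add: u_def act_diff)
lemma l_diff: "l a (x - y) = l a x - l a y" by (simp add: l_def act_diff)
lemma D_plus: "D a d (x + y) = D a d x + D a d y" by (simp add: D_def act_plus)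
lemma D_diff: "D a d (x - y) = D a d x - D a d y" by (simp add: D_def act_diff)
lemma w_plus: "w (x + y) = w x + w y" by (simp add: w_def act_plus)
lemma w_diff: "w (x - y) = w x - w y" by (simp add: w_def act_diff)
lemma u_zero [simp]: "u a 0 = 0" by (simp add: u_def)
lemma l_zero [simp]: "l a 0 = 0" by (simp add: l_def)
lemma D_zero [simp]: "D a d 0 = 0" by (simp add: D_def)
lemma w_zero [simp]: "w 0 = 0" by (simp add: w_def)
lemma u_sc: "c \<in> carrier k \<Longrightarrow> u a (sc c x) = sc c (u a x)" by (simp add: u_def act_sc)
lemma l_sc: "c \<in> carrier k \<Longrightarrow> l a (sc c x) = sc c (l a x)" by (simp add: l_def act_sc)
lemma D_sc: "\<lbrakk>c \<in> carrier k; a \<noteq> 0; d \<noteq> 0\<rbrakk> \<Longrightarrow> D a d (sc c x) = sc c (D a d x)" by (simp add: D_def act_sc)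
lemma w_sc: "c \<in> carrier k \<Longrightarrow> w (sc c x) = sc c (w x)" by (simp add: w_def act_sc)

definition G_stable :: "'x set \<Rightarrow> bool"
  where "G_stable V \<longleftrightarrow> additive_subgroup_set V \<and> (\<forall>g x. invertible g \<longrightarrow> x \<in> V \<longrightarrow> act g x \<in> V) \<and>
    (\<forall>a\<in>carrier k. \<forall>x\<in>V. sc a x \<in> V)"

lemma G_stable_M: "G_stable M"
  by (simp add: G_stable_def M_subgroup M_act M_sc)

lemma G_stableD:
  assumes "G_stable V"
  shows "0 \<in> V" "\<And>x y. x \<in> V \<Longrightarrow> y \<in> V \<Longrightarrow> x + y \<in> V" "\<And>x y. x \<in> V \<Longrightarrow> y \<in> V \<Longrightarrow> x - y \<in> V"
    "\<And>x. x \<in> V \<Longrightarrow> - x \<in> V"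
    "\<And>a x. x \<in> V \<Longrightarrow> u a x \<in> V" "\<And>a x. x \<in> V \<Longrightarrow> l a x \<in> V" "\<And>x. x \<in> V \<Longrightarrow> w x \<in> V"
    "\<And>a d x. \<lbrakk>x \<in> V; a \<noteq> 0; d \<noteq> 0\<rbrakk> \<Longrightarrow> D a d x \<in> V" "\<And>a x. \<lbrakk>a \<in> carrier k; x \<in> V\<rbrakk> \<Longrightarrow> sc a x \<in> V"
    "\<And>g x. \<lbrakk>invertible g; x \<in> V\<rbrakk> \<Longrightarrow> act g x \<in> V"
  using assms additive_subgroup_setD[of V] by (auto simp: G_stable_def gens_def)

lemma G_stable_sum: "\<lbrakk>G_stable V; \<And>i. i \<in> I \<Longrightarrow> f i \<in> V\<rbrakk> \<Longrightarrow> (\<Sum>i\<in>I. f i) \<in> V"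
  by (induction I rule: infinite_finite_induct) (auto simp: G_stableD)

lemma smoothE:
  obtains n where "n \<ge> 1" "\<And>a. a \<in> pideal n \<Longrightarrow> u a x = x" "\<And>a. a \<in> pideal n \<Longrightarrow> l a x = x"
    "\<And>a d. \<lbrakk>a - 1 \<in> pideal n; d - 1 \<in> pideal n\<rbrakk> \<Longrightarrow> D a d x = x"
proof -
  obtain n where n: "\<And>a b c d. \<lbrakk>a - 1 \<in> pideal n; b \<in> pideal n; c \<in> pideal n; d - 1 \<in> pideal n;
      a * d - b * c \<noteq> 0\<rbrakk> \<Longrightarrow> act (mk2 a b c d) x = x"
    using smooth[of x] by blast
  define m where "m = max n 1"
  have mn: "a \<in> pideal m \<Longrightarrow> a \<in> pideal n" for a :: 'l by (rule pideal_monoD) (auto simp: m_def)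
  have nz: "a \<noteq> 0" if "a - 1 \<in> pideal m" for a :: 'l
    using that by (auto simp: m_def pideal_iff)
  show ?thesis
  proof (rule that[of m])
    show "1 \<le> m" by (simp add: m_def)
    show "u a x = x" if "a \<in> pideal m" for a
      using n[of 1 a 0 1] mn[OF that] by (simp add: u_def)
    show "l a x = x" if "a \<in> pideal m" for a
      using n[of 1 0 a 1] mn[OF that] by (simp add: l_def)
    show "D a d x = x" if "a - 1 \<in> pideal m" "d - 1 \<in> pideal m" for a d
      using n[of a 0 0 d] mn[OF that(1)] mn[OF that(2)] nz[OF that(1)] nz[OF that(2)] by (simp add: D_def)
  qed
qed

definition fixed :: "int \<Rightarrow> 'x set"
  where "fixed n = {x. \<forall>a\<in>pideal n. u a x = x}"

lemma fixedD: "\<lbrakk>x \<in> fixed n; a \<in> pideal n\<rbrakk> \<Longrightarrow> u a x = x"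
  by (simp add: fixed_def)

lemma fixed_zero [simp]: "0 \<in> fixed n" by (simp add: fixed_def)

lemma fixed_add: "\<lbrakk>x \<in> fixed n; y \<in> fixed n\<rbrakk> \<Longrightarrow> x + y \<in> fixed n"
  by (simp add: fixed_def u_plus)

lemma fixed_diff: "\<lbrakk>x \<in> fixed n; y \<in> fixed n\<rbrakk> \<Longrightarrow> x - y \<in> fixed n"
  by (simp add: fixed_def u_diff)

lemma fixed_sc: "\<lbrakk>a \<in> carrier k; x \<in> fixed n\<rbrakk> \<Longrightarrow> sc a x \<in> fixed n"
  by (simp add: fixed_def u_sc)

lemma fixed_u_eq: "\<lbrakk>x \<in> fixed n; a - b \<in> pideal n\<rbrakk> \<Longrightarrow> u a x = u b x"
  using u_u[of b "a - b" x] by (simp add: fixedD)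

lemma fixed_u: "x \<in> fixed n \<Longrightarrow> u a x \<in> fixed n"
  unfolding fixed_def
proof safe
  fix b :: 'l assume "\<forall>a\<in>pideal n. u a x = x" "b \<in> pideal n"
  then have "u a (u b x) = u a x" by simp
  then show "u b (u a x) = u a x" by (simp add: u_u add.commute)
qed

lemma fixed_D:
  assumes "x \<in> fixed n" "a \<noteq> 0" "d \<noteq> 0" "val a - val d + n \<le> m"
  shows "D a d x \<in> fixed m"
  unfolding fixed_def
proof safe
  fix b :: 'l assume b: "b \<in> pideal m"
  have "d * b / a \<in> pideal n"
    using b assms by (cases "b = 0") (auto simp: pideal_iff val_mult val_divide)
  then have "D a d (u (d * b / a) x) = D a d x" using assms(1) by (simp add: fixedD)
  then show "u b (D a d x) = D a d x" using assms by (simp add: D_u)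
qed

lemma exists_fixed: "\<exists>n\<ge>1. x \<in> fixed n"
  by (rule smoothE[of x]) (auto simp: fixed_def)

text \<open>Independent of the chosen representatives only on \<open>fixed j\<close>; it is
  nevertheless defined on all vectors, so that \<open>h\<close> is an additive map of the whole
  type.\<close>

definition nrm :: "int \<Rightarrow> int \<Rightarrow> 'x \<Rightarrow> 'x"
  where "nrm i j x = (\<Sum>a\<in>reps i j. u a x)"

lemma nrm_transversal:
  assumes "i \<le> j" "transversal R (pideal j) (pideal i)" "x \<in> fixed j"
  shows "(\<Sum>a\<in>R. u a x) = nrm i j x"
  unfolding nrm_def
  by (rule transversal_sum_eq[OF assms(2) reps[OF assms(1)] subgroup_pideal]) (rule fixed_u_eq[OF assms(3)])

lemma nrm_plus: "nrm i j (x + y) = nrm i j x + nrm i j y"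
  by (simp add: nrm_def u_plus sum.distrib)
lemma nrm_sc: "c \<in> carrier k \<Longrightarrow> nrm i j (sc c x) = sc c (nrm i j x)"
  by (simp add: nrm_def u_sc sc_sum)
lemma nrm_fixed:
  assumes "i \<le> j" "x \<in> fixed j" shows "nrm i j x \<in> fixed i"
  unfolding fixed_def
proof safe
  fix a :: 'l assume a: "a \<in> pideal i"
  have "transversal ((+) a ` reps i j) (pideal j) (pideal i)"
  proof (rule transversal_image[OF reps[OF assms(1)]])
    show "bij_betw ((+) a) (pideal i) (pideal i)"
      by (rule bij_betw_byWitness[of _ "\<lambda>x. x - a"]) (use a in \<open>auto intro: pideal_add pideal_diff\<close>)
  qed simp
  from nrm_transversal[OF assms(1) this assms(2)] show "u a (nrm i j x) = nrm i j x"
    by (simp add: sum.reindex nrm_def u_sum u_u)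
qed

lemma nrm_nrm:
  assumes "i \<le> j" "j \<le> m" "x \<in> fixed m" shows "nrm i j (nrm j m x) = nrm i m x"
proof -
  have "nrm i m x = (\<Sum>r\<in>reps i j. \<Sum>s\<in>reps j m. u (r + s) x)"
    unfolding nrm_def
  proof (rule transversal_sum_plus[OF reps[OF assms(1)] reps[OF assms(2)] subgroup_pideal subgroup_pideal])
    show "transversal (reps i m) (pideal m) (pideal i :: 'l set)" using assms by (intro reps) simp
    show "c + h \<in> pideal i" if "c \<in> pideal i" "h \<in> pideal j" for c h :: 'l
      using that pideal_add pideal_monoD[OF that(2) assms(1)] by blast
  qed (use assms pideal_mono fixed_u_eq[OF assms(3)] in auto)
  then show ?thesis by (simp add: nrm_def u_sum u_u)
qed

text \<open>Conjugation by \<open>D a d\<close> multiplies the unipotent parameter by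
  \<open>a / d\<close>, hence shifts both ideals by \<open>val a - val d\<close>.\<close>

lemma D_nrm:
  assumes "a \<noteq> 0" "d \<noteq> 0" "i \<le> j" "x \<in> fixed j"
  shows "D a d (nrm i j x) = nrm (val a - val d + i) (val a - val d + j) (D a d x)"
proof -
  have v: "val (a / d) = val a - val d" using assms by (simp add: val_divide)
  have "transversal ((*) (a / d) ` reps i j) (pideal (val a - val d + j)) (pideal (val a - val d + i))"
    using transversal_scale[OF _ reps[OF assms(3)], of "a / d"] assms v by simp
  moreover have "D a d x \<in> fixed (val a - val d + j)" using assms by (intro fixed_D[OF assms(4)]) auto
  ultimately have "nrm (val a - val d + i) (val a - val d + j) (D a d x)
      = (\<Sum>b\<in>(*) (a / d) ` reps i j. u b (D a d x))"
    using assms by (intro nrm_transversal[symmetric]) auto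
  also have "\<dots> = (\<Sum>b\<in>reps i j. u (a * b / d) (D a d x))"
    using assms by (subst sum.reindex) (auto intro: inj_onI)
  finally show ?thesis using assms by (simp add: nrm_def D_sum D_u)
qed

definition h :: "'x \<Rightarrow> 'x" where "h x = nrm 0 1 (D unif 1 x)"

lemma additive_h: "Modules.additive h"
  by (simp add: Modules.additive_def h_def nrm_plus D_plus)
lemma h_diff: "h (x - y) = h x - h y" using additive_h by (rule Modules.additive.diff)
lemma h_sc: "c \<in> carrier k \<Longrightarrow> h (sc c x) = sc c (h x)"
  by (simp add: h_def D_sc nrm_sc)

lemma hn_diff: "(h ^^ n) (x - y) = (h ^^ n) x - (h ^^ n) y"
  using additive_funpow[OF additive_h] by (rule Modules.additive.diff)
lemma hn_plus: "(h ^^ n) (x + y) = (h ^^ n) x + (h ^^ n) y"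
  using additive_funpow[OF additive_h] by (rule Modules.additive.add)
lemma hn_zero [simp]: "(h ^^ n) 0 = 0"
  using additive_funpow[OF additive_h] by (rule Modules.additive.zero)
lemma hn_sc: "c \<in> carrier k \<Longrightarrow> (h ^^ n) (sc c x) = sc c ((h ^^ n) x)"
  by (induction n) (simp_all add: h_sc)

lemma h_fixed: "x \<in> fixed 0 \<Longrightarrow> h x \<in> fixed 0"
  unfolding h_def by (intro nrm_fixed fixed_D) auto

lemma hn_fixed: "x \<in> fixed 0 \<Longrightarrow> (h ^^ n) x \<in> fixed 0"
  by (induction n) (simp_all add: h_fixed)

lemma h_stable: "\<lbrakk>G_stable V; x \<in> V\<rbrakk> \<Longrightarrow> h x \<in> V"
  unfolding h_def nrm_def by (intro G_stable_sum) (auto intro!: G_stableD(5,8))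

lemma hn_stable: "\<lbrakk>G_stable V; x \<in> V\<rbrakk> \<Longrightarrow> (h ^^ n) x \<in> V"
  by (induction n) (simp_all add: h_stable)

text \<open>Pulling \<open>t\<close> through the inner norm shifts its ideals by one, after which
  the outer and the inner norm fit together by \<open>nrm_nrm\<close>.\<close>

lemma hn_eq_nrm: "x \<in> fixed 0 \<Longrightarrow> (h ^^ n) x = nrm 0 (int n) (D (unif powi int n) 1 x)"
proof (induction n)
  case 0
  have "transversal {0} (pideal 0) (pideal 0 :: 'l set)" by (auto simp: transversal_def)
  from nrm_transversal[OF _ this 0] show ?case by simp
next
  case (Suc n)
  let ?t = "D (unif powi int n) 1"
  have f: "?t x \<in> fixed (int n)" "D (unif powi int (Suc n)) 1 x \<in> fixed (int (Suc n))"
    using Suc.prems by (auto intro!: fixed_D)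
  have "(h ^^ Suc n) x = nrm 0 1 (D unif 1 (nrm 0 (int n) (?t x)))"
    by (simp only: funpow.simps comp_apply Suc.IH[OF Suc.prems] h_def[of "nrm 0 (int n) (?t x)"])
  also have "D unif 1 (nrm 0 (int n) (?t x)) = nrm 1 (int (Suc n)) (D unif 1 (?t x))"
    using D_nrm[of unif 1 0 "int n" "?t x"] f by (simp add: add.commute)
  also have "D unif 1 (?t x) = D (unif powi int (Suc n)) 1 x"
    by (simp add: D_D power_int_add mult.commute)
  also have "nrm 0 1 (nrm 1 (int (Suc n)) (D (unif powi int (Suc n)) 1 x))
      = nrm 0 (int (Suc n)) (D (unif powi int (Suc n)) 1 x)"
    by (rule nrm_nrm[OF _ _ f(2)]) auto
  finally show ?case .
qed

lemma D_h:
  assumes "x \<in> fixed 0" "a \<noteq> 0" "d \<noteq> 0" "val a = val d" shows "D a d (h x) = h (D a d x)"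
proof -
  have "D unif 1 x \<in> fixed 1" using assms by (intro fixed_D) auto
  then show ?thesis using D_nrm[of a d 0 1 "D unif 1 x"] assms by (simp add: h_def D_D mult.commute)
qed

lemma D_hn:
  assumes "x \<in> fixed 0" "a \<noteq> 0" "d \<noteq> 0" "val a = val d"
  shows "D a d ((h ^^ n) x) = (h ^^ n) (D a d x)"
  by (induction n) (use assms in \<open>simp_all add: D_h hn_fixed\<close>)

lemma sc_eq_zeroD: "\<lbrakk>a \<in> carrier k; x \<in> M; sc a x = 0\<rbrakk> \<Longrightarrow> a = \<zero> \<or> x = 0"
proof -
  assume a: "a \<in> carrier k" "x \<in> M" "sc a x = 0"
  show ?thesis
  proof (rule ccontr)
    assume n: "\<not> ?thesis"
    then have U: "a \<in> Units k" using a field_Units by blast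
    have "x = sc (inv a \<otimes> a) x" using Units_l_inv[OF U] sc_one[OF a(2)] by simp
    also have "\<dots> = sc (inv a) (sc a x)" using a Units_inv_closed[OF U] by (simp only: sc_mult)
    finally show False using n a by simp
  qed
qed

lemma sc_cancel: "\<lbrakk>a \<in> carrier k; b \<in> carrier k; x \<in> M; x \<noteq> 0; sc a x = sc b x\<rbrakk> \<Longrightarrow> a = b"
proof -
  assume a: "a \<in> carrier k" "b \<in> carrier k" "x \<in> M" "x \<noteq> 0" "sc a x = sc b x"
  have "sc (a \<ominus> b) x = 0" using a by (simp add: a_minus_def sc_add sc_a_inv)
  then have "a \<ominus> b = \<zero>" using sc_eq_zeroD[of "a \<ominus> b" x] a by auto
  then show "a = b" using a by simp
qed

text \<open>That \<open>k\<close> has characteristic \<open>p\<close> is extracted from the module: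
  multiplication by a scalar of order dividing \<open>p\<close> is a unipotent operator on the
  nonzero \<open>M\<close>, so it fixes a nonzero vector and the scalar is \<open>1\<close>.\<close>

lemma p_power_root_of_unity:
  assumes "c \<in> carrier k" "c [^] (p ^ r) = \<one>" and x: "x \<in> M" "x \<noteq> 0"
  shows "c = \<one>"
  using assms(1,2)
proof (induction r arbitrary: c)
  case (Suc r)
  let ?c = "c [^] (p ^ r)"
  have c: "?c \<in> carrier k" "?c [^] p = \<one>" using Suc.prems by (auto simp: nat_pow_pow mult.commute)
  have pow: "(sc ?c ^^ n) z = sc (?c [^] n) z" if "z \<in> M" for n z
    by (induction n) (use that c(1) in \<open>simp_all add: sc_one m_comm flip: sc_mult\<close>)
  have "\<exists>y\<in>M. y \<notin> {0} \<and> (\<forall>f\<in>{sc ?c}. f y - y \<in> {0})"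
  proof (rule unipotent_fixed_vector[OF prime_p char_x])
    show "(f ^^ p) z = z" if "f \<in> {sc ?c}" "z \<in> M" for f z using that pow[of z p] c sc_one by simp
    show "f z - z \<in> M" if "f \<in> {sc ?c}" "z \<in> M" for f z
      using that c M_sc additive_subgroup_setD[OF M_subgroup] by auto
    show "x \<in> M" by fact
  qed (use x sc_additive in auto)
  then obtain y where "y \<in> M" "y \<noteq> 0" "sc ?c y = sc \<one> y" using sc_one by auto
  then have "?c = \<one>" using sc_cancel c by blast
  then show ?case using Suc by blast
qed simp

end

lemma transversal_subset:
  assumes R: "transversal R H C" and "E \<subseteq> C" and H: "additive_subgroup_set H"
    and E: "\<And>c h. c \<in> E \<Longrightarrow> h \<in> H \<Longrightarrow> c + h \<in> E"
  shows "transversal (R \<inter> E) H E"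
  unfolding transversal_def
proof (intro conjI ballI)
  note r = transversalD[OF R]
  show "finite (R \<inter> E)" using r(1) by simp
  show "R \<inter> E \<subseteq> E" by simp
  fix x assume x: "x \<in> E"
  then obtain y where y: "y \<in> R" "x - y \<in> H" using r(3) assms(2) by blast
  have "x + - (x - y) \<in> E" using E[OF x] additive_subgroup_setD(3)[OF H y(2)] by blast
  then have "y \<in> E" by simp
  show "\<exists>!r. r \<in> R \<inter> E \<and> x - r \<in> H"
  proof (rule ex1I[of _ y])
    show "y \<in> R \<inter> E \<and> x - y \<in> H" using y \<open>y \<in> E\<close> by simp
    show "z = y" if "z \<in> R \<inter> E \<and> x - z \<in> H" for z
      using that r(4)[of x z y] y x assms(2) by blast
  qed
qed

definition ounits :: "'a::nonarch_local_field set"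
  where "ounits = {x. x \<noteq> 0 \<and> val x = 0}"

lemma ounits_subset: "ounits \<subseteq> (pideal 0 :: 'a::nonarch_local_field set)"
  by (auto simp: ounits_def pideal_iff)

lemma ounits_add: "\<lbrakk>x \<in> ounits; y \<in> pideal n; 1 \<le> n\<rbrakk> \<Longrightarrow> x + y \<in> (ounits :: 'a::nonarch_local_field set)"
  using val_add_eq[of x y n] by (simp add: ounits_def)

lemma ounits_iff: "x \<in> ounits \<longleftrightarrow> x \<in> pideal 0 \<and> x \<notin> (pideal 1 :: 'a::nonarch_local_field set)"
  by (auto simp: ounits_def pideal_iff)

lemma ounits_mult: "\<lbrakk>x \<in> ounits; y \<in> ounits\<rbrakk> \<Longrightarrow> x * y \<in> (ounits :: 'a::nonarch_local_field set)"
  by (simp add: ounits_def val_mult)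

lemma ounits_inverse: "x \<in> ounits \<Longrightarrow> inverse x \<in> (ounits :: 'a::nonarch_local_field set)"
  by (simp add: ounits_def val_inverse)

lemma ounits_divide: "\<lbrakk>x \<in> ounits; y \<in> ounits\<rbrakk> \<Longrightarrow> x / y \<in> (ounits :: 'a::nonarch_local_field set)"
  by (simp add: ounits_def val_divide)

lemma ounits_power: "x \<in> ounits \<Longrightarrow> x ^ n \<in> (ounits :: 'a::nonarch_local_field set)"
  by (induction n) (auto simp: ounits_mult, simp add: ounits_def)

lemma one_in_ounits [simp]: "1 \<in> (ounits :: 'a::nonarch_local_field set)"
  by (simp add: ounits_def)

lemma ounits_mult_pideal: "x \<in> ounits \<Longrightarrow> x * y \<in> pideal n \<longleftrightarrow> y \<in> (pideal n :: 'a::nonarch_local_field set)"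
  using pideal_scale[of x y n] by (simp add: ounits_def)

lemma ounits_divide_pideal: "x \<in> ounits \<Longrightarrow> y / x \<in> pideal n \<longleftrightarrow> y \<in> (pideal n :: 'a::nonarch_local_field set)"
  using ounits_mult_pideal[OF ounits_inverse, of x y n] by (simp add: divide_inverse mult.commute)

lemma one_plus_ounits: "\<lbrakk>x \<in> pideal n; 1 \<le> n\<rbrakk> \<Longrightarrow> 1 + x \<in> (ounits :: 'a::nonarch_local_field set)"
  by (rule ounits_add) auto

text \<open>Pigeonhole on the finitely many residue classes modulo \<open>pideal n\<close>.\<close>

lemma exists_power_near_one:
  assumes "b \<in> (ounits :: 'a::nonarch_local_field set)" "0 \<le> n"
  shows "\<exists>r>0. b ^ r - 1 \<in> pideal n"
proof -
  note tr = transversalD[OF reps[OF assms(2), where ?'a = 'a]]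
  have b: "b ^ i \<in> pideal 0" for i using ounits_power[OF assms(1), of i] ounits_subset by blast
  define g where "g = (\<lambda>i. SOME r. r \<in> reps 0 n \<and> b ^ i - r \<in> pideal n)"
  have g: "g i \<in> reps 0 n \<and> b ^ i - g i \<in> pideal n" for i
    unfolding g_def by (rule someI_ex) (use tr(3)[OF b] in blast)
  have "range g \<subseteq> reps 0 n" using g by blast
  then have "finite (range g)" using tr(1) finite_subset by blast
  then have "\<not> inj g" using finite_imageD infinite_UNIV_nat by blast
  then obtain i j where ij: "i < j" "g i = g j"
    unfolding inj_def by (metis nat_neq_iff)
  have "(b ^ j - g j) - (b ^ i - g i) \<in> pideal n" using g[of i] g[of j] by (intro pideal_diff[of "b ^ j - g j" n "b ^ i - g i"]) auto
  then have "b ^ j - b ^ i \<in> pideal n" using ij by simp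
  also have "b ^ j - b ^ i = b ^ i * (b ^ (j - i) - 1)"
    using ij by (simp add: right_diff_distrib flip: power_add)
  finally have "b ^ (j - i) - 1 \<in> pideal n"
    using ounits_mult_pideal[OF ounits_power[OF assms(1)]] by blast
  then show ?thesis using ij by (intro exI[of _ "j - i"]) simp
qed

section \<open>Nilpotent vectors, torus eigenvectors and Iwahori vectors\<close>

context smooth_module
begin

definition nil :: "'x \<Rightarrow> bool" where "nil x \<longleftrightarrow> (\<exists>n. (h ^^ n) x = 0)"

lemma hn_zero_mono: "\<lbrakk>(h ^^ m) x = 0; m \<le> n\<rbrakk> \<Longrightarrow> (h ^^ n) x = 0"
proof -
  assume a: "(h ^^ m) x = 0" "m \<le> n"
  have "(h ^^ n) x = (h ^^ (n - m)) ((h ^^ m) x)"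
    using a(2) by (simp flip: funpow_add[THEN fun_cong, unfolded comp_apply])
  then show ?thesis using a(1) by simp
qed

lemma nil_0 [simp]: "nil 0" by (simp add: nil_def)

lemma nil_uniform: "\<lbrakk>finite F; \<And>a. a \<in> F \<Longrightarrow> nil (g a)\<rbrakk> \<Longrightarrow> \<exists>m. \<forall>a\<in>F. (h ^^ m) (g a) = 0"
proof (induction F rule: finite_induct)
  case (insert a F)
  then obtain m n where mn: "\<forall>a\<in>F. (h ^^ m) (g a) = 0" "(h ^^ n) (g a) = 0"
    unfolding nil_def by (metis insertI1 insertI2)
  have "\<forall>b\<in>insert a F. (h ^^ max m n) (g b) = 0"
    using mn hn_zero_mono[of m _ "max m n"] hn_zero_mono[of n _ "max m n"] by auto
  then show ?case by blast
qed simp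

lemma nil_plus: "\<lbrakk>nil x; nil y\<rbrakk> \<Longrightarrow> nil (x + y)"
proof -
  assume "nil x" "nil y"
  then obtain m n where "(h ^^ m) x = 0" "(h ^^ n) y = 0" by (auto simp: nil_def)
  then have "(h ^^ max m n) (x + y) = 0"
    using hn_zero_mono[of m x "max m n"] hn_zero_mono[of n y "max m n"] by (simp add: hn_plus)
  then show ?thesis unfolding nil_def by blast
qed

lemma nil_sc: "\<lbrakk>c \<in> carrier k; nil x\<rbrakk> \<Longrightarrow> nil (sc c x)"
  by (auto simp: nil_def hn_sc) (metis sc_zero_right)

lemma nil_hn_iff: "nil ((h ^^ m) x) \<longleftrightarrow> nil x"
proof
  assume "nil ((h ^^ m) x)"
  then obtain n where "(h ^^ n) ((h ^^ m) x) = 0" by (auto simp: nil_def)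
  then have "(h ^^ (n + m)) x = 0" by (simp add: funpow_add)
  then show "nil x" unfolding nil_def by blast
next
  assume "nil x"
  then obtain n where "(h ^^ n) x = 0" by (auto simp: nil_def)
  then have "(h ^^ n) ((h ^^ m) x) = 0"
    by (metis comp_apply funpow_add add.commute hn_zero)
  then show "nil ((h ^^ m) x)" unfolding nil_def by blast
qed

lemma nil_D_iff:
  assumes "x \<in> fixed 0" "a \<noteq> 0" "d \<noteq> 0" "val a = val d"
  shows "nil (D a d x) \<longleftrightarrow> nil x"
proof -
  have "D a d z = 0 \<Longrightarrow> z = 0" for z
    using D_D[of "1 / a" "1 / d" a d z] assms by simp
  then have "(h ^^ n) (D a d x) = 0 \<longleftrightarrow> (h ^^ n) x = 0" for n
    using D_hn[OF assms, of n] by (metis D_zero)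
  then show ?thesis by (simp add: nil_def)
qed

text \<open>The pairs with \<open>val a = val d\<close> make up the product of the centre and the
  integral torus. By \<open>D_h\<close> these diagonal elements commute with \<open>h\<close> on
  \<open>fixed 0\<close>.\<close>

definition torus_eigen :: "'x \<Rightarrow> bool"
  where "torus_eigen x \<longleftrightarrow> (\<forall>a d. a \<noteq> 0 \<longrightarrow> d \<noteq> 0 \<longrightarrow> val a = val d \<longrightarrow> (\<exists>c\<in>carrier k. D a d x = sc c x))"

lemma torus_eigen_hn: "\<lbrakk>torus_eigen x; x \<in> fixed 0\<rbrakk> \<Longrightarrow> torus_eigen ((h ^^ n) x)"
  unfolding torus_eigen_def by (metis D_hn hn_sc)

end

locale irreducible_submodule = smooth_module k sc p act M
  for k :: "'k ring" (structure) and sc :: "'k \<Rightarrow> 'x::comm_ring_1 \<Rightarrow> 'x"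
    and p and act :: "'l::nonarch_local_field ^ 2 ^ 2 \<Rightarrow> 'x \<Rightarrow> 'x" and M +
  fixes V :: "'x set"
  assumes V_stable: "G_stable V" and V_subset: "V \<subseteq> M"
    and irreducible: "\<And>W. G_stable W \<Longrightarrow> W \<subseteq> V \<Longrightarrow> W = {0} \<or> W = V"
    and central: "\<And>z. z \<noteq> 0 \<Longrightarrow> \<exists>c\<in>carrier k. \<forall>x\<in>V. D z z x = sc c x"
begin

lemmas V = G_stableD[OF V_stable]

text \<open>Units act on \<open>x0\<close> through a finite quotient, so each \<open>D b 1\<close>
  satisfies an equation \<open>X^r = 1\<close> and has eigenvectors; the units are treated one after
  the other. Working modulo the nilpotent vectors keeps the vector non-nilpotent, and at the end a
  power of \<open>h\<close> removes the finitely many nilpotent errors.\<close>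

lemma exists_torus_eigenvector:
  assumes x0: "x0 \<in> V" "x0 \<in> fixed 0" "\<not> nil x0"
  shows "\<exists>y. y \<in> V \<and> y \<in> fixed 0 \<and> \<not> nil y \<and> torus_eigen y"
proof -
  obtain n where n: "n \<ge> 1" "\<And>a d. \<lbrakk>a - 1 \<in> pideal n; d - 1 \<in> pideal n\<rbrakk> \<Longrightarrow> D a d x0 = x0"
    using smoothE[of x0] by metis
  define M0 where "M0 = {x \<in> V \<inter> fixed 0. \<forall>a. a - 1 \<in> pideal n \<longrightarrow> D a 1 x = x}"
  define N0 where "N0 = {x \<in> V \<inter> fixed 0. nil x}"
  have near_one: "a \<in> ounits" if "a - 1 \<in> pideal n" for a :: 'l
    using one_plus_ounits[OF that n(1)] by simp
  have M0_plus: "x + y \<in> M0" if "x \<in> M0" "y \<in> M0" for x y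
    using that V(2) by (auto simp: M0_def fixed_add D_plus)
  have M0_sc: "sc c x \<in> M0" if "c \<in> carrier k" "x \<in> M0" for c x
  proof -
    have "D a 1 (sc c x) = sc c x" if "a - 1 \<in> pideal n" for a
      using \<open>x \<in> M0\<close> \<open>c \<in> _\<close> that near_one[OF that] by (simp add: M0_def D_sc ounits_def)
    then show ?thesis using that V(9) by (auto simp: M0_def fixed_sc)
  qed
  have M0_D: "D a 1 x \<in> M0" if "a \<in> ounits" "x \<in> M0" for a x
  proof -
    have nz: "a \<noteq> 0" "val a = 0" using that by (auto simp: ounits_def)
    have "D b 1 (D a 1 x) = D a 1 x" if "b - 1 \<in> pideal n" for b
    proof -
      have "b \<noteq> 0" using near_one[OF that] by (simp add: ounits_def)
      then have "D b 1 (D a 1 x) = D a 1 (D b 1 x)" using nz by (simp add: D_D mult.commute)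
      then show ?thesis using \<open>x \<in> M0\<close> that by (simp add: M0_def)
    qed
    then show ?thesis using that V(8)[of x a 1] fixed_D[of x 0 a 1 0] nz by (simp add: M0_def)
  qed
  have N0_plus: "x + y \<in> N0" if "x \<in> N0" "y \<in> N0" for x y
    using that V(2) by (auto simp: N0_def fixed_add nil_plus)
  have N0_sc: "sc c x \<in> N0" if "c \<in> carrier k" "x \<in> N0" for c x
    using that V(9) by (auto simp: N0_def fixed_sc nil_sc)
  have N0_D: "D a 1 x \<in> N0 \<longleftrightarrow> nil x" if "a \<in> ounits" "x \<in> V" "x \<in> fixed 0" for a x
    using that V(8)[of x a 1] fixed_D[of x 0 a 1 0] nil_D_iff[of x a 1] by (simp add: N0_def ounits_def)
  have claim: "\<exists>x\<in>M0. \<not> nil x \<and> (\<forall>a\<in>F. \<exists>c\<in>carrier k. D a 1 x - sc c x \<in> N0)"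
    if "finite F" "F \<subseteq> ounits" for F
    using that
  proof (induction F rule: finite_induct)
    case empty
    have "x0 \<in> M0" using x0 n(2)[of _ 1] by (simp add: M0_def)
    then show ?case using x0 by blast
  next
    case (insert b F)
    then obtain x where x: "x \<in> M0" "\<not> nil x" "\<forall>a\<in>F. \<exists>c\<in>carrier k. D a 1 x - sc c x \<in> N0" by auto
    then obtain c where c: "\<And>a. a \<in> F \<Longrightarrow> c a \<in> carrier k \<and> D a 1 x - sc (c a) x \<in> N0" by metis
    have b: "b \<in> ounits" "b \<noteq> 0" using insert.prems by (auto simp: ounits_def)
    have F: "a \<noteq> 0" if "a \<in> F" for a using insert.prems that by (auto simp: ounits_def)
    have pow: "(D b 1 ^^ i) x = D (b ^ i) 1 x" for i
      by (induction i) (use b in \<open>simp_all add: D_D\<close>)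
    obtain r where r: "r > 0" "b ^ r - 1 \<in> pideal n" using exists_power_near_one[OF b(1), of n] n(1) by auto
    \<comment> \<open>The vectors that keep, modulo \<open>N0\<close>, the eigenvalues already found
      for \<open>F\<close>; the eigenvector of the new unit is sought among them.\<close>
    define M1 where "M1 = {y \<in> M0. \<forall>a\<in>F. D a 1 y - sc (c a) y \<in> N0}"
    \<comment> \<open>Coefficients of \<open>X^r - 1\<close>, which annihilates \<open>x\<close>
      because \<open>b^r\<close> is close to \<open>1\<close>.\<close>
    define e where "e = (\<lambda>i. if i = 0 then \<ominus> \<one> else if i = r then \<one> else \<zero>)"
    have xM: "x \<in> M" using x V_subset by (auto simp: M0_def)
    have powM: "D (b ^ i) 1 x \<in> M0" for i using M0_D[OF ounits_power[OF b(1)] x(1)] .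
    have M1p: "D (b ^ i) 1 x \<in> M1" for i
    proof -
      have "D a 1 (D (b ^ i) 1 x) - sc (c a) (D (b ^ i) 1 x) \<in> N0" if a: "a \<in> F" for a
      proof -
        have "D a 1 (D (b ^ i) 1 x) - sc (c a) (D (b ^ i) 1 x) = D (b ^ i) 1 (D a 1 x - sc (c a) x)"
          using b F[OF a] c[OF a] by (simp add: D_D D_diff D_sc mult.commute)
        then show ?thesis using N0_D[OF ounits_power[OF b(1)], of "D a 1 x - sc (c a) x" i] c[OF a]
          by (simp add: N0_def)
      qed
      then show ?thesis using powM by (simp add: M1_def)
    qed
    have "\<exists>l w. l \<in> carrier k \<and> l \<noteq> \<zero> \<and> w \<in> M1 \<and> w \<notin> N0 \<and> D b 1 w - sc l w \<in> N0"
    proof (rule exists_eigenvector_mod[where a = e and n = r and v = x])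
      show "Modules.additive (D b 1)" by (simp add: D_def act_additive)
      show "D b 1 (sc a z) = sc a (D b 1 z)" if "a \<in> carrier k" for a z using that b by (simp add: D_sc)
      show "0 \<in> N0" by (simp add: N0_def V(1))
      show "sc \<one> ((D b 1 ^^ i) x) = (D b 1 ^^ i) x" for i
        unfolding pow using powM[of i] V_subset by (intro sc_one) (auto simp: M0_def)
      show "(D b 1 ^^ i) x \<notin> N0" for i
        unfolding pow using N0_D[OF ounits_power[OF b(1)], of x i] x by (simp add: M0_def)
      show "e i \<in> carrier k" for i by (simp add: e_def)
      show "e r \<noteq> \<zero>" using r by (simp add: e_def)
      have "(\<Sum>i\<le>r. sc (e i) ((D b 1 ^^ i) x)) = (\<Sum>i\<in>{0, r}. sc (e i) ((D b 1 ^^ i) x))"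
        by (rule sum.mono_neutral_right) (auto simp: e_def)
      also have "\<dots> = - x + D (b ^ r) 1 x"
        using r xM powM[of r] V_subset by (simp add: e_def pow sc_a_inv sc_one M0_def subset_iff)
      also have "\<dots> = 0" using x(1) r by (simp add: M0_def)
      finally show "(\<Sum>i\<le>r. sc (e i) ((D b 1 ^^ i) x)) \<in> N0" by (simp add: N0_def V(1))
      show "(D b 1 ^^ i) x \<in> M1" for i unfolding pow by (rule M1p)
      show "0 \<in> M1" by (simp add: M1_def M0_def N0_def V(1))
      show "y + z \<in> M1" if "y \<in> M1" "z \<in> M1" for y z
      proof -
        have "D a 1 (y + z) - sc (c a) (y + z) = (D a 1 y - sc (c a) y) + (D a 1 z - sc (c a) z)" for a
          by (simp add: D_plus sc_plus)
        then show ?thesis using that M0_plus N0_plus by (simp add: M1_def)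
      qed
      show "sc a y \<in> M1" if a: "a \<in> carrier k" "y \<in> M1" for a y
      proof -
        have "D b 1 (sc a y) - sc (c b) (sc a y) = sc a (D b 1 y - sc (c b) y)" if "b \<in> F" for b
          using c[OF that] a F[OF that] by (simp add: D_sc sc_diff sc_commute)
        then show ?thesis using a M0_sc N0_sc by (simp add: M1_def)
      qed
    qed (use N0_plus N0_sc in auto)
    then obtain l w where "l \<in> carrier k" "w \<in> M1" "w \<notin> N0" "D b 1 w - sc l w \<in> N0" by blast
    then show ?case using c by (intro bexI[of _ w]) (auto simp: M1_def N0_def M0_def)
  qed
  \<comment> \<open>Finitely many units suffice: every unit is one of them times an element of
    \<open>1 + pideal n\<close>, and the latter acts trivially on \<open>M0\<close>.\<close>
  define U where "U = reps 0 n \<inter> (ounits :: 'l set)"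
  have U: "finite U" "U \<subseteq> ounits" using finite_reps[of 0 n] n(1) by (auto simp: U_def)
  from claim[OF this] obtain x where x: "x \<in> M0" "\<not> nil x"
    "\<forall>a\<in>U. \<exists>c\<in>carrier k. D a 1 x - sc c x \<in> N0" by blast
  then obtain c where c: "\<And>a. a \<in> U \<Longrightarrow> c a \<in> carrier k \<and> D a 1 x - sc (c a) x \<in> N0" by metis
  then obtain m where m: "\<And>a. a \<in> U \<Longrightarrow> (h ^^ m) (D a 1 x - sc (c a) x) = 0"
    using nil_uniform[OF U(1), of "\<lambda>a. D a 1 x - sc (c a) x"] by (auto simp: N0_def)
  \<comment> \<open>\<open>h^m\<close> commutes with the units and kills all errors at once, so the
    congruences modulo \<open>N0\<close> become equations.\<close>
  define y where "y = (h ^^ m) x"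
  have xf: "x \<in> V" "x \<in> fixed 0" using x by (auto simp: M0_def)
  have yf: "y \<in> V" "y \<in> fixed 0" "\<not> nil y"
    using xf x hn_stable[OF V_stable] by (auto simp: y_def hn_fixed nil_hn_iff)
  have Dy: "D a 1 y = (h ^^ m) (D a 1 x)" if "a \<in> ounits" for a
    using D_hn[OF xf(2), of a 1] that by (simp add: y_def ounits_def)
  have unit: "\<exists>c\<in>carrier k. D a 1 y = sc c y" if a: "a \<in> ounits" for a
  proof -
    have "transversal U (pideal n) ounits"
      unfolding U_def using n(1) by (intro transversal_subset[OF reps] ounits_subset subgroup_pideal ounits_add) auto
    then obtain r where r: "r \<in> U" "a - r \<in> pideal n" using transversalD(3) a by blast
    have ru: "r \<in> ounits" using r U by blast
    have q: "a / r - 1 \<in> pideal n"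
      using r ounits_divide_pideal[OF ru, of "a - r" n] ru by (simp add: diff_divide_distrib ounits_def)
    have "D a 1 x = D r 1 (D (a / r) 1 x)" using ru a by (simp add: D_D ounits_def)
    also have "D (a / r) 1 x = x" using x(1) q by (simp add: M0_def)
    finally have "D a 1 y = (h ^^ m) (D r 1 x)" using Dy[OF a] by simp
    also have "\<dots> = sc (c r) y" using m[OF r(1)] c[OF r(1)] by (simp add: hn_diff hn_sc y_def)
    finally show ?thesis using c[OF r(1)] by blast
  qed
  have "torus_eigen y"
    unfolding torus_eigen_def
  proof (intro allI impI)
    fix a d :: 'l assume ad: "a \<noteq> 0" "d \<noteq> 0" "val a = val d"
    then have "a / d \<in> ounits" by (simp add: ounits_def val_divide)
    then obtain c1 where c1: "c1 \<in> carrier k" "D (a / d) 1 y = sc c1 y" using unit by blast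
    obtain c2 where c2: "c2 \<in> carrier k" "\<forall>x\<in>V. D d d x = sc c2 x" using central ad by blast
    have "D a d y = D d d (D (a / d) 1 y)" using ad by (simp add: D_D)
    also have "\<dots> = sc (c1 \<otimes> c2) y" using c1 c2 yf ad by (simp add: D_sc sc_mult)
    finally show "\<exists>c\<in>carrier k. D a d y = sc c y" using c1 c2 by blast
  qed
  then show ?thesis using yf by blast
qed

text \<open>The vectors on which the pro-\<open>p\<close> Iwahori subgroup acts trivially and the Iwahori subgroup by a
  character.\<close>

definition iwahori_vector :: "'x \<Rightarrow> bool"
  where "iwahori_vector y \<longleftrightarrow> y \<in> V \<and> y \<in> fixed 0 \<and> torus_eigen y \<and> (\<forall>c\<in>pideal 1. l c y = y) \<and>
    (\<forall>a d. a - 1 \<in> pideal 1 \<longrightarrow> d - 1 \<in> pideal 1 \<longrightarrow> D a d y = y)"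

text \<open>By Frobenius in characteristic \<open>p\<close>, a one-unit raised to a high power of
  \<open>p\<close> is as close to \<open>1\<close> as desired. So its eigenvalue is a root of unity
  of \<open>p\<close>-power order, hence \<open>1\<close>.\<close>

lemma torus_eigen_one_units:
  assumes y: "y \<in> V" "torus_eigen y" and ad: "a - 1 \<in> pideal 1" "d - 1 \<in> pideal 1"
  shows "D a d y = y"
proof (cases "y = 0")
  case False
  have "a \<in> ounits" "d \<in> ounits" using one_plus_ounits[OF ad(1)] one_plus_ounits[OF ad(2)] by simp_all
  then have nz: "a \<noteq> 0" "d \<noteq> 0" "val a = 0" "val d = 0" by (auto simp: ounits_def)
  obtain c where c: "c \<in> carrier k" "D a d y = sc c y" using y(2) nz unfolding torus_eigen_def by metis
  obtain n where n: "n \<ge> 1" "\<And>a d. \<lbrakk>a - 1 \<in> pideal n; d - 1 \<in> pideal n\<rbrakk> \<Longrightarrow> D a d y = y"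
    using smoothE[of y] by metis
  have yM: "y \<in> M" using y V_subset by blast
  have pow: "D (a ^ i) (d ^ i) y = sc (c [^] i) y" for i :: nat
  proof (induction i)
    case (Suc i)
    have "D (a ^ Suc i) (d ^ Suc i) y = D a d (D (a ^ i) (d ^ i) y)" using nz by (simp add: D_D)
    then show ?case using Suc c nz by (simp add: D_sc sc_mult sc_commute m_comm)
  qed (use yM sc_one in simp)
  \<comment> \<open>What is needed is \<open>n \<le> p^r\<close>, and this follows from
    \<open>r \<le> p^r\<close>.\<close>
  define r where "r = nat n"
  have near: "b ^ (p ^ r) - 1 \<in> pideal n" if b: "b - 1 \<in> pideal 1" for b :: 'l
  proof -
    have "(b - 1 + 1) ^ (CHAR('l) ^ r) = (b - 1) ^ (CHAR('l) ^ r) + 1 ^ (CHAR('l) ^ r)"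
      by (rule freshmans_dream') (use char_l prime_p in auto)
    then have e: "b ^ (p ^ r) - 1 = (b - 1) ^ (p ^ r)" using char_l by simp
    have pw: "z ^ i \<in> pideal (int i)" if "z \<in> pideal 1" for z :: 'l and i
    proof (induction i)
      case (Suc i)
      then show ?case using pideal_mult[OF that Suc] by (simp add: add.commute)
    qed simp
    have "r \<le> p ^ r" using prime_gt_1_nat[OF prime_p] by (simp add: less_imp_le_nat power_gt_expt)
    then have "n \<le> int (p ^ r)" unfolding r_def by linarith
    then show ?thesis unfolding e using pideal_monoD[OF pw[OF b]] by blast
  qed
  have "sc (c [^] (p ^ r)) y = sc \<one> y"
    using n(2)[OF near[OF ad(1)] near[OF ad(2)]] pow[of "p ^ r"] sc_one[OF yM] by simp
  then have "c [^] (p ^ r) = \<one>" using sc_cancel[OF _ _ yM False] c by auto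
  then have "c = \<one>" using p_power_root_of_unity[OF c(1) _ yM False] by blast
  then show ?thesis using c sc_one[OF yM] by simp
qed simp

text \<open>\<open>l c\<close> sends the summand at \<open>a\<close> to the one at
  \<open>a / (1 + c a)\<close>: by \<open>l_u\<close> there remain a torus factor made of one-units
  and a lower unipotent which, pulled through \<open>t^j\<close>, has its parameter in
  \<open>pideal (j + 1)\<close>, and both fix \<open>y\<close>. The map \<open>a / (1 + c a)\<close>
  permutes the classes modulo \<open>pideal j\<close>.\<close>

lemma l_hn:
  assumes y: "y \<in> V" "y \<in> fixed 0" "torus_eigen y"
    and m: "\<And>c. c \<in> pideal m \<Longrightarrow> l c y = y" "m \<le> int j + 1" and c: "c \<in> pideal 1"
  shows "l c ((h ^^ j) y) = (h ^^ j) y"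
proof -
  let ?t = "D (unif powi int j) 1"
  have tf: "?t y \<in> fixed (int j)" using y by (intro fixed_D[of _ 0]) auto
  have s: "1 + c * a \<in> ounits" if "a \<in> pideal 0" for a
    using pideal_mult[OF c that] by (intro one_plus_ounits[of _ 1]) simp_all
  have l: "l c (u a (?t y)) = u (a / (1 + c * a)) (?t y)" if a: "a \<in> pideal 0" for a
  proof -
    define s' where "s' = 1 + c * a"
    have su: "s' \<in> ounits" "s' \<noteq> 0" using s[OF a] by (auto simp: s'_def ounits_def)
    have "unif powi int j * (c / s') \<in> pideal (int j + 1)"
      using c su ounits_divide_pideal[OF su(1), of c 1] pideal_scale[of "unif powi int j" "c / s'" 1] by simp
    then have ly: "l (unif powi int j * (c / s')) y = y" using m pideal_monoD by blast
    have "l (c / s') (?t y) = ?t (l (unif powi int j * (c / s')) y)" by (simp add: D_l)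
    then have "l (c / s') (?t y) = ?t y" by (simp only: ly)
    moreover have "D (1 / s') s' (?t y) = ?t (D (1 / s') s' y)" using su by (simp add: D_D mult.commute)
    moreover have "D (1 / s') s' y = y"
    proof (rule torus_eigen_one_units[OF y(1,3)])
      have "c * a \<in> pideal 1" using pideal_mult[OF c a] by simp
      then show "s' - 1 \<in> pideal 1" by (simp add: s'_def)
      have "1 / s' - 1 = - (c * a) / s'" using su by (simp add: s'_def field_simps)
      then show "1 / s' - 1 \<in> pideal 1"
        using ounits_divide_pideal[OF su(1), of "- (c * a)" 1] \<open>c * a \<in> pideal 1\<close> by simp
    qed
    ultimately show ?thesis using l_u[of c a "?t y"] su by (simp add: s'_def)
  qed
  have inj: "a / (1 + c * a) - b / (1 + c * b) = (a - b) / ((1 + c * a) * (1 + c * b))"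
    if "a \<in> pideal 0" "b \<in> pideal 0" for a b
    using s[OF that(1)] s[OF that(2)] by (simp add: ounits_def field_simps)
  have bij: "bij_betw (\<lambda>a. a / (1 + c * a)) (pideal 0) (pideal 0)"
  proof (rule bij_betw_byWitness[of _ "\<lambda>a. a / (1 - c * a)"])
    have s2: "1 - c * a \<in> ounits" if "a \<in> pideal 0" for a using s[of "- a"] that by simp
    show "(\<lambda>a. a / (1 + c * a)) ` pideal 0 \<subseteq> pideal 0" using s ounits_divide_pideal by blast
    show "(\<lambda>a. a / (1 - c * a)) ` pideal 0 \<subseteq> pideal 0" using s2 ounits_divide_pideal by blast
    show "\<forall>a\<in>pideal 0. a / (1 + c * a) / (1 - c * (a / (1 + c * a))) = a"
    proof
      fix a :: 'l assume "a \<in> pideal 0"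
      then have "1 + c * a \<noteq> 0" using s by (simp add: ounits_def)
      then have "1 - c * (a / (1 + c * a)) = 1 / (1 + c * a)" by (simp add: field_simps)
      then show "a / (1 + c * a) / (1 - c * (a / (1 + c * a))) = a" using \<open>1 + c * a \<noteq> 0\<close> by simp
    qed
    show "\<forall>a\<in>pideal 0. a / (1 - c * a) / (1 + c * (a / (1 - c * a))) = a"
    proof
      fix a :: 'l assume "a \<in> pideal 0"
      then have "1 - c * a \<noteq> 0" using s2 by (simp add: ounits_def)
      then have "1 + c * (a / (1 - c * a)) = 1 / (1 - c * a)" by (simp add: field_simps)
      then show "a / (1 - c * a) / (1 + c * (a / (1 - c * a))) = a" using \<open>1 - c * a \<noteq> 0\<close> by simp
    qed
  qed
  \<comment> \<open>By \<open>inj\<close> the map multiplies differences by a unit, so it preserves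
    classes modulo \<open>pideal j\<close> in both directions.\<close>
  have tr: "transversal ((\<lambda>a. a / (1 + c * a)) ` reps 0 (int j)) (pideal (int j)) (pideal 0)"
  proof (rule transversal_image[OF reps bij])
    fix a b :: 'l assume ab: "a \<in> pideal 0" "b \<in> pideal 0"
    show "a / (1 + c * a) - b / (1 + c * b) \<in> pideal (int j) \<longleftrightarrow> a - b \<in> pideal (int j)"
      unfolding inj[OF ab] by (rule ounits_divide_pideal) (use s ab ounits_mult in blast)
  qed simp
  have "l c ((h ^^ j) y) = (\<Sum>a\<in>reps 0 (int j). l c (u a (?t y)))"
    unfolding hn_eq_nrm[OF y(2)] by (simp only: nrm_def l_sum)
  also have "\<dots> = (\<Sum>a\<in>reps 0 (int j). u (a / (1 + c * a)) (?t y))"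
    using l reps_subset[of 0 "int j"] by (intro sum.cong) auto
  also have "\<dots> = (\<Sum>a\<in>(\<lambda>a. a / (1 + c * a)) ` reps 0 (int j). u a (?t y))"
    by (subst sum.reindex) (use bij reps_subset[of 0 "int j"] in \<open>auto simp: bij_betw_def intro: inj_on_subset\<close>)
  also have "\<dots> = nrm 0 (int j) (?t y)" by (rule nrm_transversal[OF _ tr tf]) simp
  finally show ?thesis by (simp add: hn_eq_nrm[OF y(2)])
qed

lemma iwahori_vector_h: "iwahori_vector y \<Longrightarrow> iwahori_vector (h y)"
proof -
  assume y: "iwahori_vector y"
  then have yy: "y \<in> V" "y \<in> fixed 0" "torus_eigen y" "\<And>c. c \<in> pideal 1 \<Longrightarrow> l c y = y"
    by (auto simp: iwahori_vector_def)
  have hy: "h y \<in> V" "h y \<in> fixed 0" "torus_eigen (h y)"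
    using yy h_stable[OF V_stable] h_fixed torus_eigen_hn[of y 1] by auto
  moreover have "l c (h y) = h y" if "c \<in> pideal 1" for c
    using l_hn[OF yy(1-4), where j = 1 and c = c] that by simp
  ultimately show ?thesis using torus_eigen_one_units[OF hy(1,3)] by (auto simp: iwahori_vector_def)
qed

lemma exists_iwahori_vector:
  assumes "x0 \<in> V" "x0 \<in> fixed 0" "\<not> nil x0"
  shows "\<exists>y. iwahori_vector y \<and> \<not> nil y"
proof -
  obtain y where y: "y \<in> V" "y \<in> fixed 0" "\<not> nil y" "torus_eigen y"
    using exists_torus_eigenvector[OF assms] by blast
  obtain n where n: "n \<ge> 1" "\<And>c. c \<in> pideal n \<Longrightarrow> l c y = y" using smoothE[of y] by metis
  \<comment> \<open>Since \<open>n \<le> j + 1\<close>, applying \<open>h\<close> this often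
    enlarges the invariance under lower unipotents from \<open>pideal n\<close> to
    \<open>pideal 1\<close>.\<close>
  define j where "j = nat n"
  let ?y = "(h ^^ j) y"
  have hy: "?y \<in> V" "?y \<in> fixed 0" "torus_eigen ?y"
    using y hn_stable[OF V_stable] hn_fixed torus_eigen_hn by auto
  moreover have "l c ?y = ?y" if "c \<in> pideal 1" for c
    by (rule l_hn[OF y(1,2,4) n(2) _ that]) (auto simp: j_def)
  ultimately have "iwahori_vector ?y"
    using torus_eigen_one_units[OF hy(1,3)] by (auto simp: iwahori_vector_def)
  then show ?thesis using y(3) by (auto simp: nil_hn_iff)
qed

end

lemma sum_eq_single:
  assumes "finite I" "j \<in> I" "\<And>i. i \<in> I \<Longrightarrow> i \<noteq> j \<Longrightarrow> f i = (0::'b::comm_monoid_add)"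
  shows "sum f I = f j"
proof -
  have "sum f I = f j + sum f (I - {j})" using assms(1,2) by (rule sum.remove)
  also have "sum f (I - {j}) = 0" using assms(3) by (intro sum.neutral) auto
  finally show ?thesis by simp
qed

lemma transversal_ounits: "transversal (reps 0 1 \<inter> ounits) (pideal 1) (ounits :: 'a::nonarch_local_field set)"
  by (rule transversal_subset[OF reps ounits_subset subgroup_pideal]) (auto intro: ounits_add)

lemma transversal_inverse_ounits:
  assumes R: "transversal R (pideal 1) (ounits :: 'a::nonarch_local_field set)"
  shows "transversal ((/) 1 ` R) (pideal 1) ounits"
proof (rule transversal_image[OF R])
  show "bij_betw ((/) 1) ounits (ounits :: 'a set)"
    by (rule bij_betw_byWitness[of _ "\<lambda>x. 1 / x"]) (auto intro: ounits_divide)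
  fix x y :: 'a assume xy: "x \<in> ounits" "y \<in> ounits"
  then have "1 / x - 1 / y = - (x - y) / (x * y)" by (simp add: ounits_def field_simps)
  then show "1 / x - 1 / y \<in> pideal 1 \<longleftrightarrow> x - y \<in> pideal 1"
    using ounits_divide_pideal[OF ounits_mult[OF xy], of "- (x - y)" 1] pideal_minus[of "x - y" 1] by simp
qed

lemma of_nat_fun_eq_zero: "of_nat p = (0::'b::comm_ring_1) \<Longrightarrow> of_nat p = (0::'a \<Rightarrow> 'b)"
  by (simp add: fun_eq_iff)

section \<open>Nilpotency of the Hecke operator\<close>

text \<open>One horn of a dilemma, set up to be refuted: an Iwahori vector that is not nilpotent
  either satisfies a relation between its iterates under \<open>h\<close> or is of this
  kind.\<close>

locale free_iwahori_vector = irreducible_submodule k sc p act M V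
  for k :: "'k ring" (structure) and sc :: "'k \<Rightarrow> 'x::comm_ring_1 \<Rightarrow> 'x"
    and p and act :: "'l::nonarch_local_field ^ 2 ^ 2 \<Rightarrow> 'x \<Rightarrow> 'x" and M V +
  fixes y :: 'x
  assumes y: "iwahori_vector y"
    and independent: "\<And>n a. \<lbrakk>\<And>i. a i \<in> carrier k; (\<Sum>i\<le>n. sc (a i) ((h ^^ i) y)) = 0\<rbrakk> \<Longrightarrow> \<forall>i\<le>n. a i = \<zero>"
begin

abbreviation "t j \<equiv> D (unif powi j) 1"

lemma y_props: "y \<in> V" "y \<in> M" "y \<in> fixed 0" "torus_eigen y" "\<And>c. c \<in> pideal 1 \<Longrightarrow> l c y = y"
  "\<And>a d. \<lbrakk>a - 1 \<in> pideal 1; d - 1 \<in> pideal 1\<rbrakk> \<Longrightarrow> D a d y = y"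
  using y V_subset by (auto simp: iwahori_vector_def)

lemma y_nz: "y \<noteq> 0"
proof
  assume "y = 0"
  then have "\<forall>i\<le>(0::nat). \<one> = \<zero>"
    by (intro independent[where a = "\<lambda>_. \<one>" and n = 0]) auto
  then have "\<one> = \<zero>" by blast
  then show False by simp
qed

lemma t_t: "t i (t j x) = t (i + j) x"
  by (simp add: D_D power_int_add)

lemma t_u: "t j (u a x) = u (unif powi j * a) (t j x)"
  by (simp add: D_u)

lemma t_fixed: "x \<in> fixed 0 \<Longrightarrow> t j x \<in> fixed j"
  by (rule fixed_D[of _ 0]) auto

text \<open>The eigenvalue of the torus factor of \<open>w_u_bruhat\<close> at
  \<open>c = 1 / b\<close>, extended by zero to nonunits like a Dirichlet character, so that sums
  may run over all of \<open>reps 0 1\<close>.\<close>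

definition chi :: "'l \<Rightarrow> 'k"
  where "chi b = (if b \<in> ounits then (SOME c. c \<in> carrier k \<and> D (- b) (1 / b) y = sc c y) else \<zero>)"

lemma chi: "b \<in> ounits \<Longrightarrow> chi b \<in> carrier k \<and> D (- b) (1 / b) y = sc (chi b) y"
proof -
  assume b: "b \<in> ounits"
  then have "- b \<noteq> 0" "1 / b \<noteq> 0" "val (- b) = val (1 / b)" by (auto simp: ounits_def val_divide)
  then have "\<exists>c. c \<in> carrier k \<and> D (- b) (1 / b) y = sc c y"
    using y_props(4) unfolding torus_eigen_def by blast
  then have "(SOME c. c \<in> carrier k \<and> D (- b) (1 / b) y = sc c y) \<in> carrier k \<and>
      D (- b) (1 / b) y = sc (SOME c. c \<in> carrier k \<and> D (- b) (1 / b) y = sc c y) y"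
    by (rule someI_ex)
  then show ?thesis using b by (simp add: chi_def)
qed

lemma chi_closed [simp]: "chi b \<in> carrier k"
  using chi[of b] by (cases "b \<in> ounits") (auto simp: chi_def)

lemma chi_eq: "b - b' \<in> pideal 1 \<Longrightarrow> chi b = chi b'"
proof -
  assume bb: "b - b' \<in> pideal 1"
  show ?thesis
  proof (cases "b' \<in> ounits")
    case True
    have b: "b \<in> ounits" using ounits_add[OF True bb] by simp
    have nz: "b \<noteq> 0" "b' \<noteq> 0" using b True by (auto simp: ounits_def)
    have "b' - b \<in> pideal 1" using pideal_minus[of "b - b'" 1] bb by simp
    then have "b / b' - 1 \<in> pideal 1" "b' / b - 1 \<in> pideal 1"
      using ounits_divide_pideal[OF True, of "b - b'" 1] ounits_divide_pideal[OF b, of "b' - b" 1] bb nz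
      by (simp_all add: diff_divide_distrib)
    then have "D (- b') (1 / b') (D (b / b') (b' / b) y) = D (- b') (1 / b') y"
      using y_props(6) by simp
    moreover have "D (- b') (1 / b') (D (b / b') (b' / b) y) = D (- b) (1 / b) y"
      using nz by (simp add: D_D)
    ultimately have "sc (chi b) y = sc (chi b') y" using chi b True by simp
    then show ?thesis using sc_cancel[OF _ _ y_props(2) y_nz] by simp
  next
    case False
    have "b \<notin> ounits"
    proof
      assume "b \<in> ounits"
      moreover have "b' - b \<in> pideal 1" using pideal_minus[of "b - b'" 1] bb by simp
      ultimately have "b + (b' - b) \<in> ounits" by (intro ounits_add[of _ _ 1]) simp_all
      then show False using False by simp
    qed
    then show ?thesis using False by (simp add: chi_def)
  qed
qed

text \<open>The eigenspace of the Iwahori subgroup and the centre for the character by which they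
  act on \<open>y\<close>. Prescribing the character makes the condition linear, which is needed for
  \<open>h v - \<omega> v\<close>.\<close>

definition same_char :: "'x \<Rightarrow> bool"
  where "same_char x \<longleftrightarrow> x \<in> V \<and> x \<in> fixed 0 \<and> (\<forall>c\<in>pideal 1. l c x = x) \<and>
    (\<forall>a d c. a \<noteq> 0 \<longrightarrow> d \<noteq> 0 \<longrightarrow> val a = val d \<longrightarrow> c \<in> carrier k \<longrightarrow> D a d y = sc c y \<longrightarrow> D a d x = sc c x)"

lemma same_char_y: "same_char y"
  using y_props by (auto simp: same_char_def)

lemma same_char_hn: "same_char ((h ^^ n) y)"
proof -
  have "iwahori_vector ((h ^^ n) y)"
    by (induction n) (use y iwahori_vector_h in auto)
  then show ?thesis
    using y_props D_hn by (auto simp: same_char_def iwahori_vector_def hn_sc)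
qed

lemma same_char_diff: "\<lbrakk>same_char x; same_char z\<rbrakk> \<Longrightarrow> same_char (x - z)"
  using V(3) by (auto simp: same_char_def fixed_diff l_diff D_diff sc_diff)

lemma same_char_sc: "\<lbrakk>same_char x; a \<in> carrier k\<rbrakk> \<Longrightarrow> same_char (sc a x)"
  using V(9) by (auto simp: same_char_def fixed_sc l_sc D_sc sc_commute)

text \<open>The unit representatives are inverted by the Bruhat identity and contribute the twisted
  sum, to which nonunits add nothing as \<open>chi\<close> vanishes there; the class of
  \<open>0\<close> contributes \<open>w (t 1 x)\<close>.\<close>

lemma w_h:
  assumes x: "same_char x"
  shows "w (h x) = w (t 1 x) + (\<Sum>b\<in>reps 0 1. sc (chi b) (u b (t 1 x)))"
proof -
  have xf: "x \<in> fixed 0" "x \<in> V" "\<And>c. c \<in> pideal 1 \<Longrightarrow> l c x = x" using x by (auto simp: same_char_def)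
  have tf: "t 1 x \<in> fixed 1" using t_fixed[OF xf(1)] .
  define R where "R = reps 0 1 \<inter> (ounits :: 'l set)"
  define f where "f = (\<lambda>b. sc (chi b) (u b (t 1 x)))"
  have fin: "finite (reps 0 1 :: 'l set)" by (rule finite_reps) simp
  have R: "transversal R (pideal 1) ounits" unfolding R_def by (rule transversal_ounits)
  have unit: "w (u c (t 1 x)) = f (1 / c)" if c: "c \<in> R" for c
  proof -
    have cu: "c \<in> ounits" "c \<noteq> 0" using c by (auto simp: R_def ounits_def)
    have "unif * (1 / c) \<in> pideal 1"
      using ounits_divide_pideal[OF cu(1), of unif 1] by (simp add: pideal_iff)
    then have "l (1 / c) (t 1 x) = t 1 x"
      using xf(3) D_l[of unif 1 "unif * (1 / c)" x] by simp
    then have "w (u c (t 1 x)) = u (1 / c) (D (- 1 / c) c (t 1 x))" using cu by (simp add: w_u_bruhat)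
    also have "D (- 1 / c) c (t 1 x) = t 1 (D (- (1 / c)) (1 / (1 / c)) x)" using cu by (simp add: D_D)
    also have "D (- (1 / c)) (1 / (1 / c)) x = sc (chi (1 / c)) x"
    proof -
      have c': "1 / c \<in> ounits" using cu ounits_divide[of 1 c] by simp
      have "- (1 / c) \<noteq> 0" "1 / (1 / c) \<noteq> 0" "val (- (1 / c)) = val (1 / (1 / c))"
        using cu by (auto simp: ounits_def val_divide)
      then show ?thesis using x chi[OF c'] unfolding same_char_def by blast
    qed
    finally show ?thesis by (simp add: f_def D_sc u_sc)
  qed
  have "w (h x) = (\<Sum>c\<in>reps 0 1. w (u c (t 1 x)))" by (simp add: h_def nrm_def w_sum)
  also have "\<dots> = (\<Sum>c\<in>R. w (u c (t 1 x))) + (\<Sum>c\<in>reps 0 1 - R. w (u c (t 1 x)))"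
    using fin by (subst sum.subset_diff[of R]) (auto simp: R_def add.commute)
  also have "reps 0 1 - R = reps 0 1 \<inter> pideal 1"
    using reps_subset[of 0 1, where ?'a = 'l] by (auto simp: R_def ounits_iff)
  also have "(\<Sum>c\<in>reps 0 1 \<inter> pideal 1. w (u c (t 1 x))) = (\<Sum>c\<in>{0}. w (u c (t 1 x)))"
  proof (rule transversal_sum_eq[OF _ _ subgroup_pideal])
    show "transversal (reps 0 1 \<inter> pideal 1) (pideal 1) (pideal 1 :: 'l set)"
      by (rule transversal_subset[OF reps _ subgroup_pideal]) (auto intro: pideal_monoD pideal_add)
    show "transversal {0} (pideal 1) (pideal 1 :: 'l set)" by (auto simp: transversal_def)
    show "w (u a (t 1 x)) = w (u b (t 1 x))" if "a - b \<in> pideal 1" for a b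
      using fixed_u_eq[OF tf that] by simp
  qed
  also have "(\<Sum>c\<in>R. w (u c (t 1 x))) = (\<Sum>c\<in>R. f (1 / c))" using unit by simp
  also have "\<dots> = sum f ((/) 1 ` R)"
    by (subst sum.reindex) (auto intro!: inj_onI simp: R_def ounits_def)
  also have "\<dots> = sum f R"
  proof (rule transversal_sum_eq[OF transversal_inverse_ounits[OF R] R subgroup_pideal])
    show "f a = f b" if "a - b \<in> pideal 1" for a b
      unfolding f_def chi_eq[OF that] fixed_u_eq[OF tf that] ..
  qed
  also have "sum f R = sum f (reps 0 1)"
    by (rule sum.mono_neutral_left) (use fin in \<open>auto simp: R_def f_def chi_def\<close>)
  finally show ?thesis by (simp add: f_def add.commute)
qed

text \<open>Passing from \<open>y\<close> to \<open>h y\<close> puts both \<open>v\<close> and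
  \<open>w v\<close> into the span of translates of \<open>y\<close> and of
  \<open>w (t 1 y)\<close>, with the \<open>y\<close>-part of \<open>w v\<close> twisted by
  \<open>chi\<close>. That \<open>chi\<close> is not constant is what will separate
  \<open>w v\<close> from the translates of \<open>v\<close>.\<close>

definition v :: 'x where "v = h y"

lemma same_char_v: "same_char v" "same_char (h v)"
  using same_char_hn[of 1] same_char_hn[of 2] by (simp_all add: v_def numeral_2_eq_2)

text \<open>A term \<open>(s, c, b, j)\<close> stands for \<open>c u(b) t\<^sup>j w v\<close> if \<open>s\<close> and for \<open>c u(b) t\<^sup>j v\<close> otherwise.  Expanding \<open>v\<close>
  and \<open>w v\<close>, a list of terms is a formal combination of the \<open>u(a) t\<^sup>i w t y\<close> and the \<open>u(a) t\<^sup>i y\<close> with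
  \<open>a\<close> modulo \<open>\<pi>\<^sup>i\<close>; \<open>coeff1\<close> and \<open>form\<close> record its coefficients, at \<open>(True, i, a)\<close> and
  \<open>(False, i, a)\<close> respectively.\<close>

fun term_val :: "bool \<times> 'k \<times> 'l \<times> int \<Rightarrow> 'x"
  where "term_val (s, c, b, j) = sc c (u b (t j (if s then w v else v)))"

text \<open>The bounds confine a list to finitely many levels and, at each level, to finitely many
  cosets, so that the double sums over levels and representatives capture it completely.\<close>

fun term_ok :: "int \<Rightarrow> int \<Rightarrow> bool \<times> 'k \<times> 'l \<times> int \<Rightarrow> bool"
  where "term_ok n m (s, c, b, j) \<longleftrightarrow> c \<in> carrier k \<and> b \<in> pideal (- n) \<and> - n \<le> j \<and> j \<le> m"

fun coeff1 :: "bool \<times> 'k \<times> 'l \<times> int \<Rightarrow> bool \<times> int \<times> 'l \<Rightarrow> 'k"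
  where "coeff1 (s, c, b, j) (s', i, a) =
    (if s' then (if s \<and> i = j \<and> a - b \<in> pideal j then c else \<zero>)
     else if i = j + 1 \<and> a - b \<in> pideal j then c \<otimes> (if s then chi ((a - b) / unif powi j) else \<one>) else \<zero>)"

definition form :: "(bool \<times> 'k \<times> 'l \<times> int) list \<Rightarrow> bool \<times> int \<times> 'l \<Rightarrow> 'x \<Rightarrow> 'x"
  where "form ds x = (\<Sum>q\<leftarrow>ds. sc (coeff1 q x))"

definition vals :: "(bool \<times> 'k \<times> 'l \<times> int) list \<Rightarrow> 'x"
  where "vals ds = (\<Sum>q\<leftarrow>ds. term_val q)"

text \<open>Coefficients, here as in \<open>form\<close>, are kept as operators \<open>sc c\<close>
  on \<open>'x\<close>: the field \<open>k\<close> is a record without type class structure, whereas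
  such operators can be added and live in a ring type of characteristic \<open>p\<close>, as
  \<open>unipotent_fixed_vector\<close> requires. Evaluation at a nonzero vector of \<open>M\<close>
  recovers \<open>c\<close>.\<close>

definition weight :: "(bool \<times> 'k \<times> 'l \<times> int) list \<Rightarrow> 'x \<Rightarrow> 'x"
  where "weight ds = (\<Sum>(s, c, b, j)\<leftarrow>ds. if s then sc c else 0)"

lemma sc_zero_fun: "sc \<zero> = 0"
  by (simp add: fun_eq_iff)

lemma coeff1_closed: "term_ok n m q \<Longrightarrow> coeff1 q x \<in> carrier k"
  by (cases q; cases x) auto

text \<open>The coset of \<open>b\<close> modulo \<open>pideal j\<close> is parametrised by
  \<open>a = b + unif^j c\<close> with integral \<open>c\<close>; its classes modulo
  \<open>pideal (j + 1)\<close> correspond to the residue classes of \<open>c\<close>.\<close>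

lemma expand_children:
  assumes f: "\<And>a. f a \<in> carrier k" "\<And>a b. a - b \<in> pideal 1 \<Longrightarrow> f a = f b"
    and b: "b \<in> pideal (- n)" and j: "- n \<le> j"
  shows "(\<Sum>a\<in>reps (- n) (j + 1) \<inter> {a. a - b \<in> pideal j}. sc (f ((a - b) / unif powi j)) (u a (t (j + 1) y)))
    = u b (t j (\<Sum>c\<in>reps 0 1. sc (f c) (u c (t 1 y))))"
proof -
  let ?E = "{a. a - b \<in> pideal j}"
  let ?g = "\<lambda>a. sc (f ((a - b) / unif powi j)) (u a (t (j + 1) y))"
  have tf: "t (j + 1) y \<in> fixed (j + 1)" by (rule t_fixed[OF y_props(3)])
  have pj: "pideal (j + 1) \<subseteq> (pideal j :: 'l set)" by (rule pideal_mono) simp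
  have sub: "?E \<subseteq> pideal (- n)"
  proof
    fix a assume "a \<in> ?E"
    then have "(a - b) + b \<in> pideal (- n)" using b pideal_monoD[OF _ j] by (intro pideal_add) auto
    then show "a \<in> pideal (- n)" by simp
  qed
  have tr1: "transversal (reps (- n) (j + 1) \<inter> ?E) (pideal (j + 1)) ?E"
  proof (rule transversal_subset[OF reps sub subgroup_pideal])
    show "c + d \<in> ?E" if "c \<in> ?E" "d \<in> pideal (j + 1)" for c d
    proof -
      have "(c - b) + d \<in> pideal j" using that pj by (intro pideal_add) auto
      then show ?thesis by (simp add: algebra_simps)
    qed
  qed (use j in simp)
  have tr2: "transversal ((\<lambda>c. b + unif powi j * c) ` reps 0 1) (pideal (j + 1)) ?E"
  proof (rule transversal_image[OF reps])
    show "bij_betw (\<lambda>c. b + unif powi j * c) (pideal 0) ?E"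
    proof (rule bij_betw_byWitness[of _ "\<lambda>a. (a - b) / unif powi j"])
      show "(\<lambda>c. b + unif powi j * c) ` pideal 0 \<subseteq> ?E"
        using pideal_scale[of "unif powi j :: 'l" _ 0] by auto
      show "(\<lambda>a. (a - b) / unif powi j) ` ?E \<subseteq> pideal 0"
      proof clarify
        fix a assume "a - b \<in> pideal j"
        then show "(a - b) / unif powi j \<in> pideal 0"
          using pideal_scale[of "unif powi j :: 'l" "(a - b) / unif powi j" 0] by simp
      qed
    qed auto
    fix x z :: 'l
    have "b + unif powi j * x - (b + unif powi j * z) = unif powi j * (x - z)" by (simp add: algebra_simps)
    then show "b + unif powi j * x - (b + unif powi j * z) \<in> pideal (j + 1) \<longleftrightarrow> x - z \<in> pideal 1"
      using pideal_scale[of "unif powi j :: 'l" "x - z" 1] by simp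
  qed simp
  have "sum ?g (reps (- n) (j + 1) \<inter> ?E) = sum ?g ((\<lambda>c. b + unif powi j * c) ` reps 0 1)"
  proof (rule transversal_sum_eq[OF tr1 tr2 subgroup_pideal])
    fix x z :: 'l assume xz: "x - z \<in> pideal (j + 1)"
    have "(x - b) / unif powi j - (z - b) / unif powi j = (x - z) / unif powi j"
      by (simp flip: diff_divide_distrib)
    also have "\<dots> \<in> pideal 1" using xz pideal_scale[of "unif powi j :: 'l" "(x - z) / unif powi j" 1] by simp
    finally have "f ((x - b) / unif powi j) = f ((z - b) / unif powi j)" by (rule f(2))
    then show "?g x = ?g z" using fixed_u_eq[OF tf xz] by simp
  qed
  also have "\<dots> = (\<Sum>c\<in>reps 0 1. ?g (b + unif powi j * c))"
    by (subst sum.reindex) (auto intro: inj_onI)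
  also have "\<dots> = (\<Sum>c\<in>reps 0 1. u b (t j (sc (f c) (u c (t 1 y)))))"
  proof (rule sum.cong)
    fix c :: 'l
    have "t (j + 1) y = t j (t 1 y)" by (simp only: t_t)
    then show "?g (b + unif powi j * c) = u b (t j (sc (f c) (u c (t 1 y))))"
      using f(1) by (simp add: D_sc u_sc t_u u_u)
  qed simp
  finally show ?thesis by (simp only: u_sum D_sum)
qed

text \<open>Only the level \<open>j\<close> and the representative congruent to \<open>b\<close>
  have a nonzero coefficient. The summand \<open>G\<close> is left general, so that the lemma serves
  for vectors and for weights.\<close>

lemma sum_coeff1_True:
  fixes G :: "int \<Rightarrow> 'l \<Rightarrow> 'k \<Rightarrow> 'b::comm_monoid_add"
  assumes q: "term_ok n m (s, c, b, j)" and G0: "\<And>i a. G i a \<zero> = 0"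
    and G: "\<And>a. a - b \<in> pideal j \<Longrightarrow> G j a c = G j b c"
  shows "(\<Sum>i\<in>{- n..m + 1}. \<Sum>a\<in>reps (- n) i. G i a (coeff1 (s, c, b, j) (True, i, a))) = (if s then G j b c else 0)"
proof (cases s)
  case True
  have j: "- n \<le> j" "j \<le> m" and b: "b \<in> pideal (- n)" using q by auto
  obtain a where a: "a \<in> reps (- n) j" "b - a \<in> pideal j" using transversalD(3)[OF reps[OF j(1)] b] by blast
  have ab: "a - b \<in> pideal j" using a pideal_minus[of "b - a" j] by simp
  have "(\<Sum>i\<in>{- n..m + 1}. \<Sum>a\<in>reps (- n) i. G i a (coeff1 (s, c, b, j) (True, i, a)))
      = (\<Sum>a\<in>reps (- n) j. G j a (coeff1 (s, c, b, j) (True, j, a)))"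
    by (rule sum_eq_single) (use j G0 in \<open>auto intro: sum.neutral\<close>)
  also have "\<dots> = G j a (coeff1 (s, c, b, j) (True, j, a))"
  proof (rule sum_eq_single[OF finite_reps[OF j(1)] a(1)])
    fix a' assume a': "a' \<in> reps (- n) j" "a' \<noteq> a"
    have "a' - b \<notin> pideal j"
    proof
      assume "a' - b \<in> pideal j"
      then have "b - a' \<in> pideal j" using pideal_minus[of "a' - b" j] by simp
      then show False using transversalD(4)[OF reps[OF j(1)] b a'(1) a(1) _ a(2)] a'(2) by blast
    qed
    then show "G j a' (coeff1 (s, c, b, j) (True, j, a')) = 0" by (simp add: G0)
  qed
  also have "\<dots> = G j b c" using G[OF ab] ab True by simp
  finally show ?thesis using True by simp
qed (simp add: G0)

text \<open>Insert \<open>w_h\<close> for \<open>w v\<close> and the definition of \<open>h\<close>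
  for \<open>v\<close>. A term of level \<open>j\<close> contributes to the translates of
  \<open>y\<close> at level \<open>j + 1\<close>, hence the upper limit
  \<open>m + 1\<close>.\<close>

lemma term_val_expand:
  assumes q: "term_ok n m q"
  shows "term_val q = (\<Sum>i\<in>{- n..m + 1}. \<Sum>a\<in>reps (- n) i. sc (coeff1 q (True, i, a)) (u a (t i (w (t 1 y)))))
    + (\<Sum>i\<in>{- n..m + 1}. \<Sum>a\<in>reps (- n) i. sc (coeff1 q (False, i, a)) (u a (t i y)))"
proof -
  obtain s c b j where qq: "q = (s, c, b, j)" by (metis prod.exhaust)
  have j: "- n \<le> j" "j \<le> m" and b: "b \<in> pideal (- n)" and c: "c \<in> carrier k" using q by (auto simp: qq)
  \<comment> \<open>Conjugation by \<open>w\<close> turns \<open>u e\<close> into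
    \<open>l e\<close>, and pulling this through \<open>t\<close> multiplies \<open>e\<close> by the
    uniformizer. Therefore the translates of \<open>t i (w (t 1 y))\<close> depend on
    \<open>a\<close> only modulo \<open>pideal i\<close>.\<close>
  have wf: "w (t 1 y) \<in> fixed 0"
    unfolding fixed_def
  proof safe
    fix e :: 'l assume "e \<in> pideal 0"
    then have "unif * e \<in> pideal 1" using pideal_mult[of unif 1 e 0] by (simp add: pideal_iff)
    then have "l e (t 1 y) = t 1 y" using y_props(5) D_l[of unif 1 "unif * e" y] by simp
    then show "u e (w (t 1 y)) = w (t 1 y)" by (simp flip: w_l)
  qed
  define f where "f = (\<lambda>z. if s then chi z else \<one>)"
  have f: "f a \<in> carrier k" for a by (simp add: f_def)
  have fp: "f a = f b" if "a - b \<in> pideal 1" for a b using chi_eq[OF that] by (simp add: f_def)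
  have T: "(\<Sum>i\<in>{- n..m + 1}. \<Sum>a\<in>reps (- n) i. sc (coeff1 q (True, i, a)) (u a (t i (w (t 1 y)))))
      = (if s then sc c (u b (t j (w (t 1 y)))) else 0)"
    unfolding qq
    by (rule sum_coeff1_True[where G = "\<lambda>i a c. sc c (u a (t i (w (t 1 y))))"])
      (use q qq fixed_u_eq[OF t_fixed[OF wf]] in auto)
  have "(\<Sum>i\<in>{- n..m + 1}. \<Sum>a\<in>reps (- n) i. sc (coeff1 q (False, i, a)) (u a (t i y)))
      = (\<Sum>a\<in>reps (- n) (j + 1). sc (coeff1 q (False, j + 1, a)) (u a (t (j + 1) y)))"
    by (rule sum_eq_single) (use j in \<open>auto simp: qq intro!: sum.neutral\<close>)
  also have "\<dots> = (\<Sum>a\<in>reps (- n) (j + 1) \<inter> {a. a - b \<in> pideal j}. sc (coeff1 q (False, j + 1, a)) (u a (t (j + 1) y)))"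
    using finite_reps[of "- n" "j + 1", where ?'a = 'l] j by (intro sum.mono_neutral_right) (auto simp: qq)
  also have "\<dots> = (\<Sum>a\<in>reps (- n) (j + 1) \<inter> {a. a - b \<in> pideal j}.
      sc c (sc (f ((a - b) / unif powi j)) (u a (t (j + 1) y))))"
    by (rule sum.cong) (use c f in \<open>auto simp: qq f_def sc_mult\<close>)
  also have "\<dots> = sc c (u b (t j (\<Sum>e\<in>reps 0 1. sc (f e) (u e (t 1 y)))))"
    by (simp only: sc_sum[symmetric] expand_children[where f = f, OF f fp b j(1)])
  finally have F: "(\<Sum>i\<in>{- n..m + 1}. \<Sum>a\<in>reps (- n) i. sc (coeff1 q (False, i, a)) (u a (t i y)))
      = sc c (u b (t j (\<Sum>e\<in>reps 0 1. sc (f e) (u e (t 1 y)))))" .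
  show ?thesis
  proof (cases s)
    case True
    then show ?thesis unfolding T F
      using w_h[OF same_char_y] by (simp add: qq f_def v_def D_plus u_plus sc_plus)
  next
    case False
    have "t 1 y \<in> M" using M_act y_props(2) by (simp add: D_def)
    then have "u e (t 1 y) \<in> M" for e using M_act by (simp add: u_def)
    then have "v = (\<Sum>e\<in>reps 0 1. sc \<one> (u e (t 1 y)))" by (simp add: v_def h_def nrm_def sc_one)
    then show ?thesis unfolding T F using False by (simp add: qq f_def)
  qed
qed

definition shift_term :: "'l \<Rightarrow> bool \<times> 'k \<times> 'l \<times> int \<Rightarrow> bool \<times> 'k \<times> 'l \<times> int"
  where "shift_term e = (\<lambda>(s, c, b, j). (s, c, b + e, j))"

definition neg_term :: "bool \<times> 'k \<times> 'l \<times> int \<Rightarrow> bool \<times> 'k \<times> 'l \<times> int"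
  where "neg_term = (\<lambda>(s, c, b, j). (s, \<ominus> c, b, j))"

text \<open>The effect of \<open>u e\<close> on forms. Combined with \<open>neg_term\<close> it
  realises \<open>u e - 1\<close> on lists of terms.\<close>

definition shift :: "'l \<Rightarrow> (bool \<times> int \<times> 'l \<Rightarrow> 'x \<Rightarrow> 'x) \<Rightarrow> bool \<times> int \<times> 'l \<Rightarrow> 'x \<Rightarrow> 'x"
  where "shift e f = (\<lambda>(s, i, a). f (s, i, a - e))"

lemma term_val_shift: "term_ok n m q \<Longrightarrow> term_val (shift_term e q) = u e (term_val q)"
  by (cases q) (auto simp: shift_term_def u_sc u_u add.commute)

lemma vals_shift: "(\<And>q. q \<in> set ds \<Longrightarrow> term_ok n m q) \<Longrightarrow> vals (map (shift_term e) ds) = u e (vals ds)"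
proof (induction ds)
  case (Cons q ds)
  then show ?case using term_val_shift[of n m q e] by (simp add: vals_def u_plus)
qed (simp add: vals_def)

lemma form_shift: "form (map (shift_term e) ds) = shift e (form ds)"
proof -
  have "coeff1 (shift_term e q) (s, i, a) = coeff1 q (s, i, a - e)" for q s i a
    by (cases q) (simp add: shift_term_def diff_diff_eq add.commute)
  then show ?thesis by (auto simp: fun_eq_iff form_def shift_def comp_def)
qed

lemma term_ok_shift: "\<lbrakk>term_ok n m q; e \<in> pideal (- n)\<rbrakk> \<Longrightarrow> term_ok n m (shift_term e q)"
  by (cases q) (auto simp: shift_term_def intro: pideal_add)

lemma term_ok_neg: "term_ok n m q \<Longrightarrow> term_ok n m (neg_term q)"
  by (cases q) (auto simp: neg_term_def)

lemma vals_neg: "(\<And>q. q \<in> set ds \<Longrightarrow> term_ok n m q) \<Longrightarrow> vals (map neg_term ds) = - vals ds"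
proof (induction ds)
  case (Cons q ds)
  have "term_val (neg_term q) = - term_val q"
    using Cons.prems[of q] by (cases q) (auto simp: neg_term_def sc_a_inv)
  then show ?case using Cons by (simp add: vals_def)
qed (simp add: vals_def)

lemma form_neg: "(\<And>q. q \<in> set ds \<Longrightarrow> term_ok n m q) \<Longrightarrow> form (map neg_term ds) x = - form ds x"
proof (induction ds)
  case (Cons q ds)
  have "coeff1 (neg_term q) x = \<ominus> coeff1 q x"
    using Cons.prems[of q] by (cases q; cases x) (auto simp: neg_term_def l_minus)
  then have "sc (coeff1 (neg_term q) x) = - sc (coeff1 q x)"
    using coeff1_closed[of n m q x] Cons.prems[of q] by (simp add: fun_eq_iff sc_a_inv)
  then show ?case using Cons by (simp add: form_def fun_eq_iff)
qed (simp add: form_def)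

lemma vals_append: "vals (xs @ ys) = vals xs + vals ys"
  by (simp add: vals_def)

lemma form_append: "form (xs @ ys) x = form xs x + form ys x"
  by (simp add: form_def)

lemma form_scalar: "(\<And>q. q \<in> set ds \<Longrightarrow> term_ok n m q) \<Longrightarrow> \<exists>c\<in>carrier k. form ds x = sc c"
proof (induction ds)
  case Nil
  then show ?case by (auto simp: form_def sc_zero_fun intro!: bexI[of _ \<zero>])
next
  case (Cons q ds)
  then obtain c where "c \<in> carrier k" "form ds x = sc c" by auto
  moreover have "coeff1 q x \<in> carrier k" using Cons.prems by (intro coeff1_closed[of n m]) (simp del: term_ok.simps)
  ultimately show ?case
    by (intro bexI[of _ "coeff1 q x \<oplus> c"]) (auto simp: form_def fun_eq_iff sc_add)
qed

text \<open>\<open>chi\<close> sees one more digit than membership in \<open>pideal j\<close> does,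
  which is exactly the precision available at its level \<open>i = j + 1\<close>.\<close>

lemma form_periodic:
  assumes "a - a' \<in> pideal i" shows "form ds (s, i, a) = form ds (s, i, a')"
proof -
  have "coeff1 q (s, i, a) = coeff1 q (s, i, a')" for q
  proof (cases q)
    case (fields s' c b j)
    have e: "a - b \<in> pideal j \<longleftrightarrow> a' - b \<in> pideal j" if "j \<le> i" for j
    proof -
      have "a - a' \<in> pideal j" "a' - a \<in> pideal j"
        using pideal_monoD[OF assms that] pideal_minus[of "a - a'" j] by auto
      then show ?thesis using pideal_add[of "a - b" j "a' - a"] pideal_add[of "a' - b" j "a - a'"] by auto
    qed
    have ch: "chi ((a - b) / unif powi j) = chi ((a' - b) / unif powi j)" if "i = j + 1"
    proof (rule chi_eq)
      have "(a - b) / unif powi j - (a' - b) / unif powi j = (a - a') / unif powi j"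
        by (simp flip: diff_divide_distrib)
      also have "\<dots> \<in> pideal 1"
        using assms that pideal_scale[of "unif powi j :: 'l" "(a - a') / unif powi j" 1] by simp
      finally show "(a - b) / unif powi j - (a' - b) / unif powi j \<in> pideal 1" .
    qed
    show ?thesis using e[of j] ch by (auto simp: fields)
  qed
  then show ?thesis by (simp add: form_def)
qed

lemma form_support:
  assumes ok: "\<And>q. q \<in> set ds \<Longrightarrow> term_ok n m q" and nz: "form ds (s, i, a) \<noteq> 0"
  shows "- n \<le> i" "i \<le> m + 1" "a \<in> pideal (- n)"
proof -
  have "\<exists>q\<in>set ds. coeff1 q (s, i, a) \<noteq> \<zero>"
  proof (rule ccontr)
    assume "\<not> ?thesis"
    then have "form ds (s, i, a) = (\<Sum>q\<leftarrow>ds. sc \<zero>)"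
      unfolding form_def by (intro arg_cong[of _ _ sum_list] map_cong) auto
    then show False using nz by (simp add: sc_zero_fun)
  qed
  then obtain s' c b j where q: "(s', c, b, j) \<in> set ds" "coeff1 (s', c, b, j) (s, i, a) \<noteq> \<zero>"
    by (metis prod.exhaust)
  have o: "b \<in> pideal (- n)" "- n \<le> j" "j \<le> m" using ok[OF q(1)] by auto
  have "a - b \<in> pideal j" using q(2) by (auto split: if_splits)
  then have "(a - b) + b \<in> pideal (- n)" using pideal_monoD[OF _ o(2)] o(1) by (intro pideal_add) auto
  then show "a \<in> pideal (- n)" by simp
  show "- n \<le> i" "i \<le> m + 1" using q(2) o by (auto split: if_splits)
qed

text \<open>If \<open>\<Sum>c \<noteq> 0\<close>, the convolution of \<open>chi\<close> with \<open>\<Sum>c\<cdot>[b]\<close> on the residue field is not constant, as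
  \<open>\<Sum>c\<cdot>[b]\<close> is a unit of the (local) group algebra and \<open>chi\<close> is not constant: \<open>chi 0 = 0 \<noteq> chi 1\<close>.\<close>

lemma weight_zero_of_constant_convolution:
  fixes L :: "('k \<times> 'l) list"
  assumes L: "\<And>c b. (c, b) \<in> set L \<Longrightarrow> c \<in> carrier k \<and> b \<in> pideal 0"
    and const: "\<And>a. a \<in> pideal 0 \<Longrightarrow> (\<Sum>(c, b)\<leftarrow>L. sc (c \<otimes> chi (a - b))) = C"
  shows "(\<Sum>(c, b)\<leftarrow>L. sc c) = (0 :: 'x \<Rightarrow> 'x)"
proof -
  define conv where "conv = (\<lambda>(\<zeta> :: 'l \<Rightarrow> 'k) a. (\<Sum>(c, b)\<leftarrow>L. sc (c \<otimes> \<zeta> (a - b))) :: 'x \<Rightarrow> 'x)"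
  define P where "P = (\<lambda>\<zeta> :: 'l \<Rightarrow> 'k. (\<forall>a. \<zeta> a \<in> carrier k) \<and> (\<forall>a a'. a - a' \<in> pideal 1 \<longrightarrow> \<zeta> a = \<zeta> a') \<and>
    (\<exists>C. \<forall>a\<in>pideal 0. conv \<zeta> a = C))"
  \<comment> \<open>Functions are considered modulo those constant on the integers. A
    \<open>\<zeta>\<close> that is not constant but fixed by all translations modulo constants has
    increments independent of the point, like an additive map.\<close>
  define M2 where "M2 = {z :: 'l \<Rightarrow> 'x \<Rightarrow> 'x. \<exists>\<zeta>. z = (\<lambda>a. sc (\<zeta> a)) \<and> P \<zeta>}"
  define N2 where "N2 = {z :: 'l \<Rightarrow> 'x \<Rightarrow> 'x. \<exists>C. \<forall>a\<in>pideal 0. z a = C}"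
  define sh where "sh = (\<lambda>e (z :: 'l \<Rightarrow> 'x \<Rightarrow> 'x) a. z (a - e))"
  have r0: "reps 0 1 \<subseteq> (pideal 0 :: 'l set)" by (rule reps_subset) simp
  have "\<exists>z\<in>M2. z \<notin> N2 \<and> (\<forall>f\<in>sh ` reps 0 1. f z - z \<in> N2)"
  proof (rule unipotent_fixed_vector[OF prime_p])
    show "of_nat p = (0 :: 'l \<Rightarrow> 'x \<Rightarrow> 'x)" using char_x by (intro of_nat_fun_eq_zero)
    show "finite (sh ` reps 0 1)" using finite_reps[of 0 1, where ?'a = 'l] by simp
    show "Modules.additive f" if "f \<in> sh ` reps 0 1" for f
      using that by (auto simp: Modules.additive_def sh_def)
    show "f (g z) = g (f z)" if "f \<in> sh ` reps 0 1" "g \<in> sh ` reps 0 1" for f g z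
      using that by (auto simp: sh_def fun_eq_iff diff_diff_eq add.commute)
    show "(f ^^ p) z = z" if fz: "f \<in> sh ` reps 0 1" for f z
    proof -
      obtain e where e: "f = sh e" using fz by blast
      have "(sh e ^^ n) z = sh (of_nat n * e) z" for n
        by (induction n) (auto simp: sh_def fun_eq_iff algebra_simps)
      then show ?thesis using char_l e of_nat_CHAR[where ?'a = 'l] by (simp add: sh_def)
    qed
    show "f z - z \<in> N2" if fz: "f \<in> sh ` reps 0 1" "z \<in> N2" for f z
    proof -
      obtain e where e: "f = sh e" "e \<in> pideal 0" using fz r0 by blast
      obtain C where C: "\<And>a. a \<in> pideal 0 \<Longrightarrow> z a = C" using fz by (auto simp: N2_def)
      have "(f z - z) a = 0" if "a \<in> pideal 0" for a
        using C[OF that] C[of "a - e"] pideal_diff[OF that e(2)] e by (simp add: sh_def)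
      then show ?thesis unfolding N2_def by blast
    qed
    show "0 \<in> N2" by (auto simp: N2_def)
    show "f z - z \<in> M2" if fz: "f \<in> sh ` reps 0 1" "z \<in> M2" for f z
    proof -
      obtain e where e: "f = sh e" "e \<in> pideal 0" using fz r0 by blast
      obtain \<zeta> where z: "z = (\<lambda>a. sc (\<zeta> a))" "P \<zeta>" using fz by (auto simp: M2_def)
      then obtain C where C: "\<And>a. a \<in> pideal 0 \<Longrightarrow> conv \<zeta> a = C" by (auto simp: P_def)
      define \<xi> where "\<xi> = (\<lambda>a. \<zeta> (a - e) \<ominus> \<zeta> a)"
      have \<zeta>: "\<zeta> a \<in> carrier k" for a using z(2) by (simp add: P_def)
      have "f z - z = (\<lambda>a. sc (\<xi> a))"
        using e z \<zeta> by (auto simp: fun_eq_iff sh_def \<xi>_def a_minus_def sc_add sc_a_inv)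
      moreover have "P \<xi>"
        unfolding P_def
      proof (intro conjI allI impI)
        show "\<xi> a \<in> carrier k" for a using \<zeta> by (simp add: \<xi>_def)
        show "\<xi> a = \<xi> a'" if aa: "a - a' \<in> pideal 1" for a a'
        proof -
          have "\<zeta> a = \<zeta> a'" using z(2) aa by (simp add: P_def)
          moreover have "\<zeta> (a - e) = \<zeta> (a' - e)"
          proof -
            have "(a - e) - (a' - e) \<in> pideal 1" using aa by simp
            then show ?thesis using z(2) unfolding P_def by blast
          qed
          ultimately show ?thesis by (simp add: \<xi>_def)
        qed
        have "conv \<xi> a = conv \<zeta> (a - e) - conv \<zeta> a" for a
        proof -
          have "(\<Sum>(c, b)\<leftarrow>L'. sc (c \<otimes> \<xi> (a - b))) = (\<Sum>(c, b)\<leftarrow>L'. sc (c \<otimes> \<zeta> (a - e - b))) - (\<Sum>(c, b)\<leftarrow>L'. sc (c \<otimes> \<zeta> (a - b)))"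
            if "set L' \<subseteq> set L" for L'
            using that
          proof (induction L')
            case (Cons q L')
            obtain c b where q: "q = (c, b)" by (cases q)
            have c: "c \<in> carrier k" using Cons.prems L q by auto
            have e': "a - b - e = a - e - b" by simp
            have "sc (c \<otimes> \<xi> (a - b)) = sc (c \<otimes> \<zeta> (a - e - b)) - sc (c \<otimes> \<zeta> (a - b))"
              using c \<zeta> by (simp add: fun_eq_iff \<xi>_def e' a_minus_def r_distr r_minus sc_add sc_a_inv)
            then show ?case using Cons by (simp add: q fun_eq_iff algebra_simps)
          qed simp
          then show ?thesis by (simp add: conv_def)
        qed
        then have "\<forall>a\<in>pideal 0. conv \<xi> a = C - C" using C pideal_diff[OF _ e(2)] by simp
        then show "\<exists>C. \<forall>a\<in>pideal 0. conv \<xi> a = C" by blast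
      qed
      ultimately show ?thesis unfolding M2_def by blast
    qed
    have "P chi" using chi_eq const unfolding P_def conv_def by auto
    then show "(\<lambda>a. sc (chi a)) \<in> M2" unfolding M2_def by blast
    show "(\<lambda>a. sc (chi a)) \<notin> N2"
    proof
      assume "(\<lambda>a. sc (chi a)) \<in> N2"
      then obtain C where "\<And>a. a \<in> pideal 0 \<Longrightarrow> sc (chi a) = C" by (auto simp: N2_def)
      from this[of 0] this[of 1] have "sc (chi 1) y = sc (chi 0) y" by simp
      also have "chi 0 = \<zero>" by (simp add: chi_def ounits_def)
      finally have "D (- 1) 1 y = 0" using chi[of 1] by simp
      then have "D (- 1) 1 (D (- 1) 1 y) = 0" by simp
      then show False using y_nz by (simp add: D_D)
    qed
  qed
  then obtain \<zeta> where P: "P \<zeta>" and notN: "(\<lambda>a. sc (\<zeta> a)) \<notin> N2"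
    and fix': "\<And>e. e \<in> reps 0 1 \<Longrightarrow> sh e (\<lambda>a. sc (\<zeta> a)) - (\<lambda>a. sc (\<zeta> a)) \<in> N2"
    by (auto simp: M2_def)
  have \<zeta>: "\<zeta> a \<in> carrier k" for a using P by (simp add: P_def)
  obtain C where C: "\<And>a. a \<in> pideal 0 \<Longrightarrow> conv \<zeta> a = C" using P by (auto simp: P_def)
  have diff: "sc (\<zeta> (a - b)) - sc (\<zeta> a) = sc (\<zeta> (0 - b)) - sc (\<zeta> 0)"
    if a: "a \<in> pideal 0" and b: "b \<in> pideal 0" for a b
  proof -
    obtain e where e: "e \<in> reps 0 1" "b - e \<in> pideal 1"
      using transversalD(3)[OF reps[of 0 1] b] by auto
    have ze: "\<zeta> (a' - b) = \<zeta> (a' - e)" for a'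
    proof -
      have "(a' - b) - (a' - e) \<in> pideal 1" using e(2) pideal_minus[of "b - e" 1] by simp
      then show ?thesis using P unfolding P_def by blast
    qed
    obtain K where K: "\<And>a. a \<in> pideal 0 \<Longrightarrow> (sh e (\<lambda>a. sc (\<zeta> a)) - (\<lambda>a. sc (\<zeta> a))) a = K"
      using fix'[OF e(1)] by (auto simp: N2_def)
    have "sc (\<zeta> (a' - b)) - sc (\<zeta> a') = K" if "a' \<in> pideal 0" for a'
      using K[OF that] unfolding ze by (simp add: sh_def)
    from this[OF a] this[OF zero_in_pideal] show ?thesis by (simp only:)
  qed
  define s where "s = foldr (\<lambda>(c, b) s. c \<oplus> s) L \<zero>"
  have s: "s \<in> carrier k \<and> (\<Sum>(c, b)\<leftarrow>L. sc c) = sc s"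
  proof -
    have "foldr (\<lambda>(c, b) s. c \<oplus> s) L' \<zero> \<in> carrier k \<and>
        (\<Sum>(c, b)\<leftarrow>L'. sc c) = sc (foldr (\<lambda>(c, b) s. c \<oplus> s) L' \<zero>)" if "set L' \<subseteq> set L" for L'
      using that
    proof (induction L')
      case (Cons q L')
      obtain c b where q: "q = (c, b)" by (cases q)
      then have "c \<in> carrier k" using Cons.prems L by auto
      then show ?case using Cons q by (auto simp: fun_eq_iff sc_add)
    qed (simp add: sc_zero_fun)
    then show ?thesis by (simp add: s_def)
  qed
  \<comment> \<open>As the increments of \<open>\<zeta>\<close> do not depend on the point, the
    convolution changes between \<open>0\<close> and \<open>a\<close> by
    \<open>\<zeta> a - \<zeta> 0\<close> times the total coefficient \<open>s\<close>. Constancy of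
    the convolution then forces \<open>s = \<zero>\<close>.\<close>
  have lin: "(\<Sum>(c, b)\<leftarrow>L'. sc (c \<otimes> \<zeta> (a - b)) x) - (\<Sum>(c, b)\<leftarrow>L'. sc (c \<otimes> \<zeta> (0 - b)) x)
      = (\<Sum>(c, b)\<leftarrow>L'. sc c (sc (\<zeta> a) x - sc (\<zeta> 0) x))"
    if "set L' \<subseteq> set L" "a \<in> pideal 0" for L' a x
    using that
  proof (induction L')
    case (Cons q L')
    obtain c b where q: "q = (c, b)" by (cases q)
    then have cb: "c \<in> carrier k" "b \<in> pideal 0" using Cons.prems L by auto
    have "sc (\<zeta> (a - b)) x - sc (\<zeta> a) x = sc (\<zeta> (0 - b)) x - sc (\<zeta> 0) x"
      using diff[OF Cons.prems(2) cb(2)] by (simp add: fun_eq_iff)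
    then have "sc (\<zeta> (a - b)) x - sc (\<zeta> (0 - b)) x = sc (\<zeta> a) x - sc (\<zeta> 0) x" by (simp add: algebra_simps)
    then have "sc c (sc (\<zeta> (a - b)) x) - sc c (sc (\<zeta> (0 - b)) x) = sc c (sc (\<zeta> a) x - sc (\<zeta> 0) x)"
      by (simp flip: sc_diff)
    then show ?case using Cons cb \<zeta> by (simp add: q sc_mult algebra_simps)
  qed simp
  have "sc s (sc (\<zeta> a) x - sc (\<zeta> 0) x) = 0" if a: "a \<in> pideal 0" for a x
  proof -
    have ap: "(\<Sum>(c, b)\<leftarrow>L'. f c b :: 'x \<Rightarrow> 'x) x' = (\<Sum>(c, b)\<leftarrow>L'. f c b x')" for L' :: "('k \<times> 'l) list" and f x'
      by (induction L') auto
    have "conv \<zeta> a x = conv \<zeta> 0 x" using C[OF a] C[of 0] by simp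
    then have "(\<Sum>(c, b)\<leftarrow>L. sc c (sc (\<zeta> a) x - sc (\<zeta> 0) x)) = 0"
      using lin[OF order_refl a, of x] by (simp add: conv_def ap)
    then show ?thesis using s ap[of "\<lambda>c b. sc c" L] by simp
  qed
  then have zz: "sc s (sc (\<zeta> a \<ominus> \<zeta> 0) x) = 0" if "a \<in> pideal 0" for a x
    using that \<zeta> by (simp add: a_minus_def sc_add sc_a_inv)
  have "s = \<zero>"
  proof (rule ccontr)
    assume "s \<noteq> \<zero>"
    then have "s \<in> Units k" using s field_Units by blast
    have "\<zeta> a = \<zeta> 0" if "a \<in> pideal 0" for a
    proof -
      have "sc (\<zeta> a \<ominus> \<zeta> 0) y \<in> M" using \<zeta> y_props(2) by (intro M_sc) auto
      then have "sc (\<zeta> a \<ominus> \<zeta> 0) y = 0" using zz[OF that, of y] sc_eq_zeroD[of s] s \<open>s \<noteq> \<zero>\<close> by blast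
      then have "\<zeta> a \<ominus> \<zeta> 0 = \<zero>" using sc_eq_zeroD[of "\<zeta> a \<ominus> \<zeta> 0" y] \<zeta> y_props(2) y_nz by auto
      then show ?thesis using \<zeta> by simp
    qed
    then have "\<forall>a\<in>pideal 0. sc (\<zeta> a) = sc (\<zeta> 0)" by metis
    then show False using notN unfolding N2_def by blast
  qed
  then show ?thesis using s by (simp add: sc_zero_fun)
qed

end

context free_iwahori_vector
begin

text \<open>On \<open>pideal i\<close> the coefficients at level \<open>i + 1\<close> are a
  constant, coming from the terms without \<open>w\<close>, plus the convolution of
  \<open>chi\<close> with the coefficients of the \<open>w v\<close> terms of level
  \<open>i\<close>, rescaled to the integers by \<open>unif^i\<close>. If the sum is constant, the
  total of the latter coefficients vanishes.\<close>

lemma form_True_zero: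
  assumes ok: "\<And>q. q \<in> set ds \<Longrightarrow> term_ok n m q"
    and inv: "\<And>a. a \<in> pideal i \<Longrightarrow> form ds (False, i + 1, a) = form ds (False, i + 1, 0)"
  shows "form ds (True, i, 0) = 0"
proof -
  define S where "S = filter (\<lambda>(s, c, b, j). j = i \<and> b \<in> pideal i) ds"
  define L where "L = map (\<lambda>(s, c, b, j). (c, b / unif powi i)) (filter fst S)"
  define cst where "cst = (\<Sum>(s, c, b, j)\<leftarrow>filter (Not \<circ> fst) S. sc c)"
  have okS: "\<And>q. q \<in> set S \<Longrightarrow> term_ok n m q" using ok by (simp add: S_def)
  have T: "form ds (True, i, 0) = (\<Sum>(c, b)\<leftarrow>L. sc c)"
  proof -
    have "form ds (True, i, 0) = (\<Sum>(c, b)\<leftarrow>map (\<lambda>(s, c, b, j). (c, b / unif powi i))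
        (filter fst (filter (\<lambda>(s, c, b, j). j = i \<and> b \<in> pideal i) ds)). sc c)" for ds
      by (induction ds) (auto simp: form_def sc_zero_fun)
    then show ?thesis by (simp add: L_def S_def)
  qed
  have F: "form ds (False, i + 1, a) = (\<Sum>(c, b)\<leftarrow>L. sc (c \<otimes> chi (a / unif powi i - b))) + cst" if a: "a \<in> pideal i" for a
  proof -
    have mem: "a - b \<in> pideal i \<longleftrightarrow> b \<in> pideal i" for b
      using pideal_diff[OF a, of b] pideal_diff[OF a, of "a - b"] by auto
    have "form ds' (False, i + 1, a) = (\<Sum>(c, b)\<leftarrow>map (\<lambda>(s, c, b, j). (c, b / unif powi i))
        (filter fst (filter (\<lambda>(s, c, b, j). j = i \<and> b \<in> pideal i) ds')). sc (c \<otimes> chi (a / unif powi i - b)))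
        + (\<Sum>(s, c, b, j)\<leftarrow>filter (Not \<circ> fst) (filter (\<lambda>(s, c, b, j). j = i \<and> b \<in> pideal i) ds'). sc c)"
      if "\<And>q. q \<in> set ds' \<Longrightarrow> term_ok n m q" for ds'
      using that
    proof (induction ds')
      case (Cons q ds')
      obtain s c b j where q: "q = (s, c, b, j)" by (metis prod.exhaust)
      have c: "c \<in> carrier k" using Cons.prems[of q] q by auto
      have IH: "form ds' (False, i + 1, a) = (\<Sum>(c, b)\<leftarrow>map (\<lambda>(s, c, b, j). (c, b / unif powi i))
        (filter fst (filter (\<lambda>(s, c, b, j). j = i \<and> b \<in> pideal i) ds')). sc (c \<otimes> chi (a / unif powi i - b)))
        + (\<Sum>(s, c, b, j)\<leftarrow>filter (Not \<circ> fst) (filter (\<lambda>(s, c, b, j). j = i \<and> b \<in> pideal i) ds'). sc c)"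
        by (rule Cons.IH) (rule Cons.prems, simp)
      have st: "form (q # ds') x = sc (coeff1 q x) + form ds' x" for x by (simp add: form_def)
      show ?case
        by (rule ext, unfold st IH plus_fun_apply)
          (use c mem[of b] in \<open>cases s; auto simp: q diff_divide_distrib add_ac\<close>)
    qed (simp add: form_def)
    from this[of ds, OF ok] show ?thesis by (simp add: L_def S_def cst_def)
  qed
  have "(\<Sum>(c, b)\<leftarrow>L. sc c) = (0 :: 'x \<Rightarrow> 'x)"
  proof (rule weight_zero_of_constant_convolution)
    show "c \<in> carrier k \<and> b \<in> pideal 0" if cb: "(c, b) \<in> set L" for c b
    proof -
      obtain s b' j where q: "(s, c, b', j) \<in> set S" "b = b' / unif powi i"
        using cb by (auto simp: L_def)
      then have "b' \<in> pideal i" by (auto simp: S_def)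
      then show ?thesis using okS[OF q(1)] q(2) pideal_scale[of "unif powi i :: 'l" b 0] by simp
    qed
    show "(\<Sum>(c, b)\<leftarrow>L. sc (c \<otimes> chi (a - b))) = form ds (False, i + 1, 0) - cst" if a: "a \<in> pideal 0" for a
    proof -
      have "unif powi i * a \<in> pideal i" using a pideal_scale[of "unif powi i :: 'l" a 0] by simp
      from F[OF this] inv[OF this] show ?thesis by simp
    qed
  qed
  then show ?thesis using T by simp
qed

lemma vals_eq_form:
  assumes ok: "\<And>q. q \<in> set ds \<Longrightarrow> term_ok n m q"
  shows "vals ds = (\<Sum>i\<in>{- n..m + 1}. \<Sum>a\<in>reps (- n) i. form ds (True, i, a) (u a (t i (w (t 1 y)))))
    + (\<Sum>i\<in>{- n..m + 1}. \<Sum>a\<in>reps (- n) i. form ds (False, i, a) (u a (t i y)))"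
  using ok
proof (induction ds)
  case (Cons q ds)
  have st: "form (q # ds) x z = sc (coeff1 q x) z + form ds x z" for x z by (simp add: form_def)
  have IH: "vals ds = (\<Sum>i\<in>{- n..m + 1}. \<Sum>a\<in>reps (- n) i. form ds (True, i, a) (u a (t i (w (t 1 y)))))
    + (\<Sum>i\<in>{- n..m + 1}. \<Sum>a\<in>reps (- n) i. form ds (False, i, a) (u a (t i y)))"
    using Cons by simp
  have q: "term_ok n m q" using Cons.prems by simp
  have "vals (q # ds) = term_val q + vals ds" by (simp add: vals_def)
  then show ?case unfolding st IH term_val_expand[OF q] by (simp add: sum.distrib algebra_simps)
qed (simp add: vals_def form_def)

text \<open>Relations between the vectors \<open>u(a) t\<^sup>j w v\<close> and \<open>u(a) t\<^sup>j v\<close> already hold formally: otherwise there is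
  one whose form is invariant under a large unipotent subgroup, and this gives a relation between the
  \<open>h\<^sup>n y\<close>.\<close>

lemma form_eq_zero:
  assumes ds: "\<And>q. q \<in> set ds \<Longrightarrow> term_ok n m q" "vals ds = 0"
  shows "form ds = 0"
proof (rule ccontr)
  assume nz: "form ds \<noteq> 0"
  define Q where "Q = {form ds | ds. (\<forall>q\<in>set ds. term_ok n m q) \<and> vals ds = 0}"
  \<comment> \<open>At every level that can occur, forms are periodic modulo
    \<open>pideal B\<close>, so invariance under the finitely many translations by
    \<open>reps (- n) B\<close> amounts to invariance under \<open>pideal (- n)\<close>.\<close>
  define B where "B = max (m + 1) (- n)"
  have B: "- n \<le> B" "m + 1 \<le> B" by (auto simp: B_def)
  have rB: "reps (- n) B \<subseteq> (pideal (- n) :: 'l set)" by (rule reps_subset[OF B(1)])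
  have "\<exists>f\<in>Q. f \<notin> {0} \<and> (\<forall>g\<in>shift ` reps (- n) B. g f - f \<in> {0})"
  proof (rule unipotent_fixed_vector[OF prime_p])
    show "of_nat p = (0 :: bool \<times> int \<times> 'l \<Rightarrow> 'x \<Rightarrow> 'x)" using char_x by (intro of_nat_fun_eq_zero)
    show "finite (shift ` reps (- n) B)" using finite_reps[OF B(1), where ?'a = 'l] by simp
    show "Modules.additive f" if "f \<in> shift ` reps (- n) B" for f
      using that by (auto simp: Modules.additive_def shift_def)
    show "f (g z) = g (f z)" if "f \<in> shift ` reps (- n) B" "g \<in> shift ` reps (- n) B" for f g z
      using that by (auto simp: shift_def fun_eq_iff diff_diff_eq add.commute)
    show "(f ^^ p) z = z" if fz: "f \<in> shift ` reps (- n) B" for f z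
    proof -
      obtain e where e: "f = shift e" using fz by blast
      have "(shift e ^^ i) z = shift (of_nat i * e) z" for i
        by (induction i) (auto simp: shift_def fun_eq_iff algebra_simps)
      then show ?thesis using char_l e of_nat_CHAR[where ?'a = 'l] by (simp add: shift_def)
    qed
    show "f z - z \<in> Q" if f: "f \<in> shift ` reps (- n) B" and z: "z \<in> Q" for f z
    proof -
      obtain e where e: "f = shift e" "e \<in> pideal (- n)" using f rB by blast
      obtain xs where xs: "z = form xs" "\<And>q. q \<in> set xs \<Longrightarrow> term_ok n m q" "vals xs = 0"
        using z by (auto simp: Q_def)
      let ?ys = "map (shift_term e) xs @ map neg_term xs"
      have "f z - z = form ?ys"
        using form_neg[where ds = xs and n = n and m = m, OF xs(2)] form_shift[of e xs]
        by (simp add: fun_eq_iff form_append e xs(1))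
      moreover have "vals ?ys = 0"
        using vals_shift[of xs n m e] vals_neg[of xs n m] xs by (simp add: vals_append)
      moreover have "\<forall>q\<in>set ?ys. term_ok n m q"
        using xs(2) term_ok_shift[OF _ e(2)] term_ok_neg by auto
      ultimately show ?thesis unfolding Q_def by blast
    qed
    show "form ds \<in> Q" using ds unfolding Q_def by blast
  qed (use nz in \<open>auto simp: shift_def fun_eq_iff\<close>)
  then obtain xs where xs: "\<And>q. q \<in> set xs \<Longrightarrow> term_ok n m q" "vals xs = 0" "form xs \<noteq> 0"
    and inv: "\<And>e. e \<in> reps (- n) B \<Longrightarrow> shift e (form xs) = form xs"
    by (auto simp: Q_def)
  have const: "form xs (s, i, a) = form xs (s, i, 0)" if a: "a \<in> pideal (- n)" and i: "i \<le> m + 1" for s i a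
  proof -
    obtain e where e: "e \<in> reps (- n) B" "a - e \<in> pideal B" using transversalD(3)[OF reps[OF B(1)] a] by blast
    have "form xs (s, i, a) = form xs (s, i, a - e)"
      using inv[OF e(1)] by (simp add: shift_def fun_eq_iff)
    also have "\<dots> = form xs (s, i, 0)"
      by (rule form_periodic) (use e(2) i B(2) pideal_monoD[of "a - e" B i] in simp)
    finally show ?thesis .
  qed
  \<comment> \<open>Invariance makes the coefficients at level \<open>i + 1\<close> constant on
    \<open>pideal i\<close>, unless that level exceeds \<open>m + 1\<close>, where they vanish
    anyway; so \<open>form_True_zero\<close> applies.\<close>
  have zeroT: "form xs (True, i, a) = 0" for i a
  proof (rule ccontr)
    assume "form xs (True, i, a) \<noteq> 0"
    from form_support[OF xs(1) this] have s: "- n \<le> i" "i \<le> m + 1" "a \<in> pideal (- n)" by auto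
    have "form xs (False, i + 1, a') = form xs (False, i + 1, 0)" if "a' \<in> pideal i" for a'
    proof (cases "i + 1 \<le> m + 1")
      case True
      then show ?thesis using const pideal_monoD[OF that s(1)] by blast
    next
      case False
      have "form xs (False, i + 1, b) = 0" for b
      proof (rule ccontr)
        assume "form xs (False, i + 1, b) \<noteq> 0"
        from form_support(2)[OF xs(1) this] False show False by simp
      qed
      then show ?thesis by simp
    qed
    then have "form xs (True, i, 0) = 0" using form_True_zero[of xs n m i] xs(1) by blast
    then show False using const[OF s(3,2)] \<open>form xs (True, i, a) \<noteq> 0\<close> by simp
  qed
  obtain c where c: "\<And>i. c i \<in> carrier k \<and> form xs (False, i, 0) = sc (c i)"
  proof -
    have "\<exists>c. c \<in> carrier k \<and> form xs (False, i, 0) = sc c" for i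
      using form_scalar[of xs n m "(False, i, 0)"] xs(1) by blast
    then have "\<exists>c. \<forall>i. c i \<in> carrier k \<and> form xs (False, i, 0) = sc (c i)" by (intro choice) blast
    then show ?thesis using that by blast
  qed
  \<comment> \<open>What remains is a combination of norms of the \<open>t i y\<close>, as the
    coefficients are constant at each level. Up to \<open>t (- n)\<close> these norms are the
    iterates of \<open>h\<close> on \<open>y\<close> with exponents \<open>i + n\<close>.\<close>
  have "0 = (\<Sum>i\<in>{- n..m + 1}. \<Sum>a\<in>reps (- n) i. form xs (False, i, a) (u a (t i y)))"
    using vals_eq_form[OF xs(1)] xs(2) zeroT by simp
  also have "\<dots> = (\<Sum>i\<in>{- n..m + 1}. sc (c i) (nrm (- n) i (t i y)))"
  proof (rule sum.cong)
    fix i assume i: "i \<in> {- n..m + 1}"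
    have "form xs (False, i, a) = sc (c i)" if "a \<in> reps (- n) i" for a
      using const[of a i False] c reps_subset[of "- n" i, where ?'a = 'l] i that by auto
    then show "(\<Sum>a\<in>reps (- n) i. form xs (False, i, a) (u a (t i y))) = sc (c i) (nrm (- n) i (t i y))"
      by (simp add: nrm_def sc_sum)
  qed simp
  also have "\<dots> = (\<Sum>i\<in>{- n..m + 1}. sc (c i) (t (- n) ((h ^^ nat (i + n)) y)))"
  proof (rule sum.cong)
    fix i assume i: "i \<in> {- n..m + 1}"
    define r where "r = i + n"
    have r: "0 \<le> r" "i = r - n" using i by (auto simp: r_def)
    have "(h ^^ nat r) y = nrm 0 r (t r y)" using hn_eq_nrm[OF y_props(3), of "nat r"] r by simp
    then have "t (- n) ((h ^^ nat r) y) = nrm (- n) (r - n) (t (- n) (t r y))"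
      using D_nrm[of "unif powi (- n)" 1 0 r "t r y"] t_fixed[OF y_props(3), of r] r by simp
    also have "t (- n) (t r y) = t (- n + r) y" by (rule t_t)
    also have "- n + r = i" using r by simp
    finally have e: "t (- n) ((h ^^ nat r) y) = nrm (- n) (r - n) (t i y)" .
    have "r - n = i" by (simp add: r_def)
    then have "t (- n) ((h ^^ nat (i + n)) y) = nrm (- n) i (t i y)" using e unfolding r_def by (simp only:)
    then show "sc (c i) (nrm (- n) i (t i y)) = sc (c i) (t (- n) ((h ^^ nat (i + n)) y))" by (simp only:)
  qed simp
  finally have "t n 0 = t n (\<Sum>i\<in>{- n..m + 1}. sc (c i) (t (- n) ((h ^^ nat (i + n)) y)))" by simp
  also have "\<dots> = (\<Sum>i\<in>{- n..m + 1}. sc (c i) ((h ^^ nat (i + n)) y))"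
  proof -
    have "t n (sc (c i) (t (- n) z)) = sc (c i) z" for i z
      using t_t[of n "- n" z] c by (simp add: D_sc)
    then show ?thesis by (simp only: D_sum)
  qed
  finally have rel: "(\<Sum>i\<in>{- n..m + 1}. sc (c i) ((h ^^ nat (i + n)) y)) = 0" by simp
  have ci: "c i = \<zero>" if i: "i \<in> {- n..m + 1}" for i
  proof -
    define N where "N = nat (m + 1 + n)"
    have "(\<Sum>j\<le>N. sc (c (int j - n)) ((h ^^ j) y)) = (\<Sum>i\<in>{- n..m + 1}. sc (c i) ((h ^^ nat (i + n)) y))"
      by (rule sum.reindex_bij_witness[of _ "\<lambda>i. nat (i + n)" "\<lambda>j. int j - n"]) (use i in \<open>auto simp: N_def\<close>)
    then have "\<forall>j\<le>N. c (int j - n) = \<zero>" using rel c by (intro independent) auto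
    then show ?thesis using i by (auto simp: N_def dest!: spec[of _ "nat (i + n)"])
  qed
  have "form xs (s, i, a) = 0" for s i a
  proof (cases s)
    case True then show ?thesis using zeroT by simp
  next
    case False
    show ?thesis
    proof (rule ccontr)
      assume "form xs (s, i, a) \<noteq> 0"
      then have nz: "form xs (False, i, a) \<noteq> 0" using False by simp
      note sp = form_support[OF xs(1) nz]
      have "form xs (False, i, a) = sc (c i)" using const[OF sp(3,2)] c by simp
      then show False using nz ci[of i] sp by (simp add: sc_zero_fun)
    qed
  qed
  then show False using xs(3) by (auto simp: fun_eq_iff)
qed

definition term_good :: "bool \<times> 'k \<times> 'l \<times> int \<Rightarrow> bool"
  where "term_good = (\<lambda>(s, c, b, j). c \<in> carrier k)"

lemma term_ok_bound:
  "(\<And>q. q \<in> set ds \<Longrightarrow> term_good q) \<Longrightarrow> \<exists>n m. \<forall>q\<in>set ds. term_ok n m q"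
proof (induction ds)
  case (Cons q ds)
  then obtain n m where nm: "\<forall>q\<in>set ds. term_ok n m q" by auto
  obtain s c b j where q: "q = (s, c, b, j)" by (metis prod.exhaust)
  obtain i where i: "b \<in> pideal i" using exists_pideal by blast
  define n' where "n' = max n (max (- i) (- j))"
  define m' where "m' = max m j"
  have mono: "term_ok n' m' r" if "term_ok n m r" for r
    using that pideal_monoD[of _ "- n" "- n'"] by (cases r) (auto simp: n'_def m'_def)
  have "c \<in> carrier k" using Cons.prems[of q] by (simp add: q term_good_def)
  then have "term_ok n' m' q"
    using pideal_monoD[OF i, of "- n'"] by (auto simp: q n'_def m'_def)
  then have "\<forall>q\<in>set (q # ds). term_ok n' m' q" using nm mono by auto
  then show ?case by blast
qed auto

text \<open>The weight is the sum of the coefficients at \<open>w (t 1 y)\<close> in the form, which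
  is zero by \<open>form_eq_zero\<close>. So the weight of a vector does not depend on how it is
  written as a combination.\<close>

lemma weight_zero:
  assumes ds: "\<And>q. q \<in> set ds \<Longrightarrow> term_good q" "vals ds = 0"
  shows "weight ds = 0"
proof -
  obtain n m where ok: "\<And>q. q \<in> set ds \<Longrightarrow> term_ok n m q" using term_ok_bound[OF ds(1)] by blast
  have "weight ds' = (\<Sum>i\<in>{- n..m + 1}. \<Sum>a\<in>reps (- n) i. form ds' (True, i, a))"
    if "\<And>q. q \<in> set ds' \<Longrightarrow> term_ok n m q" for ds'
    using that
  proof (induction ds')
    case (Cons q ds')
    obtain s c b j where q: "q = (s, c, b, j)" by (metis prod.exhaust)
    have ok: "term_ok n m (s, c, b, j)" using Cons.prems[of q] q by simp
    have st: "form (q # ds') x = sc (coeff1 q x) + form ds' x" for x by (simp add: form_def)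
    have wt: "weight (q # ds') = (if s then sc c else 0) + weight ds'" by (simp add: weight_def q)
    have IH: "weight ds' = (\<Sum>i\<in>{- n..m + 1}. \<Sum>a\<in>reps (- n) i. form ds' (True, i, a))"
      using Cons by simp
    have "(\<Sum>i\<in>{- n..m + 1}. \<Sum>a\<in>reps (- n) i. sc (coeff1 q (True, i, a))) = (if s then sc c else 0)"
      unfolding q by (rule sum_coeff1_True[OF ok, where G = "\<lambda>_ _. sc"]) (simp_all add: sc_zero_fun)
    then show ?case unfolding st wt IH sum.distrib by simp
  qed (simp add: weight_def form_def)
  then show ?thesis using form_eq_zero[OF ok ds(2)] ok by simp
qed

text \<open>The kernel of the weight on the span of the Borel translates of \<open>v\<close> and
  \<open>w v\<close>. It is stable under the Borel subgroup; stability under \<open>w\<close> is not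
  claimed and is checked separately for the vector that matters.\<close>

definition Wt :: "'x set"
  where "Wt = {vals ds | ds. (\<forall>q\<in>set ds. term_good q) \<and> weight ds = 0}"

lemma weight_append: "weight (xs @ ys) = weight xs + weight ys"
  by (simp add: weight_def)

lemma Wt_zero: "0 \<in> Wt"
  unfolding Wt_def by (intro CollectI exI[of _ "[]"]) (simp add: vals_def weight_def)

lemma Wt_plus: "\<lbrakk>x \<in> Wt; z \<in> Wt\<rbrakk> \<Longrightarrow> x + z \<in> Wt"
proof -
  assume "x \<in> Wt" "z \<in> Wt"
  then obtain xs ys where "x = vals xs" "\<forall>q\<in>set xs. term_good q" "weight xs = 0"
    "z = vals ys" "\<forall>q\<in>set ys. term_good q" "weight ys = 0" by (auto simp: Wt_def)
  then have "x + z = vals (xs @ ys)" "\<forall>q\<in>set (xs @ ys). term_good q" "weight (xs @ ys) = 0"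
    by (auto simp: vals_append weight_append)
  then show ?thesis unfolding Wt_def by blast
qed

text \<open>The factor \<open>d s\<close> may differ for the two kinds of terms; the weight only
  sees the kind \<open>True\<close>, so it is merely multiplied by \<open>d True\<close>.\<close>

lemma Wt_map:
  assumes g: "\<And>x y. g (x + y) = g x + g y" "g 0 = 0"
    and f: "\<And>s c b j. c \<in> carrier k \<Longrightarrow> \<exists>b' j'. f (s, c, b, j) = (s, c \<otimes> d s, b', j')
        \<and> term_val (f (s, c, b, j)) = g (term_val (s, c, b, j))"
    and d: "\<And>s. d s \<in> carrier k" and x: "x \<in> Wt"
  shows "g x \<in> Wt"
proof -
  obtain xs where xs: "x = vals xs" "\<forall>q\<in>set xs. term_good q" "weight xs = 0" using x by (auto simp: Wt_def)
  have "(\<forall>q\<in>set (map f xs'). term_good q) \<and> vals (map f xs') = g (vals xs') \<and>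
      weight (map f xs') = (\<lambda>z. sc (d True) (weight xs' z))" if "\<forall>q\<in>set xs'. term_good q" for xs'
    using that
  proof (induction xs')
    case (Cons q xs')
    obtain s c b j where q: "q = (s, c, b, j)" by (metis prod.exhaust)
    have c: "c \<in> carrier k" using Cons.prems by (simp add: q term_good_def)
    obtain b' j' where f': "f q = (s, c \<otimes> d s, b', j')" "term_val (f q) = g (term_val q)"
      using f[OF c, of s b j] q by blast
    have IH: "\<forall>q\<in>set (map f xs'). term_good q" "vals (map f xs') = g (vals xs')"
      "weight (map f xs') = (\<lambda>z. sc (d True) (weight xs' z))" using Cons by auto
    have "weight (map f (q # xs')) = (if s then sc (c \<otimes> d s) else 0) + weight (map f xs')"
      by (simp add: weight_def f')
    also have "\<dots> = (\<lambda>z. sc (d True) (weight (q # xs') z))"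
      unfolding IH using c d by (auto simp: fun_eq_iff weight_def q sc_plus sc_mult sc_commute)
    finally have "weight (map f (q # xs')) = (\<lambda>z. sc (d True) (weight (q # xs') z))" .
    moreover have "vals (map f (q # xs')) = g (vals (q # xs'))"
      using IH(2) f'(2) by (simp add: vals_def g del: term_val.simps)
    moreover have "\<forall>q\<in>set (map f (q # xs')). term_good q"
      using IH(1) c d by (simp add: f' term_good_def)
    ultimately show ?case by blast
  qed (simp add: vals_def weight_def g fun_eq_iff)
  from this[OF xs(2)] have "(\<forall>q\<in>set (map f xs). term_good q)" "vals (map f xs) = g x" "weight (map f xs) = 0"
    using xs by (auto simp: fun_eq_iff)
  then show ?thesis unfolding Wt_def by (intro CollectI exI[of _ "map f xs"]) simp
qed

lemma Wt_sc: "\<lbrakk>a \<in> carrier k; x \<in> Wt\<rbrakk> \<Longrightarrow> sc a x \<in> Wt"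
  by (rule Wt_map[where f = "\<lambda>(s, c, b, j). (s, c \<otimes> a, b, j)" and d = "\<lambda>_. a"])
    (auto simp: sc_plus sc_mult sc_commute)

lemma Wt_u: "x \<in> Wt \<Longrightarrow> u e x \<in> Wt"
  by (rule Wt_map[where f = "\<lambda>(s, c, b, j). (s, c \<otimes> \<one>, b + e, j)" and d = "\<lambda>_. \<one>"])
    (auto simp: u_plus u_sc u_u add.commute)

text \<open>Split \<open>D a d\<close> into a power of \<open>t\<close> and an element with entries
  of equal valuation. The latter acts on \<open>v\<close> by a scalar, and on \<open>w v\<close> by
  the scalar belonging to the swapped entries.\<close>

lemma Wt_D:
  assumes "a \<noteq> 0" "d \<noteq> 0" "x \<in> Wt" shows "D a d x \<in> Wt"
proof -
  define i where "i = val a - val d"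
  define a' where "a' = a / unif powi i"
  have a': "a' \<noteq> 0" "val a' = val d" "a = unif powi i * a'" using assms by (auto simp: a'_def i_def val_divide)
  have ex: "\<exists>c\<in>carrier k. D e f v = sc c v" if "e \<noteq> 0" "f \<noteq> 0" "val e = val f" for e f
    using that y_props(4) same_char_v(1) unfolding torus_eigen_def same_char_def by metis
  obtain c1 where c1: "c1 \<in> carrier k" "D a' d v = sc c1 v" using ex[of a' d] a' assms by auto
  obtain c2 where c2: "c2 \<in> carrier k" "D d a' v = sc c2 v" using ex[of d a'] a' assms by auto
  define r where "r = (\<lambda>s. if s then c2 else c1)"
  define F :: "bool \<times> 'k \<times> 'l \<times> int \<Rightarrow> bool \<times> 'k \<times> 'l \<times> int"
    where "F = (\<lambda>(s, c, b, j). (s, c \<otimes> r s, a * b / d, j + i))"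
  show ?thesis
  proof (rule Wt_map[where f = F and d = r and g = "D a d"])
    fix s c and b :: 'l and j assume c: "c \<in> carrier k"
    define z where "z = (if s then w v else v)"
    have zz: "D a' d z = sc (r s) z"
      using c1 c2 w_D[of d a' v] a' assms by (simp add: z_def r_def w_sc)
    have "D a d (t j z) = t (j + i) (D a' d z)"
      using a' assms by (simp add: D_D power_int_add mult_ac)
    then have "D a d (u b (t j z)) = u (a * b / d) (sc (r s) (t (j + i) z))"
      using assms zz c1 c2 by (simp add: D_u D_sc r_def)
    then have "D a d (sc c (u b (t j z))) = sc (c \<otimes> r s) (u (a * b / d) (t (j + i) z))"
      using assms c c1 c2 by (simp add: D_sc u_sc sc_mult r_def)
    then show "\<exists>b' j'. F (s, c, b, j) = (s, c \<otimes> r s, b', j') \<and> term_val (F (s, c, b, j)) = D a d (term_val (s, c, b, j))"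
      by (simp add: z_def F_def)
  qed (use c1 c2 assms in \<open>auto simp: r_def D_plus\<close>)
qed

lemma wv_not_in_Wt: "w v \<notin> Wt"
proof
  assume "w v \<in> Wt"
  then obtain xs where xs: "w v = vals xs" "\<forall>q\<in>set xs. term_good q" "weight xs = 0" by (auto simp: Wt_def)
  have wM: "w v \<in> M" using same_char_v V_subset V(7) by (auto simp: same_char_def)
  let ?ds = "(True, \<ominus> \<one>, 0, 0) # xs"
  have "vals ?ds = 0" using xs(1) sc_one[OF wM] by (simp add: vals_def sc_a_inv)
  then have "weight ?ds = 0" using xs(2) by (intro weight_zero) (auto simp: term_good_def)
  then have "sc (\<ominus> \<one>) y = 0" using xs(3) by (simp add: weight_def fun_eq_iff)
  then show False using y_nz sc_one[OF y_props(2)] by (simp add: sc_a_inv)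
qed

text \<open>By the Bruhat decomposition only \<open>w u(f)\<close> has to be treated: an integral
  \<open>f\<close> fixes \<open>x\<close>, and for any other \<open>f\<close> the identity
  \<open>w_u_bruhat\<close> leads back to the Borel subgroup because \<open>1 / f\<close> lies in
  \<open>pideal 1\<close>.\<close>

lemma Wt_same_char:
  assumes x: "x \<in> Wt" "w x \<in> Wt" "same_char x" and g: "invertible g"
  shows "act g x \<in> Wt"
proof -
  obtain a b c d where gm: "g = mk2 a b c d" using mk2_eta by metis
  have det: "a * d - b * c \<noteq> 0" using g gm by simp
  have xf: "x \<in> fixed 0" "\<And>c. c \<in> pideal 1 \<Longrightarrow> l c x = x" using x by (auto simp: same_char_def)
  show ?thesis
  proof (cases "c = 0")
    case True
    then have ad: "a \<noteq> 0" "d \<noteq> 0" using det by auto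
    then have "act g x = u (b / d) (D a d x)" using True by (simp add: gm gens_def act_mk2)
    then show ?thesis using Wt_u Wt_D ad x by simp
  next
    case False
    define e where "e = - (a * d - b * c) / c"
    have e: "e \<noteq> 0" "a / c * d + e = b"
      using det False by (simp_all add: e_def field_simps)
    have "act g x = u (a / c) (D e c (w (u (d / c) x)))"
      using e False by (simp add: gm gens_def act_mk2 add.commute)
    moreover have "w (u (d / c) x) \<in> Wt"
    proof (cases "d / c \<in> pideal 0")
      case True then show ?thesis using xf(1) x by (simp add: fixedD)
    next
      case False
      define f where "f = d / c"
      have f: "f \<noteq> 0" "val f < 0" using False by (auto simp: f_def pideal_iff)
      then have "1 / f \<in> pideal 1" by (simp add: pideal_iff val_divide)
      then have "w (u f x) = u (1 / f) (D (- 1 / f) f x)" using f xf(2) by (simp add: w_u_bruhat)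
      then show ?thesis using Wt_u Wt_D f x unfolding f_def[symmetric] by simp
    qed
    ultimately show ?thesis using Wt_u Wt_D e False by simp
  qed
qed

theorem contradiction: False
proof -
  have unz: "unif \<noteq> (0::'l)" by simp
  obtain \<omega> where om: "\<omega> \<in> carrier k" "\<And>x. x \<in> V \<Longrightarrow> D unif unif x = sc \<omega> x" using central[OF unz] by blast
  \<comment> \<open>\<open>w (t 1 v)\<close> is \<open>\<omega>\<close> times
    \<open>t (- 1) (w v)\<close>, so in \<open>w (h v)\<close> the coefficients at
    \<open>w v\<close> add up to \<open>\<omega>\<close>. Subtracting \<open>\<omega> v\<close>
    makes the weight of \<open>w x\<close> zero, and \<open>x\<close> itself involves no
    \<open>w v\<close> at all.\<close>
  define x where "x = h v - sc \<omega> v"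
  have vV: "v \<in> V" "w v \<in> V" "v \<in> M" "w v \<in> M"
    using same_char_v V_subset V(7) by (auto simp: same_char_def)
  have sx: "same_char x" unfolding x_def using same_char_v om by (intro same_char_diff same_char_sc)
  have x1: "x \<in> Wt"
  proof -
    obtain R where R: "set R = (reps 0 1 :: 'l set)" "distinct R"
      using finite_distinct_list[OF finite_reps[of 0 1]] by auto
    define ds :: "(bool \<times> 'k \<times> 'l \<times> int) list" where "ds = (False, \<ominus> \<omega>, 0, 0) # map (\<lambda>b. (False, \<one>, b, 1)) R"
    have "(\<Sum>b\<leftarrow>R. sc \<one> (u b (t 1 v))) = h v"
    proof -
      have "u b (t 1 v) \<in> M" for b using vV V_subset V(5)[OF V(8)[of v unif 1]] by auto
      then have "(\<Sum>b\<leftarrow>R. sc \<one> (u b (t 1 v))) = (\<Sum>b\<leftarrow>R. u b (t 1 v))" using sc_one by simp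
      also have "\<dots> = h v" using R by (simp add: sum_list_distinct_conv_sum_set h_def nrm_def)
      finally show ?thesis .
    qed
    then have "vals ds = x" using om vV by (simp add: ds_def vals_def x_def comp_def sc_a_inv)
    moreover have "weight ds = 0"
      by (simp add: ds_def weight_def comp_def)
    moreover have "\<forall>q\<in>set ds. term_good q" using om by (auto simp: ds_def term_good_def)
    ultimately show ?thesis unfolding Wt_def by (intro CollectI exI[of _ ds]) simp
  qed
  have x2: "w x \<in> Wt"
  proof -
    obtain R where R: "set R = (reps 0 1 :: 'l set)" "distinct R"
      using finite_distinct_list[OF finite_reps[of 0 1]] by auto
    define ds :: "(bool \<times> 'k \<times> 'l \<times> int) list" where "ds = (True, \<ominus> \<omega>, 0, 0) # (True, \<omega>, 0, - 1) # map (\<lambda>b. (False, chi b, b, 1)) R"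
    have "w (t 1 v) = t (- 1) (D unif unif (w v))" by (simp add: w_D D_D)
    also have "\<dots> = sc \<omega> (t (- 1) (w v))" using om vV by (simp add: D_sc)
    finally have "w (h v) = sc \<omega> (t (- 1) (w v)) + (\<Sum>b\<in>reps 0 1. sc (chi b) (u b (t 1 v)))"
      using w_h[OF same_char_v(1)] by simp
    moreover have "(\<Sum>b\<leftarrow>R. sc (chi b) (u b (t 1 v))) = (\<Sum>b\<in>reps 0 1. sc (chi b) (u b (t 1 v)))"
      using R by (simp add: sum_list_distinct_conv_sum_set)
    ultimately have "vals ds = w x"
      using om by (simp add: ds_def vals_def x_def comp_def sc_a_inv w_diff w_sc)
    moreover have "weight ds = 0"
    proof -
      have "(\<Sum>b\<leftarrow>R. 0 :: 'x \<Rightarrow> 'x) = 0" by (induction R) auto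
      moreover have "sc (\<ominus> \<omega>) + sc \<omega> = 0" using om by (simp add: fun_eq_iff sc_a_inv)
      ultimately show ?thesis by (simp add: ds_def weight_def comp_def add.assoc[symmetric])
    qed
    moreover have "\<forall>q\<in>set ds. term_good q" using om by (auto simp: ds_def term_good_def)
    ultimately show ?thesis unfolding Wt_def by (intro CollectI exI[of _ ds]) simp
  qed
  have xnz: "x \<noteq> 0"
  proof
    assume x0: "x = 0"
    define a where "a = (\<lambda>i::nat. if i = 2 then \<one> else if i = 1 then \<ominus> \<omega> else \<zero>)"
    have "(\<Sum>i\<le>2. sc (a i) ((h ^^ i) y)) = - sc \<omega> v + sc \<one> (h v)"
      using om by (simp add: numeral_2_eq_2 a_def v_def sc_a_inv)
    also have "\<dots> = x" using sc_one[of "h v"] h_stable[OF G_stable_M vV(3)] by (simp add: x_def)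
    finally have "\<forall>i\<le>2. a i = \<zero>" using x0 om by (intro independent) (auto simp: a_def)
    then have "a 2 = \<zero>" by blast
    then show False by (simp add: a_def)
  qed
  have xV: "x \<in> V" using sx by (simp add: same_char_def)
  \<comment> \<open>Finite combinations of translates of \<open>x\<close>; they form the
    subrepresentation generated by \<open>x\<close>, which irreducibility identifies with
    \<open>V\<close>.\<close>
  define ev where "ev = (\<lambda>L. \<Sum>q\<leftarrow>L. sc (fst q) (act (snd q) x))"
  define ok where "ok = (\<lambda>L. \<forall>q\<in>set L. fst q \<in> carrier k \<and> invertible (snd q :: 'l ^ 2 ^ 2))"
  define S where "S = {ev L | L. ok L}"
  have SI: "ev L \<in> S" if "ok L" for L using that by (auto simp: S_def)
  have "G_stable S"
    unfolding G_stable_def additive_subgroup_set_def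
  proof (intro conjI allI impI ballI)
    have "ev [] \<in> S" by (rule SI) (simp add: ok_def)
    then show "0 \<in> S" by (simp add: ev_def)
  next
    fix a b assume "a \<in> S" "b \<in> S"
    then obtain L L' where L: "ok L" "a = ev L" "ok L'" "b = ev L'" by (auto simp: S_def)
    have "ev (map (\<lambda>q. (\<ominus> fst q, snd q)) L') = - ev L'"
      using L(3) by (induction L') (auto simp: ev_def ok_def sc_a_inv)
    then have "a - b = ev (L @ map (\<lambda>q. (\<ominus> fst q, snd q)) L')" using L by (simp add: ev_def)
    moreover have "ok (L @ map (\<lambda>q. (\<ominus> fst q, snd q)) L')" using L by (auto simp: ok_def)
    ultimately show "a - b \<in> S" using SI by simp
  next
    fix g :: "'l ^ 2 ^ 2" and z assume g: "invertible g" and "z \<in> S"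
    then obtain L where L: "ok L" "z = ev L" by (auto simp: S_def)
    have "ev (map (\<lambda>q. (fst q, g ** snd q)) L) = act g (ev L)"
      using L(1) by (induction L) (auto simp: ev_def ok_def act_plus act_sc act_mult g)
    moreover have "ok (map (\<lambda>q. (fst q, g ** snd q)) L)" using L g by (auto simp: ok_def intro: invertible_mult)
    ultimately show "act g z \<in> S" using SI[of "map (\<lambda>q. (fst q, g ** snd q)) L"] L(2) by simp
  next
    fix e z assume e: "e \<in> carrier k" and "z \<in> S"
    then obtain L where L: "ok L" "z = ev L" by (auto simp: S_def)
    have "ev (map (\<lambda>q. (e \<otimes> fst q, snd q)) L) = sc e (ev L)"
      using L(1) by (induction L) (auto simp: ev_def ok_def sc_plus sc_mult e)
    moreover have "ok (map (\<lambda>q. (e \<otimes> fst q, snd q)) L)" using L e by (auto simp: ok_def)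
    ultimately show "sc e z \<in> S" using SI[of "map (\<lambda>q. (e \<otimes> fst q, snd q)) L"] L(2) by simp
  qed
  moreover have S_sub: "S \<subseteq> V \<inter> Wt"
  proof
    fix z assume "z \<in> S"
    then obtain L where L: "ok L" "z = ev L" by (auto simp: S_def)
    have "ev L \<in> V \<inter> Wt"
      using L(1)
    proof (induction L)
      case (Cons q L)
      have cg: "fst q \<in> carrier k" "invertible (snd q)" "ok L" using Cons.prems by (auto simp: ok_def)
      have "sc (fst q) (act (snd q) x) \<in> V" using V(9,10) cg xV by blast
      moreover have "sc (fst q) (act (snd q) x) \<in> Wt"
        using Wt_sc[OF cg(1)] Wt_same_char[OF x1 x2 sx cg(2)] by blast
      moreover have "ev L \<in> V \<inter> Wt" using Cons.IH cg by blast
      ultimately show ?case using V(2) Wt_plus by (simp add: ev_def)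
    qed (use V(1) Wt_zero in \<open>simp add: ev_def\<close>)
    then show "z \<in> V \<inter> Wt" using L by simp
  qed
  moreover have "x \<in> S"
  proof -
    have "ev [(\<one>, mat 1)] \<in> S" by (rule SI) (simp add: ok_def mat_eq_mk2)
    moreover have "sc \<one> x = x" using xV V_subset by (intro sc_one) auto
    ultimately show ?thesis by (simp add: ev_def act_one)
  qed
  ultimately have "S = V" using irreducible[of S] xnz by blast
  then show False using S_sub vV wv_not_in_Wt by blast
qed

end

section \<open>Open sets of matrices and ordinary vectors\<close>

lemma diag2_in_torus: "\<lbrakk>a \<noteq> 0; d \<noteq> 0\<rbrakk> \<Longrightarrow> diag2 a d \<in> carrier torus"
  unfolding torus_def by (simp, blast)

lemma absval_minus_commute: "absval (x - y) = absval (y - x)"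
  using absval_minus[of "x - y"] by simp

lemma exists_pideal_small:
  assumes "0 < e" shows "\<exists>n. \<forall>x::'a::nonarch_local_field \<in> pideal n. absval x < e"
proof -
  obtain n where n: "absval (unif::'a) ^ n < e"
    using real_arch_pow_inv[OF assms unif(2)] by blast
  have "absval x < e" if "x \<in> pideal (int n)" for x :: 'a
    using that n by (simp add: pideal_def)
  then show ?thesis by blast
qed

text \<open>The metric on matrices is an iterated Euclidean one. It is bounded by the sum of the
  four entrywise distances, hence the radius \<open>e / 4\<close>, and conversely bounds each of
  them.\<close>

lemma openin_matrix_iff:
  fixes S T :: "('l::nonarch_local_field ^ 2 ^ 2) set"
  shows "openin (top_of_set T) S \<longleftrightarrow> S \<subseteq> T \<and>
    (\<forall>x\<in>S. \<exists>n. \<forall>y\<in>T. (\<forall>i j. y $ i $ j - x $ i $ j \<in> pideal n) \<longrightarrow> y \<in> S)"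
proof -
  have 1: "\<exists>n. \<forall>y\<in>T. (\<forall>i j. y $ i $ j - x $ i $ j \<in> pideal n) \<longrightarrow> y \<in> S"
    if e: "0 < e" "ball x e \<inter> T \<subseteq> S" for x e
  proof -
    obtain n where n: "\<And>z::'l. z \<in> pideal n \<Longrightarrow> absval z < e / 4"
      using exists_pideal_small[of "e / 4"] e(1) by auto
    have "y \<in> S" if y: "y \<in> T" "\<forall>i j. y $ i $ j - x $ i $ j \<in> pideal n" for y
    proof -
      have d: "dist (x $ i $ j) (y $ i $ j) < e / 4" for i j
      proof -
        have "dist (x $ i $ j) (y $ i $ j) = absval (y $ i $ j - x $ i $ j)"
          by (metis dist_absval dist_commute)
        then show ?thesis using n[of "y $ i $ j - x $ i $ j"] y(2) by simp
      qed
      have "dist x y \<le> (\<Sum>i\<in>UNIV. dist (x $ i) (y $ i))"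
        unfolding dist_vec_def by (rule L2_set_le_sum) simp
      also have "\<dots> \<le> (\<Sum>i\<in>UNIV. \<Sum>j\<in>UNIV. dist (x $ i $ j) (y $ i $ j))"
        by (rule sum_mono) (simp add: dist_vec_def L2_set_le_sum)
      also have "\<dots> < e"
        using d[of 1 1] d[of 1 2] d[of 2 1] d[of 2 2] by (simp add: sum_2)
      finally show ?thesis using e(2) y(1) by auto
    qed
    then show ?thesis by blast
  qed
  have 2: "\<exists>e>0. ball x e \<inter> T \<subseteq> S"
    if n: "\<forall>y\<in>T. (\<forall>i j. y $ i $ j - x $ i $ j \<in> pideal n) \<longrightarrow> y \<in> S" for x n
  proof (intro exI conjI)
    show "0 < absval (unif::'l) powi n" by simp
    show "ball x (absval (unif::'l) powi n) \<inter> T \<subseteq> S"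
    proof
      fix y assume y: "y \<in> ball x (absval (unif::'l) powi n) \<inter> T"
      have "y $ i $ j - x $ i $ j \<in> pideal n" for i j
      proof -
        have "dist (x $ i $ j) (y $ i $ j) \<le> dist x y"
          using dist_vec_nth_le[of "x $ i" j "y $ i"] dist_vec_nth_le[of x i y] by linarith
        also have "\<dots> < absval (unif::'l) powi n" using y by simp
        finally show ?thesis
          by (simp add: dist_absval pideal_def absval_minus_commute[of "x $ i $ j"])
      qed
      then show "y \<in> S" using n y by blast
    qed
  qed
  show ?thesis unfolding openin_contains_ball using 1 2 by blast
qed

context smooth_module
begin

text \<open>Relations satisfied by \<open>bump 0\<close>, the function in
  \<open>Ind_borel k \<theta>\<close> supported on the Borel subgroup times \<open>w u(O)\<close>.
  The \<open>w\<close> in the support is responsible for the swapped entries in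
  \<open>diag2 d a\<close>.\<close>

definition ordinary_vector :: "('l ^ 2 ^ 2 \<Rightarrow> 'k) \<Rightarrow> 'x \<Rightarrow> bool"
  where "ordinary_vector \<theta> e \<longleftrightarrow> e \<in> M \<and> e \<in> fixed 0 \<and>
    (\<forall>a d. a \<noteq> 0 \<longrightarrow> d \<noteq> 0 \<longrightarrow> val a = val d \<longrightarrow> D a d e = sc (\<theta> (diag2 d a)) e) \<and>
    h e = sc (\<theta> (diag2 1 unif)) e"

lemma group_mult_k: "group (mult_of k)"
proof -
  have e: "mult_of k = Multiplicative_Group.mult_of k"
    by (simp add: Ring_Divisibility.mult_of_def Multiplicative_Group.mult_of_def)
  show ?thesis unfolding e by (rule field_mult_group)
qed

text \<open>\<open>\<theta>\<close> is put together from the eigencharacter on torus elements with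
  entries of equal valuation and from \<open>lam\<close>, which prescribes the value in the missing
  direction \<open>diag2 1 unif\<close>.\<close>

lemma exists_ordinary_character:
  assumes e: "e \<in> M" "e \<noteq> 0" "e \<in> fixed 0" "torus_eigen e"
    and lam: "h e = sc lam e" "lam \<in> carrier k" "lam \<noteq> \<zero>"
  shows "\<exists>\<theta>\<in>smooth_characters torus k. ordinary_vector \<theta> e"
proof -
  interpret Mk: group "mult_of k" by (rule group_mult_k)
  define ch where "ch = (\<lambda>a d. SOME c. c \<in> carrier k \<and> D a d e = sc c e)"
  have ch: "ch a d \<in> carrier k" "D a d e = sc (ch a d) e" if "a \<noteq> 0" "d \<noteq> 0" "val a = val d" for a d
  proof -
    have "\<exists>c. c \<in> carrier k \<and> D a d e = sc c e" using e(4) that unfolding torus_eigen_def by blast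
    from someI_ex[OF this] show "ch a d \<in> carrier k" "D a d e = sc (ch a d) e" by (simp_all add: ch_def)
  qed
  have ch_eq: "ch a d = c" if "a \<noteq> 0" "d \<noteq> 0" "val a = val d" "c \<in> carrier k" "D a d e = sc c e" for a d c
    using ch[OF that(1-3)] that sc_cancel[OF _ _ e(1,2)] by metis
  have ch_one: "ch 1 1 = \<one>" using e(1) by (intro ch_eq) (auto simp: sc_one)
  have ch_mult: "ch (a * a') (d * d') = ch a d \<otimes> ch a' d'"
    if "a \<noteq> 0" "d \<noteq> 0" "val a = val d" "a' \<noteq> 0" "d' \<noteq> 0" "val a' = val d'" for a d a' d'
  proof (rule ch_eq)
    have "D (a * a') (d * d') e = D a d (D a' d' e)" using that by (simp add: D_D)
    also have "\<dots> = sc (ch a d \<otimes> ch a' d') e"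
      using ch[OF that(1-3)] ch[OF that(4-6)] that by (simp add: D_sc sc_mult sc_commute)
    finally show "D (a * a') (d * d') e = sc (ch a d \<otimes> ch a' d') e" .
  qed (use that ch in \<open>auto simp: val_mult\<close>)
  have ch_nz: "ch a d \<noteq> \<zero>" if ad: "a \<noteq> 0" "d \<noteq> 0" "val a = val d" for a d
  proof
    assume "ch a d = \<zero>"
    have "\<one> = ch (a * (1 / a)) (d * (1 / d))" using ad ch_one by simp
    also have "\<dots> = \<zero> \<otimes> ch (1 / a) (1 / d)"
      unfolding \<open>ch a d = \<zero>\<close>[symmetric] by (rule ch_mult) (use ad in \<open>auto simp: val_divide\<close>)
    finally show False using ch(1)[of "1 / a" "1 / d"] ad by (simp add: val_divide)
  qed
  have lam_pow: "lam [^]\<^bsub>mult_of k\<^esub> (i::int) \<in> carrier (mult_of k)" for i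
    using lam by (intro Mk.int_pow_closed) auto
  \<comment> \<open>A power of the uniformizer is split off the second entry, so that
    \<open>ch\<close> is only applied to entries of equal valuation.\<close>
  define \<theta> where "\<theta> = (\<lambda>A :: 'l ^ 2 ^ 2. let d = A $ 1 $ 1; a = A $ 2 $ 2; i = val a - val d in
    lam [^]\<^bsub>mult_of k\<^esub> i \<otimes> ch (a / unif powi i) d)"
  have \<theta>: "\<theta> (diag2 d a) = lam [^]\<^bsub>mult_of k\<^esub> (val a - val d) \<otimes> ch (a / unif powi (val a - val d)) d" for a d
    by (simp add: \<theta>_def Let_def diag2_eq_mk2)
  have hom: "\<theta> \<in> hom torus (mult_of k)"
  proof (rule homI)
    fix A :: "'l ^ 2 ^ 2" assume "A \<in> carrier torus"
    then obtain d a where A: "A = diag2 d a" "d \<noteq> 0" "a \<noteq> 0" by (auto simp: torus_def)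
    have "ch (a / unif powi (val a - val d)) d \<in> carrier k" "ch (a / unif powi (val a - val d)) d \<noteq> \<zero>"
      using ch(1) ch_nz A by (auto simp: val_divide)
    then show "\<theta> A \<in> carrier (mult_of k)"
      using lam_pow[of "val a - val d"] integral by (auto simp: A(1) \<theta>)
  next
    fix A B :: "'l ^ 2 ^ 2" assume "A \<in> carrier torus" "B \<in> carrier torus"
    then obtain d a d' a' where A: "A = diag2 d a" "d \<noteq> 0" "a \<noteq> 0" "B = diag2 d' a'" "d' \<noteq> 0" "a' \<noteq> 0"
      by (auto simp: torus_def)
    define i j where "i = val a - val d" and "j = val a' - val d'"
    have AB: "A \<otimes>\<^bsub>torus\<^esub> B = diag2 (d * d') (a * a')"
      by (simp add: A torus_def GL2_def diag2_eq_mk2 mk2_mult)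
    have ij: "val (a * a') - val (d * d') = i + j" using A by (simp add: val_mult i_def j_def)
    have lp: "lam [^]\<^bsub>mult_of k\<^esub> (i + j) = lam [^]\<^bsub>mult_of k\<^esub> i \<otimes> lam [^]\<^bsub>mult_of k\<^esub> j"
      using Mk.int_pow_mult[of lam i j] lam by simp
    have cm: "ch (a * a' / unif powi (i + j)) (d * d') = ch (a / unif powi i) d \<otimes> ch (a' / unif powi j) d'"
      using ch_mult[of "a / unif powi i" d "a' / unif powi j" d'] A by (simp add: val_divide i_def j_def power_int_add)
    have cl: "ch (a / unif powi i) d \<in> carrier k" "ch (a' / unif powi j) d' \<in> carrier k"
      using A by (auto intro!: ch(1) simp: val_divide i_def j_def)
    have "\<theta> (A \<otimes>\<^bsub>torus\<^esub> B) = lam [^]\<^bsub>mult_of k\<^esub> (i + j) \<otimes> ch (a * a' / unif powi (i + j)) (d * d')"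
      by (simp only: AB \<theta> ij)
    moreover have "\<theta> A = lam [^]\<^bsub>mult_of k\<^esub> i \<otimes> ch (a / unif powi i) d"
      "\<theta> B = lam [^]\<^bsub>mult_of k\<^esub> j \<otimes> ch (a' / unif powi j) d'"
      by (simp_all only: A(1,4) \<theta> i_def j_def)
    ultimately show "\<theta> (A \<otimes>\<^bsub>torus\<^esub> B) = \<theta> A \<otimes>\<^bsub>mult_of k\<^esub> \<theta> B"
      using lam_pow[of i] lam_pow[of j] cl by (simp add: lp cm m_ac)
  qed
  obtain n where n: "n \<ge> 1" "\<And>a d. \<lbrakk>a - 1 \<in> pideal n; d - 1 \<in> pideal n\<rbrakk> \<Longrightarrow> D a d e = e"
    using smoothE[of e] by metis
  have ker: "\<theta> (diag2 d a) = \<one>" if "a - 1 \<in> pideal n" "d - 1 \<in> pideal n" for a d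
  proof -
    have "a \<in> ounits" "d \<in> ounits"
      using one_plus_ounits[OF that(1) n(1)] one_plus_ounits[OF that(2) n(1)] by simp_all
    then have u: "a \<noteq> 0" "d \<noteq> 0" "val a = 0" "val d = 0" by (auto simp: ounits_def)
    have "ch a d = \<one>" using u n(2)[OF that] e(1) by (intro ch_eq) (auto simp: sc_one)
    then show ?thesis using u by (simp add: \<theta>)
  qed
  have "openin (top_of_set (carrier torus)) (kernel torus (mult_of k) \<theta>)"
    unfolding openin_matrix_iff
  proof (intro conjI ballI)
    show "kernel torus (mult_of k) \<theta> \<subseteq> carrier torus" by (auto simp: kernel_def)
    fix A assume A: "A \<in> kernel torus (mult_of k) \<theta>"
    then obtain a d where Ad: "A = diag2 a d" "a \<noteq> 0" "d \<noteq> 0" "\<theta> A = \<one>" by (auto simp: kernel_def torus_def)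
    define m where "m = max (n + val a) (n + val d)"
    have "B \<in> kernel torus (mult_of k) \<theta>"
      if B: "B \<in> carrier torus" "\<forall>i j. B $ i $ j - A $ i $ j \<in> pideal m" for B
    proof -
      obtain a' d' where Bd: "B = diag2 a' d'" "a' \<noteq> 0" "d' \<noteq> 0" using B by (auto simp: torus_def)
      have near: "x' / x - 1 \<in> pideal n" if "x \<noteq> 0" "x' - x \<in> pideal m" "val x + n \<le> m" for x x' :: 'l
      proof -
        have "x * (x' / x - 1) = x' - x" using that by (simp add: right_diff_distrib)
        then show ?thesis using pideal_scale[of x "x' / x - 1" n] that pideal_monoD[OF that(2,3)] by simp
      qed
      have "a' - a \<in> pideal m" "d' - d \<in> pideal m"
        using B(2)[rule_format, of 1 1] B(2)[rule_format, of 2 2] by (simp_all add: Ad Bd diag2_eq_mk2)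
      then have "a' / a - 1 \<in> pideal n" "d' / d - 1 \<in> pideal n"
        using near Ad by (auto simp: m_def add.commute)
      then have "\<theta> (diag2 (a' / a) (d' / d)) = \<one>" using ker by blast
      moreover have "B = A \<otimes>\<^bsub>torus\<^esub> diag2 (a' / a) (d' / d)"
        using Ad Bd by (simp add: torus_def GL2_def diag2_eq_mk2 mk2_mult)
      moreover have "diag2 (a' / a) (d' / d) \<in> carrier torus" "A \<in> carrier torus"
        using Ad Bd by (simp_all add: diag2_in_torus)
      ultimately have "\<theta> B = \<one>" using Ad(4) hom_mult[OF hom] by simp
      then show ?thesis using B(1) by (simp add: kernel_def)
    qed
    then show "\<exists>n. \<forall>y\<in>carrier torus. (\<forall>i j. y $ i $ j - A $ i $ j \<in> pideal n) \<longrightarrow> y \<in> kernel torus (mult_of k) \<theta>"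
      by blast
  qed
  then have "\<theta> \<in> smooth_characters torus k" using hom by (simp add: smooth_characters_def)
  moreover have "ordinary_vector \<theta> e"
    unfolding ordinary_vector_def
  proof (intro conjI allI impI)
    show "D a d e = sc (\<theta> (diag2 d a)) e" if "a \<noteq> 0" "d \<noteq> 0" "val a = val d" for a d
      using ch[OF that] that by (simp add: \<theta>)
    have "lam [^]\<^bsub>mult_of k\<^esub> (1::int) = lam" using lam Mk.int_pow_1 by simp
    then show "h e = sc (\<theta> (diag2 1 unif)) e" using lam ch_one by (simp add: \<theta>)
  qed (use e in auto)
  ultimately show ?thesis by blast
qed

end

section \<open>Local nilpotency, and norms over a complement of the integers\<close>

locale supersingular_submodule = irreducible_submodule k sc p act M V
  for k :: "'k ring" (structure) and sc :: "'k \<Rightarrow> 'x::comm_ring_1 \<Rightarrow> 'x"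
    and p and act :: "'l::nonarch_local_field ^ 2 ^ 2 \<Rightarrow> 'x \<Rightarrow> 'x" and M V +
  assumes no_ordinary: "\<And>\<theta> e. \<lbrakk>\<theta> \<in> smooth_characters torus k; e \<in> V; ordinary_vector \<theta> e\<rbrakk> \<Longrightarrow> e = 0"
begin

text \<open>A non-nilpotent Iwahori vector cannot have independent iterates, by
  \<open>contradiction\<close>. A relation between them would give an eigenvector of
  \<open>h\<close> with nonzero eigenvalue, that is, a nonzero ordinary vector in \<open>V\<close>,
  which \<open>no_ordinary\<close> excludes.\<close>

theorem h_locally_nilpotent:
  assumes "x \<in> V" "x \<in> fixed 0" shows "nil x"
proof (rule ccontr)
  assume "\<not> nil x"
  then obtain y where y: "iwahori_vector y" "\<not> nil y" using exists_iwahori_vector assms by blast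
  have yy: "y \<in> V" "y \<in> fixed 0" "torus_eigen y" "y \<in> M"
    using y V_subset by (auto simp: iwahori_vector_def)
  show False
  proof (cases "\<forall>n a. (\<forall>i. a i \<in> carrier k) \<longrightarrow> (\<Sum>i\<le>n. sc (a i) ((h ^^ i) y)) = 0 \<longrightarrow> (\<forall>i\<le>n. a i = \<zero>)")
    case True
    interpret free_iwahori_vector k sc p act M V y
      by unfold_locales (use True y in blast)+
    show False by (rule contradiction)
  next
    case False
    then obtain n a i where a: "\<And>i. a i \<in> carrier k" "(\<Sum>i\<le>n. sc (a i) ((h ^^ i) y)) = 0" "i \<le> n" "a i \<noteq> \<zero>"
      by blast
    \<comment> \<open>The relation is cut off at its last nonzero coefficient, as
      \<open>exists_eigenvector_mod\<close> asks for a nonzero leading one.\<close>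
    define N where "N = Max {i. i \<le> n \<and> a i \<noteq> \<zero>}"
    have fin: "finite {i. i \<le> n \<and> a i \<noteq> \<zero>}" by simp
    have N: "N \<le> n" "a N \<noteq> \<zero>" using Max_in[OF fin] a unfolding N_def by blast+
    have big: "a i = \<zero>" if "i \<le> n" "N < i" for i
      using Max_ge[OF fin, of i] that unfolding N_def[symmetric] by auto
    have rel: "(\<Sum>i\<le>N. sc (a i) ((h ^^ i) y)) = 0"
    proof -
      have "(\<Sum>i\<le>n. sc (a i) ((h ^^ i) y)) = (\<Sum>i\<le>N. sc (a i) ((h ^^ i) y))"
        by (rule sum.mono_neutral_right) (use N big in auto)
      then show ?thesis using a by simp
    qed
    obtain ch where ch: "\<And>a d. \<lbrakk>a \<noteq> 0; d \<noteq> 0; val a = val d\<rbrakk> \<Longrightarrow> ch a d \<in> carrier k \<and> D a d y = sc (ch a d) y"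
      using yy(3) unfolding torus_eigen_def by metis
    \<comment> \<open>The eigenspace of the torus character of \<open>y\<close>: an eigenvector of
      \<open>h\<close> found inside it is still a torus eigenvector.\<close>
    define M1 where "M1 = {z \<in> V \<inter> fixed 0. \<forall>a d. a \<noteq> 0 \<longrightarrow> d \<noteq> 0 \<longrightarrow> val a = val d \<longrightarrow> D a d z = sc (ch a d) z}"
    have "\<exists>l w. l \<in> carrier k \<and> l \<noteq> \<zero> \<and> w \<in> M1 \<and> w \<notin> {0} \<and> h w - sc l w \<in> {0}"
    proof (rule exists_eigenvector_mod[where a = a and n = N and v = y])
      show "sc \<one> ((h ^^ i) y) = (h ^^ i) y" for i
        using hn_stable[OF G_stable_M yy(4)] by (rule sc_one)
      show "(h ^^ i) y \<notin> {0}" for i using y(2) by (auto simp: nil_def)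
      show "(h ^^ i) y \<in> M1" for i
        using hn_stable[OF V_stable yy(1)] hn_fixed[OF yy(2)] D_hn[OF yy(2)] ch by (auto simp: M1_def hn_sc)
      show "x + z \<in> M1" if "x \<in> M1" "z \<in> M1" for x z
        using that V(2) by (auto simp: M1_def fixed_add D_plus sc_plus)
      show "sc c x \<in> M1" if "c \<in> carrier k" "x \<in> M1" for c x
        using that V(9) ch by (auto simp: M1_def fixed_sc D_sc sc_commute)
    qed (use a N rel in \<open>auto simp: h_sc additive_h M1_def V(1)\<close>)
    then obtain lam e where e: "lam \<in> carrier k" "lam \<noteq> \<zero>" "e \<in> M1" "e \<noteq> 0" "h e = sc lam e" by auto
    then have "e \<in> V" "e \<in> fixed 0" "torus_eigen e" using ch by (auto simp: M1_def torus_eigen_def)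
    then show False
      using exists_ordinary_character[of e lam] e no_ordinary V_subset by blast
  qed
qed

definition A :: "'l set"
  where "A = (SOME A. additive_subgroup_set A \<and> pideal 0 \<inter> A = {0} \<and> (\<forall>x. \<exists>h\<in>pideal 0. \<exists>c\<in>A. x = h + c))"

lemma A: "additive_subgroup_set A" "pideal 0 \<inter> A = {0}" "\<exists>h\<in>pideal 0. \<exists>c\<in>A. x = h + c"
proof -
  have "of_nat p = (0::'l)" using char_l of_nat_CHAR[where ?'a = 'l] by simp
  from someI_ex[OF exists_additive_complement[OF prime_p this subgroup_pideal[of 0]]]
  show "additive_subgroup_set A" "pideal 0 \<inter> A = {0}" "\<exists>h\<in>pideal 0. \<exists>c\<in>A. x = h + c"
    unfolding A_def by blast+
qed

definition Aj :: "int \<Rightarrow> 'l set" where "Aj j = A \<inter> pideal (- j)"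

definition NA :: "int \<Rightarrow> 'x \<Rightarrow> 'x" where "NA j x = (\<Sum>a\<in>Aj j. u a x)"

text \<open>The complement makes \<open>Aj j\<close> a group and a set of representatives at once.
  So a norm over \<open>Aj j\<close> is \<open>Aj j\<close>-invariant for every vector, also for one
  that is not fixed by the integers.\<close>

lemma transversal_Aj: "0 \<le> j \<Longrightarrow> transversal (Aj j) (pideal 0) (pideal (- j))"
proof -
  assume j: "0 \<le> j"
  have uniq: "a = b" if "a \<in> A" "b \<in> A" "a - b \<in> pideal 0" for a b
  proof -
    have "a - b \<in> pideal 0 \<inter> A" using additive_subgroup_setD(2)[OF A(1) that(1,2)] that(3) by blast
    then show ?thesis unfolding A(2) by simp
  qed
  note tr = transversalD[OF reps[of "- j" 0, where ?'a = 'l]]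
  define g where "g = (\<lambda>a. SOME r. r \<in> reps (- j) 0 \<and> a - r \<in> (pideal 0 :: 'l set))"
  have g: "g a \<in> reps (- j) 0 \<and> a - g a \<in> pideal 0" if "a \<in> Aj j" for a
    unfolding g_def by (rule someI_ex) (use tr(3) that j in \<open>auto simp: Aj_def\<close>)
  have "inj_on g (Aj j)"
  proof (rule inj_onI)
    fix a b assume ab: "a \<in> Aj j" "b \<in> Aj j" "g a = g b"
    have "(a - g a) - (b - g b) \<in> pideal 0"
      using pideal_diff[OF conjunct2[OF g[OF ab(1)]] conjunct2[OF g[OF ab(2)]]] .
    then show "a = b" using ab uniq by (simp add: Aj_def)
  qed
  moreover have "g ` Aj j \<subseteq> reps (- j) 0" using g by blast
  moreover have "finite (reps (- j) 0 :: 'l set)" using j by (intro finite_reps) simp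
  ultimately have "finite (Aj j)" using finite_subset finite_imageD by blast
  moreover have "\<exists>!r. r \<in> Aj j \<and> x - r \<in> pideal 0" if x: "x \<in> pideal (- j)" for x
  proof -
    obtain e c where ec: "e \<in> pideal 0" "c \<in> A" "x = e + c" using A(3)[of x] by blast
    have "e \<in> pideal (- j)" using pideal_monoD[OF ec(1), of "- j"] j by simp
    then have "x - e \<in> pideal (- j)" using x pideal_diff by blast
    then have c: "c \<in> Aj j" using ec by (simp add: Aj_def)
    show ?thesis
    proof (rule ex1I[of _ c])
      show "c \<in> Aj j \<and> x - c \<in> pideal 0" using c ec by simp
      fix r assume r: "r \<in> Aj j \<and> x - r \<in> pideal 0"
      have "(x - r) - e \<in> pideal 0" using r ec pideal_diff by blast
      then have "c - r \<in> pideal 0" using ec by (simp add: algebra_simps)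
      then show "r = c" using uniq[of c r] r ec by (simp add: Aj_def)
    qed
  qed
  ultimately show ?thesis by (auto simp: transversal_def Aj_def)
qed

lemma NA_u: "a \<in> Aj j \<Longrightarrow> u a (NA j x) = NA j x"
proof -
  assume a: "a \<in> Aj j"
  have s: "additive_subgroup_set (Aj j)"
    using A(1) subgroup_pideal[of "- j"] by (auto simp: Aj_def additive_subgroup_set_def)
  have "u a (NA j x) = (\<Sum>b\<in>Aj j. u (a + b) x)" by (simp add: NA_def u_sum u_u)
  also have "\<dots> = NA j x"
    unfolding NA_def
    by (rule sum.reindex_bij_witness[of _ "\<lambda>b. b - a" "\<lambda>b. a + b"])
      (use additive_subgroup_setD[OF s] a in auto)
  finally show ?thesis .
qed

text \<open>Representatives of \<open>pideal (- m)\<close> modulo \<open>pideal (- j)\<close> can be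
  moved into \<open>A\<close> by integral corrections; their sums with \<open>Aj j\<close> then
  exhaust \<open>Aj m\<close>.\<close>

lemma NA_decompose:
  assumes j: "0 \<le> j" "j \<le> m"
  shows "\<exists>R. transversal R (pideal (- j)) (pideal (- m)) \<and> (\<forall>x. NA m x = (\<Sum>r\<in>R. u r (NA j x)))"
proof -
  have s: "additive_subgroup_set A" by (rule A(1))
  define g where "g = (\<lambda>x::'l. SOME c. c \<in> A \<and> x - c \<in> pideal 0)"
  have g: "g x \<in> A \<and> x - g x \<in> pideal 0" for x
  proof -
    have "\<exists>c. c \<in> A \<and> x - c \<in> pideal 0" using A(3)[of x] by auto
    then show ?thesis unfolding g_def by (rule someI_ex)
  qed
  note tr = reps[of "- m" "- j", where ?'a = 'l]
  have gm: "g x \<in> pideal (- m)" if "x \<in> pideal (- m)" for x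
  proof -
    have "x - g x \<in> pideal (- m)" using pideal_monoD[of "x - g x" 0 "- m"] g j by simp
    then have "x - (x - g x) \<in> pideal (- m)" using that pideal_diff by blast
    then show ?thesis by simp
  qed
  have gj: "x - g x \<in> pideal (- j)" for x using pideal_monoD[of "x - g x" 0 "- j"] g j by simp
  define R where "R = g ` reps (- m) (- j)"
  have R: "transversal R (pideal (- j)) (pideal (- m))"
    unfolding transversal_def
  proof (intro conjI ballI)
    note t = transversalD[OF tr]
    show "finite R" using t(1) j by (simp add: R_def)
    show "R \<subseteq> pideal (- m)" using t(2) gm j by (auto simp: R_def)
    fix x :: 'l assume x: "x \<in> pideal (- m)"
    obtain r where r: "r \<in> reps (- m) (- j)" "x - r \<in> pideal (- j)" using t(3) x j by auto
    show "\<exists>!r. r \<in> R \<and> x - r \<in> pideal (- j)"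
    proof (rule ex1I[of _ "g r"])
      have "(x - r) + (r - g r) \<in> pideal (- j)" using r(2) gj by (rule pideal_add)
      then show "g r \<in> R \<and> x - g r \<in> pideal (- j)" using r by (simp add: R_def)
      fix z assume z: "z \<in> R \<and> x - z \<in> pideal (- j)"
      then obtain r' where r': "r' \<in> reps (- m) (- j)" "z = g r'" by (auto simp: R_def)
      have "(x - g r') - (r' - g r') \<in> pideal (- j)"
        using pideal_diff[of "x - g r'" "- j" "r' - g r'"] z r' gj by blast
      then have "x - r' \<in> pideal (- j)" by simp
      then have "r' = r" using t(4)[of x r' r] r r' x j by simp
      then show "z = g r" using r' by simp
    qed
  qed
  have sub: "\<And>c e. c \<in> pideal (- m) \<Longrightarrow> e \<in> pideal (- j) \<Longrightarrow> c + e \<in> (pideal (- m) :: 'l set)"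
  proof -
    fix c e :: 'l assume c: "c \<in> pideal (- m)" and e: "e \<in> pideal (- j)"
    have "e \<in> pideal (- m)" using pideal_monoD[OF e] j by simp
    then show "c + e \<in> pideal (- m)" using c pideal_add by blast
  qed
  have sub0: "pideal 0 \<subseteq> (pideal (- j) :: 'l set)" using j by (intro pideal_mono) simp
  note pl = transversal_plus[OF R transversal_Aj[OF j(1)] subgroup_pideal subgroup_pideal sub0 sub]
  let ?P = "(\<lambda>(r, s). r + s) ` (R \<times> Aj j)"
  have "?P = Aj m"
  proof
    show "?P \<subseteq> Aj m"
      using transversalD(2)[OF pl(1)] g additive_subgroup_setD(4)[OF s] by (auto simp: Aj_def R_def)
    show "Aj m \<subseteq> ?P"
    proof
      fix x assume x: "x \<in> Aj m"
      then obtain z where z: "z \<in> ?P" "x - z \<in> pideal 0"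
        using transversalD(3)[OF pl(1), of x] by (auto simp: Aj_def)
      then have "x - z \<in> A"
        using x \<open>?P \<subseteq> Aj m\<close> additive_subgroup_setD(2)[OF s] by (auto simp: Aj_def)
      then have "x - z = 0" using z A(2) by blast
      then show "x \<in> ?P" using z by simp
    qed
  qed
  then have "NA m x = (\<Sum>z\<in>?P. u z x)" for x by (simp add: NA_def)
  also have "\<And>x. (\<Sum>z\<in>?P. u z x) = (\<Sum>(r, s)\<in>R \<times> Aj j. u (r + s) x)"
    by (subst sum.reindex[OF pl(2)]) (auto intro!: sum.cong)
  finally have "NA m x = (\<Sum>r\<in>R. u r (NA j x))" for x
    by (simp add: sum.cartesian_product[symmetric] NA_def u_sum u_u)
  then show ?thesis using R by blast
qed

lemma NA_diff: "NA j (x - y) = NA j x - NA j y"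
  by (simp add: NA_def u_diff sum_subtractf)

lemma NA_commute: "NA j (u c x) = u c (NA j x)"
  by (simp add: NA_def u_sum u_u add.commute)

lemma NA_zero_mono: "\<lbrakk>NA j x = 0; 0 \<le> j; j \<le> m\<rbrakk> \<Longrightarrow> NA m x = 0"
  using NA_decompose[of j m] by (auto intro!: sum.neutral)

lemma NA_stable: "x \<in> V \<Longrightarrow> NA j x \<in> V"
  unfolding NA_def by (intro G_stable_sum[OF V_stable] V(5))

lemma NA_zero_uniform:
  "\<lbrakk>finite F; \<And>a. a \<in> F \<Longrightarrow> \<exists>j\<ge>0. NA j (g a) = 0\<rbrakk> \<Longrightarrow> \<exists>j\<ge>0. \<forall>a\<in>F. NA j (g a) = 0"
proof (induction F rule: finite_induct)
  case (insert a F)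
  then obtain j where j: "0 \<le> j" "\<forall>a\<in>F. NA j (g a) = 0" by auto
  obtain m where m: "0 \<le> m" "NA m (g a) = 0" using insert.prems[of a] by auto
  note jm = j m
  then have "\<forall>b\<in>insert a F. NA (max j m) (g b) = 0"
    using NA_zero_mono[of j _ "max j m"] NA_zero_mono[of m _ "max j m"] by auto
  then show ?case using jm by (intro exI[of _ "max j m"]) auto
qed auto

text \<open>\<open>pideal (- j)\<close> is the sum of \<open>Aj j\<close> and the integers. The
  first part fixes any norm over \<open>Aj j\<close>; the second fixes this one because the norm
  kills the finitely many \<open>u c x - x\<close>.\<close>

lemma NA_fixed:
  assumes x: "x \<in> fixed n" "0 \<le> n" and z: "\<forall>c\<in>reps 0 n. NA j (u c x - x) = 0" and j: "0 \<le> j"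
  shows "NA j x \<in> fixed (- j)"
  unfolding fixed_def
proof safe
  fix a :: 'l assume a: "a \<in> pideal (- j)"
  have f0: "u c (NA j x) = NA j x" if c: "c \<in> pideal 0" for c
  proof -
    obtain r where r: "r \<in> reps 0 n" "c - r \<in> pideal n" using transversalD(3)[OF reps[OF x(2)] c] by blast
    have "u c (NA j x) = NA j (u r x)" using fixed_u_eq[OF x(1) r(2)] by (simp flip: NA_commute)
    also have "\<dots> = NA j x" using z r by (simp add: NA_diff)
    finally show ?thesis .
  qed
  obtain b where b: "b \<in> Aj j" "a - b \<in> pideal 0" using transversalD(3)[OF transversal_Aj[OF j] a] by blast
  have "u a (NA j x) = u (a - b) (u b (NA j x))" by (simp add: u_u)
  then show "u a (NA j x) = NA j x" using NA_u[OF b(1)] f0[OF b(2)] by simp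
qed

text \<open>The norm over a large part of the complement \<open>A\<close> of \<open>pideal 0\<close> kills every vector of \<open>V\<close>: modulo the
  vectors for which this is true, one may assume \<open>x\<close> fixed by \<open>pideal 0\<close>, and then it says that \<open>h\<close> is nilpotent.\<close>

theorem NA_eventually_zero:
  assumes x: "x \<in> V" shows "\<exists>j\<ge>0. NA j x = 0"
proof (rule ccontr)
  assume no: "\<not> ?thesis"
  define N where "N = {x \<in> V. \<exists>j\<ge>0. NA j x = 0}"
  obtain n where n: "1 \<le> n" "x \<in> fixed n" using exists_fixed by blast
  then have n0: "0 \<le> n" by simp
  have "\<exists>y\<in>V \<inter> fixed n. y \<notin> N \<and> (\<forall>f\<in>u ` reps 0 n. f y - y \<in> N)"
  proof (rule unipotent_fixed_vector[OF prime_p char_x])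
    show "finite (u ` reps 0 n)" using finite_reps[OF n0, where ?'a = 'l] by simp
    show "Modules.additive f" if "f \<in> u ` reps 0 n" for f using that act_additive by (auto simp: u_def)
    show "f (g z) = g (f z)" if "f \<in> u ` reps 0 n" "g \<in> u ` reps 0 n" for f g z
      using that by (auto simp: u_u add.commute)
    show "(f ^^ p) z = z" if fz: "f \<in> u ` reps 0 n" for f z
    proof -
      obtain e where e: "f = u e" using fz by blast
      have "(u e ^^ i) z = u (of_nat i * e) z" for i
        by (induction i) (auto simp: u_u algebra_simps)
      then show ?thesis using char_l e of_nat_CHAR[where ?'a = 'l] by simp
    qed
    show "f z - z \<in> V \<inter> fixed n" if "f \<in> u ` reps 0 n" "z \<in> V \<inter> fixed n" for f z
      using that V(3,5) fixed_diff fixed_u by auto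
    show "f z - z \<in> N" if "f \<in> u ` reps 0 n" "z \<in> N" for f z
      using that V(3,5) by (auto simp: N_def NA_diff NA_commute)
    show "0 \<in> N" using V(1) by (auto simp: N_def NA_def)
  qed (use x n no in \<open>auto simp: N_def\<close>)
  then obtain y where y: "y \<in> V" "y \<in> fixed n" "y \<notin> N" "\<And>c. c \<in> reps 0 n \<Longrightarrow> u c y - y \<in> N" by auto
  obtain j where j: "0 \<le> j" "\<forall>c\<in>reps 0 n. NA j (u c y - y) = 0"
    using NA_zero_uniform[of "reps 0 n" "\<lambda>c. u c y - y"] finite_reps[OF n0, where ?'a = 'l] y(4)
    by (auto simp: N_def)
  define z where "z = NA j y"
  have z: "z \<in> V" "z \<in> fixed (- j)" using NA_stable y NA_fixed[OF y(2) n0 j(2,1)] by (auto simp: z_def)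
  define z0 where "z0 = D (unif powi j) 1 z"
  have z0: "z0 \<in> V" "z0 \<in> fixed 0" unfolding z0_def using z fixed_D[OF z(2)] V(8) by auto
  then obtain m where m: "(h ^^ m) z0 = 0" using h_locally_nilpotent by (auto simp: nil_def)
  \<comment> \<open>With this \<open>r\<close>, the vector \<open>h^m z0\<close> moved back by
    \<open>t^(-r)\<close> is the norm of \<open>z\<close> over \<open>pideal (- r)\<close> modulo
    \<open>pideal (- j)\<close>, and by \<open>NA_decompose\<close> this is
    \<open>NA r y\<close>.\<close>
  define r where "r = int m + j"
  have f: "D (unif powi int m) 1 z0 \<in> fixed (int m)" by (rule fixed_D[OF z0(2)]) auto
  have "0 = D (unif powi (- r)) 1 (nrm 0 (int m) (D (unif powi int m) 1 z0))"
    using m hn_eq_nrm[OF z0(2), of m] by simp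
  also have "\<dots> = nrm (- r) (- r + int m) (D (unif powi (- r)) 1 (D (unif powi int m) 1 z0))"
    using D_nrm[OF _ _ _ f, of "unif powi (- r)" 1 0] by simp
  also have "D (unif powi (- r)) 1 (D (unif powi int m) 1 z0) = D (unif powi (- r) * (unif powi int m * unif powi j)) 1 z"
    by (simp add: z0_def D_D)
  also have "unif powi (- r) * (unif powi int m * unif powi j) = (1::'l)"
    by (simp add: r_def power_int_add[symmetric] power_int_minus del: power_int_of_nat)
  also have "- r + int m = - j" by (simp add: r_def)
  finally have nz: "nrm (- r) (- j) z = 0" by simp
  obtain R where R: "transversal R (pideal (- j)) (pideal (- r))" "\<And>x. NA r x = (\<Sum>r\<in>R. u r (NA j x))"
    using NA_decompose[of j r] j by (auto simp: r_def)
  have "NA r y = nrm (- r) (- j) z"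
    unfolding R(2) z_def[symmetric] by (rule nrm_transversal[OF _ R(1) z(2)]) (simp add: r_def)
  then have "y \<in> N" using nz y(1) j(1) by (auto simp: N_def r_def intro!: exI[of _ r])
  then show False using y(3) by blast
qed

end

text \<open>An additive map with kernel \<open>V\<close> takes the place of the quotient group, so
  that congruences modulo \<open>V\<close> become equations within the same type.\<close>

lemma exists_projection:
  fixes V :: "'x::comm_ring_1 set"
  assumes p: "Factorial_Ring.prime (p::nat)" "of_nat p = (0::'x)" and V: "additive_subgroup_set V"
  shows "\<exists>\<pi>::'x \<Rightarrow> 'x. Modules.additive \<pi> \<and> (\<forall>x. \<pi> x = 0 \<longleftrightarrow> x \<in> V) \<and> (\<forall>x. x - \<pi> x \<in> V)"
proof -
  obtain C where C: "additive_subgroup_set C" "V \<inter> C = {0}" "\<And>x. \<exists>h\<in>V. \<exists>c\<in>C. x = h + c"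
    using exists_additive_complement[OF p V] by blast
  note v = additive_subgroup_setD[OF V] and c = additive_subgroup_setD[OF C(1)]
  define \<pi> where "\<pi> = (\<lambda>x. SOME c. c \<in> C \<and> x - c \<in> V)"
  have \<pi>: "\<pi> x \<in> C \<and> x - \<pi> x \<in> V" for x
  proof -
    have "\<exists>c. c \<in> C \<and> x - c \<in> V" using C(3)[of x] by auto
    then show ?thesis unfolding \<pi>_def by (rule someI_ex)
  qed
  have uniq: "\<pi> x = c" if "c \<in> C" "x - c \<in> V" for x c
  proof -
    have "(x - c) - (x - \<pi> x) \<in> V" using v(2) that(2) \<pi>[of x] by blast
    moreover have "\<pi> x - c \<in> C" using c(2) \<pi>[of x] that(1) by blast
    ultimately have "\<pi> x - c \<in> V \<inter> C" by simp
    then show ?thesis unfolding C(2) by simp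
  qed
  have "\<pi> (x + y) = \<pi> x + \<pi> y" for x y
  proof (rule uniq)
    show "\<pi> x + \<pi> y \<in> C" using c(4) \<pi> by blast
    have "(x - \<pi> x) + (y - \<pi> y) \<in> V" using v(4) \<pi> by blast
    then show "x + y - (\<pi> x + \<pi> y) \<in> V" by (simp add: algebra_simps)
  qed
  moreover have "\<pi> x = 0 \<longleftrightarrow> x \<in> V" for x using uniq[OF c(1), of x] \<pi>[of x] by auto
  ultimately show ?thesis using \<pi> unfolding Modules.additive_def by blast
qed

locale borel_character = field k for k :: "'k ring" (structure) +
  fixes \<theta> :: "'l::nonarch_local_field ^ 2 ^ 2 \<Rightarrow> 'k"
  assumes smooth_character: "\<theta> \<in> smooth_characters torus k"
begin


lemma chr:
  shows "\<lbrakk>a \<noteq> 0; d \<noteq> 0\<rbrakk> \<Longrightarrow> \<theta> (diag2 a d) \<in> carrier k"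
    "\<lbrakk>a \<noteq> 0; d \<noteq> 0\<rbrakk> \<Longrightarrow> \<theta> (diag2 a d) \<noteq> \<zero>"
    "\<lbrakk>a \<noteq> 0; d \<noteq> 0; a' \<noteq> 0; d' \<noteq> 0\<rbrakk> \<Longrightarrow> \<theta> (diag2 (a * a') (d * d')) = \<theta> (diag2 a d) \<otimes> \<theta> (diag2 a' d')"
    "\<theta> (diag2 1 1) = \<one>"
proof -
  have hom: "\<theta> \<in> hom torus (mult_of k)" using smooth_character by (simp add: smooth_characters_def)
  have cl: "\<theta> (diag2 a d) \<in> carrier k - {\<zero>}" if "a \<noteq> 0" "d \<noteq> 0" for a d
    using hom_in_carrier[OF hom diag2_in_torus[OF that]] by simp
  then show "\<lbrakk>a \<noteq> 0; d \<noteq> 0\<rbrakk> \<Longrightarrow> \<theta> (diag2 a d) \<in> carrier k"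
    "\<lbrakk>a \<noteq> 0; d \<noteq> 0\<rbrakk> \<Longrightarrow> \<theta> (diag2 a d) \<noteq> \<zero>" by auto
  have mult: "\<theta> (diag2 (a * a') (d * d')) = \<theta> (diag2 a d) \<otimes> \<theta> (diag2 a' d')"
    if "a \<noteq> 0" "d \<noteq> 0" "a' \<noteq> 0" "d' \<noteq> 0" for a d a' d'
  proof -
    have "diag2 (a * a') (d * d') = diag2 a d \<otimes>\<^bsub>torus\<^esub> diag2 a' d'"
      by (simp add: torus_def GL2_def diag2_eq_mk2 mk2_mult)
    then show ?thesis
      using hom_mult[OF hom diag2_in_torus diag2_in_torus, of a d a' d'] that by simp
  qed
  then show "\<lbrakk>a \<noteq> 0; d \<noteq> 0; a' \<noteq> 0; d' \<noteq> 0\<rbrakk> \<Longrightarrow> \<theta> (diag2 (a * a') (d * d')) = \<theta> (diag2 a d) \<otimes> \<theta> (diag2 a' d')" .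
  have "\<theta> (diag2 1 1) = \<theta> (diag2 1 1) \<otimes> \<theta> (diag2 1 1)" using mult[of 1 1 1 1] by simp
  then show "\<theta> (diag2 1 1) = \<one>" using cl[of 1 1] m_lcancel[of "\<theta> (diag2 1 1)" "\<theta> (diag2 1 1)" \<one>] by auto
qed

end

context smooth_module
begin

lemma transversal_sum_eq_mod:
  assumes V: "G_stable V" and R: "transversal R H C" "transversal S H C" "additive_subgroup_set H"
    and f: "\<And>x y. \<lbrakk>x \<in> C; y \<in> C; x - y \<in> H\<rbrakk> \<Longrightarrow> f x - f y \<in> V"
  shows "sum f R - sum f S \<in> V"
proof -
  have "additive_subgroup_set V" using V by (simp add: G_stable_def)
  from exists_projection[OF prime_p char_x this] obtain \<pi> :: "'x \<Rightarrow> 'x"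
    where \<pi>: "Modules.additive \<pi>" "\<And>x. \<pi> x = 0 \<longleftrightarrow> x \<in> V" by blast
  interpret \<pi>: Modules.additive \<pi> by (rule \<pi>(1))
  have "(\<Sum>x\<in>R. \<pi> (f x)) = (\<Sum>x\<in>S. \<pi> (f x))"
  proof (rule transversal_sum_eq[OF R])
    show "\<pi> (f x) = \<pi> (f y)" if "x \<in> C" "y \<in> C" "x - y \<in> H" for x y
      using f[OF that] \<pi>(2)[of "f x - f y"] by (simp add: \<pi>.diff)
  qed
  then show ?thesis using \<pi>(2)[of "sum f R - sum f S"] by (simp add: \<pi>.diff \<pi>.sum)
qed

lemma borel_characterI: "\<theta> \<in> smooth_characters torus k \<Longrightarrow> borel_character k \<theta>"
  by unfold_locales

lemmas character_torus = borel_character.chr[OF borel_characterI]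

end

section \<open>Lifting ordinary vectors through an extension\<close>

context supersingular_submodule
begin

text \<open>Two corrections, each changing the vector only within \<open>V\<close> once it is
  rescaled: the norm over \<open>Aj j\<close>, moved by \<open>t^j\<close>, makes it fixed by the
  integers, and a power of \<open>h\<close> makes it an exact eigenvector. The torus relations then
  hold automatically, since their defect lies in \<open>V\<close>, hence is nilpotent, and is also
  an eigenvector of \<open>h\<close> for the nonzero \<open>lam\<close>.\<close>

lemma exists_ordinary_lift:
  assumes \<theta>: "\<theta> \<in> smooth_characters torus k" and e0: "e0 \<in> M"
    and eu: "\<And>c. c \<in> pideal 0 \<Longrightarrow> u c e0 - e0 \<in> V"
    and eD: "\<And>a d. \<lbrakk>a \<noteq> 0; d \<noteq> 0; val a = val d\<rbrakk> \<Longrightarrow> D a d e0 - sc (\<theta> (diag2 d a)) e0 \<in> V"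
    and eh: "h e0 - sc (\<theta> (diag2 1 unif)) e0 \<in> V"
  shows "\<exists>e. ordinary_vector \<theta> e \<and> e - e0 \<in> V"
proof -
  define lam where "lam = \<theta> (diag2 1 unif)"
  have lam: "lam \<in> carrier k" "lam \<noteq> \<zero>" using character_torus(1,2)[OF \<theta>, of 1 unif] by (auto simp: lam_def)
  have pow: "lam [^] (i::nat) \<in> Units k" for i
  proof -
    have "lam \<in> Units k" using lam field_Units by blast
    then show ?thesis by (rule Units_pow_closed)
  qed
  have powc: "lam [^] (i::nat) \<in> carrier k" "inv (lam [^] i) \<in> carrier k" for i
    using lam pow by (auto intro: Units_inv_closed)
  have inv_pow: "sc (inv (lam [^] (i::nat))) (sc (lam [^] i) x) = x" if "x \<in> M" for i x
    using powc[of i] Units_l_inv[OF pow[of i]] sc_one[OF that] by (simp flip: sc_mult)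
  obtain n where n: "1 \<le> n" "e0 \<in> fixed n" using exists_fixed by blast
  have n0: "0 \<le> n" using n by simp
  have r0: "reps 0 n \<subseteq> (pideal 0 :: 'l set)" by (rule reps_subset[OF n0])
  obtain j where j: "0 \<le> j" "\<forall>c\<in>reps 0 n. NA j (u c e0 - e0) = 0"
  proof -
    have "\<exists>j\<ge>0. NA j (u c e0 - e0) = 0" if "c \<in> reps 0 n" for c
      using NA_eventually_zero[OF eu] r0 that by blast
    then have "\<exists>j\<ge>0. \<forall>c\<in>reps 0 n. NA j (u c e0 - e0) = 0"
      by (rule NA_zero_uniform[OF finite_reps[OF n0]])
    then show ?thesis using that by blast
  qed
  let ?t = "\<lambda>m. D (unif powi m) 1"
  define e1 where "e1 = NA j e0"
  have e1: "e1 \<in> fixed (- j)" unfolding e1_def using NA_fixed[OF n(2) n0 j(2,1)] .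
  define e2 where "e2 = ?t j e1"
  have e2: "e2 \<in> fixed 0" unfolding e2_def by (rule fixed_D[OF e1]) auto
  have Mst: "x \<in> M \<Longrightarrow> ?t m x \<in> M" "x \<in> M \<Longrightarrow> u a x \<in> M" for x m a
    using G_stableD(5,8)[OF G_stable_M] by auto
  have e2M: "e2 \<in> M"
    unfolding e2_def e1_def NA_def by (intro Mst(1) G_stable_sum[OF G_stable_M] Mst(2) e0)
  have per: "u r (?t m e0) - u s (?t m e0) \<in> V" if rs: "r - s \<in> pideal m" for r s m
  proof -
    have "unif powi (- m) * (r - s) \<in> pideal 0" using rs pideal_scale[of "unif powi (- m) :: 'l" "r - s" m] by simp
    then have "u s (?t m (u (unif powi (- m) * (r - s)) e0 - e0)) \<in> V" using eu V(5,8) by simp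
    moreover have "unif powi m * (unif powi (- m) * (r - s)) = r - s"
      by (simp add: power_int_minus)
    ultimately show ?thesis by (simp add: D_diff D_u u_diff u_u)
  qed
  \<comment> \<open>Modulo \<open>V\<close> the vector \<open>e0\<close> behaves like an ordinary
    vector, so the norm of \<open>t^m e0\<close> is \<open>lam^m e0\<close>. As \<open>e0\<close>
    itself is not fixed by the integers, sums over different transversals agree only modulo
    \<open>V\<close>.\<close>
  have Q: "(\<Sum>r\<in>R. u r (?t (int m) e0)) - sc (lam [^] m) e0 \<in> V"
    if "transversal R (pideal (int m)) (pideal 0)" for R m
    using that
  proof (induction m arbitrary: R)
    case 0
    have "transversal {0} (pideal 0) (pideal 0 :: 'l set)" by (auto simp: transversal_def)
    from transversal_sum_eq_mod[OF V_stable _ this subgroup_pideal, of R "\<lambda>r. u r (?t 0 e0)"]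
    show ?case using 0 per[of _ _ 0] sc_one[OF e0] by simp
  next
    case (Suc m)
    define S where "S = (*) (unif powi int m) ` (reps 0 1 :: 'l set)"
    have S: "transversal S (pideal (int m + 1)) (pideal (int m))"
      unfolding S_def using transversal_scale[OF _ reps[of 0 1], of "unif powi int m :: 'l"] by simp
    have sub: "pideal (int m + 1) \<subseteq> (pideal (int m) :: 'l set)" by (rule pideal_mono) simp
    have add: "c + d \<in> pideal 0" if "c \<in> pideal 0" "d \<in> pideal (int m)" for c d :: 'l
      using that pideal_add pideal_monoD[OF that(2), of 0] by simp
    note pl = transversal_plus[OF reps[of 0 "int m"] S subgroup_pideal subgroup_pideal sub add, simplified]
    let ?P = "(\<lambda>(r, s). r + s) ` (reps 0 (int m) \<times> S)"
    have eq: "int (Suc m) = int m + 1" by simp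
    have "(\<Sum>r\<in>R. u r (?t (int m + 1) e0)) - (\<Sum>r\<in>?P. u r (?t (int m + 1) e0)) \<in> V"
      by (rule transversal_sum_eq_mod[OF V_stable _ pl(1) subgroup_pideal])
        (use Suc.prems per[of _ _ "int m + 1"] eq in \<open>auto simp: add.commute\<close>)
    moreover have "(\<Sum>r\<in>?P. u r (?t (int m + 1) e0)) = (\<Sum>r\<in>reps 0 (int m). u r (?t (int m) (h e0)))"
    proof -
      have "?t (int m + 1) e0 = ?t (int m) (D unif 1 e0)"
        by (simp add: D_D power_int_add)
      then have "u (r + unif powi int m * b) (?t (int m + 1) e0) = u r (?t (int m) (u b (D unif 1 e0)))" for r b
        by (simp add: D_u u_u)
      then have "(\<Sum>s\<in>S. u (r + s) (?t (int m + 1) e0)) = u r (?t (int m) (h e0))" for r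
        unfolding S_def by (subst sum.reindex) (auto intro: inj_onI simp: h_def nrm_def D_sum u_sum)
      moreover have "(\<Sum>r\<in>?P. u r (?t (int m + 1) e0)) = (\<Sum>(r, s)\<in>reps 0 (int m) \<times> S. u (r + s) (?t (int m + 1) e0))"
        by (subst sum.reindex[OF pl(2)]) (auto intro!: sum.cong)
      ultimately show ?thesis by (simp add: sum.cartesian_product[symmetric])
    qed
    ultimately have 1: "(\<Sum>r\<in>R. u r (?t (int m + 1) e0)) - (\<Sum>r\<in>reps 0 (int m). u r (?t (int m) (h e0))) \<in> V"
      by simp
    have 2: "(\<Sum>r\<in>reps 0 (int m). u r (?t (int m) (h e0))) - sc lam (\<Sum>r\<in>reps 0 (int m). u r (?t (int m) e0)) \<in> V"
    proof -
      have "(\<Sum>r\<in>reps 0 (int m). u r (?t (int m) (h e0 - sc lam e0))) \<in> V"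
        using eh V(5,8) unfolding lam_def by (intro G_stable_sum[OF V_stable]) simp
      then show ?thesis using lam by (simp add: sc_sum D_diff D_sc u_diff u_sc sum_subtractf)
    qed
    have 3: "sc lam ((\<Sum>r\<in>reps 0 (int m). u r (?t (int m) e0)) - sc (lam [^] m) e0) \<in> V"
      using Suc.IH[OF reps] V(9) lam by simp
    have "sc (lam [^] Suc m) e0 = sc lam (sc (lam [^] m) e0)"
      using lam by (simp add: m_comm flip: sc_mult)
    then show ?case using V(2)[OF V(2)[OF 1 2] 3] eq by (simp add: sc_diff add.commute)
  qed
  define J where "J = nat j"
  have J: "int J = j" using j by (simp add: J_def)
  have "e2 - sc (lam [^] J) e0 \<in> V"
  proof -
    have tr: "transversal ((*) (unif powi j) ` Aj j) (pideal j) (pideal 0)"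
      using transversal_scale[OF _ transversal_Aj[OF j(1)], of "unif powi j"] by simp
    have "e2 = (\<Sum>a\<in>Aj j. u (unif powi j * a) (?t j e0))"
      by (simp add: e2_def e1_def NA_def D_sum D_u)
    also have "\<dots> = (\<Sum>r\<in>(*) (unif powi j) ` Aj j. u r (?t j e0))"
      by (subst sum.reindex) (auto intro: inj_onI)
    finally show ?thesis using Q[of "(*) (unif powi j) ` Aj j" J] tr by (simp only: J)
  qed
  then have "sc (inv (lam [^] J)) (e2 - sc (lam [^] J) e0) \<in> V" using V(9) powc by blast
  then have e3V: "sc (inv (lam [^] J)) e2 - e0 \<in> V" using inv_pow[OF e0] by (simp add: sc_diff)
  define e3 where "e3 = sc (inv (lam [^] J)) e2"
  have e3: "e3 \<in> M" "e3 \<in> fixed 0" "e3 - e0 \<in> V"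
    using e2M e2 e3V powc by (auto simp: e3_def M_sc fixed_sc)
  have hV: "h e3 - sc lam e3 \<in> V"
  proof -
    have "h (e3 - e0) \<in> V" "sc lam (e3 - e0) \<in> V"
      using e3(3) h_stable[OF V_stable] V(9) lam by simp_all
    then have "h (e3 - e0) - sc lam (e3 - e0) + (h e0 - sc lam e0) \<in> V"
      using eh V(2,3) unfolding lam_def by simp
    then show ?thesis by (simp add: h_diff sc_diff)
  qed
  have "h e3 - sc lam e3 \<in> fixed 0" using e3(2) lam by (intro fixed_diff h_fixed fixed_sc)
  then obtain N where N: "(h ^^ N) (h e3 - sc lam e3) = 0"
    using h_locally_nilpotent[OF hV] by (auto simp: nil_def)
  define e where "e = sc (inv (lam [^] N)) ((h ^^ N) e3)"
  have eM: "e \<in> M" "e \<in> fixed 0"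
    using e3 powc hn_stable[OF G_stable_M] hn_fixed by (auto simp: e_def M_sc fixed_sc)
  have he: "h e = sc lam e"
  proof -
    have "(h ^^ N) (h e3) = sc lam ((h ^^ N) e3)" using N lam by (simp add: hn_diff hn_sc)
    then have "h ((h ^^ N) e3) = sc lam ((h ^^ N) e3)" by (simp add: funpow_swap1)
    then show ?thesis using powc lam by (simp add: e_def h_sc sc_commute)
  qed
  have "(h ^^ N) e3 - sc (lam [^] N) e3 \<in> V" for N
  proof (induction N)
    case (Suc N)
    have "h ((h ^^ N) e3 - sc (lam [^] N) e3) + sc (lam [^] N) (h e3 - sc lam e3) \<in> V"
      by (rule V(2)[OF h_stable[OF V_stable Suc] V(9)[OF powc(1) hV]])
    moreover have "sc (lam [^] Suc N) e3 = sc (lam [^] N) (sc lam e3)" using lam powc by (simp add: sc_mult)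
    ultimately show ?case using powc by (simp add: h_diff h_sc sc_diff)
  qed (use sc_one[OF e3(1)] V(1) in simp)
  then have "sc (inv (lam [^] N)) ((h ^^ N) e3 - sc (lam [^] N) e3) \<in> V" using V(9) powc by blast
  then have "e - e3 \<in> V" using inv_pow[OF e3(1)] by (simp add: e_def sc_diff)
  then have "(e - e3) + (e3 - e0) \<in> V" using e3(3) by (rule V(2))
  then have ee0: "e - e0 \<in> V" by simp
  have "D a d e = sc (\<theta> (diag2 d a)) e" if ad: "a \<noteq> 0" "d \<noteq> 0" "val a = val d" for a d
  proof -
    define c where "c = \<theta> (diag2 d a)"
    have c: "c \<in> carrier k" using character_torus(1)[OF \<theta>] ad by (simp add: c_def)
    define g where "g = D a d e - sc c e"
    have "D a d (e - e0) \<in> V" "sc c (e - e0) \<in> V" using ee0 V(8,9) c ad by simp_all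
    then have "D a d (e - e0) - sc c (e - e0) + (D a d e0 - sc c e0) \<in> V"
      using V(2,3) eD[OF ad] unfolding c_def by simp
    then have gV: "g \<in> V" by (simp add: g_def D_diff sc_diff)
    have gf: "g \<in> fixed 0" unfolding g_def using eM c fixed_D[of e 0 a d 0] ad by (intro fixed_diff fixed_sc) auto
    have hg: "h g = sc lam g"
      using D_h[OF eM(2) ad] c lam ad by (simp add: g_def h_diff h_sc he D_sc sc_diff sc_commute)
    have "(h ^^ m) g = sc (lam [^] m) g" for m
      by (induction m) (use gV V_subset lam in \<open>auto simp: sc_one h_sc hg sc_mult\<close>)
    then obtain m :: nat where "sc (lam [^] m) g = 0"
      using h_locally_nilpotent[OF gV gf] by (auto simp: nil_def)
    then have "g = 0" using inv_pow[of g m] gV V_subset by auto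
    then show ?thesis by (simp add: g_def c_def)
  qed
  then have "ordinary_vector \<theta> e" using eM he by (simp add: ordinary_vector_def lam_def)
  then show ?thesis using ee0 by blast
qed

end

section \<open>Maps from induced representations\<close>

definition annulus :: "int \<Rightarrow> 'a::nonarch_local_field set"
  where "annulus i = {x. x \<noteq> 0 \<and> val x = i}"

lemma pideal_eq_annulus: "pideal i = pideal (i + 1) \<union> (annulus i :: 'a::nonarch_local_field set)"
  by (auto simp: annulus_def pideal_iff)

lemma annulus_subset: "annulus i \<subseteq> (pideal i :: 'a::nonarch_local_field set)"
  by (auto simp: annulus_def pideal_iff)

lemma annulus_add: "\<lbrakk>x \<in> annulus i; y \<in> pideal m; i < m\<rbrakk> \<Longrightarrow> x + y \<in> (annulus i :: 'a::nonarch_local_field set)"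
  using val_add_eq[of x y m] by (auto simp: annulus_def)

text \<open>The difference \<open>1 / x - 1 / y\<close> is \<open>- (x - y) / (x y)\<close>, and on
  the annulus \<open>x y\<close> has valuation \<open>2 i\<close>.\<close>

lemma transversal_inverse_annulus:
  assumes R: "transversal R (pideal m) (annulus i :: 'a::nonarch_local_field set)"
  shows "transversal ((/) 1 ` R) (pideal (m - 2 * i)) (annulus (- i))"
proof (rule transversal_image[OF R])
  show "bij_betw ((/) 1) (annulus i) (annulus (- i) :: 'a set)"
    by (rule bij_betw_byWitness[of _ "\<lambda>x. 1 / x"]) (auto simp: annulus_def val_divide)
  fix x y :: 'a assume xy: "x \<in> annulus i" "y \<in> annulus i"
  then have nz: "x \<noteq> 0" "y \<noteq> 0" "val (x * y) = 2 * i" by (auto simp: annulus_def val_mult)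
  then have "- (x * y) * (1 / x - 1 / y) = x - y" by (simp add: field_simps)
  then show "1 / x - 1 / y \<in> pideal (m - 2 * i) \<longleftrightarrow> x - y \<in> pideal m"
    using pideal_scale[of "- (x * y)" "1 / x - 1 / y" "m - 2 * i"] nz by simp
qed

locale ordinary = smooth_module k sc p act M
  for k :: "'k ring" (structure) and sc :: "'k \<Rightarrow> 'x::comm_ring_1 \<Rightarrow> 'x"
    and p and act :: "'l::nonarch_local_field ^ 2 ^ 2 \<Rightarrow> 'x \<Rightarrow> 'x" and M +
  fixes \<theta> :: "'l ^ 2 ^ 2 \<Rightarrow> 'k" and e :: 'x
  assumes \<theta>: "\<theta> \<in> smooth_characters torus k" and e: "ordinary_vector \<theta> e"
begin

lemmas th = character_torus[OF \<theta>]

lemma e_props: "e \<in> M" "e \<in> fixed 0" "\<lbrakk>a \<noteq> 0; d \<noteq> 0; val a = val d\<rbrakk> \<Longrightarrow> D a d e = sc (\<theta> (diag2 d a)) e"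
  "h e = sc (\<theta> (diag2 1 unif)) e"
  using e by (auto simp: ordinary_vector_def)

text \<open>The intended image of \<open>bump m\<close>: the scalar cancels the factor that appears
  when \<open>t^m\<close> carries \<open>bump 0\<close> to \<open>bump m\<close>.\<close>

definition E :: "int \<Rightarrow> 'x"
  where "E m = sc (\<theta> (diag2 1 (unif powi (- m)))) (D (unif powi m) 1 e)"

lemma E_0: "E 0 = e"
  using th(4) sc_one[OF e_props(1)] by (simp add: E_def)

lemma E_fixed: "E m \<in> fixed m"
  unfolding E_def using th(1) fixed_D[OF e_props(2), of "unif powi m" 1 m] by (intro fixed_sc) auto

lemma D_E:
  assumes "a \<noteq> 0" "d \<noteq> 0" shows "D a d (E m) = sc (\<theta> (diag2 d a)) (E (m + val a - val d))"
proof -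
  define i where "i = val a - val d"
  define a' where "a' = a / unif powi i"
  have a': "a' \<noteq> 0" "val a' = val d" "a = unif powi i * a'" using assms by (auto simp: a'_def i_def val_divide)
  have "D a d (D (unif powi m) 1 e) = D (unif powi (m + i)) 1 (D a' d e)"
    using a' assms by (simp add: D_D power_int_add mult_ac)
  then have "D a d (E m) = sc (\<theta> (diag2 1 (unif powi (- m))) \<otimes> \<theta> (diag2 d a')) (D (unif powi (m + i)) 1 e)"
    using assms a' e_props(3)[of a' d] th(1) by (simp add: E_def D_sc sc_mult)
  also have "\<theta> (diag2 1 (unif powi (- m))) \<otimes> \<theta> (diag2 d a') = \<theta> (diag2 (1 * d) (unif powi (- m) * a'))"
    using assms a' by (intro th(3)[symmetric]) auto
  also have "unif powi (- m) * a' = a * unif powi (- (m + i))"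
  proof -
    have "unif powi i * unif powi (- (m + i)) = (unif powi (- m) :: 'l)" by (simp flip: power_int_add)
    then show ?thesis by (simp add: a'(3) mult.commute mult.left_commute)
  qed
  also have "\<theta> (diag2 (1 * d) (a * unif powi (- (m + i)))) = \<theta> (diag2 d a) \<otimes> \<theta> (diag2 1 (unif powi (- (m + i))))"
    using assms th(3)[of d a 1 "unif powi (- (m + i))"] by simp
  finally show ?thesis using th(1) assms by (simp add: E_def sc_mult i_def add_diff_eq)
qed

text \<open>Additivity of the measure: the indicator of \<open>pideal m\<close> is the sum of those
  of its cosets modulo \<open>pideal m'\<close>. One step of this is the eigenvalue equation for
  \<open>h\<close>.\<close>

lemma nrm_E: "m \<le> m' \<Longrightarrow> nrm m m' (E m') = E m"
proof (induction m' rule: int_ge_induct)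
  case base
  have "transversal {0} (pideal m) (pideal m :: 'l set)" by (auto simp: transversal_def)
  from nrm_transversal[OF _ this E_fixed] show ?case by simp
next
  case (step j)
  have t1: "D unif 1 e \<in> fixed 1" using fixed_D[OF e_props(2), of unif 1 1] by simp
  have "nrm j (j + 1) (D (unif powi (j + 1)) 1 e) = D (unif powi j) 1 (h e)"
    using D_nrm[of "unif powi j" 1 0 1 "D unif 1 e"] t1 by (simp add: h_def D_D power_int_add)
  also have "\<dots> = sc (\<theta> (diag2 1 unif)) (D (unif powi j) 1 e)" using th(1) by (simp add: e_props(4) D_sc)
  finally have "nrm j (j + 1) (E (j + 1)) = sc (\<theta> (diag2 1 (unif powi (- (j + 1)))) \<otimes> \<theta> (diag2 1 unif)) (D (unif powi j) 1 e)"
    using th(1) by (simp add: E_def nrm_sc sc_mult)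
  also have "\<theta> (diag2 1 (unif powi (- (j + 1)))) \<otimes> \<theta> (diag2 1 unif) = \<theta> (diag2 (1 * 1) (unif powi (- (j + 1)) * unif))"
    by (intro th(3)[symmetric]) auto
  also have "unif powi (- (j + 1)) * unif = (unif powi (- j) :: 'l)"
    using power_int_add[of "unif :: 'l" "- (j + 1)" 1] by simp
  finally have "nrm j (j + 1) (E (j + 1)) = E j" by (simp add: E_def)
  moreover have "nrm m (j + 1) (E (j + 1)) = nrm m j (nrm j (j + 1) (E (j + 1)))"
    using step.hyps E_fixed by (intro nrm_nrm[symmetric]) auto
  ultimately show ?case using step.IH by simp
qed

definition n0 :: int where "n0 = (SOME n. \<forall>c\<in>pideal n. l c e = e)"

lemma n0: "c \<in> pideal n0 \<Longrightarrow> l c e = e"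
proof -
  have "\<exists>n. \<forall>c\<in>pideal n. l c e = e" by (rule smoothE[of e]) blast
  from someI_ex[OF this] show "c \<in> pideal n0 \<Longrightarrow> l c e = e" by (simp add: n0_def)
qed

lemma l_E: "c \<in> pideal (n0 - m) \<Longrightarrow> l c (E m) = E m"
proof -
  assume c: "c \<in> pideal (n0 - m)"
  then have "unif powi m * c \<in> pideal n0" using pideal_scale[of "unif powi m :: 'l" c "n0 - m"] by simp
  from n0[OF this] have "D (unif powi m) 1 e = D (unif powi m) 1 (l (unif powi m * c) e)" by simp
  also have "\<dots> = l c (D (unif powi m) 1 e)" by (simp add: D_l)
  finally show ?thesis using th(1) by (simp add: E_def l_sc)
qed

text \<open>Unions of cosets of \<open>pideal m\<close>, of the two shapes that occur: discs around
  \<open>0\<close>, and the annuli, which the inversion induced by \<open>w\<close> maps to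
  annuli.\<close>

definition admissible :: "int \<Rightarrow> 'l set \<Rightarrow> bool"
  where "admissible m C \<longleftrightarrow> (\<exists>i\<le>m. C = pideal i) \<or> (\<exists>i<m. C = annulus i)"

lemma admissible_pideal: "i \<le> m \<Longrightarrow> admissible m (pideal i)"
  unfolding admissible_def by (intro disjI1 exI conjI) (assumption, rule HOL.refl)

lemma admissible_annulus: "i < m \<Longrightarrow> admissible m (annulus i)"
  unfolding admissible_def by (intro disjI2 exI conjI) (assumption, rule HOL.refl)

lemma admissibleE:
  assumes "admissible m C"
  obtains i where "i \<le> m" "C = pideal i" | i where "i < m" "C = annulus i"
  using assms unfolding admissible_def by (elim disjE exE conjE)

lemma admissible_add: "\<lbrakk>admissible m C; c \<in> C; x \<in> pideal m\<rbrakk> \<Longrightarrow> c + x \<in> C"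
proof -
  assume a: "admissible m C" "c \<in> C" "x \<in> pideal m"
  from a(1) show ?thesis
  proof (cases rule: admissibleE)
    case (1 i) then show ?thesis using a pideal_add[of c i x] pideal_monoD[OF a(3), of i] by simp
  next
    case (2 i) then show ?thesis using a annulus_add[of c i x m] by simp
  qed
qed

lemma admissible_mono: "\<lbrakk>admissible m C; m \<le> m'\<rbrakk> \<Longrightarrow> admissible m' C"
  by (erule admissibleE) (simp_all add: admissible_pideal admissible_annulus)

lemma admissible_transversal: "admissible m C \<Longrightarrow> \<exists>R. transversal R (pideal m) C"
proof -
  assume "admissible m C"
  then show ?thesis
  proof (cases rule: admissibleE)
    case (1 i)
    show ?thesis unfolding 1(2) by (intro exI) (rule reps[OF 1(1)])
  next
    case (2 i)
    have "transversal (reps i m \<inter> annulus i) (pideal m) (annulus i)"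
      by (rule transversal_subset[OF reps annulus_subset subgroup_pideal]) (use 2 annulus_add in auto)
    then show ?thesis unfolding 2(2) by (intro exI)
  qed
qed

definition tv :: "int \<Rightarrow> 'l set \<Rightarrow> 'l set"
  where "tv m C = (SOME R. transversal R (pideal m) C)"

lemma tv: "admissible m C \<Longrightarrow> transversal (tv m C) (pideal m) C"
  unfolding tv_def by (rule someI_ex[OF admissible_transversal])

text \<open>\<open>E m\<close> plays the role of the indicator function of \<open>pideal m\<close>, so \<open>integ C F m\<close> is the integral over \<open>C\<close> of
  the function \<open>F\<close>, which has to be invariant under \<open>pideal m\<close>, against an \<open>'x\<close>-valued measure on \<open>'l\<close>.\<close>

definition integ :: "'l set \<Rightarrow> ('l \<Rightarrow> 'k) \<Rightarrow> int \<Rightarrow> 'x"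
  where "integ C F m = (\<Sum>a\<in>tv m C. sc (F a) (u (- a) (E m)))"

definition periodic :: "'l set \<Rightarrow> ('l \<Rightarrow> 'k) \<Rightarrow> int \<Rightarrow> bool"
  where "periodic C F m \<longleftrightarrow> (\<forall>x\<in>C. F x \<in> carrier k) \<and> (\<forall>x\<in>C. \<forall>y\<in>C. x - y \<in> pideal m \<longrightarrow> F x = F y)"

lemma periodic_closed: "\<lbrakk>periodic C F m; x \<in> C\<rbrakk> \<Longrightarrow> F x \<in> carrier k"
  unfolding periodic_def by blast

lemma periodicD: "\<lbrakk>periodic C F m; x \<in> C; y \<in> C; x - y \<in> pideal m\<rbrakk> \<Longrightarrow> F x = F y"
  unfolding periodic_def by blast

lemma periodicI:
  assumes "\<And>x. x \<in> C \<Longrightarrow> F x \<in> carrier k"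
    and "\<And>x y. \<lbrakk>x \<in> C; y \<in> C; x - y \<in> pideal m\<rbrakk> \<Longrightarrow> F x = F y"
  shows "periodic C F m"
  unfolding periodic_def using assms by blast

lemma periodic_mono: "\<lbrakk>periodic C F m; m \<le> m'\<rbrakk> \<Longrightarrow> periodic C F m'"
proof (rule periodicI)
  assume F: "periodic C F m" "m \<le> m'"
  show "F x \<in> carrier k" if "x \<in> C" for x using F(1) that by (rule periodic_closed)
  show "F x = F y" if "x \<in> C" "y \<in> C" "x - y \<in> pideal m'" for x y
    by (rule periodicD[OF F(1) that(1,2) pideal_monoD[OF that(3) F(2)]])
qed

lemma periodic_subset: "\<lbrakk>periodic C F m; C' \<subseteq> C\<rbrakk> \<Longrightarrow> periodic C' F m"
proof (rule periodicI)
  assume F: "periodic C F m" "C' \<subseteq> C"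
  show "F x \<in> carrier k" if "x \<in> C'" for x using F that periodic_closed by blast
  show "F x = F y" if "x \<in> C'" "y \<in> C'" "x - y \<in> pideal m" for x y
    using F(2) that by (intro periodicD[OF F(1)]) auto
qed

text \<open>Right translation by \<open>u a\<close> shifts a function on the big cell by
  \<open>-a\<close>, so \<open>u (- a) (E m)\<close> belongs to the coset of \<open>a\<close>; this
  explains the sign in \<open>integ\<close>.\<close>

lemma u_minus_E: "x - y \<in> pideal m \<Longrightarrow> u (- x) (E m) = u (- y) (E m)"
  using pideal_minus[of "x - y" m] by (intro fixed_u_eq[OF E_fixed]) simp

lemma integ_transversal:
  assumes "admissible m C" "transversal R (pideal m) C" "periodic C F m"
  shows "integ C F m = (\<Sum>a\<in>R. sc (F a) (u (- a) (E m)))"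
  unfolding integ_def
proof (rule transversal_sum_eq[OF tv[OF assms(1)] assms(2) subgroup_pideal])
  fix x y assume xy: "x \<in> C" "y \<in> C" "x - y \<in> pideal m"
  then have "F x = F y" by (rule periodicD[OF assms(3)])
  then show "sc (F x) (u (- x) (E m)) = sc (F y) (u (- y) (E m))" by (simp only: u_minus_E[OF xy(3)])
qed

lemma integ_cong:
  assumes "admissible m C" "\<And>x. x \<in> C \<Longrightarrow> F x = G x" shows "integ C F m = integ C G m"
  unfolding integ_def using transversalD(2)[OF tv[OF assms(1)]] assms(2) by (intro sum.cong) auto

text \<open>Splitting each coset of \<open>pideal m\<close> into finer ones changes nothing, because
  the pieces of \<open>E m'\<close> add up to \<open>E m\<close> by \<open>nrm_E\<close>.\<close>

lemma integ_refine:
  assumes C: "admissible m C" and F: "periodic C F m" and m: "m \<le> m'"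
  shows "integ C F m = integ C F m'"
proof -
  have C': "admissible m' C" using admissible_mono[OF C m] .
  have sub: "pideal m' \<subseteq> (pideal m :: 'l set)" using m by (rule pideal_mono)
  have "integ C F m' = (\<Sum>r\<in>tv m C. \<Sum>s\<in>reps m m'. sc (F (r + s)) (u (- (r + s)) (E m')))"
    unfolding integ_def
  proof (rule transversal_sum_plus[OF tv[OF C] reps[OF m] subgroup_pideal subgroup_pideal sub _ tv[OF C']])
    show "c + x \<in> C" if "c \<in> C" "x \<in> pideal m" for c x using admissible_add[OF C that] .
    show "sc (F x) (u (- x) (E m')) = sc (F y) (u (- y) (E m'))" if "x \<in> C" "y \<in> C" "x - y \<in> pideal m'" for x y
    proof -
      have "F x = F y" by (rule periodicD[OF periodic_mono[OF F m] that])
      moreover have "u (- x) (E m') = u (- y) (E m')" by (rule u_minus_E[OF that(3)])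
      ultimately show ?thesis by (simp only:)
    qed
  qed
  also have "\<dots> = (\<Sum>r\<in>tv m C. sc (F r) (u (- r) (E m)))"
  proof (rule sum.cong)
    fix r assume r: "r \<in> tv m C"
    then have rC: "r \<in> C" using transversalD(2)[OF tv[OF C]] by blast
    have "F (r + s) = F r" if "s \<in> reps m m'" for s
    proof -
      have s: "s \<in> pideal m" using reps_subset[OF m] that by blast
      then have "(r + s) - r \<in> pideal m" by simp
      then show ?thesis by (rule periodicD[OF F admissible_add[OF C rC s] rC])
    qed
    then have "(\<Sum>s\<in>reps m m'. sc (F (r + s)) (u (- (r + s)) (E m'))) = (\<Sum>s\<in>reps m m'. sc (F r) (u (- r) (u (- s) (E m'))))"
      by (intro sum.cong) (simp_all add: u_u)
    also have "\<dots> = sc (F r) (u (- r) (\<Sum>s\<in>reps m m'. u (- s) (E m')))" by (simp only: sc_sum u_sum)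
    also have "(\<Sum>s\<in>reps m m'. u (- s) (E m')) = (\<Sum>s\<in>uminus ` reps m m'. u s (E m'))"
      by (subst sum.reindex) auto
    also have "\<dots> = nrm m m' (E m')"
    proof (rule nrm_transversal[OF m _ E_fixed])
      show "transversal (uminus ` reps m m') (pideal m') (pideal m :: 'l set)"
      proof (rule transversal_image[OF reps[OF m]])
        show "bij_betw uminus (pideal m) (pideal m :: 'l set)"
          by (rule bij_betw_byWitness[of _ uminus]) auto
        show "- x - - y \<in> pideal m' \<longleftrightarrow> x - y \<in> pideal m'" for x y :: 'l
          using pideal_minus[of "x - y" m'] by simp
      qed
    qed
    also have "\<dots> = E m" by (rule nrm_E[OF m])
    finally show "(\<Sum>s\<in>reps m m'. sc (F (r + s)) (u (- (r + s)) (E m'))) = sc (F r) (u (- r) (E m))" .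
  qed simp
  finally show ?thesis by (simp add: integ_def)
qed

lemma integ_level:
  assumes "admissible n C" "periodic C F n" "n \<le> m" "n \<le> m'" shows "integ C F m = integ C F m'"
  using integ_refine[OF assms(1,2,3)] integ_refine[OF assms(1,2,4)] by simp

lemma integ_split:
  assumes i: "i < m" and F: "periodic (pideal i) F m"
  shows "integ (pideal i) F m = integ (pideal (i + 1)) F m + integ (annulus i) F m"
proof -
  have a: "admissible m (pideal i)" "admissible m (pideal (i + 1))" "admissible m (annulus i)"
    using i by (simp_all add: admissible_pideal admissible_annulus)
  have "transversal (tv m (pideal (i + 1)) \<union> tv m (annulus i)) (pideal m) (pideal (i + 1) \<union> annulus i)"
    by (rule transversal_union[OF tv[OF a(2)] tv[OF a(3)] _ subgroup_pideal])
      (use admissible_add[OF a(2)] admissible_add[OF a(3)] in \<open>auto simp: annulus_def pideal_iff\<close>)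
  then have "integ (pideal i) F m
      = (\<Sum>a\<in>tv m (pideal (i + 1)) \<union> tv m (annulus i). sc (F a) (u (- a) (E m)))"
    using integ_transversal[OF a(1) _ F] pideal_eq_annulus[of i, where ?'a = 'l] by simp
  also have "\<dots> = integ (pideal (i + 1)) F m + integ (annulus i) F m"
    unfolding integ_def
  proof (rule sum.union_disjoint)
    show "finite (tv m (pideal (i + 1)))" "finite (tv m (annulus i))"
      using transversalD(1)[OF tv[OF a(2)]] transversalD(1)[OF tv[OF a(3)]] by auto
    show "tv m (pideal (i + 1)) \<inter> tv m (annulus i) = {}"
      using transversalD(2)[OF tv[OF a(2)]] transversalD(2)[OF tv[OF a(3)]]
      by (fastforce simp: annulus_def pideal_iff)
  qed
  finally show ?thesis .
qed

lemma integ_const: "\<lbrakk>i \<le> m; c \<in> carrier k\<rbrakk> \<Longrightarrow> integ (pideal i) (\<lambda>_. c) m = sc c (E i)"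
proof -
  assume a: "i \<le> m" "c \<in> carrier k"
  have ad: "admissible i (pideal i)" by (simp add: admissible_pideal)
  have "transversal {0} (pideal i) (pideal i :: 'l set)" by (auto simp: transversal_def)
  moreover have p: "periodic (pideal i) (\<lambda>_. c) i" by (rule periodicI) (use a in auto)
  ultimately have "integ (pideal i) (\<lambda>_. c) i = sc c (E i)" using integ_transversal[OF ad] by simp
  then show ?thesis using integ_refine[OF ad p a(1)] by simp
qed

lemma integ_split_iterated:
  assumes "- j \<le> i" "i \<le> m" "periodic (pideal (- j)) F m"
  shows "integ (pideal (- j)) F m = integ (pideal i) F m + (\<Sum>r\<in>{- j..<i}. integ (annulus r) F m)"
  using assms
proof (induction i rule: int_ge_induct)
  case (step i)
  have "periodic (pideal i) F m" using periodic_subset[OF step.prems(2)] pideal_mono[OF step.hyps] by blast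
  then have "integ (pideal i) F m = integ (pideal (i + 1)) F m + integ (annulus i) F m"
    using integ_split[of i m F] step.prems by simp
  moreover have "{- j..<i + 1} = insert i {- j..<i}" using step.hyps by auto
  ultimately show ?case using step by (simp add: add_ac)
qed simp

text \<open>In the coordinate of the big cell \<open>w\<close> is the inversion
  \<open>b = 1 / a\<close>, up to a torus factor. The condition \<open>i \<le> m - n0\<close> makes
  the lower unipotent of the Bruhat identity fix \<open>E m\<close>; the level becomes
  \<open>m - 2 i\<close> as the entries of the torus factor have valuations \<open>- i\<close> and
  \<open>i\<close>.\<close>

lemma w_integ_annulus:
  assumes i: "i < m" "i \<le> m - n0" and H: "periodic (annulus i) H m"
  shows "w (integ (annulus i) H m) = integ (annulus (- i)) (\<lambda>b. \<theta> (diag2 (- 1 / b) b) \<otimes> H (1 / b)) (m - 2 * i)"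
proof -
  have ad: "admissible m (annulus i)" "admissible (m - 2 * i) (annulus (- i))"
    using i by (simp_all add: admissible_pideal admissible_annulus)
  define g where "g = (\<lambda>b. w (sc (H (1 / b)) (u (- (1 / b)) (E m))))"
  have g: "g b = sc (\<theta> (diag2 (- 1 / b) b) \<otimes> H (1 / b)) (u (- b) (E (m - 2 * i)))" if b: "b \<in> annulus (- i)" for b
  proof -
    have nz: "b \<noteq> 0" "val b = - i" using b by (auto simp: annulus_def)
    have "1 / b \<in> annulus i" using nz by (simp add: annulus_def val_divide)
    then have Hc: "H (1 / b) \<in> carrier k" by (rule periodic_closed[OF H])
    have "- b \<in> pideal (n0 - m)" using nz i by (simp add: pideal_iff)
    then have lb: "l (- b) (E m) = E m" by (rule l_E)
    have "w (u (- (1 / b)) (E m)) = u (- b) (D b (- (1 / b)) (E m))"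
      using w_u_bruhat[of "- (1 / b)" "E m"] nz lb by simp
    also have "D b (- (1 / b)) (E m) = sc (\<theta> (diag2 (- 1 / b) b)) (E (m - 2 * i))"
      using D_E[of b "- (1 / b)" m] nz by (simp add: val_divide)
    finally show ?thesis using nz Hc th(1)[of "- 1 / b" b] by (simp add: g_def w_sc u_sc sc_mult sc_commute)
  qed
  have "w (integ (annulus i) H m) = (\<Sum>a\<in>tv m (annulus i). g (1 / a))"
    by (simp add: integ_def w_sum g_def)
  also have "\<dots> = sum g ((/) 1 ` tv m (annulus i))"
    using transversalD(2)[OF tv[OF ad(1)]] by (subst sum.reindex) (auto intro!: inj_onI simp: annulus_def)
  also have "\<dots> = sum g (tv (m - 2 * i) (annulus (- i)))"
  proof (rule transversal_sum_eq[OF transversal_inverse_annulus[OF tv[OF ad(1)]] tv[OF ad(2)] subgroup_pideal])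
    fix x y :: 'l assume xy: "x \<in> annulus (- i)" "y \<in> annulus (- i)" "x - y \<in> pideal (m - 2 * i)"
    have inv: "1 / x \<in> annulus i" "1 / y \<in> annulus i" using xy by (auto simp: annulus_def val_divide)
    have "- (x * y) * (1 / x - 1 / y) = x - y" "val (x * y) = - 2 * i" "x * y \<noteq> 0"
      using xy by (auto simp: annulus_def field_simps val_mult)
    then have d: "1 / x - 1 / y \<in> pideal m"
      using pideal_scale[of "- (x * y)" "1 / x - 1 / y" m] xy(3) by simp
    then have "H (1 / x) = H (1 / y)" by (rule periodicD[OF H inv])
    moreover have "u (- (1 / x)) (E m) = u (- (1 / y)) (E m)" by (rule u_minus_E[OF d])
    ultimately show "g x = g y" by (simp only: g_def)
  qed
  also have "\<dots> = integ (annulus (- i)) (\<lambda>b. \<theta> (diag2 (- 1 / b) b) \<otimes> H (1 / b)) (m - 2 * i)"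
    unfolding integ_def using transversalD(2)[OF tv[OF ad(2)]] g by (intro sum.cong) auto
  finally show ?thesis .
qed

end

section \<open>Functions in the induced representation\<close>

lemma Ind_borel_simps:
  "act (Ind_borel k \<theta>) x f = (\<lambda>g\<in>carrier GL2. f (g ** x))"
  "add (Ind_borel k \<theta>) f f' = (\<lambda>g\<in>carrier GL2. f g \<oplus>\<^bsub>k\<^esub> f' g)"
  "smult (Ind_borel k \<theta>) a f = (\<lambda>g\<in>carrier GL2. a \<otimes>\<^bsub>k\<^esub> f g)"
  "zero (Ind_borel k \<theta>) = (\<lambda>g\<in>carrier GL2. \<zero>\<^bsub>k\<^esub>)"
  by (simp_all add: Ind_borel_def smooth_ind_def GL2_def)

lemma GL2_simps: "carrier GL2 = {A. invertible A}" "x \<otimes>\<^bsub>GL2\<^esub> y = x ** y" "\<one>\<^bsub>GL2\<^esub> = mat 1"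
  by (simp_all add: GL2_def)

lemma Ind_borel_carrier:
  "f \<in> carrier (Ind_borel k \<theta>) \<longleftrightarrow> f \<in> carrier GL2 \<rightarrow>\<^sub>E carrier k \<and>
    (\<forall>b g. b \<in> borel_subgroup \<longrightarrow> invertible g \<longrightarrow> f (b ** g) = \<theta> (diag2 (b $ 1 $ 1) (b $ 2 $ 2)) \<otimes>\<^bsub>k\<^esub> f g) \<and>
    (\<exists>K. subgroup K GL2 \<and> openin (top_of_set (carrier GL2)) K \<and> (\<forall>g x. invertible g \<longrightarrow> x \<in> K \<longrightarrow> f (g ** x) = f g))"
  by (auto simp: Ind_borel_def smooth_ind_def GL2_simps)

lemma matrix_inv:
  fixes A :: "'l::field ^ 'n ^ 'n"
  assumes "invertible A"
  shows "A ** matrix_inv A = mat 1" "matrix_inv A ** A = mat 1" "invertible (matrix_inv A)"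
proof -
  have "A ** matrix_inv A = mat 1 \<and> matrix_inv A ** A = mat 1"
    unfolding matrix_inv_def using assms unfolding invertible_def by (rule someI_ex)
  then show "A ** matrix_inv A = mat 1" "matrix_inv A ** A = mat 1" "invertible (matrix_inv A)"
    by (auto simp: invertible_def)
qed

lemma invertible_mat_1: "invertible (mat 1 :: 'l::field ^ 'n ^ 'n)"
  unfolding invertible_def by (intro exI[of _ "mat 1"]) simp

lemma group_GL2: "group (GL2 :: ('l::field ^ 2 ^ 2) monoid)"
proof (rule groupI)
  show "\<exists>y\<in>carrier GL2. y \<otimes>\<^bsub>GL2\<^esub> x = \<one>\<^bsub>GL2\<^esub>" if "x \<in> carrier GL2" for x :: "'l ^ 2 ^ 2"
  proof
    have x: "invertible x" using that by (simp add: GL2_simps)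
    show "matrix_inv x \<in> carrier GL2" using matrix_inv(3)[OF x] by (simp add: GL2_simps)
    show "matrix_inv x \<otimes>\<^bsub>GL2\<^esub> x = \<one>\<^bsub>GL2\<^esub>" using matrix_inv(2)[OF x] by (simp add: GL2_simps)
  qed
qed (auto simp: GL2_simps invertible_mult matrix_mul_assoc invertible_mat_1)

definition congruence :: "int \<Rightarrow> ('l::nonarch_local_field ^ 2 ^ 2) set"
  where "congruence n = {y. invertible y \<and> (\<forall>i j. y $ i $ j - mat 1 $ i $ j \<in> pideal n)}"

lemma congruence_mk2: "mk2 a b c d \<in> congruence n \<longleftrightarrow>
    a * d - b * c \<noteq> 0 \<and> a - 1 \<in> pideal n \<and> b \<in> pideal n \<and> c \<in> pideal n \<and> d - 1 \<in> pideal n"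
  by (auto simp: congruence_def mat_eq_mk2 forall_2)

lemma congruence_mono: "\<lbrakk>y \<in> congruence m; n \<le> m\<rbrakk> \<Longrightarrow> y \<in> congruence n"
  unfolding congruence_def using pideal_monoD by blast

text \<open>If all entries of both outer matrices lie in \<open>pideal r\<close>, multiplying by one
  from each of them shifts an ideal by \<open>2 r\<close>, so \<open>N = - 2 r\<close>
  works.\<close>

lemma matrix_conjugation_bound:
  fixes x x' :: "'l::nonarch_local_field ^ 2 ^ 2"
  shows "\<exists>N. \<forall>n z. (\<forall>i j. z $ i $ j \<in> pideal (n + N)) \<longrightarrow> (\<forall>i j. (x' ** z ** x) $ i $ j \<in> pideal n)"
proof -
  have "finite (range (\<lambda>(i, j). x $ i $ j) \<union> range (\<lambda>(i, j). x' $ i $ j))" by simp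
  then obtain r where "range (\<lambda>(i, j). x $ i $ j) \<union> range (\<lambda>(i, j). x' $ i $ j) \<subseteq> pideal r"
    using exists_pideal_finite by blast
  then have r: "x $ i $ j \<in> pideal r" "x' $ i $ j \<in> pideal r" for i j by auto
  have "(x' ** z ** x) $ i $ j \<in> pideal n" if z: "\<forall>i j. z $ i $ j \<in> pideal (n + (- 2 * r))" for n z i j
  proof -
    have "x' $ i $ a * z $ a $ b * x $ b $ j \<in> pideal n" for a b
      using pideal_mult[OF pideal_mult[OF r(2)[of i a] z[rule_format, of a b]] r(1)[of b j]] by simp
    then show ?thesis
      by (simp add: matrix_matrix_mult_def sum_2 distrib_right pideal_add)
  qed
  then show ?thesis by blast
qed

lemma congruence_conjugate:
  fixes x :: "'l::nonarch_local_field ^ 2 ^ 2"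
  assumes x: "invertible x"
  shows "\<exists>m. \<forall>y\<in>congruence m. matrix_inv x ** y ** x \<in> congruence n"
proof -
  obtain N where N: "\<And>n z i j. (\<forall>i j. z $ i $ j \<in> pideal (n + N)) \<Longrightarrow> (matrix_inv x ** z ** x) $ i $ j \<in> pideal n"
    using matrix_conjugation_bound[of "matrix_inv x" x] by blast
  have "matrix_inv x ** y ** x \<in> congruence n" if y: "y \<in> congruence (n + N)" for y
  proof -
    have "matrix_inv x ** (y - mat 1) ** x = matrix_inv x ** y ** x - mat 1"
      by (simp add: matrix_mul_assoc matrix_inv(2)[OF x] vec_eq_iff forall_2 matrix_matrix_mult_def sum_2 algebra_simps)
        (use matrix_inv(2)[OF x] in \<open>simp add: vec_eq_iff forall_2 matrix_matrix_mult_def sum_2 mat_def algebra_simps\<close>)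
    moreover have "(matrix_inv x ** (y - mat 1) ** x) $ i $ j \<in> pideal n" for i j
      by (rule N) (use y in \<open>simp add: congruence_def\<close>)
    moreover have "invertible (matrix_inv x)" by (rule matrix_inv(3)[OF x])
    ultimately show ?thesis using y x by (simp add: congruence_def invertible_mult)
  qed
  then show ?thesis by blast
qed

lemma pideal_divide_unit:
  fixes x s :: "'l::nonarch_local_field"
  assumes "x \<in> pideal n" "s - 1 \<in> pideal 1" shows "x / s \<in> pideal n" "s \<noteq> 0" "val s = 0"
proof -
  show s: "s \<noteq> 0" "val s = 0" using val_add_eq[of 1 "s - 1" 1] assms(2) by auto
  show "x / s \<in> pideal n" using assms(1) s by (cases "x = 0") (simp_all add: pideal_iff val_divide)
qed

lemma congruence_det:
  fixes a b c d :: "'l::nonarch_local_field"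
  assumes y: "mk2 a b c d \<in> congruence n" and n: "0 \<le> n"
  shows "a * d - b * c - 1 \<in> pideal n"
proof -
  have 0: "a - 1 \<in> pideal n" "b \<in> pideal n" "c \<in> pideal n" "d - 1 \<in> pideal n"
    using y by (auto simp: congruence_mk2)
  have d0: "d \<in> pideal 0" "c \<in> pideal 0"
    using pideal_add[OF pideal_monoD[OF 0(4) n], of 1] pideal_monoD[OF 0(3) n] by simp_all
  have "(a - 1) * d + (d - 1) - b * c \<in> pideal n"
    using pideal_mult[OF 0(1) d0(1)] pideal_mult[OF 0(2) d0(2)] 0(4) by (simp add: pideal_add pideal_diff)
  then show ?thesis by (simp add: algebra_simps)
qed

lemma congruence_inverse:
  assumes y: "y \<in> (congruence n :: ('l::nonarch_local_field ^ 2 ^ 2) set)" and n: "1 \<le> n"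
  shows "\<exists>y'\<in>congruence n. y ** y' = mat 1"
proof -
  obtain a b c d where y_eq: "y = mk2 a b c d" by (metis mk2_eta)
  define s where "s = a * d - b * c"
  have c: "s \<noteq> 0" "a - 1 \<in> pideal n" "b \<in> pideal n" "c \<in> pideal n" "d - 1 \<in> pideal n"
    using y by (auto simp: y_eq s_def congruence_mk2)
  have s: "s - 1 \<in> pideal n" using congruence_det[of a b c d n] y n by (simp add: s_def y_eq)
  have s1: "s - 1 \<in> pideal 1" by (rule pideal_monoD[OF s n])
  note dv = pideal_divide_unit(1)[OF _ s1]
  have "(d - 1) - (s - 1) \<in> pideal n" "(a - 1) - (s - 1) \<in> pideal n" using c s by (simp_all only: pideal_diff)
  from this[THEN dv] have "d / s - 1 \<in> pideal n" "a / s - 1 \<in> pideal n" using c(1) by (simp_all add: diff_divide_distrib)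
  moreover have "- b / s \<in> pideal n" "- c / s \<in> pideal n" using dv[OF c(3)] dv[OF c(4)] by simp_all
  moreover have "d / s * (a / s) - (- b / s) * (- c / s) = 1 / s"
  proof -
    have "d / s * (a / s) - (- b / s) * (- c / s) = (a * d - b * c) / (s * s)" by (simp add: diff_divide_distrib mult.commute)
    then show ?thesis using c(1) by (simp flip: s_def)
  qed
  ultimately have "mk2 (d / s) (- b / s) (- c / s) (a / s) \<in> congruence n"
    using c(1) unfolding congruence_mk2 by simp
  moreover have "y ** mk2 (d / s) (- b / s) (- c / s) (a / s) = mat 1"
    using c(1) by (simp add: y_eq mk2_mult mat_eq_mk2 mk2_eq_iff s_def diff_divide_distrib[symmetric] mult.commute)
  ultimately show ?thesis by blast
qed

text \<open>The open subgroup demanded by smooth induction is taken to be the full right stabiliser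
  of \<open>f\<close>; it is open because it contains a congruence subgroup.\<close>

lemma Ind_borelI:
  fixes f :: "'l::nonarch_local_field ^ 2 ^ 2 \<Rightarrow> 'k"
  assumes f: "f \<in> carrier GL2 \<rightarrow>\<^sub>E carrier k"
    and P: "\<And>b g. \<lbrakk>b \<in> borel_subgroup; invertible g\<rbrakk> \<Longrightarrow> f (b ** g) = \<theta> (diag2 (b $ 1 $ 1) (b $ 2 $ 2)) \<otimes>\<^bsub>k\<^esub> f g"
    and n: "\<And>g y. \<lbrakk>invertible g; y \<in> congruence n\<rbrakk> \<Longrightarrow> f (g ** y) = f g"
  shows "f \<in> carrier (Ind_borel k \<theta>)"
proof -
  interpret GL2: group "GL2 :: ('l ^ 2 ^ 2) monoid" by (rule group_GL2)
  define K where "K = {x :: 'l ^ 2 ^ 2. invertible x \<and> (\<forall>g. invertible g \<longrightarrow> f (g ** x) = f g)}"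
  have K: "subgroup K GL2"
  proof (rule GL2.subgroupI)
    show "K \<subseteq> carrier GL2" by (auto simp: K_def GL2_simps)
    show "K \<noteq> {}" by (auto simp: K_def intro!: exI[of _ "mat 1"] invertible_mat_1)
    fix x y assume x: "x \<in> K" and y: "y \<in> K"
    show "x \<otimes>\<^bsub>GL2\<^esub> y \<in> K" using x y by (simp add: K_def GL2_simps invertible_mult matrix_mul_assoc)
    have xc: "x \<in> carrier GL2" using x by (simp add: K_def GL2_simps)
    define x' where "x' = inv\<^bsub>GL2\<^esub> x"
    have x': "invertible x'" "x' ** x = mat 1" using GL2.inv_closed[OF xc] GL2.l_inv[OF xc] by (simp_all add: x'_def GL2_simps)
    have "f (g ** x') = f g" if g: "invertible g" for g
    proof -
      have "f (g ** x' ** x) = f (g ** x')" using x g x' by (simp add: K_def invertible_mult)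
      then show ?thesis using x'(2) by (simp add: matrix_mul_assoc[symmetric])
    qed
    then show "inv\<^bsub>GL2\<^esub> x \<in> K" using x'(1) by (simp add: K_def x'_def)
  qed
  have "openin (top_of_set (carrier GL2)) K"
    unfolding openin_matrix_iff
  proof (intro conjI ballI)
    show "K \<subseteq> carrier GL2" by (auto simp: K_def GL2_simps)
    fix x assume x: "x \<in> K"
    then have ix: "invertible x" by (simp add: K_def)
    obtain N where N: "\<forall>n (z :: 'l ^ 2 ^ 2). (\<forall>i j. z $ i $ j \<in> pideal (n + N)) \<longrightarrow> (\<forall>i j. (matrix_inv x ** z ** mat 1) $ i $ j \<in> pideal n)"
      using matrix_conjugation_bound[of "matrix_inv x" "mat 1"] by (rule exE)
    have "y \<in> K" if y: "invertible y" "\<forall>i j. y $ i $ j - x $ i $ j \<in> pideal (n + N)" for y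
    proof -
      have "matrix_inv x ** (y - x) = matrix_inv x ** y - mat 1"
        using matrix_inv(2)[OF ix] by (simp add: vec_eq_iff forall_2 matrix_matrix_mult_def sum_2 mat_def algebra_simps)
      moreover have "(matrix_inv x ** (y - x)) $ i $ j \<in> pideal n" for i j
        using N[rule_format, of "y - x" n i j] y(2) by simp
      moreover have "invertible (matrix_inv x)" by (rule matrix_inv(3)[OF ix])
      ultimately have c: "matrix_inv x ** y \<in> congruence n" using y by (simp add: congruence_def invertible_mult)
      have "f (g ** y) = f g" if g: "invertible g" for g
      proof -
        have "f (g ** x ** (matrix_inv x ** y)) = f (g ** x)" using n[of "g ** x", OF _ c] g ix by (simp add: invertible_mult)
        moreover have "g ** x ** (matrix_inv x ** y) = g ** y"
          using matrix_inv(1)[OF ix] by (metis matrix_mul_assoc matrix_mul_rid)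
        ultimately show ?thesis using x g by (simp add: K_def)
      qed
      then show ?thesis using y by (simp add: K_def)
    qed
    then show "\<exists>m. \<forall>y\<in>carrier GL2. (\<forall>i j. y $ i $ j - x $ i $ j \<in> pideal m) \<longrightarrow> y \<in> K"
      by (intro exI[of _ "n + N"]) (simp add: GL2_simps)
  qed
  then show ?thesis unfolding Ind_borel_carrier using f P K by (auto simp: K_def)
qed

lemma Ind_borelD:
  fixes f :: "'l::nonarch_local_field ^ 2 ^ 2 \<Rightarrow> 'k"
  assumes f: "f \<in> carrier (Ind_borel k \<theta>)"
  shows "f \<in> carrier GL2 \<rightarrow>\<^sub>E carrier k"
    and "\<And>b g. \<lbrakk>b \<in> borel_subgroup; invertible g\<rbrakk> \<Longrightarrow> f (b ** g) = \<theta> (diag2 (b $ 1 $ 1) (b $ 2 $ 2)) \<otimes>\<^bsub>k\<^esub> f g"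
    and "invertible g \<Longrightarrow> f g \<in> carrier k"
    and "\<exists>n. \<forall>g y. invertible g \<longrightarrow> y \<in> congruence n \<longrightarrow> f (g ** y) = f g"
proof -
  show "f \<in> carrier GL2 \<rightarrow>\<^sub>E carrier k"
    "\<And>b g. \<lbrakk>b \<in> borel_subgroup; invertible g\<rbrakk> \<Longrightarrow> f (b ** g) = \<theta> (diag2 (b $ 1 $ 1) (b $ 2 $ 2)) \<otimes>\<^bsub>k\<^esub> f g"
    using f by (simp_all add: Ind_borel_carrier)
  then show "invertible g \<Longrightarrow> f g \<in> carrier k" by (auto simp: GL2_simps)
  obtain K where K: "subgroup K GL2" "openin (top_of_set (carrier GL2)) K"
    "\<And>g x. invertible g \<Longrightarrow> x \<in> K \<Longrightarrow> f (g ** x) = f g"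
    using f by (auto simp: Ind_borel_carrier)
  have "mat 1 \<in> K" using subgroup.one_closed[OF K(1)] by (simp add: GL2_simps)
  then obtain n where n: "\<And>y. invertible y \<Longrightarrow> \<forall>i j. y $ i $ j - mat 1 $ i $ j \<in> pideal n \<Longrightarrow> y \<in> K"
    using K(2) unfolding openin_matrix_iff GL2_simps by blast
  have "f (g ** y) = f g" if "invertible g" "y \<in> congruence n" for g y
    using K(3)[OF that(1) n] that(2) by (simp add: congruence_def)
  then show "\<exists>n. \<forall>g y. invertible g \<longrightarrow> y \<in> congruence n \<longrightarrow> f (g ** y) = f g" by blast
qed

lemma Ind_borel_eqI:
  assumes "f \<in> extensional (carrier GL2)" "f' \<in> extensional (carrier GL2)" "\<And>g. invertible g \<Longrightarrow> f g = f' g"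
  shows "f = f'"
  using assms by (intro extensionalityI) (auto simp: GL2_simps)

lemma borel_mult_invertible: "\<lbrakk>b \<in> borel_subgroup; invertible g\<rbrakk> \<Longrightarrow> invertible (b ** g)"
  by (simp add: borel_subgroup_def invertible_mult)

lemma borel_diagonal: "b \<in> borel_subgroup \<Longrightarrow> b $ 1 $ 1 \<noteq> 0" "b \<in> borel_subgroup \<Longrightarrow> b $ 2 $ 2 \<noteq> 0"
  by (auto simp: borel_subgroup_def invertible_det_nz det_2)

lemma invertible_GL2 [simp]: "g \<in> carrier GL2 \<longleftrightarrow> invertible g" by (simp add: GL2_simps)

context borel_character
begin

lemma torus_character_trivial:
  shows "\<exists>n\<ge>1. \<forall>a d. a - 1 \<in> pideal n \<longrightarrow> d - 1 \<in> pideal n \<longrightarrow> \<theta> (diag2 a d) = \<one>"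
proof -
  let ?K = "kernel torus (mult_of k) \<theta>"
  have "diag2 1 1 \<in> ?K" using chr(4) diag2_in_torus[of 1 1] by (simp add: kernel_def)
  moreover have "openin (top_of_set (carrier torus)) ?K" using smooth_character by (simp add: smooth_characters_def)
  ultimately obtain n where n: "\<And>y. y \<in> carrier torus \<Longrightarrow> \<forall>i j. y $ i $ j - diag2 1 1 $ i $ j \<in> pideal n \<Longrightarrow> y \<in> ?K"
    unfolding openin_matrix_iff by blast
  have "\<theta> (diag2 a d) = \<one>" if ad: "a - 1 \<in> pideal (max n 1)" "d - 1 \<in> pideal (max n 1)" for a d
  proof -
    have "a - 1 \<in> pideal 1" "d - 1 \<in> pideal 1" "a - 1 \<in> pideal n" "d - 1 \<in> pideal n"
      using ad by (auto elim: pideal_monoD)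
    then have "a \<noteq> 0" "d \<noteq> 0" "\<forall>i j. diag2 a d $ i $ j - diag2 1 1 $ i $ j \<in> pideal n"
      using pideal_divide_unit(2)[of 0 0 a] pideal_divide_unit(2)[of 0 0 d] by (auto simp: diag2_eq_mk2 forall_2)
    then show ?thesis using n[OF diag2_in_torus] by (simp add: kernel_def)
  qed
  then show ?thesis by (intro exI[of _ "max n 1"]) auto
qed

abbreviation "I \<equiv> Ind_borel k \<theta>"

lemma Ind_translate: 
  assumes f: "f \<in> carrier I" and x: "invertible x" shows "act I x f \<in> carrier I"
proof -
  obtain n where n: "\<And>g y. invertible g \<Longrightarrow> y \<in> congruence n \<Longrightarrow> f (g ** y) = f g" using Ind_borelD(4)[OF f] by blast
  obtain m where m: "\<And>y. y \<in> congruence m \<Longrightarrow> matrix_inv x ** y ** x \<in> congruence n"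
    using congruence_conjugate[OF x] by blast
  show ?thesis
  proof (rule Ind_borelI)
    show "act I x f \<in> carrier GL2 \<rightarrow>\<^sub>E carrier k" using Ind_borelD(3)[OF f] x by (auto simp: Ind_borel_simps invertible_mult)
    show "act I x f (b ** g) = \<theta> (diag2 (b $ 1 $ 1) (b $ 2 $ 2)) \<otimes> act I x f g" if "b \<in> borel_subgroup" "invertible g" for b g
      using that Ind_borelD(2)[OF f, of b "g ** x"] x borel_mult_invertible[OF that]
      by (simp add: Ind_borel_simps invertible_mult matrix_mul_assoc)
    show "act I x f (g ** y) = act I x f g" if "invertible g" "y \<in> congruence m" for g y
    proof -
      have "invertible y" using that by (simp add: congruence_def)
      moreover have "g ** x ** (matrix_inv x ** y ** x) = g ** y ** x"
        using matrix_inv(1)[OF x] by (metis matrix_mul_assoc matrix_mul_rid)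
      ultimately show ?thesis using n[of "g ** x", OF _ m[OF that(2)]] that x by (simp add: Ind_borel_simps invertible_mult)
    qed
  qed
qed

lemma Ind_add:
  assumes f: "f \<in> carrier I" and f': "f' \<in> carrier I" shows "f \<oplus>\<^bsub>I\<^esub> f' \<in> carrier I"
proof -
  obtain n where n: "\<And>g y. invertible g \<Longrightarrow> y \<in> congruence n \<Longrightarrow> f (g ** y) = f g" using Ind_borelD(4)[OF f] by blast
  obtain n' where n': "\<And>g y. invertible g \<Longrightarrow> y \<in> congruence n' \<Longrightarrow> f' (g ** y) = f' g" using Ind_borelD(4)[OF f'] by blast
  show ?thesis
  proof (rule Ind_borelI)
    show "f \<oplus>\<^bsub>I\<^esub> f' \<in> carrier GL2 \<rightarrow>\<^sub>E carrier k" using Ind_borelD(3)[OF f] Ind_borelD(3)[OF f'] by (auto simp: Ind_borel_simps)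
    show "(f \<oplus>\<^bsub>I\<^esub> f') (b ** g) = \<theta> (diag2 (b $ 1 $ 1) (b $ 2 $ 2)) \<otimes> (f \<oplus>\<^bsub>I\<^esub> f') g" if "b \<in> borel_subgroup" "invertible g" for b g
    proof -
      from borel_diagonal[OF that(1)] show ?thesis using that Ind_borelD(2,3)[OF f] Ind_borelD(2,3)[OF f'] borel_mult_invertible[OF that] chr(1)
        by (simp add: Ind_borel_simps r_distr)
    qed
    show "(f \<oplus>\<^bsub>I\<^esub> f') (g ** y) = (f \<oplus>\<^bsub>I\<^esub> f') g" if "invertible g" "y \<in> congruence (max n n')" for g y
      using that n[of g y] n'[of g y] congruence_mono[OF that(2), of n] congruence_mono[OF that(2), of n']
      by (simp add: Ind_borel_simps invertible_mult congruence_def)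
  qed
qed

lemma Ind_smult:
  assumes f: "f \<in> carrier I" and c: "c \<in> carrier k" shows "c \<odot>\<^bsub>I\<^esub> f \<in> carrier I"
proof -
  obtain n where n: "\<And>g y. invertible g \<Longrightarrow> y \<in> congruence n \<Longrightarrow> f (g ** y) = f g" using Ind_borelD(4)[OF f] by blast
  show ?thesis
  proof (rule Ind_borelI)
    show "c \<odot>\<^bsub>I\<^esub> f \<in> carrier GL2 \<rightarrow>\<^sub>E carrier k" using Ind_borelD(3)[OF f] c by (auto simp: Ind_borel_simps)
    show "(c \<odot>\<^bsub>I\<^esub> f) (b ** g) = \<theta> (diag2 (b $ 1 $ 1) (b $ 2 $ 2)) \<otimes> (c \<odot>\<^bsub>I\<^esub> f) g" if "b \<in> borel_subgroup" "invertible g" for b g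
    proof -
      from borel_diagonal[OF that(1)] show ?thesis using that Ind_borelD(2,3)[OF f] borel_mult_invertible[OF that] chr(1) c
        by (simp add: Ind_borel_simps m_lcomm)
    qed
    show "(c \<odot>\<^bsub>I\<^esub> f) (g ** y) = (c \<odot>\<^bsub>I\<^esub> f) g" if "invertible g" "y \<in> congruence n" for g y
      using that n[of g y] by (simp add: Ind_borel_simps invertible_mult congruence_def)
  qed
qed

lemma Ind_zero: "\<zero>\<^bsub>I\<^esub> \<in> carrier I"
proof (rule Ind_borelI[where n = 0])
  show "\<zero>\<^bsub>I\<^esub> (b ** g) = \<theta> (diag2 (b $ 1 $ 1) (b $ 2 $ 2)) \<otimes> \<zero>\<^bsub>I\<^esub> g" if "b \<in> borel_subgroup" "invertible g" for b g
  proof -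
    from borel_diagonal[OF that(1)] show ?thesis using that borel_mult_invertible[OF that] chr(1) by (simp add: Ind_borel_simps)
  qed
qed (auto simp: Ind_borel_simps congruence_def invertible_mult)

lemma Ind_extensional: "f \<in> carrier I \<Longrightarrow> f \<in> extensional (carrier GL2)"
  using Ind_borelD(1)[of f k \<theta>] by (simp add: PiE_iff)

lemma Ind_representation: "representation GL2 k I"
proof -
  note cl = Ind_borelD(3) and ext = Ind_extensional
  have ag: "abelian_group I"
  proof (rule abelian_groupI)
    fix f assume f: "f \<in> carrier I"
    show "\<zero>\<^bsub>I\<^esub> \<oplus>\<^bsub>I\<^esub> f = f" using cl[OF f] ext[OF f] by (intro Ind_borel_eqI) (auto simp: Ind_borel_simps)
    show "\<exists>y\<in>carrier I. y \<oplus>\<^bsub>I\<^esub> f = \<zero>\<^bsub>I\<^esub>"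
    proof
      show "(\<ominus> \<one>) \<odot>\<^bsub>I\<^esub> f \<in> carrier I" using f by (intro Ind_smult) auto
      show "(\<ominus> \<one>) \<odot>\<^bsub>I\<^esub> f \<oplus>\<^bsub>I\<^esub> f = \<zero>\<^bsub>I\<^esub>" using cl[OF f]
        by (intro Ind_borel_eqI) (auto simp: Ind_borel_simps l_minus l_neg)
    qed
  next
    fix f f' f'' assume f: "f \<in> carrier I" "f' \<in> carrier I" "f'' \<in> carrier I"
    show "(f \<oplus>\<^bsub>I\<^esub> f') \<oplus>\<^bsub>I\<^esub> f'' = f \<oplus>\<^bsub>I\<^esub> (f' \<oplus>\<^bsub>I\<^esub> f'')"
      using cl[OF f(1)] cl[OF f(2)] cl[OF f(3)] by (intro Ind_borel_eqI) (auto simp: Ind_borel_simps a_assoc)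
  next
    fix f f' assume f: "f \<in> carrier I" "f' \<in> carrier I"
    show "f \<oplus>\<^bsub>I\<^esub> f' = f' \<oplus>\<^bsub>I\<^esub> f"
      using cl[OF f(1)] cl[OF f(2)] by (intro Ind_borel_eqI) (auto simp: Ind_borel_simps a_comm)
  qed (auto intro: Ind_add Ind_zero)
  have "module k I"
  proof (rule moduleI[OF is_cring ag])
    fix a b f assume "a \<in> carrier k" "b \<in> carrier k" "f \<in> carrier I"
    note h = this cl[OF this(3)] ext[OF this(3)]
    show "a \<odot>\<^bsub>I\<^esub> f \<in> carrier I" using h by (intro Ind_smult)
    show "(a \<oplus> b) \<odot>\<^bsub>I\<^esub> f = a \<odot>\<^bsub>I\<^esub> f \<oplus>\<^bsub>I\<^esub> b \<odot>\<^bsub>I\<^esub> f" "(a \<otimes> b) \<odot>\<^bsub>I\<^esub> f = a \<odot>\<^bsub>I\<^esub> (b \<odot>\<^bsub>I\<^esub> f)"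
      using h by (auto intro!: Ind_borel_eqI simp: Ind_borel_simps l_distr m_assoc)
  next
    fix a f f' assume "a \<in> carrier k" "f \<in> carrier I" "f' \<in> carrier I"
    note h = this cl[OF this(2)] cl[OF this(3)]
    show "a \<odot>\<^bsub>I\<^esub> (f \<oplus>\<^bsub>I\<^esub> f') = a \<odot>\<^bsub>I\<^esub> f \<oplus>\<^bsub>I\<^esub> a \<odot>\<^bsub>I\<^esub> f'"
      using h by (auto intro!: Ind_borel_eqI simp: Ind_borel_simps r_distr)
  next
    fix f assume "f \<in> carrier I" then show "\<one> \<odot>\<^bsub>I\<^esub> f = f"
      using cl[of f] ext[of f] by (intro Ind_borel_eqI) (auto simp: Ind_borel_simps)
  qed
  then show ?thesis
    using group_GL2[where ?'l = 'l] field_axioms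
  proof (intro representation.intro representation_axioms.intro)
    fix g :: "'l ^ 2 ^ 2" and f assume g: "g \<in> carrier GL2" and f: "f \<in> carrier I"
    show "act I g f \<in> carrier I" using Ind_translate[OF f] g by simp
    show "act I g (f \<oplus>\<^bsub>I\<^esub> f') = act I g f \<oplus>\<^bsub>I\<^esub> act I g f'" for f'
      using g by (intro Ind_borel_eqI) (auto simp: Ind_borel_simps invertible_mult)
    show "act I g (a \<odot>\<^bsub>I\<^esub> f) = a \<odot>\<^bsub>I\<^esub> act I g f" for a
      using g by (intro Ind_borel_eqI) (auto simp: Ind_borel_simps invertible_mult)
    show "act I (g \<otimes>\<^bsub>GL2\<^esub> h) f = act I g (act I h f)" if "h \<in> carrier GL2" for h :: "'l ^ 2 ^ 2"
      using g that by (intro Ind_borel_eqI) (auto simp: Ind_borel_simps invertible_mult matrix_mul_assoc GL2_simps)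
  next
    fix f assume "f \<in> carrier I" then show "act I \<one>\<^bsub>GL2\<^esub> f = f"
      using ext by (intro Ind_borel_eqI) (auto simp: Ind_borel_simps GL2_simps)
  qed auto
qed


text \<open>Only the unipotent directions are recorded. They control \<open>f\<close> on the big
  cell and on the opposite cell, and this is all that the integrals see.\<close>

definition level :: "('l ^ 2 ^ 2 \<Rightarrow> 'k) \<Rightarrow> int \<Rightarrow> bool"
  where "level f n \<longleftrightarrow> (\<forall>g a. invertible g \<longrightarrow> a \<in> pideal n \<longrightarrow>
    f (g ** mk2 1 a 0 1) = f g \<and> f (g ** mk2 1 0 a 1) = f g)"

lemma level_mono: "\<lbrakk>level f n; n \<le> m\<rbrakk> \<Longrightarrow> level f m"
  unfolding level_def using pideal_monoD by blast

lemma exists_level: "f \<in> carrier I \<Longrightarrow> \<exists>n. level f n"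
proof -
  assume f: "f \<in> carrier I"
  obtain n where n: "\<And>g y. invertible g \<Longrightarrow> y \<in> congruence n \<Longrightarrow> f (g ** y) = f g" using Ind_borelD(4)[OF f] by blast
  have "level f n" unfolding level_def
  proof (intro allI impI conjI)
    fix g :: "'l ^ 2 ^ 2" and a :: 'l assume "invertible g" "a \<in> pideal n"
    then show "f (g ** mk2 1 a 0 1) = f g" "f (g ** mk2 1 0 a 1) = f g" by (simp_all add: n congruence_mk2)
  qed
  then show ?thesis by blast
qed

lemma level_big_cell: "\<lbrakk>level f n; x - y \<in> pideal n\<rbrakk> \<Longrightarrow> f (mk2 0 1 1 x) = f (mk2 0 1 1 y)"
proof -
  assume a: "level f n" "x - y \<in> pideal n"
  have "mk2 0 1 1 y ** mk2 1 (x - y) 0 1 = mk2 0 1 1 x" by (simp add: mk2_mult)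
  moreover have "f (mk2 0 1 1 y ** mk2 1 (x - y) 0 1) = f (mk2 0 1 1 y)"
    using a unfolding level_def by simp
  ultimately show ?thesis by simp
qed

lemma level_opposite_cell: "\<lbrakk>level f n; x - y \<in> pideal n\<rbrakk> \<Longrightarrow> f (mk2 1 0 x 1) = f (mk2 1 0 y 1)"
proof -
  assume a: "level f n" "x - y \<in> pideal n"
  have "mk2 1 0 y 1 ** mk2 1 0 (x - y) 1 = mk2 1 0 x 1" by (simp add: mk2_mult)
  moreover have "f (mk2 1 0 y 1 ** mk2 1 0 (x - y) 1) = f (mk2 1 0 y 1)"
    using a unfolding level_def by simp
  ultimately show ?thesis by simp
qed

lemma Ind_inverse:
  assumes f: "f \<in> carrier I" and a: "a \<noteq> 0"
  shows "f (mk2 0 1 1 a) = \<theta> (diag2 (- 1 / a) a) \<otimes> f (mk2 1 0 (1 / a) 1)"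
proof -
  have "mk2 (- 1 / a) 1 0 a ** mk2 1 0 (1 / a) 1 = mk2 0 1 1 a" using a by (simp add: mk2_mult)
  then show ?thesis
    using Ind_borelD(2)[OF f, of "mk2 (- 1 / a) 1 0 a" "mk2 1 0 (1 / a) 1"] a by (simp add: borel_subgroup_def)
qed

text \<open>A matrix \<open>g\<close> of the big cell is an upper triangular matrix with diagonal
  entries \<open>- det g / g $ 2 $ 1\<close> and \<open>g $ 2 $ 1\<close>, times
  \<open>mk2 0 1 1 z\<close> with \<open>z = g $ 2 $ 2 / g $ 2 $ 1\<close>. So this is the element
  of the induced representation whose restriction to the coordinate \<open>z\<close> is the
  indicator of \<open>pideal m\<close>.\<close>

definition bump :: "int \<Rightarrow> 'l ^ 2 ^ 2 \<Rightarrow> 'k"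
  where "bump m = (\<lambda>g\<in>carrier GL2. if g $ 2 $ 1 \<noteq> 0 \<and> g $ 2 $ 2 / g $ 2 $ 1 \<in> pideal m
    then \<theta> (diag2 (- det g / g $ 2 $ 1) (g $ 2 $ 1)) else \<zero>)"

lemma bump_eq: "invertible g \<Longrightarrow> bump m g = (if g $ 2 $ 1 \<noteq> 0 \<and> g $ 2 $ 2 / g $ 2 $ 1 \<in> pideal m
    then \<theta> (diag2 (- det g / g $ 2 $ 1) (g $ 2 $ 1)) else \<zero>)"
  by (simp add: bump_def)

lemma bump_closed: "invertible g \<Longrightarrow> bump m g \<in> carrier k"
  by (simp add: bump_eq chr(1) invertible_det_nz)

lemma mat_mult_nth: "(g ** y) $ i $ j = g $ i $ 1 * y $ 1 $ j + g $ i $ 2 * y $ 2 $ j" for g y :: "'l ^ 2 ^ 2"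
  by (simp add: matrix_matrix_mult_def sum_2)

text \<open>Right multiplication by \<open>y\<close> replaces \<open>z\<close> by
  \<open>(b + z d) / s\<close> with \<open>s = a + z c\<close>, and multiplies the diagonal entries
  by \<open>\<delta> / s\<close> and \<open>s\<close>. The three bounds on \<open>n\<close> make the
  latter trivial for \<open>\<theta>\<close> and keep the new \<open>z\<close> in
  \<open>pideal m\<close>.\<close>

lemma bump_congruence_aux:
  assumes N: "1 \<le> N" "\<And>a d. \<lbrakk>a - 1 \<in> pideal N; d - 1 \<in> pideal N\<rbrakk> \<Longrightarrow> \<theta> (diag2 a d) = \<one>"
    and n: "N \<le> n" "N - m \<le> n" "m \<le> n"
    and g: "invertible g" "g $ 2 $ 1 \<noteq> 0" "g $ 2 $ 2 / g $ 2 $ 1 \<in> pideal m"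
    and y: "y \<in> congruence n"
  shows "bump m (g ** y) = bump m g"
proof -
  obtain a b c d where y_eq: "y = mk2 a b c d" by (metis mk2_eta)
  define z where "z = g $ 2 $ 2 / g $ 2 $ 1"
  define s where "s = a + z * c"
  define \<delta> where "\<delta> = a * d - b * c"
  have c: "\<delta> \<noteq> 0" "a - 1 \<in> pideal n" "b \<in> pideal n" "c \<in> pideal n" "d - 1 \<in> pideal n"
    using y by (auto simp: y_eq \<delta>_def congruence_mk2)
  have z: "z \<in> pideal m" "g $ 2 $ 2 = z * g $ 2 $ 1" using g by (simp_all add: z_def)
  have d0: "d \<in> pideal 0" using pideal_add[OF pideal_monoD[OF c(5)], of 0 1] n N(1) by simp
  have "(a - 1) + z * c \<in> pideal N"
    using pideal_monoD[OF c(2) n(1)] pideal_monoD[OF pideal_mult[OF z(1) c(4)], of N] n by (simp add: pideal_add)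
  then have s: "s - 1 \<in> pideal N" by (simp add: s_def algebra_simps)
  have s1: "s - 1 \<in> pideal 1" by (rule pideal_monoD[OF s N(1)])
  note dv = pideal_divide_unit(1)[OF _ s1]
  have s0: "s \<noteq> 0" by (rule pideal_divide_unit(2)[OF zero_in_pideal s1])
  have "\<delta> - 1 \<in> pideal n" using congruence_det[of a b c d n] y n N(1) by (simp add: y_eq \<delta>_def)
  then have "(\<delta> - 1) - (s - 1) \<in> pideal N" using s pideal_monoD[OF _ n(1)] by (blast intro: pideal_diff)
  from dv[OF this] have \<delta>: "\<delta> / s - 1 \<in> pideal N" using s0 by (simp add: diff_divide_distrib)
  have "b + z * d \<in> pideal m"
    using pideal_monoD[OF c(3) n(3)] pideal_mult[OF z(1) d0] by (simp add: pideal_add)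
  from dv[OF this] have r: "(b + z * d) / s \<in> pideal m" .
  have e21: "(g ** y) $ 2 $ 1 = g $ 2 $ 1 * s" using z(2) by (simp add: mat_mult_nth y_eq s_def algebra_simps)
  have "(g ** y) $ 2 $ 2 = g $ 2 $ 1 * (b + z * d)" using z(2) by (simp add: mat_mult_nth y_eq algebra_simps)
  then have e22: "(g ** y) $ 2 $ 2 / (g ** y) $ 2 $ 1 = (b + z * d) / s" using g(2) e21 by simp
  have dt: "- det (g ** y) / (g ** y) $ 2 $ 1 = - det g / g $ 2 $ 1 * (\<delta> / s)"
  proof -
    have "det y = \<delta>" by (simp add: y_eq \<delta>_def)
    then show ?thesis by (simp add: det_mul e21)
  qed
  have nz: "det g \<noteq> 0" using g(1) by (simp add: invertible_det_nz)
  have iv: "invertible (g ** y)" using g(1) y by (simp add: invertible_mult congruence_def)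
  have "g $ 2 $ 1 * s \<noteq> 0 \<and> (b + z * d) / s \<in> pideal m" using g(2) s0 r by simp
  then have "bump m (g ** y) = \<theta> (diag2 (- det g / g $ 2 $ 1 * (\<delta> / s)) (g $ 2 $ 1 * s))"
    unfolding bump_eq[OF iv] e22 dt unfolding e21 by (rule if_P)
  also have "\<dots> = \<theta> (diag2 (- det g / g $ 2 $ 1) (g $ 2 $ 1)) \<otimes> \<theta> (diag2 (\<delta> / s) s)"
    using g(2) s0 nz c(1) by (intro chr(3)) auto
  also have "\<dots> = bump m g" using g nz by (simp add: N(2)[OF \<delta> s] bump_eq chr(1))
  finally show ?thesis .
qed

lemma bump_Ind: "bump m \<in> carrier I"
proof -
  obtain N where N: "1 \<le> N" "\<And>a d. \<lbrakk>a - 1 \<in> pideal N; d - 1 \<in> pideal N\<rbrakk> \<Longrightarrow> \<theta> (diag2 a d) = \<one>"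
    using torus_character_trivial by blast
  define n where "n = max N (max (N - m) m)"
  show ?thesis
  proof (rule Ind_borelI)
    show "bump m \<in> carrier GL2 \<rightarrow>\<^sub>E carrier k" using bump_closed by (auto simp: bump_def)
    fix g :: "'l ^ 2 ^ 2" assume g: "invertible g"
    show "bump m (b ** g) = \<theta> (diag2 (b $ 1 $ 1) (b $ 2 $ 2)) \<otimes> bump m g" if b: "b \<in> borel_subgroup" for b
    proof -
      have b': "b $ 2 $ 1 = 0" "b $ 1 $ 1 \<noteq> 0" "b $ 2 $ 2 \<noteq> 0" "det b = b $ 1 $ 1 * b $ 2 $ 2"
        using b by (auto simp: borel_subgroup_def invertible_det_nz det_2)
      have nz: "det g \<noteq> 0" using g by (simp add: invertible_det_nz)
      show ?thesis
      proof (cases "g $ 2 $ 1 = 0")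
        case False
        have "\<theta> (diag2 (b $ 1 $ 1 * (- det g / g $ 2 $ 1)) (b $ 2 $ 2 * g $ 2 $ 1))
            = \<theta> (diag2 (b $ 1 $ 1) (b $ 2 $ 2)) \<otimes> \<theta> (diag2 (- det g / g $ 2 $ 1) (g $ 2 $ 1))"
          using b' False nz by (intro chr(3)) auto
        then show ?thesis using b' False g borel_mult_invertible[OF b g] chr(1)[of "b $ 1 $ 1" "b $ 2 $ 2"]
          by (simp add: bump_eq mat_mult_nth det_mul)
      qed (use b' g borel_mult_invertible[OF b g] chr(1)[of "b $ 1 $ 1" "b $ 2 $ 2"] in \<open>simp add: bump_eq mat_mult_nth\<close>)
    qed
    show "bump m (g ** y) = bump m g" if y: "y \<in> congruence n" for y
    proof -
      let ?P = "\<lambda>g :: 'l ^ 2 ^ 2. g $ 2 $ 1 \<noteq> 0 \<and> g $ 2 $ 2 / g $ 2 $ 1 \<in> pideal m"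
      have nn: "N \<le> n" "N - m \<le> n" "m \<le> n" "1 \<le> n" using N(1) by (auto simp: n_def)
      have gy: "invertible (g ** y)" using g y by (simp add: invertible_mult congruence_def)
      obtain y' where y': "y' \<in> congruence n" "y ** y' = mat 1" using congruence_inverse[OF y nn(4)] by blast
      \<comment> \<open>If \<open>g y\<close> lies in the support, the first case is applied to
        \<open>g y\<close> and the inverse of \<open>y\<close>.\<close>
      consider "?P g" | "?P (g ** y)" | "\<not> ?P g" "\<not> ?P (g ** y)" by blast
      then show ?thesis
      proof cases
        case 1 then show ?thesis using bump_congruence_aux[OF N nn(1-3) g _ _ y] by blast
      next
        case 2
        then have "bump m (g ** y ** y') = bump m (g ** y)" using bump_congruence_aux[OF N nn(1-3) gy _ _ y'(1)] by blast
        then show ?thesis by (simp add: matrix_mul_assoc[symmetric] y'(2))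
      next
        case 3 show ?thesis unfolding bump_eq[OF g] bump_eq[OF gy] if_not_P[OF 3(1)] if_not_P[OF 3(2)] ..
      qed
    qed
  qed
qed

lemma bump_u:
  assumes g: "invertible g"
  shows "bump m (g ** mk2 1 a 0 1) = (if g $ 2 $ 1 \<noteq> 0 \<and> g $ 2 $ 2 / g $ 2 $ 1 + a \<in> pideal m
    then \<theta> (diag2 (- det g / g $ 2 $ 1) (g $ 2 $ 1)) else \<zero>)"
  using g by (simp add: bump_eq invertible_mult mat_mult_nth det_mul add_divide_distrib add.commute)

lemma bump_D:
  assumes g: "invertible g" and a: "a \<noteq> 0" "d \<noteq> 0"
  shows "bump m (g ** mk2 a 0 0 d) = \<theta> (diag2 d a) \<otimes> bump (m + val a - val d) g"
proof (cases "g $ 2 $ 1 = 0")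
  case False
  have nz: "det g \<noteq> 0" using g by (simp add: invertible_det_nz)
  have "g $ 2 $ 2 * d / (g $ 2 $ 1 * a) = (d / a) * (g $ 2 $ 2 / g $ 2 $ 1)" by (simp add: mult.commute)
  then have 1: "g $ 2 $ 2 * d / (g $ 2 $ 1 * a) \<in> pideal m \<longleftrightarrow> g $ 2 $ 2 / g $ 2 $ 1 \<in> pideal (m + val a - val d)"
    using pideal_scale[of "d / a" "g $ 2 $ 2 / g $ 2 $ 1" "m + val a - val d"] a by (simp add: val_divide)
  have "- (det g * (a * d)) / (g $ 2 $ 1 * a) = d * (- det g / g $ 2 $ 1)" using a by simp
  moreover have "\<theta> (diag2 (d * (- det g / g $ 2 $ 1)) (a * g $ 2 $ 1)) = \<theta> (diag2 d a) \<otimes> \<theta> (diag2 (- det g / g $ 2 $ 1) (g $ 2 $ 1))"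
    using a nz False by (intro chr(3)) auto
  ultimately have 2: "\<theta> (diag2 (- (det g * (a * d)) / (g $ 2 $ 1 * a)) (g $ 2 $ 1 * a))
      = \<theta> (diag2 d a) \<otimes> \<theta> (diag2 (- det g / g $ 2 $ 1) (g $ 2 $ 1))" by (simp only: mult.commute)
  have i: "invertible (g ** mk2 a 0 0 d)" using g a by (simp add: invertible_mult)
  have e: "(g ** mk2 a 0 0 d) $ 2 $ 1 = g $ 2 $ 1 * a" "(g ** mk2 a 0 0 d) $ 2 $ 2 = g $ 2 $ 2 * d"
    "det (g ** mk2 a 0 0 d) = det g * (a * d)" by (simp_all add: mat_mult_nth det_mul)
  show ?thesis unfolding bump_eq[OF i] bump_eq[OF g] e 1 2 using chr(1)[of d a] a False by simp
qed (use g a chr(1)[of d a] in \<open>simp add: bump_eq invertible_mult mat_mult_nth\<close>)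

lemma bump_w:
  assumes g: "invertible g"
  shows "bump m (g ** mk2 0 1 1 0) = (if g $ 2 $ 2 \<noteq> 0 \<and> g $ 2 $ 1 / g $ 2 $ 2 \<in> pideal m
    then \<theta> (diag2 (det g / g $ 2 $ 2) (g $ 2 $ 2)) else \<zero>)"
  using g by (simp add: bump_eq invertible_mult mat_mult_nth det_mul)

lemma finsum_transversal:
  fixes x :: 'l
  assumes R: "transversal R (pideal m) (pideal i)" and i: "i \<le> m"
    and F: "\<And>a. a \<in> R \<Longrightarrow> F a \<in> carrier k" "\<And>a. \<lbrakk>a \<in> R; x \<in> pideal i; x - a \<in> pideal m\<rbrakk> \<Longrightarrow> F a = v"
  shows "(\<Oplus>a\<in>R. if x - a \<in> pideal m then F a else \<zero>) = (if x \<in> pideal i then v else \<zero>)"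
proof (cases "x \<in> pideal i")
  case True
  then obtain r where r: "r \<in> R" "x - r \<in> pideal m" "\<And>s. s \<in> R \<Longrightarrow> x - s \<in> pideal m \<Longrightarrow> s = r"
    using R unfolding transversal_def by blast
  have e: "x - a \<in> pideal m \<longleftrightarrow> r = a" if "a \<in> R" for a using r that by blast
  have "(\<Oplus>a\<in>R. if x - a \<in> pideal m then F a else \<zero>) = (\<Oplus>a\<in>R. if r = a then F a else \<zero>)"
    using F(1) by (intro add.finprod_cong') (simp_all add: e)
  also have "\<dots> = F r" by (rule add.finprod_singleton[OF r(1) transversalD(1)[OF R]]) (simp add: F(1))
  finally show ?thesis using True F(2)[OF r(1) True r(2)] by simp
next
  case False
  have n: "x - a \<notin> pideal m" if "a \<in> R" for a
  proof
    assume "x - a \<in> pideal m"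
    moreover have "a \<in> pideal i" using transversalD(2)[OF R] that by blast
    ultimately have "(x - a) + a \<in> pideal i" using i by (intro pideal_add) (auto elim: pideal_monoD)
    then show False using False by simp
  qed
  have "(\<Oplus>a\<in>R. if x - a \<in> pideal m then F a else \<zero>) = (\<Oplus>a\<in>R. \<zero>)"
    by (intro add.finprod_cong') (simp_all add: n)
  then show ?thesis using False by simp
qed

text \<open>The translates of \<open>bump 1\<close> by representatives of the residue field tile the
  support of \<open>bump 0\<close>.\<close>

lemma bump_h:
  fixes g :: "'l ^ 2 ^ 2"
  assumes g: "invertible g"
  shows "(\<Oplus>a\<in>reps 0 1. bump 0 (g ** mk2 1 a 0 1 ** mk2 unif 0 0 1)) = \<theta> (diag2 1 unif) \<otimes> bump 0 g"
proof -
  define \<xi> where "\<xi> = \<theta> (diag2 1 unif) \<otimes> \<theta> (diag2 (- det g / g $ 2 $ 1) (g $ 2 $ 1))"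
  have th: "\<theta> (diag2 1 unif) \<in> carrier k" using chr(1) by simp
  have b: "bump 0 (g ** mk2 1 a 0 1 ** mk2 unif 0 0 1) = \<theta> (diag2 1 unif) \<otimes> bump 1 (g ** mk2 1 a 0 1)" for a
    using bump_D[of "g ** mk2 1 a 0 1" unif 1 0] g by (simp add: invertible_mult)
  show ?thesis
  proof (cases "g $ 2 $ 1 = 0")
    case True
    then have "(\<Oplus>a\<in>reps 0 1. bump 0 (g ** mk2 1 a 0 1 ** mk2 unif 0 0 1)) = (\<Oplus>a\<in>(reps 0 1 :: 'l set). \<zero>)"
      using g th by (intro add.finprod_cong') (auto simp: b bump_u)
    then show ?thesis using True g th by (simp add: bump_eq)
  next
    case False
    have \<xi>: "\<xi> \<in> carrier k" using chr(1) False g by (simp add: \<xi>_def invertible_det_nz)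
    define z where "z = - (g $ 2 $ 2 / g $ 2 $ 1)"
    have e: "g $ 2 $ 2 / g $ 2 $ 1 + a \<in> pideal 1 \<longleftrightarrow> z - a \<in> pideal 1" for a
      using pideal_minus[of "z - a" 1] by (simp add: z_def add.commute)
    have "(\<Oplus>a\<in>reps 0 1. bump 0 (g ** mk2 1 a 0 1 ** mk2 unif 0 0 1)) = (\<Oplus>a\<in>reps 0 1. if z - a \<in> pideal 1 then \<xi> else \<zero>)"
      using g th False \<xi> by (intro add.finprod_cong') (auto simp: b bump_u \<xi>_def e)
    also have "\<dots> = (if z \<in> pideal 0 then \<xi> else \<zero>)" by (rule finsum_transversal[OF reps]) (use \<xi> in auto)
    finally show ?thesis using False g th by (simp add: z_def bump_eq \<xi>_def)
  qed
qed

text \<open>A locally constant function on the projective line is a finite combination of indicators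
  of discs: here the cosets of \<open>pideal m\<close> in \<open>pideal (- j)\<close>, and one disc
  around the point at infinity, which is the class of \<open>mat 1\<close>.\<close>

lemma Ind_expansion:
  assumes f: "f \<in> carrier I" and l: "level f n" and jm: "n \<le> j" "n \<le> m" "- j \<le> m"
    and R: "transversal R (pideal m) (pideal (- j))" and g: "invertible g"
  shows "f g = (\<Oplus>a\<in>R. f (mk2 0 1 1 a) \<otimes> bump m (g ** mk2 1 (- a) 0 1)) \<oplus> f (mat 1) \<otimes> bump (j + 1) (g ** mk2 0 1 1 0)"
proof -
  have fc: "f (mk2 0 1 1 a) \<in> carrier k" "f (mat 1) \<in> carrier k" for a
    using Ind_borelD(3)[OF f] invertible_mat_1 by auto
  have nz: "det g \<noteq> 0" using g by (simp add: invertible_det_nz)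
  show ?thesis
  proof (cases "g $ 2 $ 1 = 0")
    case True
    have d: "g $ 1 $ 1 \<noteq> 0" "g $ 2 $ 2 \<noteq> 0" "det g = g $ 1 $ 1 * g $ 2 $ 2" using nz True by (auto simp: det_2)
    have "(\<Oplus>a\<in>R. f (mk2 0 1 1 a) \<otimes> bump m (g ** mk2 1 (- a) 0 1)) = (\<Oplus>a\<in>R. \<zero>)"
      using True g fc by (intro add.finprod_cong') (auto simp: bump_u)
    moreover have "f g = \<theta> (diag2 (g $ 1 $ 1) (g $ 2 $ 2)) \<otimes> f (mat 1)"
      using Ind_borelD(2)[OF f, of g "mat 1"] g True invertible_mat_1 by (simp add: borel_subgroup_def)
    ultimately show ?thesis using True g fc d chr(1) by (simp add: bump_w m_comm)
  next
    case False
    define z where "z = g $ 2 $ 2 / g $ 2 $ 1"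
    define \<xi> where "\<xi> = \<theta> (diag2 (- det g / g $ 2 $ 1) (g $ 2 $ 1))"
    have \<xi>: "\<xi> \<in> carrier k" using chr(1) False nz by (simp add: \<xi>_def)
    have ge: "mk2 (- det g / g $ 2 $ 1) (g $ 1 $ 1) 0 (g $ 2 $ 1) ** mk2 0 1 1 z = g"
      using False by (simp add: mk2_mult z_def vec_eq_iff forall_2 det_2 diff_divide_distrib)
    have fg: "f g = \<xi> \<otimes> f (mk2 0 1 1 z)"
      using Ind_borelD(2)[OF f, of "mk2 (- det g / g $ 2 $ 1) (g $ 1 $ 1) 0 (g $ 2 $ 1)" "mk2 0 1 1 z"] ge False nz
      by (simp add: borel_subgroup_def \<xi>_def)
    have "(\<Oplus>a\<in>R. f (mk2 0 1 1 a) \<otimes> bump m (g ** mk2 1 (- a) 0 1))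
        = (\<Oplus>a\<in>R. if z - a \<in> pideal m then f (mk2 0 1 1 a) \<otimes> \<xi> else \<zero>)"
      using False g fc \<xi> by (intro add.finprod_cong') (auto simp: bump_u z_def \<xi>_def)
    also have "\<dots> = (if z \<in> pideal (- j) then f (mk2 0 1 1 z) \<otimes> \<xi> else \<zero>)"
    proof (rule finsum_transversal[OF R jm(3)])
      fix a assume "z - a \<in> pideal m"
      then have "f (mk2 0 1 1 z) = f (mk2 0 1 1 a)" using level_big_cell[OF level_mono[OF l jm(2)]] by blast
      then show "f (mk2 0 1 1 a) \<otimes> \<xi> = f (mk2 0 1 1 z) \<otimes> \<xi>" by simp
    qed (use fc \<xi> in auto)
    finally have 1: "(\<Oplus>a\<in>R. f (mk2 0 1 1 a) \<otimes> bump m (g ** mk2 1 (- a) 0 1))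
        = (if z \<in> pideal (- j) then f (mk2 0 1 1 z) \<otimes> \<xi> else \<zero>)" .
    show ?thesis
    proof (cases "z \<in> pideal (- j)")
      case True
      have "\<not> (g $ 2 $ 2 \<noteq> 0 \<and> g $ 2 $ 1 / g $ 2 $ 2 \<in> pideal (j + 1))"
        using True False by (auto simp: z_def pideal_iff val_divide)
      then have "bump (j + 1) (g ** mk2 0 1 1 0) = \<zero>" unfolding bump_w[OF g] by (rule if_not_P)
      then show ?thesis using True fc \<xi> unfolding 1 fg by (simp add: m_comm)
    next
      case zj: False
      then have z0: "z \<noteq> 0" "g $ 2 $ 2 \<noteq> 0" by (auto simp: z_def)
      have zi: "g $ 2 $ 1 / g $ 2 $ 2 \<in> pideal (j + 1)" "1 / z = g $ 2 $ 1 / g $ 2 $ 2"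
        using zj False z0(2) by (auto simp: z_def pideal_iff val_divide)
      \<comment> \<open>Outside \<open>pideal (- j)\<close> the inverse coordinate lies in
        \<open>pideal (j + 1)\<close>, where \<open>f\<close> on the opposite cell has its value at
        \<open>mat 1\<close>.\<close>
      have "1 / z - 0 \<in> pideal n" using pideal_monoD[OF zi(1), of n] jm zi(2) by simp
      then have "f (mk2 1 0 (1 / z) 1) = f (mk2 1 0 0 1)" by (rule level_opposite_cell[OF l])
      then have "f (mk2 0 1 1 z) = \<theta> (diag2 (- 1 / z) z) \<otimes> f (mat 1)"
        using Ind_inverse[OF f z0(1)] by (simp add: mat_eq_mk2)
      moreover have "\<xi> \<otimes> \<theta> (diag2 (- 1 / z) z) = \<theta> (diag2 (- det g / g $ 2 $ 1 * (- 1 / z)) (g $ 2 $ 1 * z))"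
        unfolding \<xi>_def using False nz z0 by (intro chr(3)[symmetric]) auto
      moreover have "- det g / g $ 2 $ 1 * (- 1 / z) = det g / g $ 2 $ 2" "g $ 2 $ 1 * z = g $ 2 $ 2"
        using False z0 by (simp_all add: z_def)
      ultimately have "f g = \<theta> (diag2 (det g / g $ 2 $ 2) (g $ 2 $ 2)) \<otimes> f (mat 1)"
        using fg \<xi> fc(2) chr(1)[of "- 1 / z" z] z0 by (simp add: m_assoc[symmetric])
      then show ?thesis using zj zi z0 g fc(2) chr(1) nz unfolding 1 by (simp add: bump_w m_comm)
    qed
  qed
qed

end

sublocale ordinary \<subseteq> borel_character k \<theta>
  by unfold_locales (rule \<theta>)

context borel_character
begin

lemma bump_extensional: "bump m \<in> extensional (carrier GL2)" by (simp add: bump_def)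

lemma bump_unipotent: "c \<in> pideal 0 \<Longrightarrow> act I (mk2 1 c 0 1) (bump 0) = bump 0"
proof (rule Ind_borel_eqI[OF _ bump_extensional])
  fix g :: "'l ^ 2 ^ 2" assume c: "c \<in> pideal 0" and g: "invertible g"
  have "g $ 2 $ 2 / g $ 2 $ 1 + c \<in> pideal 0 \<longleftrightarrow> g $ 2 $ 2 / g $ 2 $ 1 \<in> pideal 0"
    using pideal_add[of "g $ 2 $ 2 / g $ 2 $ 1" 0 c] pideal_diff[of "g $ 2 $ 2 / g $ 2 $ 1 + c" 0 c] c by auto
  then show "act I (mk2 1 c 0 1) (bump 0) g = bump 0 g" using g by (simp add: Ind_borel_simps bump_u bump_eq)
qed (simp add: Ind_borel_simps)

lemma bump_torus: "\<lbrakk>a \<noteq> 0; d \<noteq> 0\<rbrakk> \<Longrightarrow> act I (mk2 a 0 0 d) (bump m) = \<theta> (diag2 d a) \<odot>\<^bsub>I\<^esub> bump (m + val a - val d)"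
  by (rule Ind_borel_eqI) (auto simp: Ind_borel_simps bump_D)

lemma bump_hecke: "(\<lambda>g\<in>carrier GL2. \<Oplus>a\<in>reps 0 1. act I (mk2 1 a 0 1) (act I (mk2 unif 0 0 1) (bump 0)) g)
    = \<theta> (diag2 1 unif) \<odot>\<^bsub>I\<^esub> bump 0"
proof (rule Ind_borel_eqI)
  fix g :: "'l ^ 2 ^ 2" assume g: "invertible g"
  then have "act I (mk2 1 a 0 1) (act I (mk2 unif 0 0 1) (bump 0)) g = bump 0 (g ** mk2 1 a 0 1 ** mk2 unif 0 0 1)" for a
    by (simp add: Ind_borel_simps invertible_mult)
  then show "(\<lambda>g\<in>carrier GL2. \<Oplus>a\<in>reps 0 1. act I (mk2 1 a 0 1) (act I (mk2 unif 0 0 1) (bump 0)) g) g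
      = (\<theta> (diag2 1 unif) \<odot>\<^bsub>I\<^esub> bump 0) g" using g bump_h[OF g] by (simp add: Ind_borel_simps)
qed (auto simp: Ind_borel_simps)

text \<open>Matches finite sums in the ring type \<open>'x\<close> with pointwise sums over the
  record \<open>k\<close>. A compatible relation is used in place of a map, so that it covers
  membership in a submodule as well as liftings.\<close>

lemma related_sum:
  fixes R :: "'x::comm_monoid_add \<Rightarrow> ('l ^ 2 ^ 2 \<Rightarrow> 'k) \<Rightarrow> bool"
  assumes RI: "\<And>x f. R x f \<Longrightarrow> f \<in> carrier I"
    and R0: "R 0 \<zero>\<^bsub>I\<^esub>" and R_add: "\<And>x y f f'. \<lbrakk>R x f; R y f'\<rbrakk> \<Longrightarrow> R (x + y) (f \<oplus>\<^bsub>I\<^esub> f')"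
    and A: "finite A" and R: "\<And>a. a \<in> A \<Longrightarrow> R (x a) (f a)"
  shows "R (\<Sum>a\<in>A. x a) (\<lambda>g\<in>carrier GL2. \<Oplus>a\<in>A. f a g)"
  using A R
proof (induction A)
  case empty then show ?case using R0 by (simp only: sum.empty finsum_empty Ind_borel_simps)
next
  case (insert b A)
  have cl: "f a g \<in> carrier k" if "a \<in> insert b A" "invertible g" for a g
    using Ind_borelD(3)[OF RI[OF insert.prems[OF that(1)]] that(2)] .
  have "(\<lambda>g\<in>carrier GL2. \<Oplus>a\<in>insert b A. f a g) = f b \<oplus>\<^bsub>I\<^esub> (\<lambda>g\<in>carrier GL2. \<Oplus>a\<in>A. f a g)"
  proof (rule Ind_borel_eqI)
    fix g :: "'l ^ 2 ^ 2" assume g: "invertible g"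
    have "(\<Oplus>a\<in>insert b A. f a g) = f b g \<oplus> (\<Oplus>a\<in>A. f a g)"
      using insert.hyps cl[OF _ g] by (intro finsum_insert) auto
    then show "(\<lambda>g\<in>carrier GL2. \<Oplus>a\<in>insert b A. f a g) g = (f b \<oplus>\<^bsub>I\<^esub> (\<lambda>g\<in>carrier GL2. \<Oplus>a\<in>A. f a g)) g"
      using g by (simp add: Ind_borel_simps)
  qed (auto simp: Ind_borel_simps)
  moreover have "R (x b + (\<Sum>a\<in>A. x a)) (f b \<oplus>\<^bsub>I\<^esub> (\<lambda>g\<in>carrier GL2. \<Oplus>a\<in>A. f a g))"
  proof (rule R_add)
    show "R (x b) (f b)" by (rule insert.prems) simp
    show "R (\<Sum>a\<in>A. x a) (\<lambda>g\<in>carrier GL2. \<Oplus>a\<in>A. f a g)" by (rule insert.IH) (rule insert.prems, simp)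
  qed
  ultimately show ?case using insert.hyps by simp
qed

lemma Ind_inverse':
  assumes f: "f \<in> carrier I" and b: "b \<noteq> 0"
  shows "f (mk2 1 0 b 1) = \<theta> (diag2 (- 1 / b) b) \<otimes> f (mk2 0 1 1 (1 / b))"
proof -
  have "mk2 (- 1 / b) 1 0 b ** mk2 0 1 1 (1 / b) = mk2 1 0 b 1" using b by (simp add: mk2_mult)
  then show ?thesis
    using Ind_borelD(2)[OF f, of "mk2 (- 1 / b) 1 0 b" "mk2 0 1 1 (1 / b)"] b by (simp add: borel_subgroup_def)
qed

end

section \<open>The equivariant map attached to an ordinary vector\<close>

context ordinary
begin

text \<open>\<open>1 \<le> n\<close> gives \<open>- n < n\<close>, so that
  \<open>pideal (- n)\<close> is a union of cosets of \<open>pideal n\<close>;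
  \<open>n0 \<le> n\<close> provides the invariance of the \<open>E m\<close> under lower unipotents
  that \<open>w_integ_annulus\<close> asks for.\<close>

definition good :: "('l ^ 2 ^ 2 \<Rightarrow> 'k) \<Rightarrow> int \<Rightarrow> bool"
  where "good f n \<longleftrightarrow> f \<in> carrier I \<and> level f n \<and> 1 \<le> n \<and> n0 \<le> n"

lemma goodD: assumes "good f n" shows "f \<in> carrier I" "level f n" "1 \<le> n" "n0 \<le> n"
  using assms by (simp_all add: good_def)

lemma good_mono: "\<lbrakk>good f n; n \<le> m\<rbrakk> \<Longrightarrow> good f m"
  using level_mono[of f n m] by (simp add: good_def)

lemma exists_good: "f \<in> carrier I \<Longrightarrow> \<exists>n. good f n"
proof -
  assume f: "f \<in> carrier I"
  obtain n where "level f n" using exists_level[OF f] by blast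
  then have "good f (max n (max 1 n0))" using f level_mono[of f n "max n (max 1 n0)"] by (simp add: good_def le_max_iff_disj)
  then show ?thesis by blast
qed

lemma exists_good2: "\<lbrakk>f \<in> carrier I; f' \<in> carrier I\<rbrakk> \<Longrightarrow> \<exists>n. good f n \<and> good f' n"
proof -
  assume f: "f \<in> carrier I" "f' \<in> carrier I"
  obtain n n' where "good f n" "good f' n'" using exists_good[OF f(1)] exists_good[OF f(2)] by blast
  then have "good f (max n n')" "good f' (max n n')" by (auto elim: good_mono)
  then show ?thesis by blast
qed

abbreviation "bc f \<equiv> \<lambda>a. f (mk2 0 1 1 a)"
abbreviation "oc f \<equiv> \<lambda>a. f (mk2 1 0 a 1)"

lemma cells_closed: "f \<in> carrier I \<Longrightarrow> bc f a \<in> carrier k" "f \<in> carrier I \<Longrightarrow> oc f a \<in> carrier k"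
  "f \<in> carrier I \<Longrightarrow> f (mat 1) \<in> carrier k"
  by (auto intro!: Ind_borelD(3) simp: invertible_mat_1)

lemma bc_periodic: "\<lbrakk>good f n; n \<le> m\<rbrakk> \<Longrightarrow> periodic C (bc f) m"
  by (rule periodic_mono, rule periodicI) (auto dest: goodD intro: cells_closed level_big_cell)

lemma oc_periodic: "\<lbrakk>good f n; n \<le> m\<rbrakk> \<Longrightarrow> periodic C (oc f) m"
  by (rule periodic_mono, rule periodicI) (auto dest: goodD intro: cells_closed level_opposite_cell)

lemma integ_bc_ideal:
  assumes "good f n" "n \<le> i" "i \<le> m" shows "integ (pideal i) (bc f) m = sc (bc f 0) (E i)"
proof -
  have "integ (pideal i) (bc f) m = integ (pideal i) (\<lambda>_. bc f 0) m"
  proof (rule integ_cong[OF admissible_pideal[OF assms(3)]])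
    fix x :: 'l assume "x \<in> pideal i"
    then show "bc f x = bc f 0" using level_big_cell[OF goodD(2)[OF assms(1)], of x 0] pideal_monoD[of x i n] assms(2) by simp
  qed
  also have "\<dots> = sc (bc f 0) (E i)" using cells_closed(1)[OF goodD(1)[OF assms(1)]] by (rule integ_const[OF assms(3)])
  finally show ?thesis .
qed

lemma integ_oc_ideal:
  assumes "good f n" "n \<le> i" "i \<le> m" shows "integ (pideal i) (oc f) m = sc (f (mat 1)) (E i)"
proof -
  have "integ (pideal i) (oc f) m = integ (pideal i) (\<lambda>_. f (mat 1)) m"
  proof (rule integ_cong[OF admissible_pideal[OF assms(3)]])
    fix x :: 'l assume "x \<in> pideal i"
    then show "oc f x = f (mat 1)" unfolding mat_eq_mk2
      using level_opposite_cell[OF goodD(2)[OF assms(1)], of x 0] pideal_monoD[of x i n] assms(2) by simp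
  qed
  also have "\<dots> = sc (f (mat 1)) (E i)" using cells_closed(3)[OF goodD(1)[OF assms(1)]] by (rule integ_const[OF assms(3)])
  finally show ?thesis .
qed

lemma w_annulus:
  assumes f: "good f n" and i: "i < m" "i \<le> m - n0" "n \<le> m"
  shows "w (integ (annulus i) (bc f) m) = integ (annulus (- i)) (oc f) (m - 2 * i)"
    and "w (integ (annulus i) (oc f) m) = integ (annulus (- i)) (bc f) (m - 2 * i)"
proof -
  have ad: "admissible (m - 2 * i) (annulus (- i))" using i by (simp add: admissible_annulus)
  show "w (integ (annulus i) (bc f) m) = integ (annulus (- i)) (oc f) (m - 2 * i)"
    unfolding w_integ_annulus[OF i(1,2) bc_periodic[OF f i(3)]]
    by (rule integ_cong[OF ad]) (simp add: annulus_def Ind_inverse'[OF goodD(1)[OF f]])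
  show "w (integ (annulus i) (oc f) m) = integ (annulus (- i)) (bc f) (m - 2 * i)"
    unfolding w_integ_annulus[OF i(1,2) oc_periodic[OF f i(3)]]
    by (rule integ_cong[OF ad]) (simp add: annulus_def Ind_inverse[OF goodD(1)[OF f]])
qed

text \<open>The function \<open>f\<close> is split into its restriction to the part \<open>val a \<ge> - j\<close> of the big cell and
  a function supported near the point at infinity, where \<open>f\<close> is constant.\<close>

definition \<Phi>0 :: "('l ^ 2 ^ 2 \<Rightarrow> 'k) \<Rightarrow> int \<Rightarrow> int \<Rightarrow> 'x"
  where "\<Phi>0 f j m = integ (pideal (- j)) (bc f) m + sc (f (mat 1)) (w (E (j + 1)))"

text \<open>A level is chosen for each \<open>f\<close> separately; \<open>\<Phi>_eq\<close> frees
  the value from this choice, so that two functions can be compared at a common level.\<close>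

definition \<Phi> :: "('l ^ 2 ^ 2 \<Rightarrow> 'k) \<Rightarrow> 'x"
  where "\<Phi> f = (let n = SOME n. good f n in \<Phi>0 f n n)"

text \<open>Enlarging the disc in the big cell adds the annulus of valuation
  \<open>- (j + 1)\<close>, shrinking the disc at infinity removes the one of valuation
  \<open>j + 1\<close>, and \<open>w\<close> identifies the two contributions.\<close>

lemma \<Phi>0_step:
  assumes f: "good f n" and j: "n \<le> j" and m: "n \<le> m" shows "\<Phi>0 f (j + 1) m = \<Phi>0 f j m"
proof -
  note g = goodD[OF f]
  define i where "i = j + 1"
  \<comment> \<open>Large enough for \<open>i \<le> M - n0\<close> and
    \<open>n \<le> M - 2 i\<close>, given that \<open>n\<close> and \<open>n0\<close> are at most
    the positive \<open>i\<close>.\<close>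
  define M where "M = 3 * i"
  have i: "n \<le> i" "n \<le> i + 1" "i < M" "i \<le> M" "i + 1 \<le> M" "i \<le> M - n0" "n \<le> M" "n \<le> M - 2 * i"
    using g(3,4) j by (simp_all add: i_def M_def)
  have "sc (f (mat 1)) (w (E i)) = w (integ (pideal i) (oc f) M)"
    using integ_oc_ideal[OF f i(1,4)] cells_closed(3)[OF g(1)] by (simp add: w_sc)
  also have "\<dots> = w (integ (pideal (i + 1)) (oc f) M) + w (integ (annulus i) (oc f) M)"
    using integ_split[OF i(3) oc_periodic[OF f i(7)]] by (simp add: w_plus)
  also have "w (integ (pideal (i + 1)) (oc f) M) = sc (f (mat 1)) (w (E (i + 1)))"
    using integ_oc_ideal[OF f i(2,5)] cells_closed(3)[OF g(1)] by (simp add: w_sc)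
  also have "w (integ (annulus i) (oc f) M) = integ (annulus (- i)) (bc f) (M - 2 * i)"
    by (rule w_annulus(2)[OF f i(3,6,7)])
  also have "\<dots> = integ (annulus (- i)) (bc f) m"
  proof (rule integ_level[OF admissible_annulus bc_periodic[OF f] i(8) m])
    show "- i < n" using g(3) i by simp
  qed simp
  finally have 1: "sc (f (mat 1)) (w (E i)) = sc (f (mat 1)) (w (E (i + 1))) + integ (annulus (- i)) (bc f) m" .
  have "- i < m" using g(3) i m by simp
  from integ_split[OF this bc_periodic[OF f m]]
  have "integ (pideal (- i)) (bc f) m = integ (pideal (- j)) (bc f) m + integ (annulus (- i)) (bc f) m" by (simp add: i_def)
  with 1 show ?thesis by (simp add: \<Phi>0_def i_def add_ac)
qed

lemma \<Phi>0_const: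
  assumes f: "good f n" and j: "n \<le> j" and m: "n \<le> m" shows "\<Phi>0 f j m = \<Phi>0 f n n"
  using j
proof (induction j rule: int_ge_induct)
  case base
  have "integ (pideal (- n)) (bc f) m = integ (pideal (- n)) (bc f) n"
    by (rule integ_level[OF admissible_pideal bc_periodic[OF f] m]) (use goodD(3)[OF f] in simp_all)
  then show ?case by (simp add: \<Phi>0_def)
next
  case (step j) then show ?case using \<Phi>0_step[OF f step.hyps m] by simp
qed

lemma \<Phi>_eq:
  assumes f: "good f n" and j: "n \<le> j" and m: "n \<le> m" shows "\<Phi> f = \<Phi>0 f j m"
proof -
  define n' where "n' = (SOME n. good f n)"
  have "\<exists>n. good f n" using f by (rule exI)
  then have n': "good f n'" unfolding n'_def by (rule someI_ex)
  have "\<Phi> f = \<Phi>0 f n' n'" by (simp add: \<Phi>_def n'_def Let_def)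
  also have "\<dots> = \<Phi>0 f (max n n') (max n n')" by (rule \<Phi>0_const[OF n', symmetric]) simp_all
  also have "\<dots> = \<Phi>0 f n n" by (rule \<Phi>0_const[OF f]) simp_all
  also have "\<dots> = \<Phi>0 f j m" by (rule \<Phi>0_const[OF f j m, symmetric])
  finally show ?thesis .
qed

lemma \<Phi>_add:
  assumes f: "f \<in> carrier I" "f' \<in> carrier I" shows "\<Phi> (f \<oplus>\<^bsub>I\<^esub> f') = \<Phi> f + \<Phi> f'"
proof -
  obtain n1 where n1: "good f n1" "good f' n1" using exists_good2[OF f] by blast
  obtain n2 where n2: "good (f \<oplus>\<^bsub>I\<^esub> f') n2" using exists_good[OF Ind_add[OF f]] by blast
  define n where "n = max n1 n2"
  have n: "good f n" "good f' n" "good (f \<oplus>\<^bsub>I\<^esub> f') n" using n1 n2 by (auto simp: n_def elim: good_mono)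
  have "integ (pideal (- n)) (bc (f \<oplus>\<^bsub>I\<^esub> f')) n = integ (pideal (- n)) (bc f) n + integ (pideal (- n)) (bc f') n"
    by (simp add: integ_def Ind_borel_simps sc_add cells_closed[OF f(1)] cells_closed[OF f(2)] sum.distrib)
  then show ?thesis
    unfolding \<Phi>_eq[OF n(1) order_refl order_refl] \<Phi>_eq[OF n(2) order_refl order_refl] \<Phi>_eq[OF n(3) order_refl order_refl]
    by (simp add: \<Phi>0_def Ind_borel_simps sc_add cells_closed[OF f(1)] cells_closed[OF f(2)] invertible_mat_1 add_ac)
qed

lemma \<Phi>_sc:
  assumes f: "f \<in> carrier I" and c: "c \<in> carrier k" shows "\<Phi> (c \<odot>\<^bsub>I\<^esub> f) = sc c (\<Phi> f)"
proof -
  obtain n where n: "good f n" "good (c \<odot>\<^bsub>I\<^esub> f) n" using exists_good2[OF f Ind_smult[OF f c]] by blast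
  have "integ (pideal (- n)) (bc (c \<odot>\<^bsub>I\<^esub> f)) n = sc c (integ (pideal (- n)) (bc f) n)"
    by (simp add: integ_def Ind_borel_simps sc_mult c cells_closed[OF f] sc_sum)
  then show ?thesis
    unfolding \<Phi>_eq[OF n(1) order_refl order_refl] \<Phi>_eq[OF n(2) order_refl order_refl]
    by (simp add: \<Phi>0_def Ind_borel_simps sc_mult sc_plus c cells_closed[OF f] invertible_mat_1)
qed

text \<open>A property of single matrices, closed under products, so that by the Bruhat
  decomposition it need only be checked on generators.\<close>

definition equivariant :: "'l ^ 2 ^ 2 \<Rightarrow> bool"
  where "equivariant g \<longleftrightarrow> invertible g \<and> (\<forall>f\<in>carrier I. \<Phi> (rep.act I g f) = act g (\<Phi> f))"

lemma equivariant_mult: "\<lbrakk>equivariant g; equivariant g'\<rbrakk> \<Longrightarrow> equivariant (g ** g')"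
proof -
  assume g: "equivariant g" "equivariant g'"
  then have i: "invertible g" "invertible g'" by (simp_all add: equivariant_def)
  have "rep.act I (g ** g') f = rep.act I g (rep.act I g' f)" for f
    using i by (intro Ind_borel_eqI) (auto simp: Ind_borel_simps invertible_mult matrix_mul_assoc)
  then show ?thesis using g i Ind_translate[OF _ i(2)] by (simp add: equivariant_def invertible_mult act_mult)
qed

text \<open>The disc \<open>pideal (- j)\<close> is chosen to contain \<open>c\<close>, so
  translation by \<open>c\<close> only permutes its cosets. Near infinity \<open>l c\<close> fixes
  \<open>E (j + 1)\<close>, and therefore \<open>u c\<close> fixes
  \<open>w (E (j + 1))\<close>.\<close>

lemma equivariant_u: "equivariant (mk2 1 c 0 1)"
  unfolding equivariant_def
proof (intro conjI ballI)
  fix f assume f: "f \<in> carrier I"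
  define f' where "f' = rep.act I (mk2 1 c 0 1) f"
  have f': "f' \<in> carrier I" unfolding f'_def by (rule Ind_translate[OF f]) simp
  obtain n where n: "good f n" "good f' n" using exists_good2[OF f f'] by blast
  obtain i where i: "c \<in> pideal i" using exists_pideal by blast
  define j where "j = max n (max (- i) (n0 - i))"
  have j: "n \<le> j" "- j \<le> j" "- j \<le> i" "n0 - (j + 1) \<le> i" using goodD(3)[OF n(1)] by (auto simp: j_def)
  have ad: "admissible j (pideal (- j))" by (rule admissible_pideal[OF j(2)])
  have bcf': "bc f' a = bc f (a + c)" for a
    by (simp add: f'_def Ind_borel_simps mk2_mult add.commute)
  have "mk2 1 c 0 1 \<in> borel_subgroup" by (simp add: borel_subgroup_def)
  from Ind_borelD(2)[OF f this invertible_mat_1] have f'1: "f' (mat 1) = f (mat 1)"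
    using cells_closed(3)[OF f] by (simp add: f'_def Ind_borel_simps invertible_mat_1 chr(4))
  have T: "transversal ((\<lambda>a. a - c) ` tv j (pideal (- j))) (pideal j) (pideal (- j))"
  proof (rule transversal_image[OF tv[OF ad]])
    have "c \<in> pideal (- j)" by (rule pideal_monoD[OF i j(3)])
    then show "bij_betw (\<lambda>a. a - c) (pideal (- j)) (pideal (- j))"
      by (intro bij_betw_byWitness[of _ "\<lambda>a. a + c"]) (auto intro: pideal_diff pideal_add)
  qed simp
  have "integ (pideal (- j)) (bc f') j = (\<Sum>a\<in>(\<lambda>a. a - c) ` tv j (pideal (- j)). sc (bc f' a) (u (- a) (E j)))"
    by (rule integ_transversal[OF ad T bc_periodic[OF n(2) j(1)]])
  also have "\<dots> = (\<Sum>a\<in>tv j (pideal (- j)). sc (bc f a) (u (c - a) (E j)))"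
    by (subst sum.reindex) (auto simp: bcf' inj_on_def)
  also have "\<dots> = u c (integ (pideal (- j)) (bc f) j)"
    using cells_closed(1)[OF f] by (simp add: integ_def u_sum u_sc u_u)
  finally have 1: "integ (pideal (- j)) (bc f') j = u c (integ (pideal (- j)) (bc f) j)" .
  have "l c (E (j + 1)) = E (j + 1)" by (rule l_E[OF pideal_monoD[OF i j(4)]])
  then have "u c (w (E (j + 1))) = w (E (j + 1))" by (simp flip: w_l)
  then have "\<Phi>0 f' j j = u c (\<Phi>0 f j j)"
    using cells_closed(3)[OF f] by (simp add: \<Phi>0_def 1 f'1 u_plus u_sc)
  then show "\<Phi> (rep.act I (mk2 1 c 0 1) f) = act (mk2 1 c 0 1) (\<Phi> f)"
    unfolding \<Phi>_eq[OF n(1) j(1,1)] f'_def[symmetric] \<Phi>_eq[OF n(2) j(1,1)] u_def .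
qed simp

text \<open>Scaling by \<open>\<alpha> / \<beta>\<close> changes radius and level by
  \<open>r\<close>, so the two sides are computed with different parameters: \<open>j\<close> and
  \<open>j\<close> for \<open>f\<close>, but \<open>j - r\<close> and \<open>j + r\<close> for its
  translate.\<close>

lemma equivariant_D:
  assumes ab: "\<alpha> \<noteq> 0" "\<beta> \<noteq> 0" shows "equivariant (mk2 \<alpha> 0 0 \<beta>)"
  unfolding equivariant_def
proof (intro conjI ballI)
  fix f assume f: "f \<in> carrier I"
  define f' where "f' = rep.act I (mk2 \<alpha> 0 0 \<beta>) f"
  have f': "f' \<in> carrier I" unfolding f'_def by (rule Ind_translate[OF f]) (use ab in simp)
  obtain n where n: "good f n" "good f' n" using exists_good2[OF f f'] by blast
  define r where "r = val \<alpha> - val \<beta>"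
  define j where "j = n + \<bar>r\<bar>"
  have j: "n \<le> j" "n \<le> j - r" "n \<le> j + r" "- j \<le> j" "- (j - r) \<le> j + r" using goodD(3)[OF n(1)] by (auto simp: j_def)
  have ad: "admissible j (pideal (- j))" "admissible (j + r) (pideal (- (j - r)))"
    by (rule admissible_pideal, use j in simp)+
  define c where "c = \<theta> (diag2 \<beta> \<alpha>)"
  have c: "c \<in> carrier k" "\<theta> (diag2 \<alpha> \<beta>) \<in> carrier k" using chr(1) ab by (simp_all add: c_def)
  have bcf': "bc f' (\<alpha> / \<beta> * a) = c \<otimes> bc f a" for a
  proof -
    have "mk2 0 1 1 (\<alpha> / \<beta> * a) ** mk2 \<alpha> 0 0 \<beta> = mk2 \<beta> 0 0 \<alpha> ** mk2 0 1 1 a" using ab by (simp add: mk2_mult)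
    moreover have "mk2 \<beta> 0 0 \<alpha> \<in> borel_subgroup" using ab by (simp add: borel_subgroup_def)
    from Ind_borelD(2)[OF f this, of "mk2 0 1 1 a"] have "f (mk2 \<beta> 0 0 \<alpha> ** mk2 0 1 1 a) = c \<otimes> bc f a" by (simp add: c_def)
    ultimately show ?thesis by (simp add: f'_def Ind_borel_simps)
  qed
  have "mk2 \<alpha> 0 0 \<beta> \<in> borel_subgroup" using ab by (simp add: borel_subgroup_def)
  from Ind_borelD(2)[OF f this invertible_mat_1] have f'1: "f' (mat 1) = \<theta> (diag2 \<alpha> \<beta>) \<otimes> f (mat 1)"
    by (simp add: f'_def Ind_borel_simps invertible_mat_1)
  have ab0: "\<alpha> / \<beta> \<noteq> 0" "val (\<alpha> / \<beta>) = r" using ab by (simp_all add: r_def val_divide)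
  have T: "transversal ((*) (\<alpha> / \<beta>) ` tv j (pideal (- j))) (pideal (j + r)) (pideal (- (j - r)))"
    using transversal_scale[OF ab0(1) tv[OF ad(1)]] by (simp add: ab0(2) add.commute)
  have "integ (pideal (- (j - r))) (bc f') (j + r)
      = (\<Sum>a\<in>(*) (\<alpha> / \<beta>) ` tv j (pideal (- j)). sc (bc f' a) (u (- a) (E (j + r))))"
    by (rule integ_transversal[OF ad(2) T bc_periodic[OF n(2) j(3)]])
  also have "\<dots> = (\<Sum>a\<in>tv j (pideal (- j)). sc (c \<otimes> bc f a) (u (- (\<alpha> / \<beta> * a)) (E (j + r))))"
    by (subst sum.reindex) (use ab0(1) in \<open>auto simp: bcf' inj_on_def simp del: times_divide_eq_left\<close>)
  also have "\<dots> = D \<alpha> \<beta> (integ (pideal (- j)) (bc f) j)"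
  proof -
    have "D \<alpha> \<beta> (E j) = sc c (E (j + r))" using D_E[OF ab, of j] by (simp add: c_def r_def add_diff_eq)
    then have "D \<alpha> \<beta> (sc (bc f a) (u (- a) (E j))) = sc (c \<otimes> bc f a) (u (- (\<alpha> / \<beta> * a)) (E (j + r)))" for a
      using c cells_closed(1)[OF f, of a] ab by (simp add: D_sc D_u u_sc sc_mult sc_commute)
    then show ?thesis by (simp add: integ_def D_sum)
  qed
  finally have 1: "integ (pideal (- (j - r))) (bc f') (j + r) = D \<alpha> \<beta> (integ (pideal (- j)) (bc f) j)" .
  have "D \<beta> \<alpha> (E (j + 1)) = sc (\<theta> (diag2 \<alpha> \<beta>)) (E (j - r + 1))" using D_E[OF ab(2,1), of "j + 1"] by (simp add: r_def algebra_simps)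
  then have "D \<alpha> \<beta> (w (E (j + 1))) = sc (\<theta> (diag2 \<alpha> \<beta>)) (w (E (j - r + 1)))" using c ab by (simp add: w_sc flip: w_D)
  then have "\<Phi>0 f' (j - r) (j + r) = D \<alpha> \<beta> (\<Phi>0 f j j)"
    using cells_closed(3)[OF f] c ab unfolding \<Phi>0_def 1 by (simp add: f'1 D_plus D_sc sc_mult sc_commute)
  then show "\<Phi> (rep.act I (mk2 \<alpha> 0 0 \<beta>) f) = act (mk2 \<alpha> 0 0 \<beta>) (\<Phi> f)"
    unfolding \<Phi>_eq[OF n(1) j(1,1)] f'_def[symmetric] \<Phi>_eq[OF n(2) j(2,3)] D_def .
qed (use ab in simp)

text \<open>Decompose \<open>pideal (- j)\<close> into \<open>pideal (j + 1)\<close> and the annuli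
  in between. \<open>w\<close> inverts the annuli and exchanges the disc
  \<open>pideal (j + 1)\<close> around \<open>0\<close> with the one around infinity.\<close>

lemma equivariant_w: "equivariant (mk2 0 1 1 0)"
  unfolding equivariant_def
proof (intro conjI ballI)
  fix f assume f: "f \<in> carrier I"
  define f' where "f' = rep.act I (mk2 0 1 1 0) f"
  have f': "f' \<in> carrier I" unfolding f'_def by (rule Ind_translate[OF f]) simp
  obtain j where n: "good f j" "good f' j" using exists_good2[OF f f'] by blast
  \<comment> \<open>With this level the inversion of an annulus \<open>r\<close> between
    \<open>- j\<close> and \<open>j\<close> still leaves a level \<open>m - 2 r\<close> of at least
    \<open>j + 1\<close>.\<close>
  define m where "m = 3 * j + 1"
  have j: "j \<le> m" "j + 1 \<le> m" "- j \<le> j + 1" "j \<le> j + 1" using goodD(3)[OF n(1)] by (auto simp: m_def)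
  have bcf': "bc f' = oc f" by (simp add: f'_def Ind_borel_simps mk2_mult)
  have f'1: "f' (mat 1) = bc f 0" by (simp add: f'_def Ind_borel_simps invertible_mat_1)
  have an: "w (integ (annulus r) (bc f) m) = integ (annulus (- r)) (oc f) m" if r: "r \<in> {- j..<j + 1}" for r
  proof -
    have r': "r < m" "r \<le> m - n0" "- r < j + 1" "j + 1 \<le> m - 2 * r" using r goodD(3,4)[OF n(1)] by (auto simp: m_def)
    have "w (integ (annulus r) (bc f) m) = integ (annulus (- r)) (oc f) (m - 2 * r)" by (rule w_annulus(1)[OF n(1) r'(1,2) j(1)])
    also have "\<dots> = integ (annulus (- r)) (oc f) m"
      by (rule integ_level[OF admissible_annulus[OF r'(3)] oc_periodic[OF n(1) j(4)] r'(4) j(2)])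
    finally show ?thesis .
  qed
  have "w (integ (pideal (- j)) (bc f) m) = w (integ (pideal (j + 1)) (bc f) m) + (\<Sum>r\<in>{- j..<j + 1}. w (integ (annulus r) (bc f) m))"
    using integ_split_iterated[OF j(3,2) bc_periodic[OF n(1) j(1)]] by (simp add: w_plus w_sum)
  also have "(\<Sum>r\<in>{- j..<j + 1}. w (integ (annulus r) (bc f) m)) = (\<Sum>r\<in>{- j..<j + 1}. integ (annulus (- r)) (oc f) m)"
    by (intro sum.cong an) simp_all
  also have "\<dots> = (\<Sum>r\<in>{- j..<j + 1}. integ (annulus r) (oc f) m)"
    by (rule sum.reindex_bij_witness[of _ uminus uminus]) auto
  also have "w (integ (pideal (j + 1)) (bc f) m) = sc (bc f 0) (w (E (j + 1)))"
    using integ_bc_ideal[OF n(1) j(4,2)] cells_closed(1)[OF f] by (simp add: w_sc)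
  finally have "w (\<Phi>0 f j m) = sc (bc f 0) (w (E (j + 1))) + (\<Sum>r\<in>{- j..<j + 1}. integ (annulus r) (oc f) m) + sc (f (mat 1)) (E (j + 1))"
    using cells_closed(3)[OF f] by (simp add: \<Phi>0_def w_plus w_sc)
  moreover have "integ (pideal (- j)) (oc f) m = sc (f (mat 1)) (E (j + 1)) + (\<Sum>r\<in>{- j..<j + 1}. integ (annulus r) (oc f) m)"
    using integ_split_iterated[OF j(3,2) oc_periodic[OF n(1) j(1)]] integ_oc_ideal[OF n(1) j(4,2)] by simp
  ultimately have "\<Phi>0 f' j m = w (\<Phi>0 f j m)" by (simp add: \<Phi>0_def bcf' f'1 add_ac)
  then show "\<Phi> (rep.act I (mk2 0 1 1 0) f) = act (mk2 0 1 1 0) (\<Phi> f)"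
    unfolding \<Phi>_eq[OF n(1) order_refl j(1)] f'_def[symmetric] \<Phi>_eq[OF n(2) order_refl j(1)] w_def .
qed simp

lemma \<Phi>_act:
  assumes g: "invertible g" and f: "f \<in> carrier I" shows "\<Phi> (rep.act I g f) = act g (\<Phi> f)"
proof -
  obtain a b c d where g_eq: "g = mk2 a b c d" by (metis mk2_eta)
  have nz: "a * d - b * c \<noteq> 0" using g by (simp add: g_eq)
  have "equivariant g"
  proof (cases "c = 0")
    case True
    have "mk2 1 (b / d) 0 1 ** mk2 a 0 0 d = g" using nz True by (simp add: g_eq mk2_mult)
    moreover have "equivariant (mk2 1 (b / d) 0 1 ** mk2 a 0 0 d)"
      using nz True by (intro equivariant_mult equivariant_u equivariant_D) auto
    ultimately show ?thesis by simp
  next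
    case False
    define e where "e = - (a * d - b * c) / c"
    have "e \<noteq> 0" unfolding e_def using nz False by (simp only: divide_eq_0_iff neg_equal_0_iff_equal) simp
    moreover have "e + a * d / c = b" using False by (simp add: e_def diff_divide_distrib)
    ultimately have e: "e \<noteq> 0" "e + a * d / c = b" by simp_all
    have "mk2 1 (a / c) 0 1 ** (mk2 e 0 0 c ** (mk2 0 1 1 0 ** mk2 1 (d / c) 0 1)) = g"
      using False e(2) by (simp add: g_eq mk2_mult)
    moreover have "equivariant (mk2 1 (a / c) 0 1 ** (mk2 e 0 0 c ** (mk2 0 1 1 0 ** mk2 1 (d / c) 0 1)))"
      using e False by (intro equivariant_mult equivariant_u equivariant_D equivariant_w) auto
    ultimately show ?thesis by simp
  qed
  then show ?thesis using f by (simp add: equivariant_def)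
qed

lemma \<Phi>_bump: "\<Phi> (bump 0) = e"
proof -
  obtain n where n: "good (bump 0) n" using exists_good[OF bump_Ind] by blast
  have n1: "- n \<le> 0" "0 \<le> n" using goodD(3)[OF n] by auto
  have bc: "bc (bump 0) a = (if a \<in> pideal 0 then \<one> else \<zero>)" for a by (simp add: bump_eq chr(4))
  have b1: "bump 0 (mat 1) = \<zero>" by (simp add: bump_eq invertible_mat_1 mat_eq_mk2)
  have "integ (pideal 0) (bc (bump 0)) n = integ (pideal 0) (\<lambda>_. \<one>) n"
    by (rule integ_cong[OF admissible_pideal[OF n1(2)]]) (simp add: bc)
  also have "\<dots> = e" using integ_const[OF n1(2) one_closed] sc_one[OF e_props(1)] by (simp add: E_0)
  finally have 1: "integ (pideal 0) (bc (bump 0)) n = e" .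
  have "integ (annulus r) (bc (bump 0)) n = 0" if "r \<in> {- n..<0}" for r
  proof -
    have ad: "admissible n (annulus r)" using that n1 by (simp add: admissible_annulus)
    have "integ (annulus r) (bc (bump 0)) n = integ (annulus r) (\<lambda>_. \<zero>) n"
      using that by (intro integ_cong[OF ad]) (auto simp: bc annulus_def pideal_iff)
    then show ?thesis by (simp add: integ_def sc_zero_left)
  qed
  then have "(\<Sum>r\<in>{- n..<0}. integ (annulus r) (bc (bump 0)) n) = 0" by (intro sum.neutral) blast
  then show ?thesis
    unfolding \<Phi>_eq[OF n order_refl order_refl] \<Phi>0_def
    using integ_split_iterated[OF n1 bc_periodic[OF n order_refl]] 1 b1 by (simp add: sc_zero_left)
qed

text \<open>By \<open>Ind_expansion\<close>, \<open>f\<close> arises from \<open>bump 0\<close> by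
  the module operations and the group action, and \<open>\<Phi> f\<close> arises from
  \<open>e\<close> in the same way. It is used to see that \<open>\<Phi>\<close> has values in a
  submodule containing \<open>e\<close>, and that it lifts a given map.\<close>

lemma \<Phi>_related:
  assumes RI: "\<And>x f. R x f \<Longrightarrow> f \<in> carrier I"
    and R0: "R 0 \<zero>\<^bsub>I\<^esub>" and R_add: "\<And>x y f f'. \<lbrakk>R x f; R y f'\<rbrakk> \<Longrightarrow> R (x + y) (f \<oplus>\<^bsub>I\<^esub> f')"
    and R_sc: "\<And>c x f. \<lbrakk>c \<in> carrier k; R x f\<rbrakk> \<Longrightarrow> R (sc c x) (c \<odot>\<^bsub>I\<^esub> f)"
    and R_act: "\<And>g x f. \<lbrakk>invertible g; R x f\<rbrakk> \<Longrightarrow> R (act g x) (rep.act I g f)"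
    and R_bump: "R e (bump 0)" and f: "f \<in> carrier I"
  shows "R (\<Phi> f) f"
proof -
  have E: "R (E m) (bump m)" for m
  proof -
    have c: "\<theta> (diag2 1 (unif powi (- m))) \<in> carrier k" "\<theta> (diag2 1 (unif powi m)) \<in> carrier k" by (simp_all add: chr(1))
    have "\<theta> (diag2 1 (unif powi (- m))) \<otimes> \<theta> (diag2 1 (unif powi m)) = \<theta> (diag2 (1 * 1) (unif powi (- m) * unif powi m))"
      by (intro chr(3)[symmetric]) auto
    also have "unif powi (- m) * unif powi m = (1 :: 'l)" using power_int_add[of "unif :: 'l" "- m" m] by simp
    finally have cc: "\<theta> (diag2 1 (unif powi (- m))) \<otimes> \<theta> (diag2 1 (unif powi m)) = \<one>" by (simp add: chr(4))
    have "R (E m) (\<theta> (diag2 1 (unif powi (- m))) \<odot>\<^bsub>I\<^esub> rep.act I (mk2 (unif powi m) 0 0 1) (bump 0))"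
      unfolding E_def D_def using c by (intro R_sc R_act R_bump) simp_all
    also have "rep.act I (mk2 (unif powi m) 0 0 1) (bump 0) = \<theta> (diag2 1 (unif powi m)) \<odot>\<^bsub>I\<^esub> bump m"
      by (simp add: bump_torus)
    also have "\<theta> (diag2 1 (unif powi (- m))) \<odot>\<^bsub>I\<^esub> (\<theta> (diag2 1 (unif powi m)) \<odot>\<^bsub>I\<^esub> bump m) = bump m"
      using c cc by (intro Ind_borel_eqI bump_extensional) (auto simp: Ind_borel_simps bump_closed simp flip: m_assoc)
    finally show ?thesis .
  qed
  obtain n where n: "good f n" using exists_good[OF f] by blast
  have n1: "- n \<le> n" "n \<le> n" using goodD(3)[OF n] by auto
  define A where "A = tv n (pideal (- n))"
  have A: "transversal A (pideal n) (pideal (- n))" unfolding A_def by (rule tv[OF admissible_pideal[OF n1(1)]])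
  let ?s = "\<lambda>a. bc f a \<odot>\<^bsub>I\<^esub> rep.act I (mk2 1 (- a) 0 1) (bump n)"
  let ?t = "f (mat 1) \<odot>\<^bsub>I\<^esub> rep.act I (mk2 0 1 1 0) (bump (n + 1))"
  have "R (\<Sum>a\<in>A. sc (bc f a) (u (- a) (E n))) (\<lambda>g\<in>carrier GL2. \<Oplus>a\<in>A. ?s a g)"
    unfolding u_def by (rule related_sum[of R, OF RI R0 R_add transversalD(1)[OF A]])
      (auto intro!: R_sc R_act E cells_closed(1)[OF f])
  moreover have "R (sc (f (mat 1)) (w (E (n + 1)))) ?t"
    unfolding w_def by (intro R_sc R_act E cells_closed(3)[OF f]) simp
  ultimately have "R (\<Phi> f) ((\<lambda>g\<in>carrier GL2. \<Oplus>a\<in>A. ?s a g) \<oplus>\<^bsub>I\<^esub> ?t)"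
    unfolding \<Phi>_eq[OF n order_refl order_refl] \<Phi>0_def integ_def A_def by (rule R_add)
  also have "(\<lambda>g\<in>carrier GL2. \<Oplus>a\<in>A. ?s a g) \<oplus>\<^bsub>I\<^esub> ?t = f"
  proof (rule Ind_borel_eqI)
    fix g :: "'l ^ 2 ^ 2" assume g: "invertible g"
    show "((\<lambda>g\<in>carrier GL2. \<Oplus>a\<in>A. ?s a g) \<oplus>\<^bsub>I\<^esub> ?t) g = f g"
      using Ind_expansion[OF f goodD(2)[OF n] n1(2,2,1) A g] g by (simp add: Ind_borel_simps)
  qed (use Ind_extensional[OF f] in \<open>auto simp: Ind_borel_simps\<close>)
  finally show ?thesis .
qed

end

section \<open>Representations and extensions\<close>

lemma rep_homI:
  assumes "\<And>v. v \<in> carrier V \<Longrightarrow> f v \<in> carrier W"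
    and "\<And>v w. \<lbrakk>v \<in> carrier V; w \<in> carrier V\<rbrakk> \<Longrightarrow> f (v \<oplus>\<^bsub>V\<^esub> w) = f v \<oplus>\<^bsub>W\<^esub> f w"
    and "\<And>a v. \<lbrakk>a \<in> carrier k; v \<in> carrier V\<rbrakk> \<Longrightarrow> f (a \<odot>\<^bsub>V\<^esub> v) = a \<odot>\<^bsub>W\<^esub> f v"
    and "\<And>g v. \<lbrakk>g \<in> carrier G; v \<in> carrier V\<rbrakk> \<Longrightarrow> f (act V g v) = act W g (f v)"
  shows "f \<in> rep_hom G k V W"
  using assms by (auto simp: rep_hom_def hom_def)

lemma rep_homD:
  assumes "f \<in> rep_hom G k V W"
  shows "\<And>v. v \<in> carrier V \<Longrightarrow> f v \<in> carrier W"
    and "\<And>v w. \<lbrakk>v \<in> carrier V; w \<in> carrier V\<rbrakk> \<Longrightarrow> f (v \<oplus>\<^bsub>V\<^esub> w) = f v \<oplus>\<^bsub>W\<^esub> f w"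
    and "\<And>a v. \<lbrakk>a \<in> carrier k; v \<in> carrier V\<rbrakk> \<Longrightarrow> f (a \<odot>\<^bsub>V\<^esub> v) = a \<odot>\<^bsub>W\<^esub> f v"
    and "\<And>g v. \<lbrakk>g \<in> carrier G; v \<in> carrier V\<rbrakk> \<Longrightarrow> f (act V g v) = act W g (f v)"
  using assms by (auto simp: rep_hom_def hom_def)

lemma rep_hom_compose:
  assumes f: "f \<in> rep_hom G k U V" and g: "g \<in> rep_hom G k V W" shows "(\<lambda>x. g (f x)) \<in> rep_hom G k U W"
  by (rule rep_homI) (simp_all add: rep_homD[OF f] rep_homD[OF g])

context representation
begin

lemma add_diff_cancel: "\<lbrakk>u \<in> carrier V; a \<in> carrier V\<rbrakk> \<Longrightarrow> (u \<ominus>\<^bsub>V\<^esub> a) \<oplus>\<^bsub>V\<^esub> a = u"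
  by (simp add: a_minus_def M.a_assoc M.l_neg)

lemma minus_smult: "v \<in> carrier V \<Longrightarrow> \<ominus>\<^bsub>V\<^esub> v = (\<ominus>\<^bsub>k\<^esub> \<one>\<^bsub>k\<^esub>) \<odot>\<^bsub>V\<^esub> v"
  by (simp add: smult_l_minus)

lemma act_inverse: "\<lbrakk>g \<in> carrier G; v \<in> carrier V\<rbrakk> \<Longrightarrow> act V g (act V (inv\<^bsub>G\<^esub> g) v) = v"
  by (simp add: act_one flip: act_mult)

lemma subrepI:
  assumes "W \<subseteq> carrier V" "\<zero>\<^bsub>V\<^esub> \<in> W" "\<And>v w. \<lbrakk>v \<in> W; w \<in> W\<rbrakk> \<Longrightarrow> v \<oplus>\<^bsub>V\<^esub> w \<in> W"
    "\<And>a v. \<lbrakk>a \<in> carrier k; v \<in> W\<rbrakk> \<Longrightarrow> a \<odot>\<^bsub>V\<^esub> v \<in> W" "\<And>g v. \<lbrakk>g \<in> carrier G; v \<in> W\<rbrakk> \<Longrightarrow> act V g v \<in> W"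
  shows "subrep G k V W"
  unfolding subrep_def
proof (intro conjI ballI submoduleI)
  fix v assume v: "v \<in> W"
  then have "(\<ominus>\<^bsub>k\<^esub> \<one>\<^bsub>k\<^esub>) \<odot>\<^bsub>V\<^esub> v \<in> W" by (intro assms(4)) simp_all
  then show "\<ominus>\<^bsub>V\<^esub> v \<in> W" using minus_smult v assms(1) by auto
qed (use assms in auto)

lemma subrepD:
  assumes "subrep G k V W"
  shows "W \<subseteq> carrier V" "\<zero>\<^bsub>V\<^esub> \<in> W" "\<And>v w. \<lbrakk>v \<in> W; w \<in> W\<rbrakk> \<Longrightarrow> v \<oplus>\<^bsub>V\<^esub> w \<in> W"
    "\<And>a v. \<lbrakk>a \<in> carrier k; v \<in> W\<rbrakk> \<Longrightarrow> a \<odot>\<^bsub>V\<^esub> v \<in> W" "\<And>g v. \<lbrakk>g \<in> carrier G; v \<in> W\<rbrakk> \<Longrightarrow> act V g v \<in> W"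
    "\<And>v. v \<in> W \<Longrightarrow> \<ominus>\<^bsub>V\<^esub> v \<in> W"
proof -
  have sm: "submodule W k V" using assms by (simp add: subrep_def)
  then interpret submodule W k V .
  show "W \<subseteq> carrier V" "\<zero>\<^bsub>V\<^esub> \<in> W" "\<And>v w. \<lbrakk>v \<in> W; w \<in> W\<rbrakk> \<Longrightarrow> v \<oplus>\<^bsub>V\<^esub> w \<in> W"
    "\<And>a v. \<lbrakk>a \<in> carrier k; v \<in> W\<rbrakk> \<Longrightarrow> a \<odot>\<^bsub>V\<^esub> v \<in> W"
    using submoduleE(1,5)[OF sm] smult_closed one_closed by auto
  show "\<And>v. v \<in> W \<Longrightarrow> \<ominus>\<^bsub>V\<^esub> v \<in> W" by (rule submoduleE(3)[OF sm])
  show "\<And>g v. \<lbrakk>g \<in> carrier G; v \<in> W\<rbrakk> \<Longrightarrow> act V g v \<in> W" using assms by (simp add: subrep_def)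
qed

lemma subrep_representation:
  assumes W: "subrep G k V W" shows "representation G k (V\<lparr>carrier := W\<rparr>)"
proof -
  note w = subrepD[OF W]
  have "submodule W k V" using W by (simp add: subrep_def)
  then have "Module.module k (V\<lparr>carrier := W\<rparr>)" using module_axioms by (rule submodule.submodule_is_module)
  then show ?thesis
    using group_axioms field_axioms w
    by (intro representation.intro representation_axioms.intro) (auto simp: act_add act_smult act_one act_mult subset_iff)
qed

lemma rep_hom_zero:
  assumes "representation G k W" "f \<in> rep_hom G k V W" shows "f \<zero>\<^bsub>V\<^esub> = \<zero>\<^bsub>W\<^esub>"
proof -
  interpret W: representation G k W by fact
  have "f (\<zero>\<^bsub>k\<^esub> \<odot>\<^bsub>V\<^esub> \<zero>\<^bsub>V\<^esub>) = \<zero>\<^bsub>k\<^esub> \<odot>\<^bsub>W\<^esub> f \<zero>\<^bsub>V\<^esub>" by (rule rep_homD(3)[OF assms(2)]) simp_all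
  then show ?thesis using rep_homD(1)[OF assms(2), of "\<zero>\<^bsub>V\<^esub>"] by simp
qed

lemma rep_hom_minus:
  assumes "representation G k W" "f \<in> rep_hom G k V W" "v \<in> carrier V" shows "f (\<ominus>\<^bsub>V\<^esub> v) = \<ominus>\<^bsub>W\<^esub> f v"
proof -
  interpret W: representation G k W by fact
  show ?thesis using rep_homD(1,3)[OF assms(2)] assms(3) by (simp add: minus_smult W.minus_smult)
qed

lemma rep_hom_diff:
  assumes "representation G k W" "f \<in> rep_hom G k V W" "v \<in> carrier V" "v' \<in> carrier V"
  shows "f (v \<ominus>\<^bsub>V\<^esub> v') = f v \<ominus>\<^bsub>W\<^esub> f v'"
  using rep_homD(2)[OF assms(2)] assms rep_hom_minus[OF assms(1,2)] by (simp add: a_minus_def)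

lemma kernel_subrep:
  assumes W: "representation G k W" and f: "f \<in> rep_hom G k V W"
  shows "subrep G k V {v \<in> carrier V. f v = \<zero>\<^bsub>W\<^esub>}"
proof -
  interpret W: representation G k W by (rule W)
  have "act W g \<zero>\<^bsub>W\<^esub> = \<zero>\<^bsub>W\<^esub>" if "g \<in> carrier G" for g
    using W.act_smult[OF that, of "\<zero>\<^bsub>k\<^esub>" "\<zero>\<^bsub>W\<^esub>"] W.act_closed[OF that, of "\<zero>\<^bsub>W\<^esub>"] by simp
  then show ?thesis
    using rep_homD[OF f] rep_hom_zero[OF W f] by (intro subrepI) (auto simp: act_closed)
qed

lemma rep_iso_inverse:
  assumes f: "f \<in> rep_iso G k V W"
  shows "inv_into (carrier V) f \<in> rep_iso G k W V"
proof -
  have h: "f \<in> rep_hom G k V W" and b: "bij_betw f (carrier V) (carrier W)" using f by (auto simp: rep_iso_def)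
  let ?j = "inv_into (carrier V) f"
  have j: "?j w \<in> carrier V" "f (?j w) = w" if "w \<in> carrier W" for w
    using that b by (auto simp: bij_betw_def inv_into_into f_inv_into_f)
  have fj: "?j (f v) = v" if "v \<in> carrier V" for v using that b by (simp add: bij_betw_def)
  have eq: "?j w = v" if "v \<in> carrier V" "f v = w" for v w using that fj by blast
  have "?j \<in> rep_hom G k W V"
  proof (rule rep_homI)
    show "?j (v \<oplus>\<^bsub>W\<^esub> w) = ?j v \<oplus>\<^bsub>V\<^esub> ?j w" if "v \<in> carrier W" "w \<in> carrier W" for v w
      using j that rep_homD(2)[OF h] by (intro eq) auto
    show "?j (a \<odot>\<^bsub>W\<^esub> w) = a \<odot>\<^bsub>V\<^esub> ?j w" if "a \<in> carrier k" "w \<in> carrier W" for a w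
      using j that rep_homD(3)[OF h] by (intro eq) auto
    show "?j (act W g w) = act V g (?j w)" if "g \<in> carrier G" "w \<in> carrier W" for g w
      using j that rep_homD(4)[OF h] by (intro eq) (auto simp: act_closed)
  qed (rule j)
  then show ?thesis using bij_betw_inv_into[OF b] by (simp add: rep_iso_def)
qed

lemma quotient_coset:
  assumes W: "representation G k W" and f: "f \<in> rep_hom G k V W"
    and u: "u \<in> carrier V" and K: "K = {v \<in> carrier V. f v = \<zero>\<^bsub>W\<^esub>}"
  shows "K +>\<^bsub>V\<^esub> u = {v \<in> carrier V. f v = f u}"
proof -
  interpret W: representation G k W by (rule W)
  note h = rep_homD[OF f]
  show ?thesis
  proof (intro equalityI subsetI)
    fix v assume "v \<in> K +>\<^bsub>V\<^esub> u"
    then show "v \<in> {v \<in> carrier V. f v = f u}" using u h by (auto simp: a_r_coset_def' K)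
  next
    fix v assume v: "v \<in> {v \<in> carrier V. f v = f u}"
    then have "v \<ominus>\<^bsub>V\<^esub> u \<in> K" using u rep_hom_diff[OF W f, of v u] h(1) by (simp add: K W.M.r_neg a_minus_def)
    moreover have "v = (v \<ominus>\<^bsub>V\<^esub> u) \<oplus>\<^bsub>V\<^esub> u" using u v by (simp add: add_diff_cancel)
    ultimately show "v \<in> K +>\<^bsub>V\<^esub> u" unfolding a_r_coset_def' by blast
  qed
qed

lemma quotient_map:
  assumes K: "subrep G k V K"
  shows "(\<lambda>u. K +>\<^bsub>V\<^esub> u) \<in> rep_hom G k V (quot_rep V K)" "(\<lambda>u. K +>\<^bsub>V\<^esub> u) ` carrier V = carrier (quot_rep V K)"
proof -
  note d = subrepD[OF K]
  have "submodule K k V" using K by (simp add: subrep_def)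
  then have "subgroup K (add_monoid V)" by (rule submodule.axioms(1))
  then interpret K: abelian_subgroup K V by (rule abelian_subgroupI2[OF M.a_comm_group])
  let ?Q = "quot_rep V K"
  show "(\<lambda>u. K +>\<^bsub>V\<^esub> u) ` carrier V = carrier ?Q" by (auto simp: quot_rep_def A_RCOSETS_def')
  then show "(\<lambda>u. K +>\<^bsub>V\<^esub> u) \<in> rep_hom G k V ?Q"
  proof (intro rep_homI)
    fix u v assume "u \<in> carrier V" "v \<in> carrier V"
    then show "K +>\<^bsub>V\<^esub> (u \<oplus>\<^bsub>V\<^esub> v) = (K +>\<^bsub>V\<^esub> u) \<oplus>\<^bsub>?Q\<^esub> (K +>\<^bsub>V\<^esub> v)" by (simp add: quot_rep_def K.a_rcos_sum)
  next
    fix a u assume a: "a \<in> carrier k" and u: "u \<in> carrier V"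
    have "K +>\<^bsub>V\<^esub> (a \<odot>\<^bsub>V\<^esub> u) \<subseteq> set_add V K ((\<lambda>x. a \<odot>\<^bsub>V\<^esub> x) ` (K +>\<^bsub>V\<^esub> u))"
    proof
      fix x assume "x \<in> K +>\<^bsub>V\<^esub> (a \<odot>\<^bsub>V\<^esub> u)"
      then obtain c where c: "c \<in> K" "x = c \<oplus>\<^bsub>V\<^esub> a \<odot>\<^bsub>V\<^esub> u" by (auto simp: a_r_coset_def')
      have "\<zero>\<^bsub>V\<^esub> \<oplus>\<^bsub>V\<^esub> u \<in> K +>\<^bsub>V\<^esub> u" using d(2) unfolding a_r_coset_def' by blast
      then have "a \<odot>\<^bsub>V\<^esub> u \<in> (\<lambda>x. a \<odot>\<^bsub>V\<^esub> x) ` (K +>\<^bsub>V\<^esub> u)" using u by simp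
      then show "x \<in> set_add V K ((\<lambda>x. a \<odot>\<^bsub>V\<^esub> x) ` (K +>\<^bsub>V\<^esub> u))" using c unfolding set_add_def' by blast
    qed
    moreover have "c \<oplus>\<^bsub>V\<^esub> a \<odot>\<^bsub>V\<^esub> (c' \<oplus>\<^bsub>V\<^esub> u) \<in> K +>\<^bsub>V\<^esub> (a \<odot>\<^bsub>V\<^esub> u)" if c: "c \<in> K" "c' \<in> K" for c c'
    proof -
      have "c \<oplus>\<^bsub>V\<^esub> a \<odot>\<^bsub>V\<^esub> (c' \<oplus>\<^bsub>V\<^esub> u) = (c \<oplus>\<^bsub>V\<^esub> a \<odot>\<^bsub>V\<^esub> c') \<oplus>\<^bsub>V\<^esub> a \<odot>\<^bsub>V\<^esub> u"
        using c d(1) a u by (simp add: smult_r_distr M.a_assoc subset_iff)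
      moreover have "c \<oplus>\<^bsub>V\<^esub> a \<odot>\<^bsub>V\<^esub> c' \<in> K" using c d(3,4) a by simp
      ultimately show ?thesis unfolding a_r_coset_def' by blast
    qed
    then have "set_add V K ((\<lambda>x. a \<odot>\<^bsub>V\<^esub> x) ` (K +>\<^bsub>V\<^esub> u)) \<subseteq> K +>\<^bsub>V\<^esub> (a \<odot>\<^bsub>V\<^esub> u)"
      unfolding set_add_def' a_r_coset_def'[of V K u] by blast
    ultimately have "K +>\<^bsub>V\<^esub> (a \<odot>\<^bsub>V\<^esub> u) = set_add V K ((\<lambda>x. a \<odot>\<^bsub>V\<^esub> x) ` (K +>\<^bsub>V\<^esub> u))" by (rule equalityI)
    then show "K +>\<^bsub>V\<^esub> (a \<odot>\<^bsub>V\<^esub> u) = a \<odot>\<^bsub>?Q\<^esub> (K +>\<^bsub>V\<^esub> u)" by (simp add: quot_rep_def)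
  next
    fix g u assume g: "g \<in> carrier G" and u: "u \<in> carrier V"
    have "K +>\<^bsub>V\<^esub> act V g u \<subseteq> act V g ` (K +>\<^bsub>V\<^esub> u)"
    proof
      fix x assume "x \<in> K +>\<^bsub>V\<^esub> act V g u"
      then obtain c where c: "c \<in> K" "x = c \<oplus>\<^bsub>V\<^esub> act V g u" by (auto simp: a_r_coset_def')
      have c': "act V (inv\<^bsub>G\<^esub> g) c \<in> K" "c \<in> carrier V" using d(1,5) c g by auto
      then have "act V g (act V (inv\<^bsub>G\<^esub> g) c \<oplus>\<^bsub>V\<^esub> u) = x" using c(2) g u by (simp add: act_add act_closed act_inverse)
      then show "x \<in> act V g ` (K +>\<^bsub>V\<^esub> u)" using c'(1) unfolding a_r_coset_def' by blast
    qed
    moreover have "act V g (c \<oplus>\<^bsub>V\<^esub> u) \<in> K +>\<^bsub>V\<^esub> act V g u" if c: "c \<in> K" for c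
    proof -
      have "act V g (c \<oplus>\<^bsub>V\<^esub> u) = act V g c \<oplus>\<^bsub>V\<^esub> act V g u" using c d(1) g u by (simp add: act_add subset_iff)
      then show ?thesis using d(5)[OF g c] unfolding a_r_coset_def' by blast
    qed
    then have "act V g ` (K +>\<^bsub>V\<^esub> u) \<subseteq> K +>\<^bsub>V\<^esub> act V g u" unfolding a_r_coset_def'[of V K u] by blast
    ultimately have "K +>\<^bsub>V\<^esub> act V g u = act V g ` (K +>\<^bsub>V\<^esub> u)" by (rule equalityI)
    then show "K +>\<^bsub>V\<^esub> act V g u = act ?Q g (K +>\<^bsub>V\<^esub> u)" by (simp add: quot_rep_def)
  qed blast
qed

lemma induced_hom:
  assumes f: "f \<in> rep_hom G k V W" "f ` carrier V = carrier W" and h: "h \<in> rep_hom G k V U"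
    and wd: "\<And>v v'. \<lbrakk>v \<in> carrier V; v' \<in> carrier V; f v = f v'\<rbrakk> \<Longrightarrow> h v = h v'"
  shows "\<exists>s\<in>rep_hom G k W U. \<forall>v\<in>carrier V. s (f v) = h v"
proof -
  note fh = rep_homD[OF f(1)] and hh = rep_homD[OF h]
  define s where "s w = h (inv_into (carrier V) f w)" for w
  have sf: "s (f v) = h v" if "v \<in> carrier V" for v
    unfolding s_def using that by (intro wd inv_into_into f_inv_into_f imageI)
  have "s \<in> rep_hom G k W U"
  proof (rule rep_homI; unfold f(2)[symmetric]; elim imageE; hypsubst)
    fix v assume v: "v \<in> carrier V"
    show "s (f v) \<in> carrier U" using v hh(1) by (simp add: sf)
    show "s (f v \<oplus>\<^bsub>W\<^esub> f v') = s (f v) \<oplus>\<^bsub>U\<^esub> s (f v')" if "v' \<in> carrier V" for v'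
      using v that by (simp add: sf hh(2) flip: fh(2))
    show "s (a \<odot>\<^bsub>W\<^esub> f v) = a \<odot>\<^bsub>U\<^esub> s (f v)" if "a \<in> carrier k" for a
      using v that by (simp add: sf hh(3) flip: fh(3))
    show "s (act W g (f v)) = act U g (s (f v))" if "g \<in> carrier G" for g
      using v that by (simp add: sf hh(4) act_closed flip: fh(4))
  qed
  then show ?thesis using sf by blast
qed

lemma first_isomorphism:
  assumes W: "representation G k W" and f: "f \<in> rep_hom G k V W" and surj: "f ` carrier V = carrier W"
    and K: "K = {v \<in> carrier V. f v = \<zero>\<^bsub>W\<^esub>}"
  shows "rep_isomorphic G k W (quot_rep V K)"
proof -
  let ?\<pi> = "\<lambda>u. K +>\<^bsub>V\<^esub> u"
  have "subrep G k V K" unfolding K by (rule kernel_subrep[OF W f])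
  note \<pi> = quotient_map[OF this]
  note co = quotient_coset[OF W f _ K]
  obtain s where s: "s \<in> rep_hom G k W (quot_rep V K)" "\<And>v. v \<in> carrier V \<Longrightarrow> s (f v) = ?\<pi> v"
    using induced_hom[OF f surj \<pi>(1)] co by auto
  have "inj_on s (f ` carrier V)"
  proof (rule inj_onI; elim imageE; hypsubst)
    fix v v' assume v: "v \<in> carrier V" "v' \<in> carrier V" "s (f v) = s (f v')"
    then have "{u \<in> carrier V. f u = f v} = {u \<in> carrier V. f u = f v'}" using co by (simp only: s(2))
    then show "f v = f v'" using v(1) by blast
  qed
  moreover have "s ` f ` carrier V = carrier (quot_rep V K)" unfolding \<pi>(2)[symmetric] image_image using s(2) by (intro image_cong) simp_all
  ultimately have "s \<in> rep_iso G k W (quot_rep V K)" using s(1) by (simp add: rep_iso_def bij_betw_def surj)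
  then show ?thesis unfolding rep_isomorphic_def by blast
qed

text \<open>A nonzero map into an irreducible representation is onto, so \<open>W\<close> is the
  quotient of \<open>V2\<close> by the kernel.\<close>

lemma is_subquotientI:
  assumes W: "irreducible_rep G k W" and V2: "subrep G k V V2"
    and f: "f \<in> rep_hom G k (V\<lparr>carrier := V2\<rparr>) W" and v: "v \<in> V2" "f v \<noteq> \<zero>\<^bsub>W\<^esub>"
  shows "is_subquotient G k W V"
proof -
  interpret W: representation G k W using W by (simp add: irreducible_rep_def)
  let ?U = "V\<lparr>carrier := V2\<rparr>"
  interpret U: representation G k ?U by (rule subrep_representation[OF V2])
  note h = rep_homD[OF f]
  define V1 where "V1 = {v \<in> carrier ?U. f v = \<zero>\<^bsub>W\<^esub>}"
  have "subrep G k W (f ` carrier ?U)"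
  proof (rule W.subrepI)
    show "\<zero>\<^bsub>W\<^esub> \<in> f ` carrier ?U" using U.rep_hom_zero[OF W.representation_axioms f] U.M.zero_closed by (metis imageI)
    fix x y a g assume x: "x \<in> f ` carrier ?U"
    then obtain x' where x': "x' \<in> carrier ?U" "x = f x'" by blast
    show "x \<oplus>\<^bsub>W\<^esub> y \<in> f ` carrier ?U" if "y \<in> f ` carrier ?U"
    proof -
      obtain y' where y': "y' \<in> carrier ?U" "y = f y'" using \<open>y \<in> f ` carrier ?U\<close> by blast
      show ?thesis using h(2)[OF x'(1) y'(1)] U.M.a_closed[OF x'(1) y'(1)] x'(2) y'(2) by (metis imageI)
    qed
    show "a \<odot>\<^bsub>W\<^esub> x \<in> f ` carrier ?U" if "a \<in> carrier k"
      using h(3)[OF that x'(1)] U.smult_closed[OF that x'(1)] x'(2) by (metis imageI)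
    show "act W g x \<in> f ` carrier ?U" if "g \<in> carrier G"
      using h(4)[OF that x'(1)] U.act_closed[OF that x'(1)] x'(2) by (metis imageI)
  qed (use h(1) in blast)
  then have surj: "f ` carrier ?U = carrier W" using W v by (auto simp: irreducible_rep_def)
  have "rep_isomorphic G k W (quot_rep ?U V1)"
    by (rule U.first_isomorphism[OF W.representation_axioms f surj V1_def])
  moreover have "subrep G k V V1"
  proof -
    have "subrep G k ?U V1" unfolding V1_def by (rule U.kernel_subrep[OF W.representation_axioms f])
    note d = U.subrepD[OF this]
    show ?thesis using subrepD[OF V2] d by (intro subrepI) auto
  qed
  moreover have "V1 \<subseteq> V2" by (auto simp: V1_def)
  ultimately show ?thesis unfolding is_subquotient_def using V2 by blast
qed

end

section \<open>Extensions and their splittings\<close>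

lemma smooth_extensionsD:
  assumes "(E, i, q) \<in> smooth_extensions G k W V"
  shows "smooth_representation G k E" "i \<in> rep_hom G k V E" "inj_on i (carrier V)" "q \<in> rep_hom G k E W"
    "q ` carrier E = carrier W" "i ` carrier V = {e \<in> carrier E. q e = \<zero>\<^bsub>W\<^esub>}"
  using assms by (auto simp: smooth_extensions_def)

lemma direct_sum_simps:
  "carrier (direct_sum_rep V W) = carrier V \<times> carrier W" "\<zero>\<^bsub>direct_sum_rep V W\<^esub> = (\<zero>\<^bsub>V\<^esub>, \<zero>\<^bsub>W\<^esub>)"
  "(v, w) \<oplus>\<^bsub>direct_sum_rep V W\<^esub> (v', w') = (v \<oplus>\<^bsub>V\<^esub> v', w \<oplus>\<^bsub>W\<^esub> w')"
  "a \<odot>\<^bsub>direct_sum_rep V W\<^esub> (v, w) = (a \<odot>\<^bsub>V\<^esub> v, a \<odot>\<^bsub>W\<^esub> w)"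
  "act (direct_sum_rep V W) g (v, w) = (act V g v, act W g w)"
  by (simp_all add: direct_sum_rep_def)

lemma direct_sum_smooth:
  assumes "smooth_representation G k V" "smooth_representation G k W"
  shows "smooth_representation G k (direct_sum_rep V W)"
proof -
  interpret V: smooth_representation G k V by fact
  interpret W: smooth_representation G k W by fact
  let ?S = "direct_sum_rep V W"
  have "abelian_group ?S"
  proof (rule abelian_groupI)
    fix x assume "x \<in> carrier ?S"
    then show "\<exists>y\<in>carrier ?S. y \<oplus>\<^bsub>?S\<^esub> x = \<zero>\<^bsub>?S\<^esub>"
      by (intro bexI[of _ "(\<ominus>\<^bsub>V\<^esub> fst x, \<ominus>\<^bsub>W\<^esub> snd x)"]) (auto simp: direct_sum_simps V.M.l_neg W.M.l_neg)
  qed (auto simp: direct_sum_simps V.M.a_ac W.M.a_ac)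
  then have "Module.module k ?S"
    by (intro moduleI V.is_cring) (auto simp: direct_sum_simps V.smult_l_distr W.smult_l_distr V.smult_r_distr
      W.smult_r_distr V.smult_assoc1 W.smult_assoc1)
  then have "representation G k ?S"
    using V.group_axioms V.field_axioms
    by (intro representation.intro representation_axioms.intro) (auto simp: direct_sum_simps V.act_closed W.act_closed
      V.act_add W.act_add V.act_smult W.act_smult V.act_one W.act_one V.act_mult W.act_mult)
  moreover have "openin (top_of_set (carrier G)) {g \<in> carrier G. act ?S g x = x}" if x: "x \<in> carrier ?S" for x
  proof -
    have "{g \<in> carrier G. act ?S g x = x} = {g \<in> carrier G. act V g (fst x) = fst x} \<inter> {g \<in> carrier G. act W g (snd x) = snd x}"
      by (cases x) (auto simp: direct_sum_simps)
    then show ?thesis using V.open_stabilizer[of "fst x"] W.open_stabilizer[of "snd x"] x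
      by (auto simp: direct_sum_simps intro: openin_Int)
  qed
  ultimately show ?thesis by (intro smooth_representation.intro smooth_representation_axioms.intro)
qed

lemma extension_equivI:
  assumes "(E, i, q) \<in> smooth_extensions G k W V" "(E', i', q') \<in> smooth_extensions G k W V"
    and f: "f \<in> rep_iso G k E E'" "\<And>v. v \<in> carrier V \<Longrightarrow> f (i v) = i' v" "\<And>e. e \<in> carrier E \<Longrightarrow> q' (f e) = q e"
  shows "((E, i, q), (E', i', q')) \<in> extension_equiv G k W V"
  unfolding extension_equiv_def mem_Collect_eq prod.case
  using assms(1,2) by (intro conjI bexI[OF _ f(1)] ballI) (simp_all only: f(2,3))

text \<open>A section identifies an extension with the direct sum. Hence any two extensions are
  equivalent, and the class of the split one is the only class.\<close>

lemma Ext1_trivialI: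
  fixes V :: "('k, 'v, 'g::topological_space) rep" and W :: "('k, 'w, 'g) rep"
  assumes V: "smooth_representation G k V" and W: "smooth_representation G k W"
    and split: "\<And>(E :: ('k, 'v \<times> 'w, 'g) rep) i q. (E, i, q) \<in> smooth_extensions G k W V
      \<Longrightarrow> \<exists>s\<in>rep_hom G k W E. \<forall>w\<in>carrier W. q (s w) = w"
  shows "Ext1 G k W V = {Ext1_zero G k W V}"
proof -
  interpret V: smooth_representation G k V by (rule V)
  interpret W: smooth_representation G k W by (rule W)
  let ?S = "direct_sum_rep V W"
  interpret S: smooth_representation G k ?S by (rule direct_sum_smooth[OF V W])
  let ?R = "extension_equiv G k W V"
  let ?X = "smooth_extensions G k W V"
  define z where "z = (?S, \<lambda>v :: 'v. (v, \<zero>\<^bsub>W\<^esub>), snd :: 'v \<times> 'w \<Rightarrow> 'w)"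
  have z: "z \<in> ?X"
  proof -
    have act0: "act W g \<zero>\<^bsub>W\<^esub> = \<zero>\<^bsub>W\<^esub>" if "g \<in> carrier G" for g
      using W.act_smult[OF that, of "\<zero>\<^bsub>k\<^esub>" "\<zero>\<^bsub>W\<^esub>"] W.act_closed[OF that, of "\<zero>\<^bsub>W\<^esub>"] by simp
    have 1: "(\<lambda>v. (v, \<zero>\<^bsub>W\<^esub>)) \<in> rep_hom G k V ?S" by (rule rep_homI) (simp_all add: direct_sum_simps act0)
    have 2: "snd \<in> rep_hom G k ?S W" by (rule rep_homI) (auto simp: direct_sum_simps)
    have 3: "snd ` carrier ?S = carrier W" "(\<lambda>v. (v, \<zero>\<^bsub>W\<^esub>)) ` carrier V = {e \<in> carrier ?S. snd e = \<zero>\<^bsub>W\<^esub>}"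
      using V.M.zero_closed by (auto simp: direct_sum_simps image_iff)
    show ?thesis using 1 2 3 S.smooth_representation_axioms by (simp add: z_def smooth_extensions_def inj_on_def)
  qed
  have zx: "(z, x) \<in> ?R" if x: "x \<in> ?X" for x
  proof -
    obtain E i q where xe: "x = (E, i, q)" by (cases x)
    note e = smooth_extensionsD[OF x[unfolded xe]]
    interpret E: smooth_representation G k E by (rule e(1))
    obtain s where s: "s \<in> rep_hom G k W E" "\<And>w. w \<in> carrier W \<Longrightarrow> q (s w) = w" using split x xe by blast
    note ih = rep_homD[OF e(2)] and qh = rep_homD[OF e(4)] and sh = rep_homD[OF s(1)]
    define f where "f = (\<lambda>(v, w). i v \<oplus>\<^bsub>E\<^esub> s w)"
    have qi: "q (i v) = \<zero>\<^bsub>W\<^esub>" if "v \<in> carrier V" for v using e(6) that by blast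
    have qf: "q (f y) = snd y" if yS: "y \<in> carrier ?S" for y
    proof -
      obtain v w where y: "y = (v, w)" "v \<in> carrier V" "w \<in> carrier W" using yS by (auto simp: direct_sum_simps)
      have "q (f y) = q (i v) \<oplus>\<^bsub>W\<^esub> q (s w)" unfolding y(1) f_def prod.case by (rule qh(2)[OF ih(1)[OF y(2)] sh(1)[OF y(3)]])
      then show ?thesis using y s(2) qi by simp
    qed
    have f: "f \<in> rep_hom G k ?S E"
    proof (rule rep_homI)
      fix y y' assume "y \<in> carrier ?S" "y' \<in> carrier ?S"
      then show "f (y \<oplus>\<^bsub>?S\<^esub> y') = f y \<oplus>\<^bsub>E\<^esub> f y'"
        using ih(1,2) sh(1,2) by (auto simp: direct_sum_simps f_def E.M.a_ac)
    qed (use ih sh in \<open>auto simp: direct_sum_simps f_def E.smult_r_distr E.act_add\<close>)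
    have "inj_on f (carrier ?S)"
    proof (rule inj_onI)
      fix y y' assume y: "y \<in> carrier ?S" "y' \<in> carrier ?S" "f y = f y'"
      then have w: "snd y = snd y'" using qf by metis
      then have "i (fst y) = i (fst y')" using y ih(1) sh(1) by (auto simp: direct_sum_simps f_def)
      then have "fst y = fst y'" using e(3) y by (auto simp: direct_sum_simps dest: inj_onD)
      then show "y = y'" using w by (rule prod_eqI)
    qed
    moreover have "f ` carrier ?S = carrier E"
    proof (intro equalityI subsetI)
      fix x assume x: "x \<in> carrier E"
      have "q x \<in> carrier W" using qh(1) x by blast
      moreover from this have sx: "s (q x) \<in> carrier E" "q (s (q x)) = q x" using sh(1) s(2) by auto
      have "q (x \<ominus>\<^bsub>E\<^esub> s (q x)) = \<zero>\<^bsub>W\<^esub>"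
        using E.rep_hom_diff[OF W.representation_axioms e(4) x sx(1)] sx(2) \<open>q x \<in> carrier W\<close> by (simp add: a_minus_def W.M.r_neg)
      then have "x \<ominus>\<^bsub>E\<^esub> s (q x) \<in> i ` carrier V" unfolding e(6) using x sx by simp
      then obtain v where v: "v \<in> carrier V" "x \<ominus>\<^bsub>E\<^esub> s (q x) = i v" by blast
      have "f (v, q x) = x" using E.add_diff_cancel[OF x sx(1)] by (simp add: f_def v(2)[symmetric])
      ultimately show "x \<in> f ` carrier ?S" using v(1) by (force simp: direct_sum_simps)
    qed (use rep_homD(1)[OF f] in blast)
    ultimately have iso: "f \<in> rep_iso G k ?S E" using f by (simp add: rep_iso_def bij_betw_def)
    have "f (v, \<zero>\<^bsub>W\<^esub>) = i v" if "v \<in> carrier V" for v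
      using W.rep_hom_zero[OF E.representation_axioms s(1)] ih(1)[OF that] by (simp add: f_def)
    then show ?thesis using z x iso qf unfolding z_def xe by (intro extension_equivI)
  qed
  have xy: "(x, y) \<in> ?R" if x: "x \<in> ?X" and y: "y \<in> ?X" for x y
  proof -
    obtain E i q where xe: "x = (E, i, q)" by (cases x)
    obtain E' i' q' where ye: "y = (E', i', q')" by (cases y)
    note e = smooth_extensionsD[OF x[unfolded xe]] and e' = smooth_extensionsD[OF y[unfolded ye]]
    interpret E: smooth_representation G k E by (rule e(1))
    interpret E': smooth_representation G k E' by (rule e'(1))
    obtain f where f: "f \<in> rep_iso G k ?S E" "\<And>v. v \<in> carrier V \<Longrightarrow> f (v, \<zero>\<^bsub>W\<^esub>) = i v"
        "\<And>y. y \<in> carrier ?S \<Longrightarrow> q (f y) = snd y"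
      using zx[OF x] unfolding z_def xe extension_equiv_def by auto
    obtain f' where f': "f' \<in> rep_iso G k ?S E'" "\<And>v. v \<in> carrier V \<Longrightarrow> f' (v, \<zero>\<^bsub>W\<^esub>) = i' v"
        "\<And>y. y \<in> carrier ?S \<Longrightarrow> q' (f' y) = snd y"
      using zx[OF y] unfolding z_def ye extension_equiv_def by auto
    define j where "j = inv_into (carrier ?S) f"
    have j: "j \<in> rep_iso G k E ?S" unfolding j_def by (rule S.rep_iso_inverse[OF f(1)])
    have fb: "bij_betw f (carrier ?S) (carrier E)" using f(1) by (simp add: rep_iso_def)
    have jf: "j (f y) = y" if "y \<in> carrier ?S" for y using that fb by (simp add: j_def bij_betw_def)
    have fj: "f (j x) = x" "j x \<in> carrier ?S" if "x \<in> carrier E" for x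
      using that fb by (auto simp: j_def bij_betw_def f_inv_into_f inv_into_into)
    have "(\<lambda>x. f' (j x)) \<in> rep_iso G k E E'"
    proof -
      have "(\<lambda>x. f' (j x)) \<in> rep_hom G k E E'"
        by (rule rep_hom_compose[of j G k E ?S]) (use j f'(1) in \<open>simp_all add: rep_iso_def\<close>)
      moreover have "bij_betw (f' \<circ> j) (carrier E) (carrier E')"
        by (rule bij_betw_trans[of j _ "carrier ?S"]) (use j f'(1) in \<open>simp_all add: rep_iso_def\<close>)
      ultimately show ?thesis by (simp add: rep_iso_def comp_def)
    qed
    moreover have "f' (j (i v)) = i' v" if "v \<in> carrier V" for v
    proof -
      have "(v, \<zero>\<^bsub>W\<^esub>) \<in> carrier ?S" using that by (simp add: direct_sum_simps)
      then show ?thesis using jf f(2)[OF that] f'(2)[OF that] by metis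
    qed
    moreover have "q' (f' (j x)) = q x" if "x \<in> carrier E" for x
      using fj[OF that] f(3) f'(3) by metis
    ultimately show ?thesis using x y unfolding xe ye by (intro extension_equivI)
  qed
  have sub: "?R \<subseteq> ?X \<times> ?X" by (auto simp: extension_equiv_def)
  have "?R `` {x} = ?X" if "x \<in> ?X" for x using sub xy[OF that] by blast
  moreover have "Ext1_zero G k W V = ?R `` {z}" by (simp add: Ext1_zero_def z_def)
  ultimately show ?thesis using z unfolding Ext1_def quotient_def by auto
qed

text \<open>The abstract additive group of a representation is realised inside the functions with values in \<open>'l\<close>,
  a type of characteristic \<open>p\<close>; a complement of its image is given the trivial action.\<close>

locale embedded_representation = smooth_representation GL2 k E + algebraically_closed k
  for k :: "'k ring" and E :: "('k, 'e, 'l::nonarch_local_field ^ 2 ^ 2) rep" +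
  fixes p :: nat and \<iota> :: "'e \<Rightarrow> 'e \<Rightarrow> 'l" and C :: "('e \<Rightarrow> 'l) set"
  assumes prime_p: "Factorial_Ring.prime p" and char_l: "CHAR('l) = p"
    and \<iota>_inj: "inj_on \<iota> (carrier E)"
    and \<iota>_add: "\<lbrakk>v \<in> carrier E; v' \<in> carrier E\<rbrakk> \<Longrightarrow> \<iota> (v \<oplus>\<^bsub>E\<^esub> v') = \<iota> v + \<iota> v'"
    and C_subgroup: "additive_subgroup_set C" and C_Int: "\<iota> ` carrier E \<inter> C = {0}"
    and C_span: "\<exists>v\<in>carrier E. x - \<iota> v \<in> C"
begin

lemma \<iota>_zero: "\<iota> \<zero>\<^bsub>E\<^esub> = 0"
  using \<iota>_add[of "\<zero>\<^bsub>E\<^esub>" "\<zero>\<^bsub>E\<^esub>"] by simp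

lemma \<iota>_diff: "\<lbrakk>v \<in> carrier E; v' \<in> carrier E\<rbrakk> \<Longrightarrow> \<iota> (v \<ominus>\<^bsub>E\<^esub> v') = \<iota> v - \<iota> v'"
  using \<iota>_add[of "v \<ominus>\<^bsub>E\<^esub> v'" v'] by (simp add: add_diff_cancel eq_diff_eq)

lemmas C = additive_subgroup_setD[OF C_subgroup] additive_subgroup_set_add[OF C_subgroup]

text \<open>The additive retraction of \<open>\<iota>\<close> with kernel \<open>C\<close>.\<close>

definition \<rho> :: "('e \<Rightarrow> 'l) \<Rightarrow> 'e"
  where "\<rho> x = (SOME v. v \<in> carrier E \<and> x - \<iota> v \<in> C)"

lemma \<rho>: "\<rho> x \<in> carrier E" "x - \<iota> (\<rho> x) \<in> C"
proof -
  have "\<exists>v. v \<in> carrier E \<and> x - \<iota> v \<in> C" using C_span[of x] by blast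
  then have "\<rho> x \<in> carrier E \<and> x - \<iota> (\<rho> x) \<in> C" unfolding \<rho>_def by (rule someI_ex)
  then show "\<rho> x \<in> carrier E" "x - \<iota> (\<rho> x) \<in> C" by auto
qed

lemma \<rho>_eqI: assumes v: "v \<in> carrier E" "x - \<iota> v \<in> C" shows "\<rho> x = v"
proof -
  have "(x - \<iota> v) - (x - \<iota> (\<rho> x)) \<in> C" by (rule C(2)[OF v(2) \<rho>(2)])
  then have "\<iota> (\<rho> x \<ominus>\<^bsub>E\<^esub> v) \<in> C" using v(1) \<rho>(1)[of x] by (simp add: \<iota>_diff)
  moreover have "\<iota> (\<rho> x \<ominus>\<^bsub>E\<^esub> v) \<in> \<iota> ` carrier E" using v(1) \<rho>(1)[of x] by simp
  ultimately have "\<iota> (\<rho> x \<ominus>\<^bsub>E\<^esub> v) \<in> \<iota> ` carrier E \<inter> C" by blast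
  then have "\<iota> (\<rho> x) = \<iota> v" using v(1) \<rho>(1)[of x] unfolding C_Int by (simp add: \<iota>_diff)
  then show ?thesis using \<iota>_inj v(1) \<rho>(1) by (simp add: inj_on_eq_iff)
qed

lemma \<rho>_add: "\<rho> (x + y) = \<rho> x \<oplus>\<^bsub>E\<^esub> \<rho> y"
proof (rule \<rho>_eqI)
  have "(x - \<iota> (\<rho> x)) + (y - \<iota> (\<rho> y)) \<in> C" by (intro C \<rho>)
  then show "x + y - \<iota> (\<rho> x \<oplus>\<^bsub>E\<^esub> \<rho> y) \<in> C" by (simp add: \<iota>_add \<rho>(1) algebra_simps)
qed (simp add: \<rho>(1))

lemma \<rho>_\<iota> [simp]: "v \<in> carrier E \<Longrightarrow> \<rho> (\<iota> v) = v" by (rule \<rho>_eqI) (simp_all add: C(1))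

lemma \<iota>_\<rho>: "x \<in> \<iota> ` carrier E \<Longrightarrow> \<iota> (\<rho> x) = x" by auto

text \<open>For matrices that are not invertible the identity is taken, because \<open>act E\<close>
  is unspecified there while additivity is required of every \<open>gact g\<close>.\<close>

definition gact :: "'l ^ 2 ^ 2 \<Rightarrow> ('e \<Rightarrow> 'l) \<Rightarrow> 'e \<Rightarrow> 'l"
  where "gact g x = (if invertible g then \<iota> (act E g (\<rho> x)) + (x - \<iota> (\<rho> x)) else x)"

text \<open>\<open>C\<close> is only an additive group, so scalars are made to kill it; outside
  \<open>carrier k\<close> the value \<open>0\<close> keeps the map additive.\<close>

definition scal :: "'k \<Rightarrow> ('e \<Rightarrow> 'l) \<Rightarrow> 'e \<Rightarrow> 'l"
  where "scal a x = (if a \<in> carrier k then \<iota> (a \<odot>\<^bsub>E\<^esub> \<rho> x) else 0)"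

lemma E_act: "invertible g \<Longrightarrow> v \<in> carrier E \<Longrightarrow> act E g v \<in> carrier E" by (rule act_closed) simp_all

lemma \<rho>_gact: "invertible g \<Longrightarrow> \<rho> (gact g x) = act E g (\<rho> x)"
  by (rule \<rho>_eqI) (simp_all add: gact_def \<rho> E_act)

lemma \<rho>_scal: "a \<in> carrier k \<Longrightarrow> \<rho> (scal a x) = a \<odot>\<^bsub>E\<^esub> \<rho> x"
  by (simp add: scal_def \<rho>)

lemma gact_\<iota>: "invertible g \<Longrightarrow> v \<in> carrier E \<Longrightarrow> gact g (\<iota> v) = \<iota> (act E g v)"
  by (simp add: gact_def)

lemma scal_\<iota>: "a \<in> carrier k \<Longrightarrow> v \<in> carrier E \<Longrightarrow> scal a (\<iota> v) = \<iota> (a \<odot>\<^bsub>E\<^esub> v)"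
  by (simp add: scal_def)

sublocale sm: smooth_module k scal p gact "\<iota> ` carrier E"
proof unfold_locales
  show "scal a (x + y) = scal a x + scal a y" for a x y
    by (simp add: scal_def \<rho>_add smult_r_distr \<rho> \<iota>_add)
  show "scal (a \<otimes>\<^bsub>k\<^esub> b) x = scal a (scal b x)" if "a \<in> carrier k" "b \<in> carrier k" for a b x
    using that by (simp add: scal_def smult_assoc1 \<rho>)
  show "scal (a \<oplus>\<^bsub>k\<^esub> b) x = scal a x + scal b x" if "a \<in> carrier k" "b \<in> carrier k" for a b x
    using that by (simp add: scal_def smult_l_distr \<rho> \<iota>_add)
  show "Factorial_Ring.prime p" "CHAR('l) = p" by (rule prime_p, rule char_l)
  show "of_nat p = (0 :: 'e \<Rightarrow> 'l)" using of_nat_CHAR[where ?'a = 'l] char_l by (intro of_nat_fun_eq_zero) simp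
  show "gact g (x + y) = gact g x + gact g y" for g x y
    by (simp add: gact_def \<rho>_add act_add \<rho> \<iota>_add act_closed algebra_simps)
  show "gact (g ** h) x = gact g (gact h x)" if g: "invertible g" "invertible h" for g h x
  proof -
    have "act E (g ** h) (\<rho> x) = act E g (act E h (\<rho> x))" using act_mult[of g h "\<rho> x"] g by (simp add: GL2_simps(2) \<rho>)
    moreover have "gact g (gact h x) = \<iota> (act E g (act E h (\<rho> x))) + (gact h x - \<iota> (act E h (\<rho> x)))"
      using g by (simp add: gact_def[of g] \<rho>_gact)
    ultimately show ?thesis using g by (simp add: gact_def invertible_mult)
  qed
  show "gact (mat 1) x = x" for x
    using act_one[of "\<rho> x"] by (simp add: gact_def \<rho> GL2_simps(3))
  show "gact g (scal a x) = scal a (gact g x)" if "invertible g" "a \<in> carrier k" for g a x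
    using that act_smult[of g a "\<rho> x"] by (simp add: scal_def gact_\<iota> \<rho> \<rho>_gact)
  show "additive_subgroup_set (\<iota> ` carrier E)"
    unfolding additive_subgroup_set_def
  proof (intro conjI ballI)
    show "0 \<in> \<iota> ` carrier E" using \<iota>_zero by (metis M.zero_closed imageI)
    fix x y assume "x \<in> \<iota> ` carrier E" "y \<in> \<iota> ` carrier E"
    then obtain v v' where "v \<in> carrier E" "v' \<in> carrier E" "x = \<iota> v" "y = \<iota> v'" by blast
    then show "x - y \<in> \<iota> ` carrier E" by (simp flip: \<iota>_diff)
  qed
  show "gact g x \<in> \<iota> ` carrier E" if "invertible g" "x \<in> \<iota> ` carrier E" for g x
    using that by (auto simp: gact_\<iota> E_act)
  show "scal a x \<in> \<iota> ` carrier E" if "a \<in> carrier k" "x \<in> \<iota> ` carrier E" for a x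
    using that by (auto simp: scal_\<iota>)
  show "scal \<one>\<^bsub>k\<^esub> x = x" if "x \<in> \<iota> ` carrier E" for x using that by (auto simp: scal_\<iota>)
  show "\<exists>n. \<forall>a b c d. a - 1 \<in> pideal n \<longrightarrow> b \<in> pideal n \<longrightarrow> c \<in> pideal n \<longrightarrow> d - 1 \<in> pideal n
      \<longrightarrow> a * d - b * c \<noteq> 0 \<longrightarrow> gact (mk2 a b c d) x = x" for x
  proof -
    let ?S = "{g \<in> carrier GL2. act E g (\<rho> x) = \<rho> x}"
    have "mat 1 \<in> ?S" using act_one[of "\<rho> x"] by (simp add: \<rho> GL2_simps(3) invertible_mat_1)
    then obtain n where n: "\<And>y. y \<in> carrier GL2 \<Longrightarrow> \<forall>i j. y $ i $ j - mat 1 $ i $ j \<in> pideal n \<Longrightarrow> y \<in> ?S"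
      using open_stabilizer[OF \<rho>(1)[of x]] unfolding openin_matrix_iff by blast
    have "gact (mk2 a b c d) x = x" if "a - 1 \<in> pideal n" "b \<in> pideal n" "c \<in> pideal n" "d - 1 \<in> pideal n" "a * d - b * c \<noteq> 0" for a b c d
    proof -
      have "mk2 a b c d \<in> ?S" using that by (intro n) (simp_all add: mat_eq_mk2 forall_2)
      then show ?thesis by (simp add: gact_def)
    qed
    then show ?thesis by blast
  qed
qed

lemma ordinary_hom:
  assumes \<theta>: "\<theta> \<in> smooth_characters torus k" and e: "sm.ordinary_vector \<theta> e"
  shows "(\<lambda>f. \<rho> (ordinary.\<Phi> k scal gact \<theta> e f)) \<in> rep_hom GL2 k (Ind_borel k \<theta>) E"
proof -
  interpret o: ordinary k scal p gact "\<iota> ` carrier E" \<theta> e by unfold_locales (rule \<theta>, rule e)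
  show ?thesis
    by (rule rep_homI) (simp_all add: \<rho> o.\<Phi>_add \<rho>_add o.\<Phi>_sc \<rho>_scal o.\<Phi>_act \<rho>_gact)
qed

end

locale supersingular_extension = embedded_representation k E p \<iota> C
  for k :: "'k ring" and E :: "('k, 'e, 'l::nonarch_local_field ^ 2 ^ 2) rep" and p \<iota> C +
  fixes V1 :: "('k, 'v, 'l ^ 2 ^ 2) rep" and i :: "'v \<Rightarrow> 'e"
  assumes supersingular: "is_supersingular k V1"
    and i_hom: "i \<in> rep_hom GL2 k V1 E" and i_inj: "inj_on i (carrier V1)"
begin

sublocale V1: smooth_representation GL2 k V1 using supersingular by (simp add: is_supersingular_def)

lemmas i = rep_homD[OF i_hom]

lemma irreducible_V1: "irreducible_rep GL2 k V1" using supersingular by (simp add: is_supersingular_def)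

definition \<kappa> :: "'v \<Rightarrow> 'e \<Rightarrow> 'l" where "\<kappa> v = \<iota> (i v)"

lemma \<kappa>: "\<lbrakk>v \<in> carrier V1; v' \<in> carrier V1\<rbrakk> \<Longrightarrow> \<kappa> (v \<oplus>\<^bsub>V1\<^esub> v') = \<kappa> v + \<kappa> v'"
  "\<kappa> \<zero>\<^bsub>V1\<^esub> = 0" "\<lbrakk>v \<in> carrier V1; v' \<in> carrier V1\<rbrakk> \<Longrightarrow> \<kappa> (v \<ominus>\<^bsub>V1\<^esub> v') = \<kappa> v - \<kappa> v'"
  "\<lbrakk>invertible g; v \<in> carrier V1\<rbrakk> \<Longrightarrow> gact g (\<kappa> v) = \<kappa> (act V1 g v)"
  "\<lbrakk>a \<in> carrier k; v \<in> carrier V1\<rbrakk> \<Longrightarrow> scal a (\<kappa> v) = \<kappa> (a \<odot>\<^bsub>V1\<^esub> v)"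
  using V1.rep_hom_zero[OF representation_axioms i_hom] V1.rep_hom_diff[OF representation_axioms i_hom]
  by (simp_all add: \<kappa>_def i \<iota>_add \<iota>_zero \<iota>_diff gact_\<iota> scal_\<iota>)

definition U :: "('e \<Rightarrow> 'l) set" where "U = \<kappa> ` carrier V1"

lemma U_stable: "sm.G_stable U"
  unfolding sm.G_stable_def additive_subgroup_set_def
proof (intro conjI ballI allI impI)
  show "0 \<in> U" unfolding U_def using \<kappa>(2) V1.M.zero_closed by (metis imageI)
  fix x assume "x \<in> U"
  then obtain v where v: "v \<in> carrier V1" "x = \<kappa> v" by (auto simp: U_def)
  show "x - y \<in> U" if y: "y \<in> U" for y
  proof -
    obtain v' where v': "v' \<in> carrier V1" "y = \<kappa> v'" using y by (auto simp: U_def)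
    have "x - y = \<kappa> (v \<ominus>\<^bsub>V1\<^esub> v')" using v v' \<kappa>(3) by simp
    then show ?thesis using v v' by (simp add: U_def)
  qed
  show "gact g x \<in> U" if "invertible g" for g using v that V1.act_closed[of g v] \<kappa>(4)[OF that v(1)] by (simp add: U_def)
  show "scal a x \<in> U" if "a \<in> carrier k" for a using v that \<kappa>(5)[OF that v(1)] by (simp add: U_def)
qed

text \<open>Pulled back along the injective \<open>i\<close>, the restriction of
  \<open>\<psi>\<close> to \<open>W\<close> is a map to the irreducible \<open>V1\<close>; if it
  were nonzero, \<open>V1\<close> would be a subquotient of the induced representation.\<close>

lemma not_subquotient:
  assumes \<theta>: "\<theta> \<in> smooth_characters torus k" and h: "\<psi> \<in> rep_hom GL2 k (Ind_borel k \<theta>) E"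
    and W: "subrep GL2 k (Ind_borel k \<theta>) W" and sub: "\<And>f. f \<in> W \<Longrightarrow> \<psi> f \<in> i ` carrier V1" and f: "f \<in> W"
  shows "\<psi> f = \<zero>\<^bsub>E\<^esub>"
proof (rule ccontr)
  assume ne: "\<psi> f \<noteq> \<zero>\<^bsub>E\<^esub>"
  interpret b: borel_character k \<theta> by unfold_locales (rule \<theta>)
  interpret I: representation GL2 k "Ind_borel k \<theta>" by (rule b.Ind_representation)
  note w = I.subrepD[OF W] and \<psi> = rep_homD[OF h]
  define j where "j = inv_into (carrier V1) i"
  have j: "j (\<psi> x) \<in> carrier V1" "i (j (\<psi> x)) = \<psi> x" if "x \<in> W" for x
    using sub[OF that] by (auto simp: j_def inv_into_into f_inv_into_f)
  have ji: "j x = v" if "v \<in> carrier V1" "i v = x" for v x using that i_inj by (auto simp: j_def)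
  have "(\<lambda>f. j (\<psi> f)) \<in> rep_hom GL2 k ((Ind_borel k \<theta>)\<lparr>carrier := W\<rparr>) V1"
  proof (rule rep_homI; simp)
    fix x assume x: "x \<in> W"
    have xI: "x \<in> carrier (Ind_borel k \<theta>)" using w(1) x by blast
    show "j (\<psi> x) \<in> carrier V1" by (rule j(1)[OF x])
    show "j (\<psi> (x \<oplus>\<^bsub>Ind_borel k \<theta>\<^esub> y)) = j (\<psi> x) \<oplus>\<^bsub>V1\<^esub> j (\<psi> y)" if y: "y \<in> W" for y
    proof (rule ji)
      have yI: "y \<in> carrier (Ind_borel k \<theta>)" using w(1) y by blast
      show "i (j (\<psi> x) \<oplus>\<^bsub>V1\<^esub> j (\<psi> y)) = \<psi> (x \<oplus>\<^bsub>Ind_borel k \<theta>\<^esub> y)"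
        by (simp add: i(2) j x y \<psi>(2)[OF xI yI])
    qed (simp add: j x y)
    show "j (\<psi> (a \<odot>\<^bsub>Ind_borel k \<theta>\<^esub> x)) = a \<odot>\<^bsub>V1\<^esub> j (\<psi> x)" if a: "a \<in> carrier k" for a
      by (rule ji) (simp_all add: i(3) j x a \<psi>(3)[OF a xI])
    show "j (\<psi> (act (Ind_borel k \<theta>) g x)) = act V1 g (j (\<psi> x))" if g: "invertible g" for g
      by (rule ji) (simp_all add: i(4) j x g \<psi>(4)[OF _ xI] V1.act_closed)
  qed
  moreover have "j (\<psi> f) \<noteq> \<zero>\<^bsub>V1\<^esub>"
  proof
    assume "j (\<psi> f) = \<zero>\<^bsub>V1\<^esub>"
    then have "\<psi> f = i \<zero>\<^bsub>V1\<^esub>" using j(2)[OF f] by simp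
    then show False using ne V1.rep_hom_zero[OF representation_axioms i_hom] by simp
  qed
  ultimately have "is_subquotient GL2 k V1 (Ind_borel k \<theta>)" by (rule I.is_subquotientI[OF irreducible_V1 W _ f])
  then show False using supersingular \<theta> by (auto simp: is_supersingular_def)
qed

sublocale ss: supersingular_submodule k scal p gact "\<iota> ` carrier E" U
proof unfold_locales
  show "sm.G_stable U" by (rule U_stable)
  show "U \<subseteq> \<iota> ` carrier E" using i(1) by (auto simp: U_def \<kappa>_def)
  show "W = {0} \<or> W = U" if W: "sm.G_stable W" "W \<subseteq> U" for W
  proof -
    define W' where "W' = {v \<in> carrier V1. \<kappa> v \<in> W}"
    note ws = sm.G_stableD[OF W(1)]
    have "subrep GL2 k V1 W'"
    proof (rule V1.subrepI)
      show "act V1 g v \<in> W'" if "g \<in> carrier GL2" "v \<in> W'" for g v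
        using that \<kappa>(4)[of g v] ws(10)[of g "\<kappa> v"] V1.act_closed[of g v] by (simp add: W'_def)
      show "a \<odot>\<^bsub>V1\<^esub> v \<in> W'" if "a \<in> carrier k" "v \<in> W'" for a v
        using that \<kappa>(5)[of a v] ws(9)[of a "\<kappa> v"] by (simp add: W'_def)
    qed (use \<kappa>(1,2) ws(1,2) in \<open>auto simp: W'_def\<close>)
    then have "W' = {\<zero>\<^bsub>V1\<^esub>} \<or> W' = carrier V1" using irreducible_V1 by (simp add: irreducible_rep_def)
    moreover have "W = \<kappa> ` W'" using W(2) by (auto simp: U_def W'_def)
    ultimately show ?thesis using \<kappa>(2) by (auto simp: U_def)
  qed
  show "\<exists>c\<in>carrier k. \<forall>x\<in>U. sm.D z z x = scal c x" if z: "z \<noteq> 0" for z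
  proof -
    obtain \<omega> where \<omega>: "\<omega> \<in> smooth_characters mult_group k" "\<And>v. v \<in> carrier V1 \<Longrightarrow> act V1 (mat z) v = \<omega> z \<odot>\<^bsub>V1\<^esub> v"
      using supersingular z unfolding is_supersingular_def has_central_character_def by blast
    have hom: "\<omega> \<in> hom mult_group (mult_of k)" using \<omega>(1) by (simp add: smooth_characters_def)
    have "\<omega> z \<in> carrier k" using hom_in_carrier[OF hom, of z] z by (simp add: mult_group_def)
    moreover have "sm.D z z (\<kappa> v) = scal (\<omega> z) (\<kappa> v)" if "v \<in> carrier V1" for v
      using that \<omega>(2)[OF that] z calculation \<kappa>(4)[of "mat z" v] \<kappa>(5)[of "\<omega> z" v] by (simp add: sm.D_def mat_eq_mk2)
    ultimately show ?thesis by (auto simp: U_def)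
  qed
  \<comment> \<open>The map attached to \<open>e\<close> has all its values in \<open>U\<close>
    because its value \<open>e\<close> at \<open>bump 0\<close> lies there. By
    \<open>not_subquotient\<close> it vanishes, and so does \<open>e\<close>.\<close>
  show "e = 0" if \<theta>: "\<theta> \<in> smooth_characters torus k" and e: "e \<in> U" "sm.ordinary_vector \<theta> e" for \<theta> e
  proof -
    interpret o: ordinary k scal p gact "\<iota> ` carrier E" \<theta> e by unfold_locales (rule \<theta>, rule e(2))
    interpret I: representation GL2 k "Ind_borel k \<theta>" by (rule o.Ind_representation)
    note us = sm.G_stableD[OF U_stable]
    have U: "o.\<Phi> f \<in> U" if "f \<in> carrier (Ind_borel k \<theta>)" for f
    proof -
      have "f \<in> carrier (Ind_borel k \<theta>) \<and> o.\<Phi> f \<in> U"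
        by (rule o.\<Phi>_related[of "\<lambda>x f. f \<in> carrier (Ind_borel k \<theta>) \<and> x \<in> U", OF _ _ _ _ _ _ that])
          (use us e o.bump_Ind o.Ind_zero o.Ind_add o.Ind_smult o.Ind_translate in auto)
      then show ?thesis by simp
    qed
    have "subrep GL2 k (Ind_borel k \<theta>) (carrier (Ind_borel k \<theta>))" by (rule I.subrepI) (auto simp: I.act_closed)
    then have "\<rho> (o.\<Phi> (o.bump 0)) = \<zero>\<^bsub>E\<^esub>"
    proof (rule not_subquotient[OF \<theta> ordinary_hom[OF \<theta> e(2)] _ _ o.bump_Ind])
      fix f assume "f \<in> carrier (Ind_borel k \<theta>)"
      from U[OF this] obtain v where "v \<in> carrier V1" "o.\<Phi> f = \<iota> (i v)" by (auto simp: U_def \<kappa>_def)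
      then show "\<rho> (o.\<Phi> f) \<in> i ` carrier V1" using i(1) by simp
    qed
    then have "\<iota> (\<rho> e) = 0" by (simp add: o.\<Phi>_bump \<iota>_zero)
    then show "e = 0" using \<iota>_\<rho>[OF o.e_props(1)] by simp
  qed
qed

theorem exists_section:
  assumes \<theta>: "\<theta> \<in> smooth_characters torus k" and V2: "representation GL2 k V2"
    and q: "q \<in> rep_hom GL2 k E V2" "q ` carrier E = carrier V2" "i ` carrier V1 = {e \<in> carrier E. q e = \<zero>\<^bsub>V2\<^esub>}"
    and P: "P \<in> rep_hom GL2 k (Ind_borel k \<theta>) V2" "P ` carrier (Ind_borel k \<theta>) = carrier V2"
  shows "\<exists>s\<in>rep_hom GL2 k V2 E. \<forall>w\<in>carrier V2. q (s w) = w"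
proof -
  interpret b: borel_character k \<theta> by unfold_locales (rule \<theta>)
  let ?I = "Ind_borel k \<theta>"
  interpret I: representation GL2 k ?I by (rule b.Ind_representation)
  interpret V2: representation GL2 k V2 by (rule V2)
  note qh = rep_homD[OF q(1)] and Ph = rep_homD[OF P(1)]
  \<comment> \<open>\<open>x\<close> lifts the image of \<open>f\<close> in \<open>V2\<close>. As
    this is compatible with all operations, the identities satisfied by \<open>bump 0\<close> hold
    for its lift \<open>e0\<close> modulo \<open>U\<close>, by \<open>R_diff\<close>.\<close>
  define R where "R x f \<longleftrightarrow> x \<in> \<iota> ` carrier E \<and> f \<in> carrier ?I \<and> q (\<rho> x) = P f" for x f
  have RI: "f \<in> carrier ?I" if "R x f" for x f using that by (simp add: R_def)
  have RM: "x \<in> \<iota> ` carrier E" if "R x f" for x f using that by (simp add: R_def)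
  note ms = sm.G_stableD[OF sm.G_stable_M]
  have R0: "R 0 \<zero>\<^bsub>?I\<^esub>"
    using ms(1) \<rho>_\<iota>[of "\<zero>\<^bsub>E\<^esub>"] rep_hom_zero[OF V2 q(1)] I.rep_hom_zero[OF V2 P(1)] b.Ind_zero by (simp add: R_def \<iota>_zero)
  have R_add: "R (x + y) (f \<oplus>\<^bsub>?I\<^esub> f')" if "R x f" "R y f'" for x y f f'
    using that ms(2) by (simp add: R_def \<rho>_add \<rho> qh(2) Ph(2))
  have R_sc: "R (scal c x) (c \<odot>\<^bsub>?I\<^esub> f)" if "c \<in> carrier k" "R x f" for c x f
    using that ms(9) by (simp add: R_def \<rho>_scal \<rho> qh(3) Ph(3))
  have R_act: "R (gact g x) (act ?I g f)" if "invertible g" "R x f" for g x f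
    using that ms(10) I.act_closed[of g f] by (simp add: R_def \<rho>_gact \<rho> qh(4) Ph(4))
  have R_diff: "x - y \<in> U" if R: "R x f" "R y f" for x y f
  proof -
    have "q (\<rho> x \<ominus>\<^bsub>E\<^esub> \<rho> y) = \<zero>\<^bsub>V2\<^esub>" using R Ph(1)[OF RI[OF R(1)]] rep_hom_diff[OF V2 q(1) \<rho>(1)[of x] \<rho>(1)[of y]]
      by (simp add: R_def a_minus_def V2.M.r_neg)
    then have "\<rho> x \<ominus>\<^bsub>E\<^esub> \<rho> y \<in> i ` carrier V1" unfolding q(3) using \<rho>(1)[of x] \<rho>(1)[of y] by simp
    then have "\<iota> (\<rho> x \<ominus>\<^bsub>E\<^esub> \<rho> y) \<in> U" by (auto simp: U_def \<kappa>_def)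
    then show ?thesis using \<iota>_\<rho>[OF RM[OF R(1)]] \<iota>_\<rho>[OF RM[OF R(2)]] by (simp add: \<iota>_diff \<rho>(1))
  qed
  have "P (b.bump 0) \<in> q ` carrier E" using Ph(1)[OF b.bump_Ind] q(2) by simp
  then obtain \<epsilon> where \<epsilon>: "\<epsilon> \<in> carrier E" "q \<epsilon> = P (b.bump 0)" by force
  define e0 where "e0 = \<iota> \<epsilon>"
  have e0: "R e0 (b.bump 0)" using \<epsilon> b.bump_Ind by (simp add: R_def e0_def)
  have "\<exists>e. sm.ordinary_vector \<theta> e \<and> e - e0 \<in> U"
  proof (rule ss.exists_ordinary_lift[OF \<theta> RM[OF e0]])
    show "sm.u c e0 - e0 \<in> U" if "c \<in> pideal 0" for c
    proof (rule R_diff[OF _ e0])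
      have "R (sm.u c e0) (act ?I (mk2 1 c 0 1) (b.bump 0))" unfolding sm.u_def by (rule R_act[OF _ e0]) simp
      then show "R (sm.u c e0) (b.bump 0)" by (simp only: b.bump_unipotent[OF that])
    qed
    show "sm.D a d e0 - scal (\<theta> (diag2 d a)) e0 \<in> U" if ad: "a \<noteq> 0" "d \<noteq> 0" "val a = val d" for a d
    proof (rule R_diff)
      have "R (sm.D a d e0) (act ?I (mk2 a 0 0 d) (b.bump 0))" unfolding sm.D_def by (rule R_act[OF _ e0]) (simp add: ad)
      then show "R (sm.D a d e0) (\<theta> (diag2 d a) \<odot>\<^bsub>?I\<^esub> b.bump 0)" using b.bump_torus[OF ad(1,2), of 0] ad(3) by simp
      show "R (scal (\<theta> (diag2 d a)) e0) (\<theta> (diag2 d a) \<odot>\<^bsub>?I\<^esub> b.bump 0)" using b.chr(1)[OF ad(2,1)] by (rule R_sc[OF _ e0])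
    qed
    show "sm.h e0 - scal (\<theta> (diag2 1 unif)) e0 \<in> U"
    proof (rule R_diff)
      have "R (\<Sum>a\<in>reps 0 1. sm.u a (sm.D unif 1 e0))
          (\<lambda>g\<in>carrier GL2. \<Oplus>\<^bsub>k\<^esub>a\<in>reps 0 1. act ?I (mk2 1 a 0 1) (act ?I (mk2 unif 0 0 1) (b.bump 0)) g)"
        unfolding sm.u_def sm.D_def
        by (rule b.related_sum[of R, OF RI R0 R_add finite_reps]) (simp_all add: R_act e0)
      then show "R (sm.h e0) (\<theta> (diag2 1 unif) \<odot>\<^bsub>?I\<^esub> b.bump 0)" unfolding b.bump_hecke sm.h_def sm.nrm_def .
      have "\<theta> (diag2 1 unif) \<in> carrier k" by (rule b.chr(1)) simp_all
      then show "R (scal (\<theta> (diag2 1 unif)) e0) (\<theta> (diag2 1 unif) \<odot>\<^bsub>?I\<^esub> b.bump 0)" by (rule R_sc[OF _ e0])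
    qed
  qed
  then obtain e where e: "sm.ordinary_vector \<theta> e" "e - e0 \<in> U" by blast
  interpret o: ordinary k scal p gact "\<iota> ` carrier E" \<theta> e by unfold_locales (rule \<theta>, rule e(1))
  obtain v where v: "v \<in> carrier V1" "e - e0 = \<iota> (i v)" using e(2) by (auto simp: U_def \<kappa>_def)
  \<comment> \<open>The correction \<open>e - e0\<close> comes from \<open>V1\<close>, so
    \<open>e\<close> still lifts the image of \<open>bump 0\<close>.\<close>
  have "q (i v) = \<zero>\<^bsub>V2\<^esub>" using q(3) v(1) by blast
  then have "R (e - e0) \<zero>\<^bsub>?I\<^esub>" using v i(1)[OF v(1)] b.Ind_zero I.rep_hom_zero[OF V2 P(1)] by (simp add: R_def)
  from R_add[OF this e0] have Re: "R e (b.bump 0)" using b.bump_Ind by simp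
  define \<psi> where "\<psi> f = \<rho> (o.\<Phi> f)" for f
  have \<psi>: "\<psi> \<in> rep_hom GL2 k ?I E" unfolding \<psi>_def by (rule ordinary_hom[OF \<theta> e(1)])
  note \<psi>h = rep_homD[OF \<psi>]
  have q\<psi>: "q (\<psi> f) = P f" if f: "f \<in> carrier ?I" for f
  proof -
    have "R (o.\<Phi> f) f" by (rule o.\<Phi>_related[of R, OF RI R0 R_add R_sc R_act Re f])
    then show ?thesis by (simp add: R_def \<psi>_def)
  qed
  let ?K = "{f \<in> carrier ?I. P f = \<zero>\<^bsub>V2\<^esub>}"
  \<comment> \<open>On the kernel of \<open>P\<close> the map \<open>\<psi>\<close> takes values in
    the image of \<open>V1\<close>, hence vanishes. It therefore factors through \<open>V2\<close>,
    and the factor is the desired section.\<close>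
  have K: "\<psi> f = \<zero>\<^bsub>E\<^esub>" if f: "f \<in> ?K" for f
  proof (rule not_subquotient[OF \<theta> \<psi> I.kernel_subrep[OF V2 P(1)] _ f])
    fix f assume "f \<in> ?K"
    then show "\<psi> f \<in> i ` carrier V1" unfolding q(3) using q\<psi>[of f] \<psi>h(1)[of f] by simp
  qed
  have wd: "\<psi> f = \<psi> f'" if f: "f \<in> carrier ?I" "f' \<in> carrier ?I" "P f = P f'" for f f'
  proof -
    have "f \<ominus>\<^bsub>?I\<^esub> f' \<in> ?K" using f Ph(1)[OF f(2)] I.rep_hom_diff[OF V2 P(1) f(1,2)] by (simp add: a_minus_def V2.M.r_neg)
    then have "\<psi> f \<ominus>\<^bsub>E\<^esub> \<psi> f' = \<zero>\<^bsub>E\<^esub>" using K I.rep_hom_diff[OF representation_axioms \<psi> f(1,2)] by simp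
    then show ?thesis using add_diff_cancel[OF \<psi>h(1)[OF f(1)] \<psi>h(1)[OF f(2)]] \<psi>h(1)[OF f(2)] by simp
  qed
  obtain s where s: "s \<in> rep_hom GL2 k V2 E" "\<And>f. f \<in> carrier ?I \<Longrightarrow> s (P f) = \<psi> f"
    using I.induced_hom[OF P \<psi> wd] by blast
  have "q (s w) = w" if "w \<in> carrier V2" for w
  proof -
    have "w \<in> P ` carrier ?I" using that P(2) by simp
    then obtain f where "f \<in> carrier ?I" "w = P f" by blast
    then show ?thesis using s(2) q\<psi> by simp
  qed
  then show ?thesis using s(1) by blast
qed

end

section \<open>Embedding a representation into a ring type of characteristic
  \<open>p\<close>\<close>

lemma is_Fp_bar_algebraically_closed: "is_Fp_bar p k \<Longrightarrow> algebraically_closed k"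
proof -
  assume "is_Fp_bar p k"
  then obtain F where "algebraic_closure k F" by (auto simp: is_Fp_bar_def)
  then interpret algebraic_closure k F .
  show ?thesis by (rule algebraically_closed_axioms)
qed

text \<open>Lagrange's theorem in the additive group of the subfield with \<open>p\<close>
  elements.\<close>

lemma is_Fp_bar_exponent:
  assumes "is_Fp_bar p k" shows "\<one>\<^bsub>k\<^esub> [^]\<^bsub>add_monoid k\<^esub> p = \<zero>\<^bsub>k\<^esub>"
proof -
  obtain F where F: "card F = p" "algebraic_closure k F" using assms by (auto simp: is_Fp_bar_def)
  interpret algebraic_closure k F by (rule F(2))
  let ?A = "add_monoid k\<lparr>carrier := F\<rparr>"
  have sg: "subgroup F (add_monoid k)" by (rule subgroup_axioms)
  interpret A: group ?A by (rule subgroup.subgroup_is_group[OF sg add.is_group])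
  have "\<one>\<^bsub>k\<^esub> [^]\<^bsub>?A\<^esub> order ?A = \<one>\<^bsub>?A\<^esub>" by (rule A.pow_order_eq_1) simp
  moreover have "order ?A = p" by (simp add: order_def F(1))
  moreover have "\<one>\<^bsub>k\<^esub> [^]\<^bsub>?A\<^esub> n = \<one>\<^bsub>k\<^esub> [^]\<^bsub>add_monoid k\<^esub> n" for n :: nat by (simp add: nat_pow_def)
  ultimately show ?thesis by simp
qed

lemma (in representation) exponent:
  assumes v: "v \<in> carrier V" shows "v [^]\<^bsub>add_monoid V\<^esub> (n :: nat) = (\<one>\<^bsub>k\<^esub> [^]\<^bsub>add_monoid k\<^esub> n) \<odot>\<^bsub>V\<^esub> v"
proof (induction n)
  case (Suc n)
  have "\<one>\<^bsub>k\<^esub> [^]\<^bsub>add_monoid k\<^esub> n \<in> carrier k" by (induction n) (simp_all add: nat_pow_def)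
  then show ?case using v Suc by (simp add: nat_pow_def smult_l_distr)
qed (use v in \<open>simp add: nat_pow_def\<close>)

lemma exists_embedding:
  fixes E :: "('k, 'e, 'l::nonarch_local_field ^ 2 ^ 2) rep"
  assumes p: "Factorial_Ring.prime p" "CHAR('l) = p" and k: "is_Fp_bar p k" and E: "smooth_representation GL2 k E"
  shows "\<exists>(\<iota> :: 'e \<Rightarrow> 'e \<Rightarrow> 'l) C. embedded_representation k E p \<iota> C"
proof -
  interpret E: smooth_representation GL2 k E by (rule E)
  have "x [^]\<^bsub>add_monoid E\<^esub> p = \<one>\<^bsub>add_monoid E\<^esub>" if "x \<in> carrier (add_monoid E)" for x
    using that E.exponent[of x p] is_Fp_bar_exponent[OF k] by simp
  from comm_group.exists_injective_hom_fun[OF E.M.a_comm_group p this]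
  obtain \<iota> :: "'e \<Rightarrow> 'e \<Rightarrow> 'l" where inj: "inj_on \<iota> (carrier E)"
    and add: "\<And>a b. \<lbrakk>a \<in> carrier E; b \<in> carrier E\<rbrakk> \<Longrightarrow> \<iota> (a \<oplus>\<^bsub>E\<^esub> b) = \<iota> a + \<iota> b" by auto
  have zero: "\<iota> \<zero>\<^bsub>E\<^esub> = 0" using add[of "\<zero>\<^bsub>E\<^esub>" "\<zero>\<^bsub>E\<^esub>"] by simp
  have H: "additive_subgroup_set (\<iota> ` carrier E)"
    unfolding additive_subgroup_set_def
  proof (intro conjI ballI)
    show "0 \<in> \<iota> ` carrier E" using zero by (metis E.M.zero_closed imageI)
    fix x y assume "x \<in> \<iota> ` carrier E" "y \<in> \<iota> ` carrier E"
    then obtain v v' where v: "v \<in> carrier E" "v' \<in> carrier E" "x = \<iota> v" "y = \<iota> v'" by blast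
    have "\<iota> (v \<ominus>\<^bsub>E\<^esub> v') + \<iota> v' = \<iota> v" using v by (simp add: E.add_diff_cancel flip: add)
    then have "x - y = \<iota> (v \<ominus>\<^bsub>E\<^esub> v')" using v by (simp add: diff_eq_eq)
    then show "x - y \<in> \<iota> ` carrier E" using v by simp
  qed
  have "of_nat p = (0 :: 'e \<Rightarrow> 'l)" using of_nat_CHAR[where ?'a = 'l] p(2) by (intro of_nat_fun_eq_zero) simp
  from exists_additive_complement[OF p(1) this H]
  obtain C where C: "additive_subgroup_set C" "\<iota> ` carrier E \<inter> C = {0}" "\<And>x. \<exists>h\<in>\<iota> ` carrier E. \<exists>c\<in>C. x = h + c" by blast
  have span: "\<exists>v\<in>carrier E. x - \<iota> v \<in> C" for x
  proof -
    obtain v c where "v \<in> carrier E" "c \<in> C" "x = \<iota> v + c" using C(3)[of x] by blast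
    then show ?thesis by (intro bexI[of _ v]) simp_all
  qed
  have "embedded_representation k E p \<iota> C"
    by (intro embedded_representation.intro embedded_representation_axioms.intro E
      is_Fp_bar_algebraically_closed[OF k] p inj add C(1,2) span)
  then show ?thesis by blast
qed

text \<open>Both the principal and the special series are quotients of some \<open>Ind_borel k \<theta>\<close>, and nothing else is used about them.\<close>

theorem Ext1_quotient_of_induced:
  fixes k :: "'k ring" and V1 :: "('k, 'v, 'l::nonarch_local_field ^ 2 ^ 2) rep" and V2 :: "('k, 'w, 'l ^ 2 ^ 2) rep"
  assumes p: "Factorial_Ring.prime p" "CHAR('l) = p" and k: "is_Fp_bar p k"
    and V1: "is_supersingular k V1" and V2: "smooth_representation GL2 k V2"
    and \<theta>: "\<theta> \<in> smooth_characters torus k"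
    and P: "P \<in> rep_hom GL2 k (Ind_borel k \<theta>) V2" "P ` carrier (Ind_borel k \<theta>) = carrier V2"
  shows "Ext1 GL2 k V2 V1 = {Ext1_zero GL2 k V2 V1}"
proof (rule Ext1_trivialI[OF _ V2])
  show "smooth_representation GL2 k V1" using V1 by (simp add: is_supersingular_def)
  fix E :: "('k, 'v \<times> 'w, 'l ^ 2 ^ 2) rep" and i q assume "(E, i, q) \<in> smooth_extensions GL2 k V2 V1"
  note e = smooth_extensionsD[OF this]
  obtain \<iota> :: "'v \<times> 'w \<Rightarrow> 'v \<times> 'w \<Rightarrow> 'l" and C where "embedded_representation k E p \<iota> C"
    using exists_embedding[OF p k e(1)] by blast
  then interpret supersingular_extension k E p \<iota> C V1 i
    using V1 e(2,3) by (intro supersingular_extension.intro supersingular_extension_axioms.intro)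
  interpret V2: smooth_representation GL2 k V2 by (rule V2)
  show "\<exists>s\<in>rep_hom GL2 k V2 E. \<forall>w\<in>carrier V2. q (s w) = w"
    by (rule exists_section[OF \<theta> V2.representation_axioms e(4,5,6) P])
qed

section \<open>Principal and special series as quotients of induced representations\<close>

context field
begin

lemma mult_group_character:
  fixes \<eta> :: "'l::nonarch_local_field \<Rightarrow> 'a"
  assumes cl: "\<eta> \<in> hom mult_group (mult_of R)"
  shows "x \<noteq> 0 \<Longrightarrow> \<eta> x \<in> carrier R" "x \<noteq> 0 \<Longrightarrow> \<eta> x \<noteq> \<zero>" "\<lbrakk>x \<noteq> 0; y \<noteq> 0\<rbrakk> \<Longrightarrow> \<eta> (x * y) = \<eta> x \<otimes> \<eta> y" "\<eta> 1 = \<one>"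
proof -
  have c: "\<eta> x \<in> carrier R - {\<zero>}" if "x \<noteq> 0" for x using hom_in_carrier[OF cl, of x] that by (simp add: mult_group_def)
  then show "x \<noteq> 0 \<Longrightarrow> \<eta> x \<in> carrier R" "x \<noteq> 0 \<Longrightarrow> \<eta> x \<noteq> \<zero>" by auto
  have m: "\<eta> (x * y) = \<eta> x \<otimes> \<eta> y" if "x \<noteq> 0" "y \<noteq> 0" for x y
    using hom_mult[OF cl, of x y] that by (simp add: mult_group_def)
  then show "\<lbrakk>x \<noteq> 0; y \<noteq> 0\<rbrakk> \<Longrightarrow> \<eta> (x * y) = \<eta> x \<otimes> \<eta> y" .
  have "\<eta> 1 = \<eta> 1 \<otimes> \<eta> 1" using m[of 1 1] by simp
  then show "\<eta> 1 = \<one>" using c[of 1] m_lcancel[of "\<eta> 1" "\<eta> 1" \<one>] by auto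
qed

end

lemma mult_group_character_trivial:
  fixes \<eta> :: "'l::nonarch_local_field \<Rightarrow> 'k"
  assumes "field k" and \<eta>: "\<eta> \<in> smooth_characters mult_group k"
  shows "\<exists>n\<ge>1. \<forall>x. x - 1 \<in> pideal n \<longrightarrow> \<eta> x = \<one>\<^bsub>k\<^esub>"
proof -
  interpret field k by fact
  have hom: "\<eta> \<in> hom mult_group (mult_of k)" and op: "openin (top_of_set (- {0})) (kernel mult_group (mult_of k) \<eta>)"
    using \<eta> by (simp_all add: smooth_characters_def mult_group_def)
  have "1 \<in> kernel mult_group (mult_of k) \<eta>" using mult_group_character(4)[OF hom] by (simp add: kernel_def mult_group_def)
  then obtain r where r: "0 < r" "ball 1 r \<inter> - {0} \<subseteq> kernel mult_group (mult_of k) \<eta>"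
    using op unfolding openin_contains_ball by blast
  obtain n where n: "\<forall>x::'l \<in> pideal n. absval x < r" using exists_pideal_small[OF r(1)] by blast
  have "\<eta> x = \<one>\<^bsub>k\<^esub>" if x: "x - 1 \<in> pideal (max n 1)" for x
  proof -
    have x': "x - 1 \<in> pideal n" "x - 1 \<in> pideal 1" using x by (auto elim: pideal_monoD)
    have "x \<noteq> 0" by (rule pideal_divide_unit(2)[OF zero_in_pideal x'(2)])
    moreover have "dist 1 x < r" using n x'(1) absval_minus_commute[of 1 x] by (simp add: dist_absval)
    ultimately have "x \<in> kernel mult_group (mult_of k) \<eta>" using r(2) by auto
    then show ?thesis by (simp add: kernel_def)
  qed
  then show ?thesis by (intro exI[of _ "max n 1"]) auto
qed

lemma torus_memE: assumes "A \<in> carrier torus" obtains a d where "a \<noteq> 0" "d \<noteq> 0" "A = diag2 a d"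
  using assms by (auto simp: torus_def)

lemma trivial_smooth_character:
  assumes "field k" shows "(\<lambda>_. \<one>\<^bsub>k\<^esub>) \<in> smooth_characters (torus :: ('l::nonarch_local_field ^ 2 ^ 2) monoid) k"
proof -
  interpret field k by fact
  have "kernel torus (mult_of k) (\<lambda>_ :: 'l ^ 2 ^ 2. \<one>\<^bsub>k\<^esub>) = carrier torus" by (auto simp: kernel_def)
  then show ?thesis by (simp add: smooth_characters_def hom_def)
qed

lemma det_smooth_character:
  fixes \<eta> :: "'l::nonarch_local_field \<Rightarrow> 'k"
  assumes "field k" and \<eta>: "\<eta> \<in> smooth_characters mult_group k"
  shows "(\<lambda>A. \<eta> (A $ 1 $ 1 * A $ 2 $ 2)) \<in> smooth_characters torus k"
proof -
  interpret field k by fact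
  let ?\<theta> = "\<lambda>A :: 'l ^ 2 ^ 2. \<eta> (A $ 1 $ 1 * A $ 2 $ 2)"
  have "\<eta> \<in> hom mult_group (mult_of k)" using \<eta> by (simp add: smooth_characters_def)
  note h = mult_group_character[OF this]
  obtain n where n: "1 \<le> n" "\<And>x. x - 1 \<in> pideal n \<Longrightarrow> \<eta> x = \<one>\<^bsub>k\<^esub>" using mult_group_character_trivial[OF assms] by blast
  have hom: "?\<theta> \<in> hom torus (mult_of k)"
  proof (rule homI)
    fix A B :: "'l ^ 2 ^ 2" assume "A \<in> carrier torus"
    then obtain a d where a: "a \<noteq> 0" "d \<noteq> 0" "A = diag2 a d" by (rule torus_memE)
    then show "?\<theta> A \<in> carrier (mult_of k)" using h(1,2)[of "a * d"] by (simp add: diag2_eq_mk2)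
    assume "B \<in> carrier torus"
    then obtain a' d' where b: "a' \<noteq> 0" "d' \<noteq> 0" "B = diag2 a' d'" by (rule torus_memE)
    have "\<eta> (a * d * (a' * d')) = \<eta> (a * d) \<otimes>\<^bsub>k\<^esub> \<eta> (a' * d')" using a b by (intro h(3)) auto
    then show "?\<theta> (A \<otimes>\<^bsub>torus\<^esub> B) = ?\<theta> A \<otimes>\<^bsub>mult_of k\<^esub> ?\<theta> B"
      by (simp add: a b torus_def GL2_def diag2_eq_mk2 mk2_mult mult_ac)
  qed
  have "openin (top_of_set (carrier torus)) (kernel torus (mult_of k) ?\<theta>)"
    unfolding openin_matrix_iff
  proof (intro conjI ballI)
    show "kernel torus (mult_of k) ?\<theta> \<subseteq> carrier torus" by (auto simp: kernel_def)
    fix A assume A: "A \<in> kernel torus (mult_of k) ?\<theta>"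
    then have "A \<in> carrier torus" by (simp add: kernel_def)
    then obtain a d where a: "a \<noteq> 0" "d \<noteq> 0" "A = diag2 a d" by (rule torus_memE)
    have ad: "\<eta> (a * d) = \<one>\<^bsub>k\<^esub>" using A by (simp add: kernel_def a diag2_eq_mk2)
    define m where "m = max (val a + n) (val d + n)"
    have quot: "x' / x - 1 \<in> pideal n" if "x \<noteq> 0" "x' - x \<in> pideal m" "val x + n \<le> m" for x x' :: 'l
    proof -
      have "x * (x' / x - 1) = x' - x" using that(1) by (simp add: right_diff_distrib)
      then show ?thesis using pideal_scale[OF that(1), of "x' / x - 1" n] pideal_monoD[OF that(2,3)] by simp
    qed
    have "B \<in> kernel torus (mult_of k) ?\<theta>" if B: "B \<in> carrier torus" "\<forall>i j. B $ i $ j - A $ i $ j \<in> pideal m" for B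
    proof -
      obtain a' d' where b: "a' \<noteq> 0" "d' \<noteq> 0" "B = diag2 a' d'" using B(1) by (rule torus_memE)
      have "a' - a \<in> pideal m" "d' - d \<in> pideal m" using B(2) by (auto simp: a b diag2_eq_mk2 forall_2)
      then have "\<eta> (a' / a) = \<one>\<^bsub>k\<^esub>" "\<eta> (d' / d) = \<one>\<^bsub>k\<^esub>" using a by (auto intro!: n(2) quot simp: m_def)
      moreover have "\<eta> (a' / a * (d' / d) * (a * d)) = \<eta> (a' / a * (d' / d)) \<otimes>\<^bsub>k\<^esub> \<eta> (a * d)"
        using a b by (intro h(3)) simp_all
      moreover have "\<eta> (a' / a * (d' / d)) = \<eta> (a' / a) \<otimes>\<^bsub>k\<^esub> \<eta> (d' / d)" using a b by (intro h(3)) simp_all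
      moreover have "a' / a * (d' / d) * (a * d) = a' * d'" using a by simp
      ultimately have "\<eta> (a' * d') = \<one>\<^bsub>k\<^esub>" using ad by (simp del: times_divide_eq_left times_divide_eq_right)
      then show ?thesis using B(1) by (simp add: kernel_def b diag2_eq_mk2)
    qed
    then show "\<exists>m. \<forall>B\<in>carrier torus. (\<forall>i j. B $ i $ j - A $ i $ j \<in> pideal m) \<longrightarrow> B \<in> kernel torus (mult_of k) ?\<theta>" by blast
  qed
  then show ?thesis using hom by (simp add: smooth_characters_def)
qed

text \<open>Determinants of a small congruence subgroup are close to \<open>1\<close>, so
  multiplying by a smooth character of the determinant preserves smoothness, while the inducing
  character is twisted. Applied to a character and to its inverse, this gives a bijection.\<close>

lemma Ind_det_twist:
  fixes \<theta> \<theta>' :: "'l::nonarch_local_field ^ 2 ^ 2 \<Rightarrow> 'k"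
  assumes "field k" and f: "f \<in> carrier (Ind_borel k \<theta>)"
    and \<eta>: "\<And>x. x \<noteq> 0 \<Longrightarrow> \<eta> x \<in> carrier k" "\<And>x y. \<lbrakk>x \<noteq> 0; y \<noteq> 0\<rbrakk> \<Longrightarrow> \<eta> (x * y) = \<eta> x \<otimes>\<^bsub>k\<^esub> \<eta> y"
      "\<And>x. x - 1 \<in> pideal n \<Longrightarrow> \<eta> x = \<one>\<^bsub>k\<^esub>"
    and \<theta>: "\<And>a d. \<lbrakk>a \<noteq> 0; d \<noteq> 0\<rbrakk> \<Longrightarrow> \<theta> (diag2 a d) \<in> carrier k"
      "\<And>a d. \<lbrakk>a \<noteq> 0; d \<noteq> 0\<rbrakk> \<Longrightarrow> \<theta>' (diag2 a d) = \<eta> (a * d) \<otimes>\<^bsub>k\<^esub> \<theta> (diag2 a d)"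
  shows "(\<lambda>g\<in>carrier GL2. \<eta> (det g) \<otimes>\<^bsub>k\<^esub> f g) \<in> carrier (Ind_borel k \<theta>')"
proof -
  interpret field k by fact
  obtain m where m: "\<And>g y. invertible g \<Longrightarrow> y \<in> congruence m \<Longrightarrow> f (g ** y) = f g" using Ind_borelD(4)[OF f] by blast
  note fc = Ind_borelD(3)[OF f]
  have dt: "\<eta> (det g) \<in> carrier k" "det g \<noteq> 0" if "invertible g" for g :: "'l ^ 2 ^ 2"
    using that \<eta>(1) by (auto simp: invertible_det_nz)
  let ?f = "\<lambda>g\<in>carrier GL2. \<eta> (det g) \<otimes>\<^bsub>k\<^esub> f g"
  show ?thesis
  proof (rule Ind_borelI[where n = "max m (max n 0)"])
    show "?f \<in> carrier GL2 \<rightarrow>\<^sub>E carrier k" using fc dt by auto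
    fix g :: "'l ^ 2 ^ 2" assume g: "invertible g"
    show "?f (b ** g) = \<theta>' (diag2 (b $ 1 $ 1) (b $ 2 $ 2)) \<otimes>\<^bsub>k\<^esub> ?f g" if b: "b \<in> borel_subgroup" for b
    proof -
      have b': "b $ 1 $ 1 \<noteq> 0" "b $ 2 $ 2 \<noteq> 0" "det b = b $ 1 $ 1 * b $ 2 $ 2"
        using b by (auto simp: borel_subgroup_def invertible_det_nz det_2)
      define x where "x = \<eta> (b $ 1 $ 1 * b $ 2 $ 2)"
      define t where "t = \<theta> (diag2 (b $ 1 $ 1) (b $ 2 $ 2))"
      have cl: "x \<in> carrier k" "t \<in> carrier k" using b' \<eta>(1) \<theta>(1) by (simp_all add: x_def t_def)
      have "\<eta> (det (b ** g)) = x \<otimes>\<^bsub>k\<^esub> \<eta> (det g)" using b' dt(2)[OF g] \<eta>(2) by (simp add: det_mul x_def)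
      then show ?thesis
        using g borel_mult_invertible[OF b g] Ind_borelD(2)[OF f b g] \<theta>(2)[OF b'(1,2)] cl dt(1)[OF g] fc[OF g]
        by (simp add: m_ac flip: x_def t_def)
    qed
    show "?f (g ** y) = ?f g" if y: "y \<in> congruence (max m (max n 0))" for y
    proof -
      obtain a b c d where ye: "y = mk2 a b c d" by (metis mk2_eta)
      have "det y - 1 \<in> pideal (max m (max n 0))" using congruence_det[of a b c d "max m (max n 0)"] y by (simp add: ye)
      then have "\<eta> (det y) = \<one>\<^bsub>k\<^esub>" by (intro \<eta>(3)) (erule pideal_monoD, simp)
      moreover have "f (g ** y) = f g" by (rule m[OF g congruence_mono[OF y]]) simp
      moreover have "invertible y" using y by (simp add: congruence_def)
      ultimately show ?thesis using g dt \<eta>(2)[of "det g" "det y"] by (simp add: invertible_mult det_mul)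
    qed
  qed
qed

lemma twist_simps:
  "carrier (twist V \<delta>) = carrier V" "add (twist V \<delta>) = add V" "smult (twist V \<delta>) = smult V"
  "act (twist V \<delta>) g v = \<delta> g \<odot>\<^bsub>V\<^esub> act V g v"
  by (simp_all add: twist_def)

text \<open>Multiplication by \<open>\<eta> (1 / det g)\<close> maps
  \<open>Ind_borel k \<theta>\<close> onto the representation induced from the trivial character and
  turns its action into the twisted one; then divide by the constants.\<close>

lemma twisted_Steinberg_quotient:
  fixes \<eta> :: "'l::nonarch_local_field \<Rightarrow> 'k" and k :: "'k ring"
  assumes fk: "field k" and \<eta>: "\<eta> \<in> smooth_characters mult_group k"
  defines "\<theta> \<equiv> \<lambda>A :: 'l ^ 2 ^ 2. \<eta> (A $ 1 $ 1 * A $ 2 $ 2)"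
  shows "\<exists>P\<in>rep_hom GL2 k (Ind_borel k \<theta>) (twist (Steinberg k) (\<eta> \<circ> det)).
    P ` carrier (Ind_borel k \<theta>) = carrier (twist (Steinberg k) (\<eta> \<circ> det))"
proof -
  interpret field k by (rule fk)
  interpret b: borel_character k \<theta>
    by unfold_locales (unfold \<theta>_def, rule det_smooth_character[OF fk \<eta>])
  interpret b1: borel_character k "\<lambda>_ :: 'l ^ 2 ^ 2. \<one>\<^bsub>k\<^esub>"
    by unfold_locales (rule trivial_smooth_character[OF fk])
  let ?I = "Ind_borel k \<theta>"
  let ?I1 = "Ind_borel k (\<lambda>_ :: 'l ^ 2 ^ 2. \<one>\<^bsub>k\<^esub>)"
  interpret I1: representation GL2 k ?I1 by (rule b1.Ind_representation)
  have "\<eta> \<in> hom mult_group (mult_of k)" using \<eta> by (simp add: smooth_characters_def)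
  note h = mult_group_character[OF this]
  obtain n where n: "1 \<le> n" "\<And>x. x - 1 \<in> pideal n \<Longrightarrow> \<eta> x = \<one>\<^bsub>k\<^esub>" using mult_group_character_trivial[OF fk \<eta>] by blast
  have inv: "\<eta> (1 / x) \<otimes>\<^bsub>k\<^esub> \<eta> x = \<one>\<^bsub>k\<^esub>" if "x \<noteq> 0" for x
    using h(3)[of "1 / x" x] h(4) that by simp
  have n': "\<eta> (1 / x) = \<one>\<^bsub>k\<^esub>" if x: "x - 1 \<in> pideal n" for x
  proof -
    have x1: "x - 1 \<in> pideal 1" by (rule pideal_monoD[OF x n(1)])
    have "x \<noteq> 0" by (rule pideal_divide_unit(2)[OF zero_in_pideal x1])
    then show ?thesis using inv[of x] n(2)[OF x] h(1)[of "1 / x"] by simp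
  qed
  define \<mu> where "\<mu> f = (\<lambda>g\<in>carrier GL2. \<eta> (1 / det g) \<otimes>\<^bsub>k\<^esub> f g)" for f :: "'l ^ 2 ^ 2 \<Rightarrow> 'k"
  have \<mu>I: "\<mu> f \<in> carrier ?I1" if "f \<in> carrier ?I" for f
    unfolding \<mu>_def
  proof (rule Ind_det_twist[OF fk that, of "\<lambda>x. \<eta> (1 / x)" n])
    show "\<eta> (1 / (x * y)) = \<eta> (1 / x) \<otimes>\<^bsub>k\<^esub> \<eta> (1 / y)" if "x \<noteq> 0" "y \<noteq> 0" for x y
      using h(3)[of "1 / x" "1 / y"] that by simp
    show "\<one>\<^bsub>k\<^esub> = \<eta> (1 / (a * d)) \<otimes>\<^bsub>k\<^esub> \<theta> (diag2 a d)" if "a \<noteq> 0" "d \<noteq> 0" for a d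
      using inv[of "a * d"] that by (simp add: \<theta>_def diag2_eq_mk2)
  qed (use h(1) n' b.chr(1) in auto)
  have \<mu>_surj: "\<exists>f'\<in>carrier ?I. \<mu> f' = f" if f: "f \<in> carrier ?I1" for f
  proof
    let ?f = "\<lambda>g\<in>carrier GL2. \<eta> (det g) \<otimes>\<^bsub>k\<^esub> f g"
    show "?f \<in> carrier ?I"
      by (rule Ind_det_twist[OF fk f, of \<eta> n]) (use h n in \<open>auto simp: \<theta>_def diag2_eq_mk2\<close>)
    show "\<mu> ?f = f"
    proof (rule Ind_borel_eqI)
      fix g :: "'l ^ 2 ^ 2" assume g: "invertible g"
      then have "det g \<noteq> 0" by (simp add: invertible_det_nz)
      then show "\<mu> ?f g = f g" using g inv[of "det g"] h(1)[of "det g"] h(1)[of "1 / det g"] Ind_borelD(3)[OF f g]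
        by (simp add: \<mu>_def flip: m_assoc)
    qed (use b1.Ind_extensional[OF f] in \<open>simp_all add: \<mu>_def\<close>)
  qed
  let ?K = "{\<lambda>g\<in>carrier GL2. c | c. c \<in> carrier k} :: ('l ^ 2 ^ 2 \<Rightarrow> 'k) set"
  have K: "subrep GL2 k ?I1 ?K"
  proof (rule I1.subrepI)
    show "?K \<subseteq> carrier ?I1"
    proof
      fix f assume "f \<in> ?K"
      then obtain c where c: "c \<in> carrier k" "f = (\<lambda>g\<in>carrier GL2. c)" by blast
      show "f \<in> carrier ?I1"
        by (rule Ind_borelI[where n = 0]) (use c borel_mult_invertible in \<open>auto simp: congruence_def invertible_mult\<close>)
    qed
    show "\<zero>\<^bsub>?I1\<^esub> \<in> ?K" by (auto simp: Ind_borel_simps)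
    fix f f' a and g :: "'l ^ 2 ^ 2" assume "f \<in> ?K"
    then obtain c where c: "c \<in> carrier k" "f = (\<lambda>g\<in>carrier GL2. c)" by blast
    show "f \<oplus>\<^bsub>?I1\<^esub> f' \<in> ?K" if f': "f' \<in> ?K"
    proof -
      obtain c' where c': "c' \<in> carrier k" "f' = (\<lambda>g\<in>carrier GL2. c')" using f' by blast
      have "f \<oplus>\<^bsub>?I1\<^esub> f' = (\<lambda>g\<in>carrier GL2. c \<oplus>\<^bsub>k\<^esub> c')" by (simp add: Ind_borel_simps c c' restrict_def fun_eq_iff)
      then show ?thesis using c c' by blast
    qed
    show "a \<odot>\<^bsub>?I1\<^esub> f \<in> ?K" if a: "a \<in> carrier k"
    proof -
      have "a \<odot>\<^bsub>?I1\<^esub> f = (\<lambda>g\<in>carrier GL2. a \<otimes>\<^bsub>k\<^esub> c)" by (simp add: Ind_borel_simps c restrict_def fun_eq_iff)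
      then show ?thesis using c a by blast
    qed
    show "act ?I1 g f \<in> ?K" if g: "g \<in> carrier GL2"
    proof -
      have "act ?I1 g f = (\<lambda>g\<in>carrier GL2. c)"
        by (rule Ind_borel_eqI) (use g in \<open>simp_all add: Ind_borel_simps c invertible_mult\<close>)
      then show ?thesis using c by blast
    qed
  qed
  define \<pi> where "\<pi> f = ?K +>\<^bsub>?I1\<^esub> f" for f
  have \<pi>: "\<pi> \<in> rep_hom GL2 k ?I1 (Steinberg k)" "\<pi> ` carrier ?I1 = carrier (Steinberg k)"
    unfolding \<pi>_def Steinberg_def by (rule I1.quotient_map[OF K])+
  note \<pi>h = rep_homD[OF \<pi>(1)]
  have "(\<lambda>f. \<pi> (\<mu> f)) \<in> rep_hom GL2 k ?I (twist (Steinberg k) (\<eta> \<circ> det))"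
  proof (rule rep_homI; (simp only: twist_simps)?)
    fix f assume f: "f \<in> carrier ?I"
    note fc = Ind_borelD(3)[OF f]
    have ev: "\<eta> (1 / det g) \<in> carrier k" if "invertible g" for g :: "'l ^ 2 ^ 2"
      using that h(1) by (simp add: invertible_det_nz)
    show "\<pi> (\<mu> f) \<in> carrier (Steinberg k)" by (rule \<pi>h(1)[OF \<mu>I[OF f]])
    show "\<pi> (\<mu> (f \<oplus>\<^bsub>?I\<^esub> f')) = \<pi> (\<mu> f) \<oplus>\<^bsub>Steinberg k\<^esub> \<pi> (\<mu> f')" if f': "f' \<in> carrier ?I" for f'
    proof -
      have "\<mu> (f \<oplus>\<^bsub>?I\<^esub> f') = \<mu> f \<oplus>\<^bsub>?I1\<^esub> \<mu> f'"
        by (rule Ind_borel_eqI) (simp_all add: \<mu>_def Ind_borel_simps ev fc Ind_borelD(3)[OF f'] r_distr)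
      then show ?thesis using \<pi>h(2)[OF \<mu>I[OF f] \<mu>I[OF f']] by simp
    qed
    show "\<pi> (\<mu> (a \<odot>\<^bsub>?I\<^esub> f)) = a \<odot>\<^bsub>Steinberg k\<^esub> \<pi> (\<mu> f)" if a: "a \<in> carrier k" for a
    proof -
      have "\<mu> (a \<odot>\<^bsub>?I\<^esub> f) = a \<odot>\<^bsub>?I1\<^esub> \<mu> f"
        by (rule Ind_borel_eqI) (simp_all add: \<mu>_def Ind_borel_simps ev fc a m_lcomm)
      then show ?thesis using \<pi>h(3)[OF a \<mu>I[OF f]] by simp
    qed
    show "\<pi> (\<mu> (act ?I g f)) = (\<eta> \<circ> det) g \<odot>\<^bsub>Steinberg k\<^esub> act (Steinberg k) g (\<pi> (\<mu> f))" if g: "g \<in> carrier GL2" for g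
    proof -
      have gi: "invertible g" "det g \<noteq> 0" using g by (simp_all add: invertible_det_nz)
      have c: "\<eta> (det g) \<in> carrier k" using h(1) gi by simp
      have "\<mu> (act ?I g f) = \<eta> (det g) \<odot>\<^bsub>?I1\<^esub> act ?I1 g (\<mu> f)"
      proof (rule Ind_borel_eqI)
        fix x :: "'l ^ 2 ^ 2" assume x: "invertible x"
        have xg: "invertible (x ** g)" using x gi by (simp add: invertible_mult)
        have "\<eta> (det g * (1 / det (x ** g))) = \<eta> (det g) \<otimes>\<^bsub>k\<^esub> \<eta> (1 / det (x ** g))"
          using gi xg by (intro h(3)) (auto simp: invertible_det_nz)
        moreover have "det g * (1 / det (x ** g)) = 1 / det x" using gi by (simp add: det_mul)
        ultimately have "\<eta> (1 / det x) = \<eta> (det g) \<otimes>\<^bsub>k\<^esub> \<eta> (1 / det (x ** g))" by simp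
        then show "\<mu> (act ?I g f) x = (\<eta> (det g) \<odot>\<^bsub>?I1\<^esub> act ?I1 g (\<mu> f)) x"
          using x xg c ev[OF xg] fc[OF xg] by (simp add: \<mu>_def Ind_borel_simps m_assoc)
      qed (simp_all add: \<mu>_def Ind_borel_simps)
      then show ?thesis
        using \<pi>h(3)[OF c I1.act_closed[OF g \<mu>I[OF f]]] \<pi>h(4)[OF g \<mu>I[OF f]] by simp
    qed
  qed
  moreover have "(\<lambda>f. \<pi> (\<mu> f)) ` carrier ?I = carrier (twist (Steinberg k) (\<eta> \<circ> det))"
  proof -
    have "\<mu> ` carrier ?I = carrier ?I1" using \<mu>I \<mu>_surj by blast
    then show ?thesis using \<pi>(2) unfolding twist_simps by (metis image_image)
  qed
  ultimately show ?thesis by (intro bexI[of _ "\<lambda>f. \<pi> (\<mu> f)"])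
qed

lemma quotient_of_induced:
  assumes "rep_isomorphic GL2 k V2 W" and V2: "representation GL2 k V2"
    and P: "P \<in> rep_hom GL2 k I W" "P ` carrier I = carrier W"
  shows "\<exists>P'\<in>rep_hom GL2 k I V2. P' ` carrier I = carrier V2"
proof -
  interpret V2: representation GL2 k V2 by (rule V2)
  obtain f where "f \<in> rep_iso GL2 k V2 W" using assms(1) by (auto simp: rep_isomorphic_def)
  then have j: "inv_into (carrier V2) f \<in> rep_iso GL2 k W V2" (is "?j \<in> _") by (rule V2.rep_iso_inverse)
  have "(\<lambda>x. ?j (P x)) \<in> rep_hom GL2 k I V2"
    by (rule rep_hom_compose[OF P(1)]) (use j in \<open>simp add: rep_iso_def\<close>)
  moreover have "?j ` carrier W = carrier V2" using j by (simp add: rep_iso_def bij_betw_def)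
  then have "(\<lambda>x. ?j (P x)) ` carrier I = carrier V2" using P(2) by (metis image_image)
  ultimately show ?thesis by (intro bexI[of _ "\<lambda>x. ?j (P x)"])
qed

theorem theorem5p2:
  fixes p :: nat
    and k :: "'k ring"
    and V1 :: "('k, 'v, 'l::nonarch_local_field ^ 2 ^ 2) rep"
    and V2 :: "('k, 'w, 'l ^ 2 ^ 2) rep"
  assumes "Factorial_Ring.prime p"
    and "CHAR('l) = p"
    and "is_Fp_bar p k"
    and "is_supersingular k V1"
    and "is_principal_series k V2 \<or> is_special_series k V2"
  shows "Ext1 GL2 k V2 V1 = {Ext1_zero GL2 k V2 V1}"
proof -
  have V2: "smooth_representation GL2 k V2" using assms(5) by (auto simp: is_principal_series_def is_special_series_def)
  interpret V2: smooth_representation GL2 k V2 by (rule V2)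
  have "\<exists>\<theta>\<in>smooth_characters torus k. \<exists>P\<in>rep_hom GL2 k (Ind_borel k \<theta>) V2. P ` carrier (Ind_borel k \<theta>) = carrier V2"
    using assms(5)
  proof
    assume "is_principal_series k V2"
    then obtain \<theta> where \<theta>: "\<theta> \<in> smooth_characters torus k" "rep_isomorphic GL2 k V2 (Ind_borel k \<theta>)"
      by (auto simp: is_principal_series_def)
    have "id \<in> rep_hom GL2 k (Ind_borel k \<theta>) (Ind_borel k \<theta>)" by (rule rep_homI) simp_all
    moreover have "id ` carrier (Ind_borel k \<theta>) = carrier (Ind_borel k \<theta>)" by simp
    ultimately have "\<exists>P\<in>rep_hom GL2 k (Ind_borel k \<theta>) V2. P ` carrier (Ind_borel k \<theta>) = carrier V2"
      by (rule quotient_of_induced[OF \<theta>(2) V2.representation_axioms])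
    from this \<theta>(1) show ?thesis by (rule bexI)
  next
    assume "is_special_series k V2"
    then obtain \<eta> where \<eta>: "\<eta> \<in> smooth_characters mult_group k" "rep_isomorphic GL2 k V2 (twist (Steinberg k) (\<eta> \<circ> det))"
      by (auto simp: is_special_series_def)
    \<comment> \<open>On the torus the product of the diagonal entries is the determinant, so this
      is the inducing character \<open>\<eta> \<circ> det\<close>.\<close>
    obtain P where "P \<in> rep_hom GL2 k (Ind_borel k (\<lambda>A. \<eta> (A $ 1 $ 1 * A $ 2 $ 2))) (twist (Steinberg k) (\<eta> \<circ> det))"
        "P ` carrier (Ind_borel k (\<lambda>A. \<eta> (A $ 1 $ 1 * A $ 2 $ 2))) = carrier (twist (Steinberg k) (\<eta> \<circ> det))"
      using twisted_Steinberg_quotient[OF V2.field_axioms \<eta>(1)] by blast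
    from quotient_of_induced[OF \<eta>(2) V2.representation_axioms this] det_smooth_character[OF V2.field_axioms \<eta>(1)]
    show ?thesis by (rule bexI)
  qed
  then obtain \<theta> P where "\<theta> \<in> smooth_characters torus k" "P \<in> rep_hom GL2 k (Ind_borel k \<theta>) V2"
    "P ` carrier (Ind_borel k \<theta>) = carrier V2" by blast
  then show ?thesis by (rule Ext1_quotient_of_induced[OF assms(1-4) V2])
qed

end
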